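(* Let $k$ be a field, let $S$ be a $k$-algebra with an action of a finite group $G$ by automorphisms, and set $A=S\# G$. Let $C_\bullet\to kG$ be a $(kG)^e$-free resolution of $kG$ with $C_i=kG\otimes C_i'\otimes kG$, and let $D_\bullet\to S$ be an $S^e$-free resolution of $S$ with $D_i=S\otimes D_i'\otimes S$, both satisfying the assumptions listed in the context. Let $X_\bullet$ be the total complex of the double complex $X_{i,j}=(A\otimes_{kG}C_i)\otimes_A(D_j\otimes_SA)$ described in the context, augmented to $A$. Then $X_\bullet$ is a free resolution of the $A^e$-module $A$, and for each $i,j$ the $A^e$-module $X_{i,j}$ is isomorphic to $A\otimes C_i'\otimes D_j'\otimes A$.
   Context: Unadorned $\otimes$ means $\otimes_k$. For a $k$-algebra $\Lambda$, $\Lambda^e=\Lambda\otimes\Lambda^{op}$. The skew group algebra $A=S\# G$ is $S\otimes kG$ with multiplication $(r\otimes g)(s\otimes h)=r({}^gs)\otimes gh$ for $r,s\in S$, $g,h\in G$, where ${}^gs$ is the image of $s$ under the automorphism $g$. Assumptions on $C_\bullet$: $\cdots\to C_1\to C_0\to kG\to0$ is a $(kG)^e$-free resolution of $kG$. Each $C_i$ is $G$-graded, $C_i=\bigoplus_{g\in G}(C_i)_g$, with grading preserved by the bimodule structure, that is, $g\,(C_i)_h\,l=(C_i)_{ghl}$ for all $g,h,l\in G$. The differentials preserve the $G$-grading (where $kG$ is graded by $(kG)_g=kg$). As a free $(kG)^e$-module, $C_i=kG\otimes C_i'\otimes kG$ for a $G$-graded vector space $C_i'$ whose grading induces that on $C_i$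 under the usual tensor product of $G$-graded vector spaces, $(M\otimes N)_g=\bigoplus_{xy=g}M_x\otimes N_y$. Assumptions on $D_\bullet$: $\cdots\to D_1\to D_0\to S\to0$ is an $S^e$-free resolution of $S$ consisting of left $kG$-modules for which the differentials are $kG$-module homomorphisms, and the left actions of $S$ and of $kG$ are compatible in the sense that they induce a left action of $A=S\# G$. As a free $S^e$-module, $D_i=S\otimes D_i'\otimes S$ for a vector space $D_i'$. Bimodule structures: $A\otimes_{kG}C_i$ is regarded as an $A$-bimodule, with left multiplication by $A$, right $kG$-action from $C_i$, and right $S$-action $(a\otimes x)\cdot s=a({}^gs)\otimes x$ for $a\in A$, $x\in(C_i)_g$, $s\in S$. $D_i\otimes_SA$ is regarded as an $A$-bimodule, with right multiplication by $A$, left $S$-action from $D_i$, and left $G$-action $g\cdot(y\otimes a)={}^gy\otimes ga$ for $g\in G$, $y\in D_i$, $a\in A$. Double complex: $X_{i,j}=(A\otimes_{kG}C_i)\otimes_A(D_j\otimes_SA)$ for $i,j\ge0$, with horizontal differential $d^h_{i,j}=d_i\otimes\mathrm{id}:X_{i,j}\to X_{i-1,j}$ and vertical differential $d^v_{i,j}=(-1)^i\,\mathrm{id}\otimes d_j:X_{i,j}\to X_{i,j-1}$, where $d_i$, $d_j$ are the differentials induced from $C_\bullet$ and $D_\bullet$. $X_\bullet$ is the total complex $\cdots\to X_2\to X_1\to X_0\to A\to0$ with $X_n=\bigoplus_{i+j=n}X_{i,j}$, with augmentation $X_0=X_{0,0}\to A\otimes_AA\cong A$ induced by the augmentations $A\otimes_{kG}C_0\to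 A\otimes_{kG}kG\cong A$ and $D_0\otimes_SA\to S\otimes_SA\cong A$. *)

theory Defs
  imports
    "HOL-Algebra.Module"
    "HOL-Algebra.Group_Action"
    "HOL-Algebra.Free_Abelian_Groups"
begin

section \<open>Modules and bimodules over noncommutative rings\<close>

text \<open>The locale \<^locale>\<open>module\<close> is restricted to commutative rings of scalars.  As for the record
  type \<open>module\<close>, the ring components \<open>mult\<close> and \<open>one\<close> of a module or bimodule record play no role
  unless the object is also regarded as a ring.\<close>

locale left_module = R?: ring R + M?: abelian_group M
  for R :: "('r, 'x) ring_scheme" (structure) and M :: "('r, 'm, 'y) module_scheme" (structure) +
  assumes smult_closed:
      "\<lbrakk>a \<in> carrier R; x \<in> carrier M\<rbrakk> \<Longrightarrow> a \<odot>\<^bsub>M\<^esub> x \<in> carrier M"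
    and smult_l_distr:
      "\<lbrakk>a \<in> carrier R; b \<in> carrier R; x \<in> carrier M\<rbrakk>
       \<Longrightarrow> (a \<oplus>\<^bsub>R\<^esub> b) \<odot>\<^bsub>M\<^esub> x = a \<odot>\<^bsub>M\<^esub> x \<oplus>\<^bsub>M\<^esub> b \<odot>\<^bsub>M\<^esub> x"
    and smult_r_distr:
      "\<lbrakk>a \<in> carrier R; x \<in> carrier M; y \<in> carrier M\<rbrakk>
       \<Longrightarrow> a \<odot>\<^bsub>M\<^esub> (x \<oplus>\<^bsub>M\<^esub> y) = a \<odot>\<^bsub>M\<^esub> x \<oplus>\<^bsub>M\<^esub> a \<odot>\<^bsub>M\<^esub> y"
    and smult_assoc:
      "\<lbrakk>a \<in> carrier R; b \<in> carrier R; x \<in> carrier M\<rbrakk>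
       \<Longrightarrow> (a \<otimes>\<^bsub>R\<^esub> b) \<odot>\<^bsub>M\<^esub> x = a \<odot>\<^bsub>M\<^esub> (b \<odot>\<^bsub>M\<^esub> x)"
    and smult_one: "x \<in> carrier M \<Longrightarrow> \<one>\<^bsub>R\<^esub> \<odot>\<^bsub>M\<^esub> x = x"

definition left_module_hom ::
  "('r, 'x) ring_scheme \<Rightarrow> ('r, 'm, 'y) module_scheme \<Rightarrow> ('r, 'n, 'z) module_scheme \<Rightarrow> ('m \<Rightarrow> 'n) set"
  where "left_module_hom R M N = {f \<in> carrier M \<rightarrow> carrier N.
    (\<forall>x \<in> carrier M. \<forall>y \<in> carrier M. f (x \<oplus>\<^bsub>M\<^esub> y) = f x \<oplus>\<^bsub>N\<^esub> f y) \<and>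
    (\<forall>a \<in> carrier R. \<forall>x \<in> carrier M. f (a \<odot>\<^bsub>M\<^esub> x) = a \<odot>\<^bsub>N\<^esub> f x)}"

definition left_module_iso ::
  "('r, 'x) ring_scheme \<Rightarrow> ('r, 'm, 'y) module_scheme \<Rightarrow> ('r, 'n, 'z) module_scheme \<Rightarrow> ('m \<Rightarrow> 'n) set"
  where "left_module_iso R M N =
    {f \<in> left_module_hom R M N. bij_betw f (carrier M) (carrier N)}"

definition module_basis ::
  "('r, 'x) ring_scheme \<Rightarrow> ('r, 'm, 'y) module_scheme \<Rightarrow> 'm set \<Rightarrow> bool"
  where "module_basis R M B \<longleftrightarrow> B \<subseteq> carrier M \<and>
    (\<forall>x \<in> carrier M. \<exists>!c. c \<in> B \<rightarrow>\<^sub>E carrier R \<and> finite {b \<in> B. c b \<noteq> \<zero>\<^bsub>R\<^esub>} \<and>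
      x = (\<Oplus>\<^bsub>M\<^esub>b \<in> {b \<in> B. c b \<noteq> \<zero>\<^bsub>R\<^esub>}. c b \<odot>\<^bsub>M\<^esub> b))"

definition free_module :: "('r, 'x) ring_scheme \<Rightarrow> ('r, 'm, 'y) module_scheme \<Rightarrow> bool"
  where "free_module R M \<longleftrightarrow> left_module R M \<and> (\<exists>B. module_basis R M B)"

text \<open>Exactness of \<open>\<cdots> \<rightarrow> M 1 \<rightarrow> M 0 \<rightarrow> N \<rightarrow> 0\<close>, where \<open>d n\<close> maps \<open>M n\<close> to \<open>M (n - 1)\<close>; the map
  \<open>d 0\<close> is never used.\<close>

definition free_resolution ::
  "('r, 'x) ring_scheme \<Rightarrow> (nat \<Rightarrow> ('r, 'm, 'y) module_scheme) \<Rightarrow> (nat \<Rightarrow> 'm \<Rightarrow> 'm)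
   \<Rightarrow> ('m \<Rightarrow> 'n) \<Rightarrow> ('r, 'n, 'z) module_scheme \<Rightarrow> bool"
  where "free_resolution R M d \<epsilon> N \<longleftrightarrow>
    (\<forall>n. free_module R (M n)) \<and> left_module R N \<and>
    (\<forall>n. d (Suc n) \<in> left_module_hom R (M (Suc n)) (M n)) \<and>
    \<epsilon> \<in> left_module_hom R (M 0) N \<and>
    \<epsilon> ` carrier (M 0) = carrier N \<and>
    d 1 ` carrier (M 1) = {x \<in> carrier (M 0). \<epsilon> x = \<zero>\<^bsub>N\<^esub>} \<and>
    (\<forall>n. d (Suc (Suc n)) ` carrier (M (Suc (Suc n))) =
         {x \<in> carrier (M (Suc n)). d (Suc n) x = \<zero>\<^bsub>M n\<^esub>})"

record ('a, 'b, 'm) bimodule = "'m ring" +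
  lact :: "'a \<Rightarrow> 'm \<Rightarrow> 'm"
  ract :: "'m \<Rightarrow> 'b \<Rightarrow> 'm"

locale bimodule = R: ring R + T: ring T + M: abelian_group M
  for R :: "('a, 'x) ring_scheme" and T :: "('b, 'y) ring_scheme"
    and M :: "('a, 'b, 'm, 'z) bimodule_scheme" +
  assumes lact_closed:
      "\<lbrakk>a \<in> carrier R; x \<in> carrier M\<rbrakk> \<Longrightarrow> lact M a x \<in> carrier M"
    and lact_add_left:
      "\<lbrakk>a \<in> carrier R; a' \<in> carrier R; x \<in> carrier M\<rbrakk>
       \<Longrightarrow> lact M (a \<oplus>\<^bsub>R\<^esub> a') x = lact M a x \<oplus>\<^bsub>M\<^esub> lact M a' x"
    and lact_add_right:
      "\<lbrakk>a \<in> carrier R; x \<in> carrier M; y \<in> carrier M\<rbrakk>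
       \<Longrightarrow> lact M a (x \<oplus>\<^bsub>M\<^esub> y) = lact M a x \<oplus>\<^bsub>M\<^esub> lact M a y"
    and lact_mult:
      "\<lbrakk>a \<in> carrier R; a' \<in> carrier R; x \<in> carrier M\<rbrakk>
       \<Longrightarrow> lact M (a \<otimes>\<^bsub>R\<^esub> a') x = lact M a (lact M a' x)"
    and lact_one: "x \<in> carrier M \<Longrightarrow> lact M \<one>\<^bsub>R\<^esub> x = x"
    and ract_closed:
      "\<lbrakk>x \<in> carrier M; b \<in> carrier T\<rbrakk> \<Longrightarrow> ract M x b \<in> carrier M"
    and ract_add_left:
      "\<lbrakk>x \<in> carrier M; y \<in> carrier M; b \<in> carrier T\<rbrakk>
       \<Longrightarrow> ract M (x \<oplus>\<^bsub>M\<^esub> y) b = ract M x b \<oplus>\<^bsub>M\<^esub> ract M y b"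
    and ract_add_right:
      "\<lbrakk>x \<in> carrier M; b \<in> carrier T; b' \<in> carrier T\<rbrakk>
       \<Longrightarrow> ract M x (b \<oplus>\<^bsub>T\<^esub> b') = ract M x b \<oplus>\<^bsub>M\<^esub> ract M x b'"
    and ract_mult:
      "\<lbrakk>x \<in> carrier M; b \<in> carrier T; b' \<in> carrier T\<rbrakk>
       \<Longrightarrow> ract M x (b \<otimes>\<^bsub>T\<^esub> b') = ract M (ract M x b) b'"
    and ract_one: "x \<in> carrier M \<Longrightarrow> ract M x \<one>\<^bsub>T\<^esub> = x"
    and lact_ract:
      "\<lbrakk>a \<in> carrier R; x \<in> carrier M; b \<in> carrier T\<rbrakk>
       \<Longrightarrow> ract M (lact M a x) b = lact M a (ract M x b)"

definition with_smult :: "('m, 'x) ring_scheme \<Rightarrow> ('r \<Rightarrow> 'm \<Rightarrow> 'm) \<Rightarrow> ('r, 'm) module"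
  where "with_smult M s = \<lparr>carrier = carrier M, mult = monoid.mult M, one = \<one>\<^bsub>M\<^esub>,
    ring.zero = \<zero>\<^bsub>M\<^esub>, add = ring.add M, smult = s\<rparr>"

definition with_actions ::
  "('m, 'x) ring_scheme \<Rightarrow> ('a \<Rightarrow> 'm \<Rightarrow> 'm) \<Rightarrow> ('m \<Rightarrow> 'b \<Rightarrow> 'm) \<Rightarrow> ('a, 'b, 'm) bimodule"
  where "with_actions M l r = \<lparr>carrier = carrier M, mult = monoid.mult M, one = \<one>\<^bsub>M\<^esub>,
    ring.zero = \<zero>\<^bsub>M\<^esub>, add = ring.add M, lact = l, ract = r\<rparr>"

definition regular_bimodule :: "('a, 'x) ring_scheme \<Rightarrow> ('a, 'a, 'a) bimodule"
  where "regular_bimodule R = with_actions R (monoid.mult R) (monoid.mult R)"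

definition space_bimodule :: "('k, 'v, 'x) module_scheme \<Rightarrow> ('k, 'k, 'v) bimodule"
  where "space_bimodule V = with_actions V (smult V) (\<lambda>v c. c \<odot>\<^bsub>V\<^esub> v)"

definition bimodule_sum ::
  "'i set \<Rightarrow> ('i \<Rightarrow> ('a, 'b, 'm) bimodule) \<Rightarrow> ('a, 'b, 'i \<Rightarrow> 'm) bimodule"
  where "bimodule_sum I M = \<lparr>carrier = (\<Pi>\<^sub>E i \<in> I. carrier (M i)), mult = undefined, one = undefined,
    ring.zero = (\<lambda>i \<in> I. \<zero>\<^bsub>M i\<^esub>), add = (\<lambda>x y. \<lambda>i \<in> I. x i \<oplus>\<^bsub>M i\<^esub> y i),
    lact = (\<lambda>a x. \<lambda>i \<in> I. lact (M i) a (x i)), ract = (\<lambda>x b. \<lambda>i \<in> I. ract (M i) (x i) b)\<rparr>"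


section \<open>Tensor products over a ring\<close>

text \<open>For a right \<open>R\<close>-module \<open>M\<close> and a left \<open>R\<close>-module \<open>N\<close>, the group \<open>M \<otimes>\<^sub>R N\<close> is the
  quotient of the free abelian group on pairs by the usual relations.  If \<open>M\<close> and \<open>N\<close> are
  bimodules, the outer actions are inherited.\<close>

type_synonym ('m, 'n) tensor = "('m \<times> 'n \<Rightarrow>\<^sub>0 int) set"

definition tensor_relations ::
  "('r, 'x) ring_scheme \<Rightarrow> ('a, 'r, 'm, 'y) bimodule_scheme \<Rightarrow> ('r, 'b, 'n, 'z) bimodule_scheme
   \<Rightarrow> ('m \<times> 'n \<Rightarrow>\<^sub>0 int) set"
  where "tensor_relations R M N =
    {frag_of (x \<oplus>\<^bsub>M\<^esub> x', y) - frag_of (x, y) - frag_of (x', y) | x x' y.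
      x \<in> carrier M \<and> x' \<in> carrier M \<and> y \<in> carrier N} \<union>
    {frag_of (x, y \<oplus>\<^bsub>N\<^esub> y') - frag_of (x, y) - frag_of (x, y') | x y y'.
      x \<in> carrier M \<and> y \<in> carrier N \<and> y' \<in> carrier N} \<union>
    {frag_of (ract M x r, y) - frag_of (x, lact N r y) | x r y.
      x \<in> carrier M \<and> r \<in> carrier R \<and> y \<in> carrier N}"

definition tensor_kernel ::
  "('r, 'x) ring_scheme \<Rightarrow> ('a, 'r, 'm, 'y) bimodule_scheme \<Rightarrow> ('r, 'b, 'n, 'z) bimodule_scheme
   \<Rightarrow> ('m \<times> 'n \<Rightarrow>\<^sub>0 int) set"
  where "tensor_kernel R M N =
    generate (free_Abelian_group (carrier M \<times> carrier N)) (tensor_relations R M N)"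

definition tensor_group ::
  "('r, 'x) ring_scheme \<Rightarrow> ('a, 'r, 'm, 'y) bimodule_scheme \<Rightarrow> ('r, 'b, 'n, 'z) bimodule_scheme
   \<Rightarrow> ('m, 'n) tensor ring"
  where "tensor_group R M N =
    (let Q = free_Abelian_group (carrier M \<times> carrier N) Mod tensor_kernel R M N
     in \<lparr>carrier = carrier Q, mult = undefined, one = undefined, ring.zero = \<one>\<^bsub>Q\<^esub>, add = monoid.mult Q\<rparr>)"

definition pure_tensor ::
  "('r, 'x) ring_scheme \<Rightarrow> ('a, 'r, 'm, 'y) bimodule_scheme \<Rightarrow> ('r, 'b, 'n, 'z) bimodule_scheme
   \<Rightarrow> 'm \<Rightarrow> 'n \<Rightarrow> ('m, 'n) tensor"
  where "pure_tensor R M N x y =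
    tensor_kernel R M N #>\<^bsub>free_Abelian_group (carrier M \<times> carrier N)\<^esub> frag_of (x, y)"

text \<open>\<open>tensor_lift P f\<close> is the homomorphism into the abelian group \<open>P\<close> induced by a balanced
  map \<open>f\<close>, i.e. the additive map with value \<open>f x y\<close> on the class of \<open>x \<otimes> y\<close>; it is evaluated on an
  arbitrary representative of the coset \<open>X\<close>.\<close>

definition tensor_lift ::
  "('p, 'x) ring_scheme \<Rightarrow> ('m \<Rightarrow> 'n \<Rightarrow> 'p) \<Rightarrow> ('m, 'n) tensor \<Rightarrow> 'p"
  where "tensor_lift P f X =
    the_elem ((\<lambda>z. \<Oplus>\<^bsub>P\<^esub>p \<in> Poly_Mapping.keys z.
      [Poly_Mapping.lookup z p] \<cdot>\<^bsub>P\<^esub> f (fst p) (snd p)) ` X)"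

definition tensor ::
  "('r, 'x) ring_scheme \<Rightarrow> ('a, 'r, 'm, 'y) bimodule_scheme \<Rightarrow> ('r, 'b, 'n, 'z) bimodule_scheme
   \<Rightarrow> ('a, 'b, ('m, 'n) tensor) bimodule"
  where "tensor R M N = with_actions (tensor_group R M N)
    (\<lambda>a. tensor_lift (tensor_group R M N) (\<lambda>x y. pure_tensor R M N (lact M a x) y))
    (\<lambda>t b. tensor_lift (tensor_group R M N) (\<lambda>x y. pure_tensor R M N x (ract N y b)) t)"

definition tensor_map ::
  "('r, 'x) ring_scheme \<Rightarrow> ('a, 'r, 'm) bimodule \<Rightarrow> ('r, 'b, 'n) bimodule
   \<Rightarrow> ('c, 'r, 'm2) bimodule \<Rightarrow> ('r, 'd, 'n2) bimodule
   \<Rightarrow> ('m \<Rightarrow> 'm2) \<Rightarrow> ('n \<Rightarrow> 'n2) \<Rightarrow> ('m, 'n) tensor \<Rightarrow> ('m2, 'n2) tensor"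
  where "tensor_map R M N M2 N2 f g =
    tensor_lift (tensor_group R M2 N2) (\<lambda>x y. pure_tensor R M2 N2 (f x) (g y))"


subsection \<open>The universal property\<close>

definition frag_eval :: "('p, 'x) ring_scheme \<Rightarrow> ('m \<Rightarrow> 'n \<Rightarrow> 'p) \<Rightarrow> ('m \<times> 'n \<Rightarrow>\<^sub>0 int) \<Rightarrow> 'p"
  where "frag_eval P f z = (\<Oplus>\<^bsub>P\<^esub>p \<in> Poly_Mapping.keys z.
      [Poly_Mapping.lookup z p] \<cdot>\<^bsub>P\<^esub> f (fst p) (snd p))"

lemma (in abelian_group) frag_eval_superset:
  assumes "finite I" "Poly_Mapping.keys z \<subseteq> I" "\<And>p. p \<in> I \<Longrightarrow> f (fst p) (snd p) \<in> carrier G"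
  shows "frag_eval G f z = (\<Oplus>p \<in> I. [Poly_Mapping.lookup z p] \<cdot> f (fst p) (snd p))"
  unfolding frag_eval_def
  by (rule add.finprod_mono_neutral_cong_left)
     (use assms in \<open>auto simp: in_keys_iff add_pow_def intro!: add.int_pow_closed[unfolded add_pow_def]\<close>)

lemma (in abelian_group) frag_eval_add:
  assumes "\<And>p. p \<in> Poly_Mapping.keys z \<union> Poly_Mapping.keys w \<Longrightarrow> f (fst p) (snd p) \<in> carrier G"
  shows "frag_eval G f (z + w) = frag_eval G f z \<oplus> frag_eval G f w"
proof -
  let ?I = "Poly_Mapping.keys z \<union> Poly_Mapping.keys w"
  have "frag_eval G f (z + w) = (\<Oplus>p \<in> ?I. [Poly_Mapping.lookup (z+w) p] \<cdot> f (fst p) (snd p))"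
    by (rule frag_eval_superset) (use assms keys_add[of z w] in auto)
  also have "\<dots> = (\<Oplus>p \<in> ?I. [Poly_Mapping.lookup z p] \<cdot> f (fst p) (snd p) \<oplus> [Poly_Mapping.lookup w p] \<cdot> f (fst p) (snd p))"
    by (rule finsum_cong') (use assms in \<open>auto simp: lookup_add add.int_pow_mult\<close>)
  also have "\<dots> = (\<Oplus>p \<in> ?I. [Poly_Mapping.lookup z p] \<cdot> f (fst p) (snd p)) \<oplus> (\<Oplus>p \<in> ?I. [Poly_Mapping.lookup w p] \<cdot> f (fst p) (snd p))"
    by (rule finsum_addf) (use assms in auto)
  also have "\<dots> = frag_eval G f z \<oplus> frag_eval G f w"
    using frag_eval_superset[of ?I z f] frag_eval_superset[of ?I w f] assms by auto
  finally show ?thesis .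
qed

lemma (in abelian_group) frag_eval_of:
  assumes "f x y \<in> carrier G"
  shows "frag_eval G f (frag_of (x, y)) = f x y"
  using assms by (simp add: frag_eval_def keys_frag_of add_pow_def int_pow_def2)

lemma tensor_lift_eq: "tensor_lift P f X = the_elem (frag_eval P f ` X)"
  by (simp add: tensor_lift_def frag_eval_def)

definition balanced_map ::
  "('r, 'x) ring_scheme \<Rightarrow> ('a, 'r, 'm, 'y) bimodule_scheme \<Rightarrow> ('r, 'b, 'n, 'z) bimodule_scheme \<Rightarrow> ('p,'w) ring_scheme \<Rightarrow> ('m \<Rightarrow> 'n \<Rightarrow> 'p) \<Rightarrow> bool"
  where "balanced_map R M N P f \<longleftrightarrow>
   (\<forall>x \<in> carrier M. \<forall>y \<in> carrier N. f x y \<in> carrier P) \<and>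
   (\<forall>x \<in> carrier M. \<forall>x' \<in> carrier M. \<forall>y \<in> carrier N. f (x \<oplus>\<^bsub>M\<^esub> x') y = f x y \<oplus>\<^bsub>P\<^esub> f x' y) \<and>
   (\<forall>x \<in> carrier M. \<forall>y \<in> carrier N. \<forall>y' \<in> carrier N. f x (y \<oplus>\<^bsub>N\<^esub> y') = f x y \<oplus>\<^bsub>P\<^esub> f x y') \<and>
   (\<forall>x \<in> carrier M. \<forall>r \<in> carrier R. \<forall>y \<in> carrier N. f (ract M x r) y = f x (lact N r y))"

locale tensor_data = M: abelian_group M + N: abelian_group N
  for R :: "('r, 'x) ring_scheme" and M :: "('a, 'r, 'm, 'y) bimodule_scheme" and N :: "('r, 'b, 'n, 'z) bimodule_scheme" +
  assumes ra: "x \<in> carrier M \<Longrightarrow> r \<in> carrier R \<Longrightarrow> ract M x r \<in> carrier M"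
   and la: "y \<in> carrier N \<Longrightarrow> r \<in> carrier R \<Longrightarrow> lact N r y \<in> carrier N"
begin

abbreviation (input) "F \<equiv> free_Abelian_group (carrier M \<times> carrier N)"
sublocale F: comm_group F by (rule abelian_free_Abelian_group)

lemma diffc: "a - b \<in> carrier F" if "a \<in> carrier F" "b \<in> carrier F" for a b
  using that keys_diff[of a b] unfolding carrier_free_Abelian_group_iff by blast

lemma ofc: "frag_of (x,y) \<in> carrier F" if "x \<in> carrier M" "y \<in> carrier N"
  using that by (simp add: keys_frag_of)

lemma rel_sub: "tensor_relations R M N \<subseteq> carrier F"
  unfolding tensor_relations_def
  by (intro Un_least subsetI; elim CollectE exE conjE; hypsubst; intro diffc ofc)
     (use ra la in auto)

lemma ker_sub: "subgroup (tensor_kernel R M N) F"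
  unfolding tensor_kernel_def by (rule F.generate_is_subgroup[OF rel_sub])

lemma ker_normal: "tensor_kernel R M N \<lhd> F"
  by (rule F.subgroup_imp_normal[OF ker_sub])

lemma frag_eval_hom:
  assumes "abelian_group P" "balanced_map R M N P f"
  shows "group_hom F (add_monoid P) (frag_eval P f)"
proof -
  interpret P: abelian_group P by fact
  show ?thesis
  proof (intro group_hom.intro group_hom_axioms.intro homI)
    fix z w assume "z \<in> carrier F" "w \<in> carrier F"
    then show "frag_eval P f (z \<otimes>\<^bsub>F\<^esub> w) = frag_eval P f z \<otimes>\<^bsub>add_monoid P\<^esub> frag_eval P f w"
      using assms(2) by (auto simp: balanced_map_def intro!: P.frag_eval_add)
  next
    fix z assume "z \<in> carrier F"
    then show "frag_eval P f z \<in> carrier (add_monoid P)"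
      using assms(2) unfolding frag_eval_def by (auto simp: balanced_map_def intro!: P.finsum_closed)
  qed (use P.a_group in auto)
qed

lemma frag_eval_ker:
  assumes "abelian_group P" "balanced_map R M N P f" "z \<in> tensor_kernel R M N"
  shows "frag_eval P f z = \<zero>\<^bsub>P\<^esub>"
proof -
  interpret P: abelian_group P by fact
  interpret h: group_hom F "add_monoid P" "frag_eval P f" by (rule frag_eval_hom; fact)
  have of: "frag_eval P f (frag_of (x,y)) = f x y" if "x \<in> carrier M" "y \<in> carrier N" for x y
    using that assms(2) by (auto simp: balanced_map_def intro!: P.frag_eval_of)
  have d: "frag_eval P f (a - b) = frag_eval P f a \<ominus>\<^bsub>P\<^esub> frag_eval P f b" if "a \<in> carrier F" "b \<in> carrier F" for a b
  proof -
    have e: "a - b = a \<otimes>\<^bsub>F\<^esub> inv\<^bsub>F\<^esub> b" using that by simp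
    show ?thesis unfolding e a_minus_def a_inv_def
      using h.hom_inv[OF that(2)] h.hom_mult[OF that(1) F.inv_closed[OF that(2)]]
      by (metis monoid.simps(1) monoid.simps(2))
  qed
  have alg: "u \<oplus>\<^bsub>P\<^esub> v \<ominus>\<^bsub>P\<^esub> u \<ominus>\<^bsub>P\<^esub> v = \<zero>\<^bsub>P\<^esub>" if "u \<in> carrier P" "v \<in> carrier P" for u v
    using that by (metis P.a_comm P.a_inv_closed P.add.inv_solve_right' P.minus_eq P.r_neg P.add.m_closed)
  have "frag_eval P f r = \<zero>\<^bsub>P\<^esub>" if "r \<in> tensor_relations R M N" for r
    using that unfolding tensor_relations_def
  proof (elim UnE CollectE exE conjE)
    fix x x' y assume *: "r = frag_of (x \<oplus>\<^bsub>M\<^esub> x', y) - frag_of (x, y) - frag_of (x', y)"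
      "x \<in> carrier M" "x' \<in> carrier M" "y \<in> carrier N"
    then have "frag_eval P f r = f (x \<oplus>\<^bsub>M\<^esub> x') y \<ominus>\<^bsub>P\<^esub> f x y \<ominus>\<^bsub>P\<^esub> f x' y"
      unfolding *(1) by (subst d, intro diffc ofc; simp del: carrier_free_Abelian_group_iff add: d ofc of)+
    moreover have "f x y \<in> carrier P" "f x' y \<in> carrier P" "f (x \<oplus>\<^bsub>M\<^esub> x') y = f x y \<oplus>\<^bsub>P\<^esub> f x' y"
      using assms(2) * by (auto simp: balanced_map_def)
    ultimately show ?thesis by (simp add: alg)
  next
    fix x y y' assume *: "r = frag_of (x, y \<oplus>\<^bsub>N\<^esub> y') - frag_of (x, y) - frag_of (x, y')"
      "x \<in> carrier M" "y \<in> carrier N" "y' \<in> carrier N"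
    then have "frag_eval P f r = f x (y \<oplus>\<^bsub>N\<^esub> y') \<ominus>\<^bsub>P\<^esub> f x y \<ominus>\<^bsub>P\<^esub> f x y'"
      unfolding *(1) by (subst d, intro diffc ofc; simp del: carrier_free_Abelian_group_iff add: d ofc of)+
    moreover have "f x y \<in> carrier P" "f x y' \<in> carrier P" "f x (y \<oplus>\<^bsub>N\<^esub> y') = f x y \<oplus>\<^bsub>P\<^esub> f x y'"
      using assms(2) * by (auto simp: balanced_map_def)
    ultimately show ?thesis by (simp add: alg)
  next
    fix x y and c assume *: "r = frag_of (ract M x c, y) - frag_of (x, lact N c y)"
      "x \<in> carrier M" "c \<in> carrier R" "y \<in> carrier N"
    then have "frag_eval P f r = f (ract M x c) y \<ominus>\<^bsub>P\<^esub> f x (lact N c y)"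
      unfolding *(1) by (simp del: carrier_free_Abelian_group_iff add: d ofc of ra la)
    moreover have "f (ract M x c) y = f x (lact N c y)" "f x (lact N c y) \<in> carrier P"
      using assms(2) * la by (auto simp: balanced_map_def)
    ultimately show ?thesis by (simp add: P.minus_eq P.r_neg)
  qed
  then have "tensor_relations R M N \<subseteq> kernel F (add_monoid P) (frag_eval P f)"
    unfolding kernel_def using rel_sub by (simp del: carrier_free_Abelian_group_iff) blast
  then have "tensor_kernel R M N \<subseteq> kernel F (add_monoid P) (frag_eval P f)"
    unfolding tensor_kernel_def by (rule F.generate_subgroup_incl[OF _ h.subgroup_kernel])
  with assms(3) show ?thesis by (auto simp: kernel_def)
qed


lemma tensor_lift_coset:
  assumes "abelian_group P" "balanced_map R M N P f" "z \<in> carrier F"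
  shows "tensor_lift P f (tensor_kernel R M N #>\<^bsub>F\<^esub> z) = frag_eval P f z"
proof -
  interpret P: abelian_group P by fact
  interpret h: group_hom F "add_monoid P" "frag_eval P f" by (rule frag_eval_hom; fact)
  have eq: "frag_eval P f w = frag_eval P f z" if w: "w \<in> tensor_kernel R M N #>\<^bsub>F\<^esub> z" for w
  proof -
    obtain n where n: "n \<in> tensor_kernel R M N" "w = n \<otimes>\<^bsub>F\<^esub> z" using w unfolding r_coset_def by blast
    then have "n \<in> carrier F" using subgroup.subset[OF ker_sub] by blast
    then show ?thesis using h.hom_mult[OF _ assms(3), of n] frag_eval_ker[OF assms(1,2) n(1)] n(2)
      h.hom_closed[OF assms(3)] by simp
  qed
  have "z \<in> tensor_kernel R M N #>\<^bsub>F\<^esub> z"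
    using F.rcos_self[OF assms(3) ker_sub] .
  then have ne: "tensor_kernel R M N #>\<^bsub>F\<^esub> z \<noteq> {}" by blast
  show ?thesis unfolding tensor_lift_eq by (rule the_elem_image_unique[OF ne]) (rule eq)
qed

lemma tensor_lift_pure:
  assumes "abelian_group P" "balanced_map R M N P f" "x \<in> carrier M" "y \<in> carrier N"
  shows "tensor_lift P f (pure_tensor R M N x y) = f x y"
proof -
  interpret P: abelian_group P by fact
  show ?thesis unfolding pure_tensor_def
    using tensor_lift_coset[OF assms(1,2) ofc[OF assms(3,4)]] P.frag_eval_of[of f x y] assms
    by (simp add: balanced_map_def)
qed

lemma tensor_lift_hom:
  assumes "abelian_group P" "balanced_map R M N P f"
  shows "tensor_lift P f \<in> hom (add_monoid (tensor_group R M N)) (add_monoid P)"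
proof -
  interpret h: group_hom F "add_monoid P" "frag_eval P f" by (rule frag_eval_hom; fact)
  interpret n: normal "tensor_kernel R M N" F by (rule ker_normal)
  show ?thesis
  proof (rule homI)
    fix X Y assume "X \<in> carrier (add_monoid (tensor_group R M N))" "Y \<in> carrier (add_monoid (tensor_group R M N))"
    then obtain x y where xy: "x \<in> carrier F" "y \<in> carrier F" "X = tensor_kernel R M N #>\<^bsub>F\<^esub> x" "Y = tensor_kernel R M N #>\<^bsub>F\<^esub> y"
      by (auto simp: tensor_group_def Let_def carrier_FactGroup simp del: carrier_free_Abelian_group_iff)
    have "X \<otimes>\<^bsub>add_monoid (tensor_group R M N)\<^esub> Y = tensor_kernel R M N #>\<^bsub>F\<^esub> (x \<otimes>\<^bsub>F\<^esub> y)"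
      using n.rcos_sum[OF xy(1,2)] xy(3,4) by (simp add: tensor_group_def Let_def)
    then show "tensor_lift P f (X \<otimes>\<^bsub>add_monoid (tensor_group R M N)\<^esub> Y) = tensor_lift P f X \<otimes>\<^bsub>add_monoid P\<^esub> tensor_lift P f Y"
      using tensor_lift_coset[OF assms] h.hom_mult xy F.m_closed by metis
  next
    fix X assume "X \<in> carrier (add_monoid (tensor_group R M N))"
    then obtain x where x: "x \<in> carrier F" "X = tensor_kernel R M N #>\<^bsub>F\<^esub> x"
      by (auto simp: tensor_group_def Let_def carrier_FactGroup simp del: carrier_free_Abelian_group_iff)
    then show "tensor_lift P f X \<in> carrier (add_monoid P)"
      using tensor_lift_coset[OF assms] h.hom_closed by metis
  qed
qed


lemma T_carrier: "carrier (tensor_group R M N) = (\<lambda>z. tensor_kernel R M N #>\<^bsub>F\<^esub> z) ` carrier F"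
  by (simp add: tensor_group_def Let_def carrier_FactGroup)

lemma T_add: "z \<in> carrier F \<Longrightarrow> w \<in> carrier F \<Longrightarrow>
  (tensor_kernel R M N #>\<^bsub>F\<^esub> z) \<oplus>\<^bsub>tensor_group R M N\<^esub> (tensor_kernel R M N #>\<^bsub>F\<^esub> w)
  = tensor_kernel R M N #>\<^bsub>F\<^esub> (z + w)"
  using normal.rcos_sum[OF ker_normal, of z w]
  by (simp add: tensor_group_def Let_def)

lemma T_abelian: "abelian_group (tensor_group R M N)"
proof -
  have "comm_group (F Mod tensor_kernel R M N)"
    by (rule F.abelian_FactGroup[OF ker_sub])
  moreover have "add_monoid (tensor_group R M N) = F Mod tensor_kernel R M N"
    by (simp add: tensor_group_def Let_def)
  ultimately show ?thesis
    using comm_group.axioms by (intro abelian_group.intro abelian_monoid.intro abelian_group_axioms.intro) auto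
qed

sublocale T: abelian_group "tensor_group R M N" by (rule T_abelian)

lemma pure_closed: "x \<in> carrier M \<Longrightarrow> y \<in> carrier N \<Longrightarrow> pure_tensor R M N x y \<in> carrier (tensor_group R M N)"
  unfolding T_carrier pure_tensor_def using ofc by blast

lemma T_rel:
  assumes "z - w \<in> tensor_kernel R M N" "z \<in> carrier F" "w \<in> carrier F"
  shows "tensor_kernel R M N #>\<^bsub>F\<^esub> z = tensor_kernel R M N #>\<^bsub>F\<^esub> w"
proof -
  have "z = (z - w) \<otimes>\<^bsub>F\<^esub> w" by simp
  then have "z \<in> tensor_kernel R M N #>\<^bsub>F\<^esub> w" unfolding r_coset_def using assms(1) by blast
  then show ?thesis using F.repr_independence[OF _ assms(3) ker_sub] by metis
qed

lemma rel_ker: "r \<in> tensor_relations R M N \<Longrightarrow> r \<in> tensor_kernel R M N"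
  unfolding tensor_kernel_def by (rule generate.incl)

lemma addc: "a + b \<in> carrier F" if "a \<in> carrier F" "b \<in> carrier F" for a b
  using F.m_closed[OF that] by simp

lemma pure_balanced: "balanced_map R M N (tensor_group R M N) (pure_tensor R M N)"
  unfolding balanced_map_def
proof (intro conjI ballI)
  fix x y assume "x \<in> carrier M" "y \<in> carrier N" then show "pure_tensor R M N x y \<in> carrier (tensor_group R M N)" by (rule pure_closed)
next
  fix x x' y assume *: "x \<in> carrier M" "x' \<in> carrier M" "y \<in> carrier N"
  have "frag_of (x \<oplus>\<^bsub>M\<^esub> x', y) - frag_of (x, y) - frag_of (x', y) \<in> tensor_relations R M N"
    using * unfolding tensor_relations_def by blast
  then have "frag_of (x \<oplus>\<^bsub>M\<^esub> x', y) - (frag_of (x, y) + frag_of (x', y)) \<in> tensor_kernel R M N"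
    by (metis rel_ker diff_diff_eq)
  from T_rel[OF this ofc addc[OF ofc ofc]] show "pure_tensor R M N (x \<oplus>\<^bsub>M\<^esub> x') y = pure_tensor R M N x y \<oplus>\<^bsub>tensor_group R M N\<^esub> pure_tensor R M N x' y"
    using * unfolding pure_tensor_def by (simp del: carrier_free_Abelian_group_iff add: T_add ofc)
next
  fix x y y' assume *: "x \<in> carrier M" "y \<in> carrier N" "y' \<in> carrier N"
  have "frag_of (x, y \<oplus>\<^bsub>N\<^esub> y') - frag_of (x, y) - frag_of (x, y') \<in> tensor_relations R M N"
    using * unfolding tensor_relations_def by blast
  then have "frag_of (x, y \<oplus>\<^bsub>N\<^esub> y') - (frag_of (x, y) + frag_of (x, y')) \<in> tensor_kernel R M N"
    by (metis rel_ker diff_diff_eq)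
  from T_rel[OF this ofc addc[OF ofc ofc]] show "pure_tensor R M N x (y \<oplus>\<^bsub>N\<^esub> y') = pure_tensor R M N x y \<oplus>\<^bsub>tensor_group R M N\<^esub> pure_tensor R M N x y'"
    using * unfolding pure_tensor_def by (simp del: carrier_free_Abelian_group_iff add: T_add ofc)
next
  fix x c y assume *: "x \<in> carrier M" "c \<in> carrier R" "y \<in> carrier N"
  have "frag_of (ract M x c, y) - frag_of (x, lact N c y) \<in> tensor_relations R M N"
    using * unfolding tensor_relations_def by blast
  from T_rel[OF rel_ker[OF this] ofc ofc] show "pure_tensor R M N (ract M x c) y = pure_tensor R M N x (lact N c y)"
    using * ra la unfolding pure_tensor_def by simp
qed

lemma tensor_hom_eq:
  assumes P: "abelian_group P"
    and f: "f \<in> hom (add_monoid (tensor_group R M N)) (add_monoid P)"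
    and g: "g \<in> hom (add_monoid (tensor_group R M N)) (add_monoid P)"
    and eq: "\<And>x y. x \<in> carrier M \<Longrightarrow> y \<in> carrier N \<Longrightarrow>
      f (pure_tensor R M N x y) = g (pure_tensor R M N x y)"
    and X: "X \<in> carrier (tensor_group R M N)"
  shows "f X = g X"
proof -
  interpret P: abelian_group P by fact
  let ?c = "\<lambda>z. tensor_kernel R M N #>\<^bsub>F\<^esub> z"
  interpret c: group_hom F "add_monoid (tensor_group R M N)" ?c
    by (intro group_hom.intro group_hom_axioms.intro F.is_group T.a_group homI)
       (auto simp: T_carrier T_add simp del: carrier_free_Abelian_group_iff)
  interpret f: group_hom F "add_monoid P" "f \<circ> ?c"
    by (intro group_hom.intro group_hom_axioms.intro F.is_group P.a_group hom_compose[OF c.homh f])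
  interpret g: group_hom F "add_monoid P" "g \<circ> ?c"
    by (intro group_hom.intro group_hom_axioms.intro F.is_group P.a_group hom_compose[OF c.homh g])
  have "(f \<circ> ?c) z = (g \<circ> ?c) z" if "Poly_Mapping.keys z \<subseteq> carrier M \<times> carrier N" for z
    using that
  proof (rule free_Abelian_group_induct)
    show "(f \<circ> ?c) 0 = (g \<circ> ?c) 0" using f.hom_one g.hom_one by simp
  next
    fix a b assume 2: "Poly_Mapping.keys a \<subseteq> carrier M \<times> carrier N" "Poly_Mapping.keys b \<subseteq> carrier M \<times> carrier N"
      "(f \<circ> ?c) a = (g \<circ> ?c) a" "(f \<circ> ?c) b = (g \<circ> ?c) b"
    then have ab: "a \<in> carrier F" "b \<in> carrier F" by simp_all
    have e: "a - b = a \<otimes>\<^bsub>F\<^esub> inv\<^bsub>F\<^esub> b" using 2 by simp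
    show "(f \<circ> ?c) (a - b) = (g \<circ> ?c) (a - b)" unfolding e f.hom_mult[OF ab(1) F.inv_closed[OF ab(2)]]
        g.hom_mult[OF ab(1) F.inv_closed[OF ab(2)]] f.hom_inv[OF ab(2)] g.hom_inv[OF ab(2)] 2 ..
  next
    fix p assume "p \<in> carrier M \<times> carrier N"
    then show "(f \<circ> ?c) (frag_of p) = (g \<circ> ?c) (frag_of p)" using eq by (auto simp: pure_tensor_def)
  qed
  then show ?thesis using X unfolding T_carrier by auto
qed

end


section \<open>Algebras over a field and their enveloping algebras\<close>

locale algebra_over_field = field K + module K L + L: ring L
  for K :: "('k, 'x) ring_scheme" and L :: "('k, 'a, 'y) module_scheme" +
  assumes smult_mult_left:
      "\<lbrakk>c \<in> carrier K; x \<in> carrier L; y \<in> carrier L\<rbrakk>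
       \<Longrightarrow> (c \<odot>\<^bsub>L\<^esub> x) \<otimes>\<^bsub>L\<^esub> y = c \<odot>\<^bsub>L\<^esub> (x \<otimes>\<^bsub>L\<^esub> y)"
    and smult_mult_right:
      "\<lbrakk>c \<in> carrier K; x \<in> carrier L; y \<in> carrier L\<rbrakk>
       \<Longrightarrow> x \<otimes>\<^bsub>L\<^esub> (c \<odot>\<^bsub>L\<^esub> y) = c \<odot>\<^bsub>L\<^esub> (x \<otimes>\<^bsub>L\<^esub> y)"

text \<open>\<open>\<Lambda>\<^sup>e = \<Lambda> \<otimes>\<^sub>k \<Lambda>\<^sup>o\<^sup>p\<close>, with \<open>(a \<otimes> b)(c \<otimes> d) = ac \<otimes> db\<close>.\<close>

definition enveloping_algebra ::
  "('k, 'x) ring_scheme \<Rightarrow> ('k, 'a, 'y) module_scheme \<Rightarrow> ('a, 'a) tensor ring"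
  where "enveloping_algebra K L =
    (let V = space_bimodule L; E = tensor_group K V V
     in \<lparr>carrier = carrier E,
         mult = (\<lambda>X Y. tensor_lift E (\<lambda>a b. tensor_lift E (\<lambda>c d.
                   pure_tensor K V V (a \<otimes>\<^bsub>L\<^esub> c) (d \<otimes>\<^bsub>L\<^esub> b)) Y) X),
         one = pure_tensor K V V \<one>\<^bsub>L\<^esub> \<one>\<^bsub>L\<^esub>, ring.zero = \<zero>\<^bsub>E\<^esub>, add = ring.add E\<rparr>)"

text \<open>A \<open>\<Lambda>\<^sup>e\<close>-module is the same thing as a \<open>\<Lambda>\<close>-bimodule on which the two actions of \<open>k\<close> agree;
  \<open>a \<otimes> b\<close> acts by \<open>x \<mapsto> a x b\<close>.\<close>

locale central_bimodule = algebra_over_field K L + bimodule L L M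
  for K :: "('k, 'x) ring_scheme" and L :: "('k, 'a, 'y) module_scheme"
    and M :: "('a, 'a, 'm, 'z) bimodule_scheme" +
  assumes central: "\<lbrakk>c \<in> carrier K; x \<in> carrier M\<rbrakk>
    \<Longrightarrow> lact M (c \<odot>\<^bsub>L\<^esub> \<one>\<^bsub>L\<^esub>) x = ract M x (c \<odot>\<^bsub>L\<^esub> \<one>\<^bsub>L\<^esub>)"

definition env_module :: "('a, 'a, 'm, 'z) bimodule_scheme \<Rightarrow> (('a, 'a) tensor, 'm) module"
  where "env_module M =
    with_smult M (\<lambda>t x. tensor_lift M (\<lambda>a b. lact M a (ract M x b)) t)"

definition free_env_resolution ::
  "('k, 'x) ring_scheme \<Rightarrow> ('k, 'a, 'y) module_scheme \<Rightarrow> (nat \<Rightarrow> ('a, 'a, 'm) bimodule)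
   \<Rightarrow> (nat \<Rightarrow> 'm \<Rightarrow> 'm) \<Rightarrow> ('m \<Rightarrow> 'n) \<Rightarrow> ('a, 'a, 'n) bimodule \<Rightarrow> bool"
  where "free_env_resolution K L M d \<epsilon> N \<longleftrightarrow>
    (\<forall>n. central_bimodule K L (M n)) \<and> central_bimodule K L N \<and>
    free_resolution (enveloping_algebra K L) (\<lambda>n. env_module (M n)) d \<epsilon> (env_module N)"

text \<open>The bimodule \<open>\<Lambda> \<otimes>\<^sub>k V \<otimes>\<^sub>k \<Lambda>\<close> for a vector space \<open>V\<close>.\<close>

definition two_sided_tensor ::
  "('k, 'x) ring_scheme \<Rightarrow> ('k, 'a, 'y) module_scheme \<Rightarrow> ('k, 'k, 'v) bimodule
   \<Rightarrow> ('a, 'a, (('a, 'v) tensor, 'a) tensor) bimodule"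
  where "two_sided_tensor K L V =
    tensor K (tensor K (with_actions L (monoid.mult L) (\<lambda>x c. c \<odot>\<^bsub>L\<^esub> x)) V)
             (with_actions L (smult L) (monoid.mult L))"


section \<open>Skew group algebras\<close>

locale group_acting_on_algebra = group G + algebra_over_field K S + group_action G "carrier S" act
  for K :: "('k, 'x) ring_scheme" and S :: "('k, 's, 'y) module_scheme"
    and G :: "('g, 'z) monoid_scheme" and act :: "'g \<Rightarrow> 's \<Rightarrow> 's" +
  assumes finite_group: "finite (carrier G)"
    and act_ring_hom: "g \<in> carrier G \<Longrightarrow> act g \<in> ring_hom S S"
    and act_linear: "\<lbrakk>g \<in> carrier G; c \<in> carrier K; s \<in> carrier S\<rbrakk>
      \<Longrightarrow> act g (c \<odot>\<^bsub>S\<^esub> s) = c \<odot>\<^bsub>S\<^esub> act g s"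

text \<open>For a finite group \<open>G\<close>, the space \<open>S \<otimes>\<^sub>k kG\<close> is the direct sum of the \<open>S \<otimes> g\<close>, so its elements
  are functions \<open>a\<close> from \<open>G\<close> to \<open>S\<close>, standing for the sum of all \<open>a g \<otimes> g\<close>.  In this description
  \<open>s \<otimes> b\<close> for \<open>b \<in> kG\<close> is the function \<open>g \<mapsto> b g \<odot> s\<close>, see \<open>skew_tensor\<close>.\<close>

definition skew_group_algebra ::
  "('k, 's, 'x) module_scheme \<Rightarrow> ('g, 'y) monoid_scheme \<Rightarrow> ('g \<Rightarrow> 's \<Rightarrow> 's) \<Rightarrow> ('k, 'g \<Rightarrow> 's) module"
  where "skew_group_algebra S G act =
    \<lparr>carrier = carrier G \<rightarrow>\<^sub>E carrier S,
     mult = (\<lambda>a b. \<lambda>x \<in> carrier G.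
       \<Oplus>\<^bsub>S\<^esub>g \<in> carrier G. a g \<otimes>\<^bsub>S\<^esub> act g (b (inv\<^bsub>G\<^esub> g \<otimes>\<^bsub>G\<^esub> x))),
     one = (\<lambda>x \<in> carrier G. if x = \<one>\<^bsub>G\<^esub> then \<one>\<^bsub>S\<^esub> else \<zero>\<^bsub>S\<^esub>),
     ring.zero = (\<lambda>x \<in> carrier G. \<zero>\<^bsub>S\<^esub>),
     add = (\<lambda>a b. \<lambda>x \<in> carrier G. a x \<oplus>\<^bsub>S\<^esub> b x),
     smult = (\<lambda>c a. \<lambda>x \<in> carrier G. c \<odot>\<^bsub>S\<^esub> a x)\<rparr>"

definition group_algebra ::
  "('k, 'x) ring_scheme \<Rightarrow> ('g, 'y) monoid_scheme \<Rightarrow> ('k, 'g \<Rightarrow> 'k) module"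
  where "group_algebra K G =
    \<lparr>carrier = carrier G \<rightarrow>\<^sub>E carrier K,
     mult = (\<lambda>a b. \<lambda>x \<in> carrier G. \<Oplus>\<^bsub>K\<^esub>g \<in> carrier G. a g \<otimes>\<^bsub>K\<^esub> b (inv\<^bsub>G\<^esub> g \<otimes>\<^bsub>G\<^esub> x)),
     one = (\<lambda>x \<in> carrier G. if x = \<one>\<^bsub>G\<^esub> then \<one>\<^bsub>K\<^esub> else \<zero>\<^bsub>K\<^esub>),
     ring.zero = (\<lambda>x \<in> carrier G. \<zero>\<^bsub>K\<^esub>),
     add = (\<lambda>a b. \<lambda>x \<in> carrier G. a x \<oplus>\<^bsub>K\<^esub> b x),
     smult = (\<lambda>c a. \<lambda>x \<in> carrier G. c \<otimes>\<^bsub>K\<^esub> a x)\<rparr>"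

definition group_elt :: "('k, 'x) ring_scheme \<Rightarrow> ('g, 'y) monoid_scheme \<Rightarrow> 'g \<Rightarrow> 'g \<Rightarrow> 'k"
  where "group_elt K G g = (\<lambda>x \<in> carrier G. if x = g then \<one>\<^bsub>K\<^esub> else \<zero>\<^bsub>K\<^esub>)"

definition skew_tensor ::
  "('k, 's, 'x) module_scheme \<Rightarrow> ('g, 'y) monoid_scheme \<Rightarrow> 's \<Rightarrow> ('g \<Rightarrow> 'k) \<Rightarrow> 'g \<Rightarrow> 's"
  where "skew_tensor S G s b = (\<lambda>g \<in> carrier G. b g \<odot>\<^bsub>S\<^esub> s)"

text \<open>\<open>A\<close> as a left \<open>A\<close>-, right \<open>kG\<close>-bimodule and as a left \<open>S\<close>-, right \<open>A\<close>-bimodule, along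
  \<open>b \<mapsto> 1 \<otimes> b\<close> and \<open>s \<mapsto> s \<otimes> 1\<close>.\<close>

definition skew_as_A_kG ::
  "('k, 's, 'x) module_scheme \<Rightarrow> ('g, 'y) monoid_scheme \<Rightarrow> ('g \<Rightarrow> 's \<Rightarrow> 's)
   \<Rightarrow> ('g \<Rightarrow> 's, 'g \<Rightarrow> 'k, 'g \<Rightarrow> 's) bimodule"
  where "skew_as_A_kG S G act = (let A = skew_group_algebra S G act in
    with_actions A (monoid.mult A) (\<lambda>a b. a \<otimes>\<^bsub>A\<^esub> skew_tensor S G \<one>\<^bsub>S\<^esub> b))"

definition skew_as_S_A ::
  "('k, 'x) ring_scheme \<Rightarrow> ('k, 's, 'y) module_scheme \<Rightarrow> ('g, 'z) monoid_scheme
   \<Rightarrow> ('g \<Rightarrow> 's \<Rightarrow> 's) \<Rightarrow> ('s, 'g \<Rightarrow> 's, 'g \<Rightarrow> 's) bimodule"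
  where "skew_as_S_A K S G act = (let A = skew_group_algebra S G act in
    with_actions A (\<lambda>s a. skew_tensor S G s \<one>\<^bsub>group_algebra K G\<^esub> \<otimes>\<^bsub>A\<^esub> a) (monoid.mult A))"


subsection \<open>The skew group algebra as a tensor product\<close>

text \<open>The product of \<open>r \<otimes> g\<close> and \<open>s \<otimes> h\<close> is \<open>r (\<^sup>gs) \<otimes> gh\<close> (\<open>skew_mult\<close>), and
  \<open>s \<otimes> b \<mapsto> skew_tensor s b\<close> identifies \<open>S \<otimes>\<^sub>k kG\<close> with the space of functions used here
  (\<open>skew_iso\<close>).\<close>

context group_acting_on_algebra begin

abbreviation (input) "A \<equiv> skew_group_algebra S G act"
abbreviation (input) "kG \<equiv> group_algebra K G"

lemmas S_ab = ring.is_abelian_group[OF L.ring_axioms]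
lemmas K_ab = ring.is_abelian_group[OF cring.axioms(1)[OF domain.axioms(1)[OF field.axioms(1)[OF field_axioms]]]]
lemmas K_cr = domain.axioms(1)[OF field.axioms(1)[OF field_axioms]]

lemma finsum_delta:
  assumes "abelian_monoid P" "finite I" "i \<in> I" "\<And>j. j \<in> I \<Longrightarrow> f j \<in> carrier P"
    "\<And>j. j \<in> I \<Longrightarrow> j \<noteq> i \<Longrightarrow> f j = \<zero>\<^bsub>P\<^esub>"
  shows "(\<Oplus>\<^bsub>P\<^esub>j \<in> I. f j) = f i"
proof -
  interpret P: abelian_monoid P by fact
  have "(\<Oplus>\<^bsub>P\<^esub>j \<in> I. f j) = (\<Oplus>\<^bsub>P\<^esub>j \<in> {i}. f j)"
    by (rule P.add.finprod_mono_neutral_cong_right) (use assms in auto)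
  then show ?thesis using assms(3,4) by simp
qed

lemma act_closed: "g \<in> carrier G \<Longrightarrow> s \<in> carrier S \<Longrightarrow> act g s \<in> carrier S"
  using act_ring_hom ring_hom_closed by metis
lemma act_zero: "g \<in> carrier G \<Longrightarrow> act g \<zero>\<^bsub>S\<^esub> = \<zero>\<^bsub>S\<^esub>"
  using ring_hom_zero[OF act_ring_hom] L.ring_axioms by blast

lemma skew_tensor_elt: "s \<in> carrier S \<Longrightarrow> g \<in> carrier G \<Longrightarrow>
  skew_tensor S G s (group_elt K G g) = (\<lambda>x \<in> carrier G. if x = g then s else \<zero>\<^bsub>S\<^esub>)"
  by (auto simp: skew_tensor_def group_elt_def fun_eq_iff)

lemma skew_mult:
  assumes "s \<in> carrier S" "t \<in> carrier S" "g \<in> carrier G" "h \<in> carrier G"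
  shows "skew_tensor S G s (group_elt K G g) \<otimes>\<^bsub>A\<^esub> skew_tensor S G t (group_elt K G h)
    = skew_tensor S G (s \<otimes>\<^bsub>S\<^esub> act g t) (group_elt K G (g \<otimes>\<^bsub>G\<^esub> h))"
proof -
  let ?a = "\<lambda>y. if y = g then s else \<zero>\<^bsub>S\<^esub>" and ?b = "\<lambda>y. if y = h then t else \<zero>\<^bsub>S\<^esub>"
  have "(\<Oplus>\<^bsub>S\<^esub>y \<in> carrier G. (\<lambda>x \<in> carrier G. ?a x) y \<otimes>\<^bsub>S\<^esub> act y ((\<lambda>x \<in> carrier G. ?b x) (inv\<^bsub>G\<^esub> y \<otimes>\<^bsub>G\<^esub> x)))
    = (if x = g \<otimes>\<^bsub>G\<^esub> h then s \<otimes>\<^bsub>S\<^esub> act g t else \<zero>\<^bsub>S\<^esub>)" if x: "x \<in> carrier G" for x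
  proof -
    have "(\<Oplus>\<^bsub>S\<^esub>y \<in> carrier G. (\<lambda>x \<in> carrier G. ?a x) y \<otimes>\<^bsub>S\<^esub> act y ((\<lambda>x \<in> carrier G. ?b x) (inv\<^bsub>G\<^esub> y \<otimes>\<^bsub>G\<^esub> x)))
      = (\<lambda>x \<in> carrier G. ?a x) g \<otimes>\<^bsub>S\<^esub> act g ((\<lambda>x \<in> carrier G. ?b x) (inv\<^bsub>G\<^esub> g \<otimes>\<^bsub>G\<^esub> x))"
      by (rule finsum_delta) (use assms x finite_group act_closed act_zero abelian_group.axioms(1)[OF S_ab] in \<open>auto\<close>)
    moreover have "inv\<^bsub>G\<^esub> g \<otimes>\<^bsub>G\<^esub> x = h \<longleftrightarrow> x = g \<otimes>\<^bsub>G\<^esub> h"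
      using assms x by (metis inv_solve_left)
    ultimately show ?thesis using assms x act_zero by auto
  qed
  then show ?thesis using assms act_closed
    by (auto simp: skew_tensor_elt skew_group_algebra_def fun_eq_iff)
qed

lemma fun_abelian_group:
  assumes "abelian_group P" "carrier M = I \<rightarrow>\<^sub>E carrier P" "\<zero>\<^bsub>M\<^esub> = (\<lambda>i \<in> I. \<zero>\<^bsub>P\<^esub>)"
    "\<And>x y. x \<oplus>\<^bsub>M\<^esub> y = (\<lambda>i \<in> I. x i \<oplus>\<^bsub>P\<^esub> y i)"
  shows "abelian_group M"
proof -
  interpret P: abelian_group P by fact
  show ?thesis
  proof (rule abelian_groupI)
    fix x assume x: "x \<in> carrier M"
    show "\<exists>y\<in>carrier M. y \<oplus>\<^bsub>M\<^esub> x = \<zero>\<^bsub>M\<^esub>"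
      by (rule bexI[where x="\<lambda>g \<in> I. \<ominus>\<^bsub>P\<^esub> x g"]) (use x in \<open>auto simp: assms fun_eq_iff intro!: P.l_neg\<close>)
  next
    fix x y z assume *: "x \<in> carrier M" "y \<in> carrier M" "z \<in> carrier M"
    show "x \<oplus>\<^bsub>M\<^esub> y \<oplus>\<^bsub>M\<^esub> z = x \<oplus>\<^bsub>M\<^esub> (y \<oplus>\<^bsub>M\<^esub> z)"
      using * by (auto simp: assms fun_eq_iff intro!: P.a_assoc)
  next
    fix x y assume *: "x \<in> carrier M" "y \<in> carrier M"
    show "x \<oplus>\<^bsub>M\<^esub> y = y \<oplus>\<^bsub>M\<^esub> x" using * by (auto simp: assms fun_eq_iff intro!: P.a_comm)
    show "x \<oplus>\<^bsub>M\<^esub> y \<in> carrier M" using * by (auto simp: assms)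
  next
    fix x assume *: "x \<in> carrier M"
    show "\<zero>\<^bsub>M\<^esub> \<oplus>\<^bsub>M\<^esub> x = x" using * by (auto simp: assms fun_eq_iff PiE_def extensional_def Pi_def)
  qed (auto simp: assms)
qed

lemma abelian_group_A: "abelian_group A"
  by (rule fun_abelian_group[OF S_ab]) (auto simp: skew_group_algebra_def)

lemma abelian_group_kG: "abelian_group kG"
  by (rule fun_abelian_group[OF K_ab]) (auto simp: group_algebra_def)

lemma space_data: "tensor_data K (space_bimodule S) (space_bimodule kG)"
proof -
  have ab: "abelian_group (space_bimodule V)" if "abelian_group V" for V :: "('k, 'v, 'w) module_scheme"
  proof -
    interpret V: abelian_group V by fact
    show ?thesis
      by (rule abelian_groupI) (auto simp: space_bimodule_def with_actions_def V.a_ac intro!: bexI[OF _ V.a_inv_closed] V.l_neg)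
  qed
  have "abelian_group (space_bimodule S)" by (rule ab[OF S_ab])
  moreover have "abelian_group (space_bimodule kG)" by (rule ab[OF abelian_group_kG])
  ultimately show ?thesis
    by (auto intro!: tensor_data.intro tensor_data_axioms.intro simp: space_bimodule_def with_actions_def group_algebra_def
      intro!: cring.cring_simprules(5)[OF K_cr])
qed

interpretation X: tensor_data K "space_bimodule S" "space_bimodule kG" by (rule space_data)

lemma sb: "carrier (space_bimodule S) = carrier S" "carrier (space_bimodule kG) = carrier G \<rightarrow>\<^sub>E carrier K"
  "x \<oplus>\<^bsub>space_bimodule S\<^esub> y = x \<oplus>\<^bsub>S\<^esub> y" "u \<oplus>\<^bsub>space_bimodule kG\<^esub> v = u \<oplus>\<^bsub>kG\<^esub> v"
  "ract (space_bimodule S) x c = c \<odot>\<^bsub>S\<^esub> x" "lact (space_bimodule kG) c u = c \<odot>\<^bsub>kG\<^esub> u"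
  by (auto simp: space_bimodule_def with_actions_def group_algebra_def)

lemma bal: "balanced_map K (space_bimodule S) (space_bimodule kG) A (skew_tensor S G)"
  unfolding balanced_map_def sb
proof (intro conjI ballI)
  fix x y assume *: "x \<in> carrier S" "y \<in> carrier G \<rightarrow>\<^sub>E carrier K"
  show "skew_tensor S G x y \<in> carrier A"
    using * by (auto simp: skew_tensor_def skew_group_algebra_def intro!: smult_closed)
next
  fix x x' y assume *: "x \<in> carrier S" "x' \<in> carrier S" "y \<in> carrier G \<rightarrow>\<^sub>E carrier K"
  show "skew_tensor S G (x \<oplus>\<^bsub>S\<^esub> x') y = skew_tensor S G x y \<oplus>\<^bsub>A\<^esub> skew_tensor S G x' y"
    using * by (auto simp: skew_tensor_def skew_group_algebra_def fun_eq_iff intro!: smult_r_distr)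
next
  fix x y y' assume *: "x \<in> carrier S" "y \<in> carrier G \<rightarrow>\<^sub>E carrier K" "y' \<in> carrier G \<rightarrow>\<^sub>E carrier K"
  show "skew_tensor S G x (y \<oplus>\<^bsub>kG\<^esub> y') = skew_tensor S G x y \<oplus>\<^bsub>A\<^esub> skew_tensor S G x y'"
    using * by (auto simp: skew_tensor_def skew_group_algebra_def group_algebra_def fun_eq_iff intro!: smult_l_distr)
next
  fix x c y assume *: "x \<in> carrier S" "c \<in> carrier K" "y \<in> carrier G \<rightarrow>\<^sub>E carrier K"
  have "y g \<odot>\<^bsub>S\<^esub> (c \<odot>\<^bsub>S\<^esub> x) = (c \<otimes>\<^bsub>K\<^esub> y g) \<odot>\<^bsub>S\<^esub> x" if "g \<in> carrier G" for g
  proof -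
    have yg: "y g \<in> carrier K" using * that by auto
    show ?thesis using smult_assoc1[OF yg *(2,1)] cring.cring_simprules(14)[OF K_cr yg *(2)] by simp
  qed
  then show "skew_tensor S G (c \<odot>\<^bsub>S\<^esub> x) y = skew_tensor S G x (c \<odot>\<^bsub>kG\<^esub> y)"
    by (auto simp: skew_tensor_def group_algebra_def fun_eq_iff)
qed

lemma skew_iso: "bij_betw (tensor_lift A (skew_tensor S G)) (carrier (tensor_group K (space_bimodule S) (space_bimodule kG))) (carrier A)"
proof -
  let ?T = "tensor_group K (space_bimodule S) (space_bimodule kG)"
  let ?p = "pure_tensor K (space_bimodule S) (space_bimodule kG)"
  let ?L = "tensor_lift A (skew_tensor S G)"
  define J where "J a = (\<Oplus>\<^bsub>?T\<^esub>g \<in> carrier G. ?p (a g) (group_elt K G g))" for a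
  have elt: "group_elt K G g \<in> carrier G \<rightarrow>\<^sub>E carrier K" for g by (auto simp: group_elt_def)
  note pc = X.pure_closed[unfolded sb] and pb = X.pure_balanced[unfolded balanced_map_def sb]
  have pbr: "?p x (y \<oplus>\<^bsub>kG\<^esub> y') = ?p x y \<oplus>\<^bsub>?T\<^esub> ?p x y'" if "x \<in> carrier S" "y \<in> carrier G \<rightarrow>\<^sub>E carrier K" "y' \<in> carrier G \<rightarrow>\<^sub>E carrier K" for x y y'
    using pb that by blast
  have pbm: "?p (c \<odot>\<^bsub>S\<^esub> x) y = ?p x (c \<odot>\<^bsub>kG\<^esub> y)" if "x \<in> carrier S" "y \<in> carrier G \<rightarrow>\<^sub>E carrier K" "c \<in> carrier K" for x y c
    using pb that by blast
  have Lhom: "?L \<in> hom (add_monoid ?T) (add_monoid A)" by (rule X.tensor_lift_hom[OF abelian_group_A bal])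
  have Jc: "J a \<in> carrier ?T" if "a \<in> carrier A" for a
    unfolding J_def by (rule X.T.finsum_closed) (use that elt in \<open>auto simp: skew_group_algebra_def intro!: pc\<close>)
  have Jadd: "J (a \<oplus>\<^bsub>A\<^esub> b) = J a \<oplus>\<^bsub>?T\<^esub> J b" if "a \<in> carrier A" "b \<in> carrier A" for a b
  proof -
    have "J (a \<oplus>\<^bsub>A\<^esub> b) = (\<Oplus>\<^bsub>?T\<^esub>g \<in> carrier G. ?p (a g) (group_elt K G g) \<oplus>\<^bsub>?T\<^esub> ?p (b g) (group_elt K G g))"
      unfolding J_def
    proof (rule X.T.finsum_cong')
      fix g assume g: "g \<in> carrier G"
      then have "a g \<in> carrier S" "b g \<in> carrier S" "(a \<oplus>\<^bsub>A\<^esub> b) g = a g \<oplus>\<^bsub>S\<^esub> b g" using that by (auto simp: skew_group_algebra_def)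
      then show "?p ((a \<oplus>\<^bsub>A\<^esub> b) g) (group_elt K G g) = ?p (a g) (group_elt K G g) \<oplus>\<^bsub>?T\<^esub> ?p (b g) (group_elt K G g)"
        using pb elt by metis
    qed (use that elt in \<open>auto simp: skew_group_algebra_def intro!: pc X.T.a_closed\<close>)
    also have "\<dots> = J a \<oplus>\<^bsub>?T\<^esub> J b" unfolding J_def
      by (rule X.T.finsum_addf) (use that elt in \<open>auto simp: skew_group_algebra_def intro!: pc\<close>)
    finally show ?thesis .
  qed
  have JL: "J (?L X) = X" if "X \<in> carrier ?T" for X
  proof -
    have "(J \<circ> ?L) X = id X"
    proof (rule X.tensor_hom_eq[OF X.T_abelian _ _ _ that])
      show "J \<circ> ?L \<in> hom (add_monoid ?T) (add_monoid ?T)"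
        by (rule Group.hom_compose[OF Lhom]) (auto intro!: homI simp: Jc Jadd)
      show "id \<in> hom (add_monoid ?T) (add_monoid ?T)" by (auto intro!: homI)
      fix s b assume s: "s \<in> carrier (space_bimodule S)" and b: "b \<in> carrier (space_bimodule kG)"
      note sc = s[unfolded sb] and bc = b[unfolded sb]
      have bk: "b g \<in> carrier K" if "g \<in> carrier G" for g using that bc by auto
      have cc: "b g \<odot>\<^bsub>kG\<^esub> group_elt K G g \<in> carrier G \<rightarrow>\<^sub>E carrier K" if "g \<in> carrier G" for g
        using bk[OF that] by (auto simp: group_algebra_def group_elt_def)
      have sum: "(\<Oplus>\<^bsub>?T\<^esub>g \<in> I. ?p s (b g \<odot>\<^bsub>kG\<^esub> group_elt K G g)) = ?p s (\<lambda>g \<in> carrier G. if g \<in> I then b g else \<zero>\<^bsub>K\<^esub>)"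
        if "finite I" "I \<subseteq> carrier G" for I
        using that
      proof (induction I rule: finite_induct)
        case empty
        have z: "\<zero>\<^bsub>kG\<^esub> = (\<lambda>g \<in> carrier G. \<zero>\<^bsub>K\<^esub>)" by (simp add: group_algebra_def)
        have zc: "\<zero>\<^bsub>kG\<^esub> \<in> carrier G \<rightarrow>\<^sub>E carrier K" unfolding z by auto
        have "\<zero>\<^bsub>kG\<^esub> \<oplus>\<^bsub>kG\<^esub> \<zero>\<^bsub>kG\<^esub> = \<zero>\<^bsub>kG\<^esub>" by (auto simp: group_algebra_def fun_eq_iff)
        then have "?p s \<zero>\<^bsub>kG\<^esub> = ?p s \<zero>\<^bsub>kG\<^esub> \<oplus>\<^bsub>?T\<^esub> ?p s \<zero>\<^bsub>kG\<^esub>" using pb zc s[unfolded sb] by metis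
        then have "?p s \<zero>\<^bsub>kG\<^esub> = \<zero>\<^bsub>?T\<^esub>" using X.T.add.r_cancel_one' pc[OF s[unfolded sb] zc] by metis
        then show ?case by (simp add: z restrict_def)
      next
        case (insert h I)
        have d: "(\<lambda>g \<in> carrier G. if g \<in> I then b g else \<zero>\<^bsub>K\<^esub>) \<in> carrier G \<rightarrow>\<^sub>E carrier K" using b by (auto simp: sb)
        have "(\<Oplus>\<^bsub>?T\<^esub>g \<in> insert h I. ?p s (b g \<odot>\<^bsub>kG\<^esub> group_elt K G g))
          = ?p s (b h \<odot>\<^bsub>kG\<^esub> group_elt K G h) \<oplus>\<^bsub>?T\<^esub> ?p s (\<lambda>g \<in> carrier G. if g \<in> I then b g else \<zero>\<^bsub>K\<^esub>)"
          
        proof -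
          have "(\<Oplus>\<^bsub>?T\<^esub>g \<in> insert h I. ?p s (b g \<odot>\<^bsub>kG\<^esub> group_elt K G g))
            = ?p s (b h \<odot>\<^bsub>kG\<^esub> group_elt K G h) \<oplus>\<^bsub>?T\<^esub> (\<Oplus>\<^bsub>?T\<^esub>g \<in> I. ?p s (b g \<odot>\<^bsub>kG\<^esub> group_elt K G g))"
            by (rule X.T.finsum_insert) (use insert in \<open>auto intro!: pc[OF sc cc]\<close>)
          then show ?thesis using insert.IH insert.prems by (simp only: insert_subset)
        qed
        also have "\<dots> = ?p s ((b h \<odot>\<^bsub>kG\<^esub> group_elt K G h) \<oplus>\<^bsub>kG\<^esub> (\<lambda>g \<in> carrier G. if g \<in> I then b g else \<zero>\<^bsub>K\<^esub>))"
          using pbr[OF sc cc d, of h, symmetric] insert.prems by simp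
        also have "(b h \<odot>\<^bsub>kG\<^esub> group_elt K G h) \<oplus>\<^bsub>kG\<^esub> (\<lambda>g \<in> carrier G. if g \<in> I then b g else \<zero>\<^bsub>K\<^esub>) = (\<lambda>g \<in> carrier G. if g \<in> insert h I then b g else \<zero>\<^bsub>K\<^esub>)"
        proof
          fix x show "((b h \<odot>\<^bsub>kG\<^esub> group_elt K G h) \<oplus>\<^bsub>kG\<^esub> (\<lambda>g \<in> carrier G. if g \<in> I then b g else \<zero>\<^bsub>K\<^esub>)) x = (\<lambda>g \<in> carrier G. if g \<in> insert h I then b g else \<zero>\<^bsub>K\<^esub>) x"
            using insert.hyps insert.prems bk[of x] bk[of h] by (cases "x = h") (auto simp: group_algebra_def group_elt_def)
        qed
        finally show ?case .
      qed
      have "J (skew_tensor S G s b) = (\<Oplus>\<^bsub>?T\<^esub>g \<in> carrier G. ?p s (b g \<odot>\<^bsub>kG\<^esub> group_elt K G g))"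
        unfolding J_def
      proof (rule X.T.finsum_cong')
        fix g assume g: "g \<in> carrier G"
        show "?p (skew_tensor S G s b g) (group_elt K G g) = ?p s (b g \<odot>\<^bsub>kG\<^esub> group_elt K G g)"
          using pbm[OF sc elt bk[OF g]] g by (simp add: skew_tensor_def)
      qed (auto intro!: pc[OF sc cc])
      also have "\<dots> = ?p s b"
      proof -
        have "(\<lambda>g \<in> carrier G. if g \<in> carrier G then b g else \<zero>\<^bsub>K\<^esub>) = b" using b by (auto simp: sb fun_eq_iff PiE_def extensional_def)
        then show ?thesis using sum[OF finite_group order_refl] by (simp only:)
      qed
      finally show "(J \<circ> ?L) (?p s b) = id (?p s b)"
        using X.tensor_lift_pure[OF abelian_group_A bal s b] by simp
    qed
    then show ?thesis by simp
  qed
  have LJ: "?L (J a) = a" if a: "a \<in> carrier A" for a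
  proof -
    interpret A: abelian_group A by (rule abelian_group_A)
    interpret L: group_hom "add_monoid ?T" "add_monoid A" ?L
      by (intro group_hom.intro group_hom_axioms.intro X.T.a_group A.a_group Lhom)
    have ac: "a g \<in> carrier S" if "g \<in> carrier G" for g using a that by (auto simp: skew_group_algebra_def)
    have "?L (\<Oplus>\<^bsub>?T\<^esub>g \<in> I. ?p (a g) (group_elt K G g)) = (\<lambda>g \<in> carrier G. if g \<in> I then a g else \<zero>\<^bsub>S\<^esub>)"
      if "finite I" "I \<subseteq> carrier G" for I
      using that
    proof (induction I rule: finite_induct)
      case empty show ?case using L.hom_one by (simp add: skew_group_algebra_def)
    next
      case (insert h I)
      have 1: "(\<Oplus>\<^bsub>?T\<^esub>g \<in> insert h I. ?p (a g) (group_elt K G g)) = ?p (a h) (group_elt K G h) \<oplus>\<^bsub>?T\<^esub> (\<Oplus>\<^bsub>?T\<^esub>g \<in> I. ?p (a g) (group_elt K G g))"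
        by (rule X.T.finsum_insert) (use insert in \<open>auto intro!: pc elt ac\<close>)
      have 2: "?L (?p (a h) (group_elt K G h)) = skew_tensor S G (a h) (group_elt K G h)"
        using insert.prems by (intro X.tensor_lift_pure[OF abelian_group_A bal]) (simp_all only: sb elt ac insert_subset)
      have 3: "?p (a h) (group_elt K G h) \<in> carrier ?T" "(\<Oplus>\<^bsub>?T\<^esub>g \<in> I. ?p (a g) (group_elt K G g)) \<in> carrier ?T"
        using insert.prems by (auto intro!: X.T.finsum_closed pc elt ac)
      show ?case unfolding 1 using L.hom_mult[of "?p (a h) (group_elt K G h)" "(\<Oplus>\<^bsub>?T\<^esub>g \<in> I. ?p (a g) (group_elt K G g))"] 3 2 insert ac
        by (auto simp: skew_tensor_elt skew_group_algebra_def fun_eq_iff)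
    qed
    from this[OF finite_group] show ?thesis unfolding J_def using a
      by (auto simp: skew_group_algebra_def fun_eq_iff PiE_def extensional_def)
  qed
  show ?thesis
    by (rule bij_betw_byWitness[where f' = J]) (use JL LJ Jc Lhom in \<open>auto simp: hom_def\<close>)
qed

end


section \<open>Graded vector spaces\<close>

definition homogeneous_decomposition ::
  "('g, 'x) monoid_scheme \<Rightarrow> ('m, 'y) ring_scheme \<Rightarrow> ('g \<Rightarrow> 'm set) \<Rightarrow> 'm \<Rightarrow> ('g \<Rightarrow> 'm) \<Rightarrow> bool"
  where "homogeneous_decomposition G M gr x f \<longleftrightarrow>
    f \<in> (\<Pi>\<^sub>E g \<in> carrier G. gr g) \<and> x = (\<Oplus>\<^bsub>M\<^esub>g \<in> carrier G. f g)"

definition homogeneous_component ::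
  "('g, 'x) monoid_scheme \<Rightarrow> ('m, 'y) ring_scheme \<Rightarrow> ('g \<Rightarrow> 'm set) \<Rightarrow> 'm \<Rightarrow> 'g \<Rightarrow> 'm"
  where "homogeneous_component G M gr x = (THE f. homogeneous_decomposition G M gr x f)"

text \<open>The group is finite in the intended application, so that no finiteness condition on the
  decompositions is needed.\<close>

definition graded_space ::
  "('k, 'x) ring_scheme \<Rightarrow> ('g, 'y) monoid_scheme \<Rightarrow> ('k, 'v, 'z) module_scheme
   \<Rightarrow> ('g \<Rightarrow> 'v set) \<Rightarrow> bool"
  where "graded_space K G V gr \<longleftrightarrow> module K V \<and>
    (\<forall>g \<in> carrier G. submodule (gr g) K V) \<and>
    (\<forall>x \<in> carrier V. \<exists>!f. homogeneous_decomposition G V gr x f)"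

definition group_algebra_grading ::
  "('k, 'x) ring_scheme \<Rightarrow> ('g, 'y) monoid_scheme \<Rightarrow> 'g \<Rightarrow> ('g \<Rightarrow> 'k) set"
  where "group_algebra_grading K G g =
    {c \<odot>\<^bsub>group_algebra K G\<^esub> group_elt K G g | c. c \<in> carrier K}"

text \<open>\<open>(M \<otimes> N)\<^sub>g\<close> is the sum of all \<open>M\<^sub>x \<otimes> N\<^sub>y\<close> with \<open>xy = g\<close>.\<close>

definition tensor_grading ::
  "('k, 'x) ring_scheme \<Rightarrow> ('g, 'w) monoid_scheme
   \<Rightarrow> ('a, 'k, 'm, 'y) bimodule_scheme \<Rightarrow> ('g \<Rightarrow> 'm set)
   \<Rightarrow> ('k, 'b, 'n, 'z) bimodule_scheme \<Rightarrow> ('g \<Rightarrow> 'n set) \<Rightarrow> 'g \<Rightarrow> ('m, 'n) tensor set"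
  where "tensor_grading K G M grM N grN g =
    generate (add_monoid (tensor_group K M N))
      {pure_tensor K M N m n | x y m n. x \<in> carrier G \<and> y \<in> carrier G \<and> x \<otimes>\<^bsub>G\<^esub> y = g \<and>
        m \<in> grM x \<and> n \<in> grN y}"

definition two_sided_grading ::
  "('k, 'x) ring_scheme \<Rightarrow> ('g, 'w) monoid_scheme \<Rightarrow> ('k, 'a, 'y) module_scheme
   \<Rightarrow> ('g \<Rightarrow> 'a set) \<Rightarrow> ('k, 'k, 'v) bimodule \<Rightarrow> ('g \<Rightarrow> 'v set)
   \<Rightarrow> 'g \<Rightarrow> (('a, 'v) tensor, 'a) tensor set"
  where "two_sided_grading K G L grL V grV =
    (let L1 = with_actions L (monoid.mult L) (\<lambda>x c. c \<odot>\<^bsub>L\<^esub> x); L2 = with_actions L (smult L) (monoid.mult L)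
     in tensor_grading K G (tensor K L1 V) (tensor_grading K G L1 grL V grV) L2 grL)"


section \<open>The two given resolutions\<close>

text \<open>The resolution \<open>C\<close> of \<open>kG\<close>; \<open>gC i g\<close> is the graded piece \<open>(C\<^sub>i)\<^sub>g\<close>, and the vector space
  structure of \<open>C\<^sub>i\<close> is the one given by the scalars in \<open>kG\<close>.\<close>

locale graded_resolution_of_kG =
  fixes K :: "('k, 'x) ring_scheme" and G :: "('g, 'y) monoid_scheme"
    and C :: "nat \<Rightarrow> ('g \<Rightarrow> 'k, 'g \<Rightarrow> 'k, 'c) bimodule" and gC :: "nat \<Rightarrow> 'g \<Rightarrow> 'c set"
    and dC :: "nat \<Rightarrow> 'c \<Rightarrow> 'c" and \<epsilon>C :: "'c \<Rightarrow> 'g \<Rightarrow> 'k"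
    and C' :: "nat \<Rightarrow> ('k, 'v) module" and gC' :: "nat \<Rightarrow> 'g \<Rightarrow> 'v set"
  assumes C_resolution:
      "free_env_resolution K (group_algebra K G) C dC \<epsilon>C (regular_bimodule (group_algebra K G))"
    and C_graded:
      "graded_space K G (with_smult (C i)
         (\<lambda>c. lact (C i) (c \<odot>\<^bsub>group_algebra K G\<^esub> \<one>\<^bsub>group_algebra K G\<^esub>))) (gC i)"
    and C_graded_actions:
      "\<lbrakk>g \<in> carrier G; h \<in> carrier G; l \<in> carrier G\<rbrakk>
       \<Longrightarrow> (\<lambda>x. ract (C i) (lact (C i) (group_elt K G g) x) (group_elt K G l)) ` gC i h
           = gC i (g \<otimes>\<^bsub>G\<^esub> h \<otimes>\<^bsub>G\<^esub> l)"
    and dC_graded: "g \<in> carrier G \<Longrightarrow> dC (Suc i) ` gC (Suc i) g \<subseteq> gC i g"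
    and \<epsilon>C_graded: "g \<in> carrier G \<Longrightarrow> \<epsilon>C ` gC 0 g \<subseteq> group_algebra_grading K G g"
    and C'_graded: "graded_space K G (C' i) (gC' i)"
    and C_free: "\<exists>\<phi> \<in> left_module_iso (enveloping_algebra K (group_algebra K G))
        (env_module (two_sided_tensor K (group_algebra K G) (space_bimodule (C' i))))
        (env_module (C i)).
      \<forall>g \<in> carrier G. \<phi> ` two_sided_grading K G (group_algebra K G) (group_algebra_grading K G)
        (space_bimodule (C' i)) (gC' i) g = gC i g"

text \<open>The resolution \<open>D\<close> of \<open>S\<close>; \<open>aD j\<close> is the left action of \<open>kG\<close> on \<open>D\<^sub>j\<close>.  Compatibility of
  the left actions means that \<open>(s \<otimes> b) y = s (b y)\<close> defines an action of \<open>A\<close>.  The formula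
  \<open>g (y \<otimes> a) = \<^sup>gy \<otimes> ga\<close> on \<open>D\<^sub>j \<otimes>\<^sub>S A\<close> is well defined only if the group action is also
  compatible with the right action of \<open>S\<close>, which is \<open>D_right_compatible\<close>.\<close>

locale equivariant_resolution =
  fixes K :: "('k, 'x) ring_scheme" and S :: "('k, 's, 'y) module_scheme"
    and G :: "('g, 'z) monoid_scheme" and act :: "'g \<Rightarrow> 's \<Rightarrow> 's"
    and D :: "nat \<Rightarrow> ('s, 's, 'd) bimodule" and aD :: "nat \<Rightarrow> ('g \<Rightarrow> 'k) \<Rightarrow> 'd \<Rightarrow> 'd"
    and dD :: "nat \<Rightarrow> 'd \<Rightarrow> 'd" and \<epsilon>D :: "'d \<Rightarrow> 's"
    and D' :: "nat \<Rightarrow> ('k, 'w) module"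
  assumes D_resolution: "free_env_resolution K S D dD \<epsilon>D (regular_bimodule S)"
    and D_kG_module: "left_module (group_algebra K G) (with_smult (D j) (aD j))"
    and dD_equivariant: "dD (Suc j) \<in> left_module_hom (group_algebra K G)
      (with_smult (D (Suc j)) (aD (Suc j))) (with_smult (D j) (aD j))"
    and \<epsilon>D_equivariant: "\<epsilon>D \<in> left_module_hom (group_algebra K G) (with_smult (D 0) (aD 0))
      (with_smult S (\<lambda>b s. \<Oplus>\<^bsub>S\<^esub>g \<in> carrier G. b g \<odot>\<^bsub>S\<^esub> act g s))"
    and D_compatible: "\<exists>m. left_module (skew_group_algebra S G act) (with_smult (D j) m) \<and>
      (\<forall>s \<in> carrier S. \<forall>b \<in> carrier (group_algebra K G). \<forall>y \<in> carrier (D j).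
        m (skew_tensor S G s b) y = lact (D j) s (aD j b y))"
    and D_right_compatible: "\<lbrakk>g \<in> carrier G; y \<in> carrier (D j); s \<in> carrier S\<rbrakk>
      \<Longrightarrow> aD j (group_elt K G g) (ract (D j) y s)
        = ract (D j) (aD j (group_elt K G g) y) (act g s)"
    and D'_space: "module K (D' j)"
    and D_free: "\<exists>\<psi>. \<psi> \<in> left_module_iso (enveloping_algebra K S)
        (env_module (two_sided_tensor K S (space_bimodule (D' j)))) (env_module (D j))"


section \<open>The induced complexes of bimodules over the skew group algebra\<close>

text \<open>\<open>A \<otimes>\<^bsub>kG\<^esub> C\<^sub>i\<close>.  The action of \<open>S\<close> on the right is \<open>(a \<otimes> x) s = a (\<^sup>gs) \<otimes> x\<close> for \<open>x\<close> of degree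
  \<open>g\<close>, extended additively through the homogeneous components of \<open>x\<close>; a general element of \<open>A\<close> is
  the sum of the \<open>a g \<otimes> g\<close> and acts as the sum of \<open>t \<mapsto> (t (a g)) g\<close>.\<close>

definition kG_induced_right_S ::
  "('k, 'x) ring_scheme \<Rightarrow> ('k, 's, 'y) module_scheme \<Rightarrow> ('g, 'z) monoid_scheme \<Rightarrow> ('g \<Rightarrow> 's \<Rightarrow> 's)
   \<Rightarrow> ('g \<Rightarrow> 'k, 'g \<Rightarrow> 'k, 'c) bimodule \<Rightarrow> ('g \<Rightarrow> 'c set)
   \<Rightarrow> ('g \<Rightarrow> 's, 'c) tensor \<Rightarrow> 's \<Rightarrow> ('g \<Rightarrow> 's, 'c) tensor"
  where "kG_induced_right_S K S G act M gr t s =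
    (let kG = group_algebra K G; A = skew_group_algebra S G act; A0 = skew_as_A_kG S G act;
         T = tensor_group kG A0 M
     in tensor_lift T (\<lambda>a x. \<Oplus>\<^bsub>T\<^esub>g \<in> carrier G.
          pure_tensor kG A0 M (a \<otimes>\<^bsub>A\<^esub> skew_tensor S G (act g s) \<one>\<^bsub>kG\<^esub>)
            (homogeneous_component G M gr x g)) t)"

definition kG_induced ::
  "('k, 'x) ring_scheme \<Rightarrow> ('k, 's, 'y) module_scheme \<Rightarrow> ('g, 'z) monoid_scheme \<Rightarrow> ('g \<Rightarrow> 's \<Rightarrow> 's)
   \<Rightarrow> ('g \<Rightarrow> 'k, 'g \<Rightarrow> 'k, 'c) bimodule \<Rightarrow> ('g \<Rightarrow> 'c set)
   \<Rightarrow> ('g \<Rightarrow> 's, 'g \<Rightarrow> 's, ('g \<Rightarrow> 's, 'c) tensor) bimodule"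
  where "kG_induced K S G act M gr =
    (let T = tensor (group_algebra K G) (skew_as_A_kG S G act) M
     in with_actions T (lact T)
          (\<lambda>t a. \<Oplus>\<^bsub>T\<^esub>g \<in> carrier G.
             ract T (kG_induced_right_S K S G act M gr t (a g)) (group_elt K G g)))"

definition kG_induced_map ::
  "('k, 'x) ring_scheme \<Rightarrow> ('k, 's, 'y) module_scheme \<Rightarrow> ('g, 'z) monoid_scheme \<Rightarrow> ('g \<Rightarrow> 's \<Rightarrow> 's)
   \<Rightarrow> ('g \<Rightarrow> 'k, 'g \<Rightarrow> 'k, 'c) bimodule \<Rightarrow> ('g \<Rightarrow> 'k, 'g \<Rightarrow> 'k, 'e) bimodule \<Rightarrow> ('c \<Rightarrow> 'e)
   \<Rightarrow> ('g \<Rightarrow> 's, 'c) tensor \<Rightarrow> ('g \<Rightarrow> 's, 'e) tensor"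
  where "kG_induced_map K S G act M N f =
    tensor_map (group_algebra K G) (skew_as_A_kG S G act) M (skew_as_A_kG S G act) N (\<lambda>a. a) f"

text \<open>\<open>A \<otimes>\<^bsub>kG\<^esub> C\<^sub>0 \<rightarrow> A \<otimes>\<^bsub>kG\<^esub> kG \<cong> A\<close>.\<close>

definition kG_induced_aug ::
  "('k, 'x) ring_scheme \<Rightarrow> ('k, 's, 'y) module_scheme \<Rightarrow> ('g, 'z) monoid_scheme \<Rightarrow> ('g \<Rightarrow> 's \<Rightarrow> 's)
   \<Rightarrow> ('g \<Rightarrow> 'k, 'g \<Rightarrow> 'k, 'c) bimodule \<Rightarrow> ('c \<Rightarrow> 'g \<Rightarrow> 'k) \<Rightarrow> ('g \<Rightarrow> 's, 'c) tensor \<Rightarrow> 'g \<Rightarrow> 's"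
  where "kG_induced_aug K S G act M \<epsilon> t =
    (let A = skew_group_algebra S G act
     in tensor_lift A (\<lambda>a b. a \<otimes>\<^bsub>A\<^esub> skew_tensor S G \<one>\<^bsub>S\<^esub> b)
          (kG_induced_map K S G act M (regular_bimodule (group_algebra K G)) \<epsilon> t))"

text \<open>\<open>D\<^sub>j \<otimes>\<^sub>S A\<close>.  Here \<open>g \<in> G\<close> acts on the left by \<open>g (y \<otimes> a) = \<^sup>gy \<otimes> ga\<close>, and the sum of the
  \<open>a g \<otimes> g\<close> as the sum of \<open>t \<mapsto> a g (g t)\<close>.\<close>

definition S_induced_left_G ::
  "('k, 'x) ring_scheme \<Rightarrow> ('k, 's, 'y) module_scheme \<Rightarrow> ('g, 'z) monoid_scheme \<Rightarrow> ('g \<Rightarrow> 's \<Rightarrow> 's)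
   \<Rightarrow> ('s, 's, 'd) bimodule \<Rightarrow> (('g \<Rightarrow> 'k) \<Rightarrow> 'd \<Rightarrow> 'd)
   \<Rightarrow> 'g \<Rightarrow> ('d, 'g \<Rightarrow> 's) tensor \<Rightarrow> ('d, 'g \<Rightarrow> 's) tensor"
  where "S_induced_left_G K S G act N m g t =
    (let A = skew_group_algebra S G act; A0 = skew_as_S_A K S G act
     in tensor_lift (tensor_group S N A0) (\<lambda>y a.
          pure_tensor S N A0 (m (group_elt K G g) y)
            (skew_tensor S G \<one>\<^bsub>S\<^esub> (group_elt K G g) \<otimes>\<^bsub>A\<^esub> a)) t)"

definition S_induced ::
  "('k, 'x) ring_scheme \<Rightarrow> ('k, 's, 'y) module_scheme \<Rightarrow> ('g, 'z) monoid_scheme \<Rightarrow> ('g \<Rightarrow> 's \<Rightarrow> 's)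
   \<Rightarrow> ('s, 's, 'd) bimodule \<Rightarrow> (('g \<Rightarrow> 'k) \<Rightarrow> 'd \<Rightarrow> 'd)
   \<Rightarrow> ('g \<Rightarrow> 's, 'g \<Rightarrow> 's, ('d, 'g \<Rightarrow> 's) tensor) bimodule"
  where "S_induced K S G act N m =
    (let T = tensor S N (skew_as_S_A K S G act)
     in with_actions T
          (\<lambda>a t. \<Oplus>\<^bsub>T\<^esub>g \<in> carrier G. lact T (a g) (S_induced_left_G K S G act N m g t)) (ract T))"

definition S_induced_map ::
  "('k, 'x) ring_scheme \<Rightarrow> ('k, 's, 'y) module_scheme \<Rightarrow> ('g, 'z) monoid_scheme \<Rightarrow> ('g \<Rightarrow> 's \<Rightarrow> 's)
   \<Rightarrow> ('s, 's, 'd) bimodule \<Rightarrow> ('s, 's, 'e) bimodule \<Rightarrow> ('d \<Rightarrow> 'e)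
   \<Rightarrow> ('d, 'g \<Rightarrow> 's) tensor \<Rightarrow> ('e, 'g \<Rightarrow> 's) tensor"
  where "S_induced_map K S G act M N f =
    tensor_map S M (skew_as_S_A K S G act) N (skew_as_S_A K S G act) f (\<lambda>a. a)"

text \<open>\<open>D\<^sub>0 \<otimes>\<^sub>S A \<rightarrow> S \<otimes>\<^sub>S A \<cong> A\<close>.\<close>

definition S_induced_aug ::
  "('k, 'x) ring_scheme \<Rightarrow> ('k, 's, 'y) module_scheme \<Rightarrow> ('g, 'z) monoid_scheme \<Rightarrow> ('g \<Rightarrow> 's \<Rightarrow> 's)
   \<Rightarrow> ('s, 's, 'd) bimodule \<Rightarrow> ('d \<Rightarrow> 's) \<Rightarrow> ('d, 'g \<Rightarrow> 's) tensor \<Rightarrow> 'g \<Rightarrow> 's"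
  where "S_induced_aug K S G act M \<epsilon> t =
    (let A = skew_group_algebra S G act
     in tensor_lift A (\<lambda>s a. skew_tensor S G s \<one>\<^bsub>group_algebra K G\<^esub> \<otimes>\<^bsub>A\<^esub> a)
          (S_induced_map K S G act M (regular_bimodule S) \<epsilon> t))"


section \<open>The total complex of a tensor product of two complexes of bimodules\<close>

definition horizontal_diff ::
  "('a, 'x) ring_scheme \<Rightarrow> (nat \<Rightarrow> ('a, 'a, 'p) bimodule) \<Rightarrow> (nat \<Rightarrow> ('a, 'a, 'q) bimodule)
   \<Rightarrow> (nat \<Rightarrow> 'p \<Rightarrow> 'p) \<Rightarrow> nat \<Rightarrow> nat \<Rightarrow> ('p, 'q) tensor \<Rightarrow> ('p, 'q) tensor"
  where "horizontal_diff A P Q dP i j =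
    tensor_map A (P i) (Q j) (P (i - 1)) (Q j) (dP i) (\<lambda>y. y)"

definition vertical_diff ::
  "('a, 'x) ring_scheme \<Rightarrow> (nat \<Rightarrow> ('a, 'a, 'p) bimodule) \<Rightarrow> (nat \<Rightarrow> ('a, 'a, 'q) bimodule)
   \<Rightarrow> (nat \<Rightarrow> 'q \<Rightarrow> 'q) \<Rightarrow> nat \<Rightarrow> nat \<Rightarrow> ('p, 'q) tensor \<Rightarrow> ('p, 'q) tensor"
  where "vertical_diff A P Q dQ i j t =
    [((- 1 :: int) ^ i)] \<cdot>\<^bsub>tensor A (P i) (Q (j - 1))\<^esub>
      tensor_map A (P i) (Q j) (P i) (Q (j - 1)) (\<lambda>x. x) (dQ j) t"

definition total_complex ::
  "('a, 'x) ring_scheme \<Rightarrow> (nat \<Rightarrow> ('a, 'a, 'p) bimodule) \<Rightarrow> (nat \<Rightarrow> ('a, 'a, 'q) bimodule)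
   \<Rightarrow> nat \<Rightarrow> ('a, 'a, nat \<times> nat \<Rightarrow> ('p, 'q) tensor) bimodule"
  where "total_complex A P Q n =
    bimodule_sum {(i, j). i + j = n} (\<lambda>(i, j). tensor A (P i) (Q j))"

definition total_diff ::
  "('a, 'x) ring_scheme \<Rightarrow> (nat \<Rightarrow> ('a, 'a, 'p) bimodule) \<Rightarrow> (nat \<Rightarrow> ('a, 'a, 'q) bimodule)
   \<Rightarrow> (nat \<Rightarrow> 'p \<Rightarrow> 'p) \<Rightarrow> (nat \<Rightarrow> 'q \<Rightarrow> 'q) \<Rightarrow> nat
   \<Rightarrow> (nat \<times> nat \<Rightarrow> ('p, 'q) tensor) \<Rightarrow> nat \<times> nat \<Rightarrow> ('p, 'q) tensor"
  where "total_diff A P Q dP dQ n x =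
    (\<lambda>(i, j) \<in> {(i, j). i + j = n - 1}.
       horizontal_diff A P Q dP (i + 1) j (x (i + 1, j))
       \<oplus>\<^bsub>tensor A (P i) (Q j)\<^esub> vertical_diff A P Q dQ i (j + 1) (x (i, j + 1)))"

text \<open>\<open>P\<^sub>0 \<otimes>\<^sub>A Q\<^sub>0 \<rightarrow> A \<otimes>\<^sub>A A \<cong> A\<close>.\<close>

definition total_aug ::
  "('a, 'x) ring_scheme \<Rightarrow> (nat \<Rightarrow> ('a, 'a, 'p) bimodule) \<Rightarrow> (nat \<Rightarrow> ('a, 'a, 'q) bimodule)
   \<Rightarrow> ('p \<Rightarrow> 'a) \<Rightarrow> ('q \<Rightarrow> 'a) \<Rightarrow> (nat \<times> nat \<Rightarrow> ('p, 'q) tensor) \<Rightarrow> 'a"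
  where "total_aug A P Q \<epsilon>P \<epsilon>Q x =
    tensor_lift A (monoid.mult A)
      (tensor_map A (P 0) (Q 0) (regular_bimodule A) (regular_bimodule A) \<epsilon>P \<epsilon>Q (x (0, 0)))"

end

theory Submission
  imports Defs
begin

text \<open>The column \<open>(A \<otimes>\<^bsub>kG\<^esub> C\<^sub>i) \<otimes>\<^sub>A (D\<^sub>\<bullet> \<otimes>\<^sub>S A)\<close> is exact because \<open>A \<otimes>\<^bsub>kG\<^esub> C\<^sub>i\<close> is free
  as a right \<open>A\<close>-module: if the \<open>x\<^sub>b\<close> form a homogeneous \<open>(kG)\<^sup>e\<close>-basis of \<open>C\<^sub>i\<close>, then the
  \<open>g \<otimes> x\<^sub>b\<close> with \<open>g \<in> G\<close> form an \<open>A\<close>-basis, because \<open>(g \<otimes> x\<^sub>b) (s h) = (\<^bsup>g|b|\<^esup>s) g \<otimes> x\<^sub>b h\<close>.  The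
  augmented columns therefore resolve the complex \<open>A \<otimes>\<^bsub>kG\<^esub> C\<^sub>\<bullet>\<close>, which resolves \<open>A\<close> since \<open>A\<close> is
  free over \<open>kG\<close>, and a diagram chase gives exactness of the total complex.  If moreover the
  \<open>y\<^sub>f\<close> form an \<open>S\<^sup>e\<close>-basis of \<open>D\<^sub>j\<close>, the \<open>(1 \<otimes> x\<^sub>b) \<otimes> (y\<^sub>f \<otimes> 1)\<close> form an \<open>A\<^sup>e\<close>-basis of \<open>X\<^bsub>i,j\<^esub>\<close>, since
  \<open>((\<^bsup>g|b|\<^esup>s) g) (1 \<otimes> x\<^sub>b \<otimes> y\<^sub>f \<otimes> 1) (s' h) = (g \<otimes> x\<^sub>b) \<otimes> (s y\<^sub>f s' \<otimes> h)\<close> and the twist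
  \<open>s \<mapsto> \<^bsup>g|b|\<^esup>s\<close> is bijective.\<close>

section \<open>Additive maps and copowers\<close>

text \<open>The coefficients keep changing (kG, S, A, S^e, A^e), with modules on either side, so
  freeness is handled through \<open>copower\<close>: a direct sum of copies of a mere abelian
  group, where a ring action enters through the form of the inclusions. Exactness passes to such
  sums, and sums of sums are sums. The obstacle is the right action of S on A \<otimes> C_i, which
  twists s by the degree of the second factor. On a basis vector this is a single automorphism of S
  only if the vector is homogeneous, so the basis of C_i has to come from a homogeneous k-basis of
  C'_i. The twist also intervenes when A^e acts on the expected basis. So both X_{i,j} and A^e are
  written as sums of copies of S^e, over B \<times> F \<times> G \<times> G and G \<times> G, with
  the twist built into the inclusions, and the common factor G \<times> G is cancelled by
  \<open>copower_fuse\<close>. The same cancellation over S gives the right freeness of A \<otimes>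
  C_i over A. The k-bases B of C'_i and F of D'_j are kept throughout, so that X_{i,j} and A
  \<otimes> C'_i \<otimes> D'_j \<otimes> A can be compared by matching bases.\<close>

definition additive :: "('m, 'x) ring_scheme \<Rightarrow> ('n, 'y) ring_scheme \<Rightarrow> ('m \<Rightarrow> 'n) \<Rightarrow> bool"
  where "additive M N f \<longleftrightarrow> f \<in> carrier M \<rightarrow> carrier N \<and>
    (\<forall>x \<in> carrier M. \<forall>y \<in> carrier M. f (x \<oplus>\<^bsub>M\<^esub> y) = f x \<oplus>\<^bsub>N\<^esub> f y)"

lemma additiveI:
  assumes "\<And>x. x \<in> carrier M \<Longrightarrow> f x \<in> carrier N"
    and "\<And>x y. \<lbrakk>x \<in> carrier M; y \<in> carrier M\<rbrakk> \<Longrightarrow> f (x \<oplus>\<^bsub>M\<^esub> y) = f x \<oplus>\<^bsub>N\<^esub> f y"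
  shows "additive M N f"
  using assms unfolding additive_def by auto

lemma additive_closed: "additive M N f \<Longrightarrow> x \<in> carrier M \<Longrightarrow> f x \<in> carrier N"
  unfolding additive_def by auto

lemma additive_add:
  "additive M N f \<Longrightarrow> x \<in> carrier M \<Longrightarrow> y \<in> carrier M \<Longrightarrow> f (x \<oplus>\<^bsub>M\<^esub> y) = f x \<oplus>\<^bsub>N\<^esub> f y"
  unfolding additive_def by auto

lemma additive_iff_hom: "additive M N f \<longleftrightarrow> f \<in> hom (add_monoid M) (add_monoid N)"
  by (auto simp: additive_def hom_def)

lemma additive_comp: "additive M N f \<Longrightarrow> additive N P g \<Longrightarrow> additive M P (\<lambda>x. g (f x))"
  by (rule additiveI) (auto simp: additive_closed additive_add)

lemma additive_id: "additive M M (\<lambda>x. x)"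
  by (rule additiveI) auto

lemma additive_cong: "additive M N f \<Longrightarrow> (\<And>x. x \<in> carrier M \<Longrightarrow> f x = g x) \<Longrightarrow> abelian_monoid M \<Longrightarrow> additive M N g"
  by (rule additiveI) (metis additive_closed additive_add abelian_monoid.a_closed)+

lemma additive_zero:
  assumes "abelian_group M" "abelian_group N" "additive M N f"
  shows "f \<zero>\<^bsub>M\<^esub> = \<zero>\<^bsub>N\<^esub>"
proof -
  interpret M: abelian_group M by fact
  interpret N: abelian_group N by fact
  have "f \<zero>\<^bsub>M\<^esub> = f \<zero>\<^bsub>M\<^esub> \<oplus>\<^bsub>N\<^esub> f \<zero>\<^bsub>M\<^esub>"
    using additive_add[OF assms(3) M.zero_closed M.zero_closed] by simp
  then show ?thesis using N.add.r_cancel_one' additive_closed[OF assms(3) M.zero_closed] by metis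
qed

lemma additive_a_inv:
  assumes "abelian_group M" "abelian_group N" "additive M N f" "x \<in> carrier M"
  shows "f (\<ominus>\<^bsub>M\<^esub> x) = \<ominus>\<^bsub>N\<^esub> f x"
proof -
  interpret M: abelian_group M by fact
  interpret N: abelian_group N by fact
  have "f (\<ominus>\<^bsub>M\<^esub> x) \<oplus>\<^bsub>N\<^esub> f x = \<zero>\<^bsub>N\<^esub>"
    using additive_add[OF assms(3), of "\<ominus>\<^bsub>M\<^esub> x" x] additive_zero[OF assms(1-3)] assms(4)
    by (simp add: M.l_neg)
  then show ?thesis
    using N.minus_equality[of "f (\<ominus>\<^bsub>M\<^esub> x)" "f x"] additive_closed[OF assms(3)] assms(4) by simp
qed

lemma additive_minus:
  assumes "abelian_group M" "abelian_group N" "additive M N f" "x \<in> carrier M" "y \<in> carrier M"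
  shows "f (x \<ominus>\<^bsub>M\<^esub> y) = f x \<ominus>\<^bsub>N\<^esub> f y"
  using additive_add[OF assms(3,4), of "\<ominus>\<^bsub>M\<^esub> y"] additive_a_inv[OF assms(1-3,5)]
    abelian_group.a_inv_closed[OF assms(1,5)]
  by (simp add: a_minus_def)

lemma additive_image_add:
  assumes "additive M N f" "abelian_group M" "u \<in> f ` carrier M" "v \<in> f ` carrier M"
  shows "u \<oplus>\<^bsub>N\<^esub> v \<in> f ` carrier M"
proof -
  interpret M: abelian_group M by fact
  from assms(3,4) obtain x y where "x \<in> carrier M" "u = f x" "y \<in> carrier M" "v = f y"
    by (auto elim!: imageE)
  then show ?thesis using additive_add[OF assms(1)] by (intro image_eqI[of _ _ "x \<oplus>\<^bsub>M\<^esub> y"]) auto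
qed

lemma additive_finsum:
  assumes "abelian_group M" "abelian_group N" "additive M N f" "\<And>i. i \<in> J \<Longrightarrow> x i \<in> carrier M"
  shows "f (\<Oplus>\<^bsub>M\<^esub>i \<in> J. x i) = (\<Oplus>\<^bsub>N\<^esub>i \<in> J. f (x i))"
proof -
  interpret M: abelian_group M by fact
  interpret N: abelian_group N by fact
  show ?thesis
  proof (cases "finite J")
    case True
    then show ?thesis using assms(4)
    proof (induction J rule: finite_induct)
      case (insert i J)
      then show ?case
        by (simp add: additive_add[OF assms(3)] M.finsum_closed Pi_def additive_closed[OF assms(3)])
    qed (simp add: additive_zero[OF assms(1-3)])
  qed (simp add: additive_zero[OF assms(1-3)])
qed

lemma finsum_additive:
  assumes "abelian_group N" "\<And>j. j \<in> J \<Longrightarrow> additive M N (f j)"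
  shows "additive M N (\<lambda>x. \<Oplus>\<^bsub>N\<^esub>j \<in> J. f j x)"
proof -
  interpret N: abelian_group N by fact
  show ?thesis
  proof (rule additiveI)
    fix x y assume xy: "x \<in> carrier M" "y \<in> carrier M"
    have "(\<Oplus>\<^bsub>N\<^esub>j \<in> J. f j (x \<oplus>\<^bsub>M\<^esub> y)) = (\<Oplus>\<^bsub>N\<^esub>j \<in> J. f j x \<oplus>\<^bsub>N\<^esub> f j y)"
      by (rule N.finsum_cong') (use assms(2) xy in \<open>auto simp: additive_add[OF assms(2)] additive_closed[OF assms(2)] intro!: N.a_closed\<close>)
    also have "\<dots> = (\<Oplus>\<^bsub>N\<^esub>j \<in> J. f j x) \<oplus>\<^bsub>N\<^esub> (\<Oplus>\<^bsub>N\<^esub>j \<in> J. f j y)"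
      by (rule N.finsum_addf) (use xy in \<open>auto intro!: additive_closed[OF assms(2)]\<close>)
    finally show "(\<Oplus>\<^bsub>N\<^esub>j \<in> J. f j (x \<oplus>\<^bsub>M\<^esub> y)) = \<dots>" .
  qed (auto intro!: N.finsum_closed additive_closed[OF assms(2)])
qed

lemma abelian_group_cong:
  assumes "abelian_group M" "carrier N = carrier M" "ring.add N = ring.add M" "\<zero>\<^bsub>N\<^esub> = \<zero>\<^bsub>M\<^esub>"
  shows "abelian_group N"
proof -
  interpret M: abelian_group M by fact
  show ?thesis
    by (rule abelian_groupI) (auto simp: assms(2-4) M.a_ac intro!: bexI[OF _ M.a_inv_closed] M.l_neg)
qed

lemma finsum_cong_structure:
  "carrier N = carrier M \<Longrightarrow> ring.add N = ring.add M \<Longrightarrow> \<zero>\<^bsub>N\<^esub> = \<zero>\<^bsub>M\<^esub> \<Longrightarrow> finsum N f J = finsum M f J"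
  by (simp add: finsum_def finprod_def)

text \<open>\<open>M\<close> is the direct sum of copies of \<open>N\<close> indexed by \<open>I\<close>.  Finiteness of supports and
  spanning are both encoded in the induction principle \<open>generated\<close>.\<close>

locale copower = M: abelian_group M + N: abelian_group N
  for M :: "('m, 'x) ring_scheme" and N :: "('n, 'y) ring_scheme" +
  fixes I :: "'i set" and inc :: "'i \<Rightarrow> 'n \<Rightarrow> 'm" and prj :: "'i \<Rightarrow> 'm \<Rightarrow> 'n"
  assumes inc_additive: "i \<in> I \<Longrightarrow> additive N M (inc i)"
    and prj_additive: "i \<in> I \<Longrightarrow> additive M N (prj i)"
    and prj_inc: "\<lbrakk>i \<in> I; j \<in> I; n \<in> carrier N\<rbrakk> \<Longrightarrow> prj i (inc j n) = (if i = j then n else \<zero>\<^bsub>N\<^esub>)"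
    and generated: "\<And>P x. \<lbrakk>x \<in> carrier M; P \<zero>\<^bsub>M\<^esub>;
      \<And>u v. \<lbrakk>u \<in> carrier M; v \<in> carrier M; P u; P v\<rbrakk> \<Longrightarrow> P (u \<oplus>\<^bsub>M\<^esub> v);
      \<And>i n. \<lbrakk>i \<in> I; n \<in> carrier N\<rbrakk> \<Longrightarrow> P (inc i n)\<rbrakk> \<Longrightarrow> P x"
begin

lemmas inc_closed = additive_closed[OF inc_additive]
lemmas prj_closed = additive_closed[OF prj_additive]
lemmas induct [consumes 1, case_names zero add incl] = generated

lemma hom_eq:
  assumes "abelian_group P" "additive M P f" "additive M P g"
    and eq: "\<And>i n. i \<in> I \<Longrightarrow> n \<in> carrier N \<Longrightarrow> f (inc i n) = g (inc i n)"
    and "x \<in> carrier M"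
  shows "f x = g x"
  using assms(5)
proof (induction x rule: induct)
  case zero show ?case
    using additive_zero[OF M.abelian_group_axioms assms(1)] assms(2,3) by metis
next
  case (add u v) then show ?case using additive_add assms(2,3) by metis
qed (rule assms)+

text \<open>The expansion is claimed for every finite J' above J because the sum of two elements has
  to be expanded over a common index set; a single J per element would not survive the induction
  step.\<close>

lemma expansion_ex:
  assumes "x \<in> carrier M"
  shows "\<exists>J. finite J \<and> J \<subseteq> I \<and> (\<forall>i \<in> I - J. prj i x = \<zero>\<^bsub>N\<^esub>) \<and>
    (\<forall>J'. finite J' \<longrightarrow> J \<subseteq> J' \<longrightarrow> J' \<subseteq> I \<longrightarrow> x = (\<Oplus>\<^bsub>M\<^esub>i \<in> J'. inc i (prj i x)))"
  using assms
proof (induction x rule: induct)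
  case zero
  have p: "prj i \<zero>\<^bsub>M\<^esub> = \<zero>\<^bsub>N\<^esub>" if "i \<in> I" for i
    using additive_zero[OF M.abelian_group_axioms N.abelian_group_axioms prj_additive] that by blast
  have q: "inc i \<zero>\<^bsub>N\<^esub> = \<zero>\<^bsub>M\<^esub>" if "i \<in> I" for i
    using additive_zero[OF N.abelian_group_axioms M.abelian_group_axioms inc_additive] that by blast
  show ?case
    by (rule exI[of _ "{}"]) (auto simp: p q subset_iff intro!: M.add.finprod_one_eqI[symmetric])
next
  case (add u v)
  obtain J where J: "finite J" "J \<subseteq> I" "\<forall>i \<in> I - J. prj i u = \<zero>\<^bsub>N\<^esub>"
    "\<forall>J'. finite J' \<longrightarrow> J \<subseteq> J' \<longrightarrow> J' \<subseteq> I \<longrightarrow> u = (\<Oplus>\<^bsub>M\<^esub>i \<in> J'. inc i (prj i u))"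
    using add(3) by (elim exE conjE) (rule that)
  obtain L where L: "finite L" "L \<subseteq> I" "\<forall>i \<in> I - L. prj i v = \<zero>\<^bsub>N\<^esub>"
    "\<forall>J'. finite J' \<longrightarrow> L \<subseteq> J' \<longrightarrow> J' \<subseteq> I \<longrightarrow> v = (\<Oplus>\<^bsub>M\<^esub>i \<in> J'. inc i (prj i v))"
    using add(4) by (elim exE conjE) (rule that)
  have "u \<oplus>\<^bsub>M\<^esub> v = (\<Oplus>\<^bsub>M\<^esub>i \<in> J'. inc i (prj i (u \<oplus>\<^bsub>M\<^esub> v)))"
    if "finite J'" "J \<union> L \<subseteq> J'" "J' \<subseteq> I" for J'
  proof -
    have "(\<Oplus>\<^bsub>M\<^esub>i \<in> J'. inc i (prj i (u \<oplus>\<^bsub>M\<^esub> v)))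
      = (\<Oplus>\<^bsub>M\<^esub>i \<in> J'. inc i (prj i u) \<oplus>\<^bsub>M\<^esub> inc i (prj i v))"
      by (rule M.finsum_cong')
        (use that(3) add(1,2) in \<open>auto simp: subset_iff additive_add[OF prj_additive] additive_add[OF inc_additive] prj_closed inc_closed\<close>)
    also have "\<dots> = (\<Oplus>\<^bsub>M\<^esub>i \<in> J'. inc i (prj i u)) \<oplus>\<^bsub>M\<^esub> (\<Oplus>\<^bsub>M\<^esub>i \<in> J'. inc i (prj i v))"
      by (rule M.finsum_addf) (use that(3) add(1,2) in \<open>auto simp: subset_iff prj_closed inc_closed\<close>)
    also have "\<dots> = u \<oplus>\<^bsub>M\<^esub> v" using J(4)[rule_format, of J'] L(4)[rule_format, of J'] that by simp
    finally show ?thesis by simp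
  qed
  moreover have "\<forall>i \<in> I - (J \<union> L). prj i (u \<oplus>\<^bsub>M\<^esub> v) = \<zero>\<^bsub>N\<^esub>"
    using J(3) L(3) add(1,2) by (auto simp: additive_add[OF prj_additive])
  ultimately show ?case using J(1,2) L(1,2) by (intro exI[of _ "J \<union> L"]) simp
next
  case (incl i n)
  have z: "inc j \<zero>\<^bsub>N\<^esub> = \<zero>\<^bsub>M\<^esub>" if "j \<in> I" for j
    using additive_zero[OF N.abelian_group_axioms M.abelian_group_axioms inc_additive] that by blast
  have "inc i n = (\<Oplus>\<^bsub>M\<^esub>j \<in> J'. inc j (prj j (inc i n)))"
    if "finite J'" "i \<in> J'" "J' \<subseteq> I" for J'
  proof -
    have "(\<Oplus>\<^bsub>M\<^esub>j \<in> J'. inc j (prj j (inc i n))) = (\<Oplus>\<^bsub>M\<^esub>j \<in> J'. if i = j then inc j n else \<zero>\<^bsub>M\<^esub>)"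
      by (rule M.finsum_cong') (use that incl in \<open>auto simp: subset_iff prj_inc z inc_closed\<close>)
    also have "\<dots> = inc i n"
      by (rule M.add.finprod_singleton) (use that incl in \<open>auto simp: subset_iff inc_closed\<close>)
    finally show ?thesis by simp
  qed
  then show ?case using incl by (intro exI[of _ "{i}"]) (auto simp: prj_inc)
qed

lemma finite_support: "x \<in> carrier M \<Longrightarrow> finite {i \<in> I. prj i x \<noteq> \<zero>\<^bsub>N\<^esub>}"
  using expansion_ex by (metis (mono_tags, lifting) DiffI finite_subset mem_Collect_eq subsetI)

lemma expansion:
  assumes "x \<in> carrier M"
  shows "x = (\<Oplus>\<^bsub>M\<^esub>i \<in> {i \<in> I. prj i x \<noteq> \<zero>\<^bsub>N\<^esub>}. inc i (prj i x))"
proof -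
  obtain J where J: "finite J" "J \<subseteq> I" "\<forall>i \<in> I - J. prj i x = \<zero>\<^bsub>N\<^esub>"
    "x = (\<Oplus>\<^bsub>M\<^esub>i \<in> J. inc i (prj i x))" using expansion_ex[OF assms] by blast
  have z: "inc j \<zero>\<^bsub>N\<^esub> = \<zero>\<^bsub>M\<^esub>" if "j \<in> I" for j
    using additive_zero[OF N.abelian_group_axioms M.abelian_group_axioms inc_additive] that by blast
  have "(\<Oplus>\<^bsub>M\<^esub>i \<in> {i \<in> I. prj i x \<noteq> \<zero>\<^bsub>N\<^esub>}. inc i (prj i x)) = (\<Oplus>\<^bsub>M\<^esub>i \<in> J. inc i (prj i x))"
    by (rule M.add.finprod_mono_neutral_cong_left)
      (use J assms z in \<open>auto simp: subset_iff prj_closed inc_closed\<close>)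
  then show ?thesis using J(4) by simp
qed

lemma eqI:
  assumes "x \<in> carrier M" "y \<in> carrier M" "\<And>i. i \<in> I \<Longrightarrow> prj i x = prj i y"
  shows "x = y"
proof -
  have "{i \<in> I. prj i x \<noteq> \<zero>\<^bsub>N\<^esub>} = {i \<in> I. prj i y \<noteq> \<zero>\<^bsub>N\<^esub>}" using assms(3) by auto
  then have "(\<Oplus>\<^bsub>M\<^esub>i \<in> {i \<in> I. prj i x \<noteq> \<zero>\<^bsub>N\<^esub>}. inc i (prj i x))
     = (\<Oplus>\<^bsub>M\<^esub>i \<in> {i \<in> I. prj i y \<noteq> \<zero>\<^bsub>N\<^esub>}. inc i (prj i y))"
    by (intro M.finsum_cong') (use assms in \<open>auto simp: prj_closed inc_closed\<close>)
  then show ?thesis using expansion[OF assms(1)] expansion[OF assms(2)] by simp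
qed

text \<open>Follows from the finite expansion, since H is closed under sums. In
  \<open>copower_exact\<close> H is the image of a map, so that lifting an element reduces to
  lifting its components one at a time.\<close>

lemma mem_if_components_mem:
  assumes x: "x \<in> carrier M" and H: "\<zero>\<^bsub>M\<^esub> \<in> H" "\<And>u v. u \<in> H \<Longrightarrow> v \<in> H \<Longrightarrow> u \<oplus>\<^bsub>M\<^esub> v \<in> H"
    and c: "\<And>i. i \<in> I \<Longrightarrow> inc i (prj i x) \<in> H"
  shows "x \<in> H"
proof -
  have "(\<Oplus>\<^bsub>M\<^esub>i \<in> J. inc i (prj i x)) \<in> H" if "finite J" "J \<subseteq> I" for J
    using that
  proof (induction J rule: finite_induct)
    case (insert i J)
    then show ?case using H(2) c by (simp add: subset_iff x prj_closed inc_closed Pi_def)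
  qed (simp add: H)
  then show ?thesis using expansion[OF x] finite_support[OF x] by (metis (no_types, lifting) mem_Collect_eq subsetI)
qed

lemma zero_if_coefficients_trivial:
  assumes "carrier N = {\<zero>\<^bsub>N\<^esub>}" "x \<in> carrier M"
  shows "x = \<zero>\<^bsub>M\<^esub>"
  by (rule eqI) (use assms prj_closed in \<open>auto\<close>)

end

section \<open>Maps between direct sums of copies, and exactness\<close>

lemma copower_naturality:
  assumes "copower M N I inc prj" "copower M' N' I inc' prj'"
    and F: "additive M M' F" and f: "additive N N' f"
    and c: "\<And>i n. i \<in> I \<Longrightarrow> n \<in> carrier N \<Longrightarrow> F (inc i n) = inc' i (f n)"
    and "i \<in> I" "x \<in> carrier M"
  shows "prj' i (F x) = f (prj i x)"
proof -
  interpret M: copower M N I inc prj by fact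
  interpret M': copower M' N' I inc' prj' by fact
  have z: "f \<zero>\<^bsub>N\<^esub> = \<zero>\<^bsub>N'\<^esub>" by (rule additive_zero) (rule M.N.abelian_group_axioms M'.N.abelian_group_axioms f)+
  show ?thesis
  proof (rule M.hom_eq[OF M'.N.abelian_group_axioms _ _ _ \<open>x \<in> carrier M\<close>])
    show "additive M N' (\<lambda>x. prj' i (F x))" by (rule additive_comp[OF F M'.prj_additive]) fact
    show "additive M N' (\<lambda>x. f (prj i x))" by (rule additive_comp[OF M.prj_additive f]) fact
  qed (use c \<open>i \<in> I\<close> additive_closed[OF f] z in \<open>simp add: M.prj_inc M'.prj_inc\<close>)
qed

lemma copower_surj:
  assumes "copower M N I inc prj" "copower M' N' I inc' prj'"
    and F: "additive M M' F"
    and c: "\<And>i n. i \<in> I \<Longrightarrow> n \<in> carrier N \<Longrightarrow> F (inc i n) = inc' i (f n)"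
    and s: "f ` carrier N = carrier N'"
  shows "F ` carrier M = carrier M'"
proof -
  interpret M: copower M N I inc prj by fact
  interpret M': copower M' N' I inc' prj' by fact
  have "x \<in> F ` carrier M" if "x \<in> carrier M'" for x using that
  proof (induction x rule: M'.induct)
    case zero show ?case
      using additive_zero[OF M.M.abelian_group_axioms M'.M.abelian_group_axioms F] M.M.zero_closed
      by (metis imageI)
  next
    case (add u v) then show ?case using additive_image_add[OF F M.M.abelian_group_axioms] by simp
  next
    case (incl i n)
    then have "n \<in> f ` carrier N" using s by simp
    then obtain m where "m \<in> carrier N" "n = f m" by (rule imageE)
    then show ?case using incl(1) c M.inc_closed by (intro image_eqI[of _ _ "inc i m"]) auto
  qed
  then show ?thesis using additive_closed[OF F] by (intro equalityI subsetI) auto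
qed

text \<open>By \<open>copower_naturality\<close> every component of a kernel element lies in the
  kernel of g, hence lifts along f. Exactness of the induced complexes and of the columns is drawn
  from here.\<close>

lemma copower_exact:
  assumes "copower M2 N2 I inc2 prj2" "copower M1 N1 I inc1 prj1" "copower M0 N0 I inc0 prj0"
    and F: "additive M2 M1 F" and f: "additive N2 N1 f" and G: "additive M1 M0 G" and g: "additive N1 N0 g"
    and cF: "\<And>i n. i \<in> I \<Longrightarrow> n \<in> carrier N2 \<Longrightarrow> F (inc2 i n) = inc1 i (f n)"
    and cG: "\<And>i n. i \<in> I \<Longrightarrow> n \<in> carrier N1 \<Longrightarrow> G (inc1 i n) = inc0 i (g n)"
    and e: "f ` carrier N2 = {x \<in> carrier N1. g x = \<zero>\<^bsub>N0\<^esub>}"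
  shows "F ` carrier M2 = {x \<in> carrier M1. G x = \<zero>\<^bsub>M0\<^esub>}"
proof -
  interpret M2: copower M2 N2 I inc2 prj2 by fact
  interpret M1: copower M1 N1 I inc1 prj1 by fact
  interpret M0: copower M0 N0 I inc0 prj0 by fact
  have p0: "prj0 i \<zero>\<^bsub>M0\<^esub> = \<zero>\<^bsub>N0\<^esub>" if "i \<in> I" for i
    by (rule additive_zero[OF M0.M.abelian_group_axioms M0.N.abelian_group_axioms M0.prj_additive[OF that]])
  have "G (F x) = \<zero>\<^bsub>M0\<^esub>" if x: "x \<in> carrier M2" for x
  proof (rule M0.eqI)
    fix i assume i: "i \<in> I"
    have "prj0 i (G (F x)) = g (f (prj2 i x))"
      using copower_naturality[OF assms(2,3) G g cG i additive_closed[OF F x]]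
        copower_naturality[OF assms(1,2) F f cF i x] by simp
    also have "\<dots> = \<zero>\<^bsub>N0\<^esub>" using e M2.prj_closed[OF i x] by blast
    finally show "prj0 i (G (F x)) = prj0 i \<zero>\<^bsub>M0\<^esub>" using p0[OF i] by simp
  qed (auto intro!: additive_closed[OF G] additive_closed[OF F] x)
  moreover have "x \<in> F ` carrier M2" if x: "x \<in> carrier M1" and 0: "G x = \<zero>\<^bsub>M0\<^esub>" for x
  proof (rule M1.mem_if_components_mem[OF x])
    show "\<zero>\<^bsub>M1\<^esub> \<in> F ` carrier M2"
      using additive_zero[OF M2.M.abelian_group_axioms M1.M.abelian_group_axioms F] M2.M.zero_closed
      by (metis imageI)
    show "u \<oplus>\<^bsub>M1\<^esub> v \<in> F ` carrier M2" if "u \<in> F ` carrier M2" "v \<in> F ` carrier M2" for u v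
      using additive_image_add[OF F M2.M.abelian_group_axioms that] .
    fix i assume i: "i \<in> I"
    have "g (prj1 i x) = \<zero>\<^bsub>N0\<^esub>"
      using copower_naturality[OF assms(2,3) G g cG i x] 0 p0[OF i] by simp
    then have "prj1 i x \<in> f ` carrier N2" using e M1.prj_closed[OF i x] by simp
    then obtain y where "y \<in> carrier N2" "prj1 i x = f y" by (auto elim!: imageE)
    then show "inc1 i (prj1 i x) \<in> F ` carrier M2"
      using cF[OF i] M2.inc_closed[OF i] by (intro image_eqI[of _ _ "inc2 i y"]) auto
  qed
  ultimately show ?thesis using additive_closed[OF F] by auto
qed

section \<open>Composing, reindexing and regrouping direct sums\<close>

lemma copower_comp:
  assumes "copower M N I inc prj" "copower N L J inc' prj'"
  shows "copower M L (I \<times> J) (\<lambda>(i, j) l. inc i (inc' j l)) (\<lambda>(i, j) x. prj' j (prj i x))"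
proof -
  interpret M: copower M N I inc prj by fact
  interpret N: copower N L J inc' prj' by fact
  have z: "inc i \<zero>\<^bsub>N\<^esub> = \<zero>\<^bsub>M\<^esub>" if "i \<in> I" for i
    using additive_zero[OF M.N.abelian_group_axioms M.M.abelian_group_axioms M.inc_additive[OF that]] .
  have z': "prj' j \<zero>\<^bsub>N\<^esub> = \<zero>\<^bsub>L\<^esub>" if "j \<in> J" for j
    using additive_zero[OF M.N.abelian_group_axioms N.N.abelian_group_axioms N.prj_additive[OF that]] .
  show ?thesis
  proof (intro copower.intro copower_axioms.intro M.M.abelian_group_axioms N.N.abelian_group_axioms)
    fix P x assume x: "x \<in> carrier M" and P: "P \<zero>\<^bsub>M\<^esub>"
      "\<And>u v. u \<in> carrier M \<Longrightarrow> v \<in> carrier M \<Longrightarrow> P u \<Longrightarrow> P v \<Longrightarrow> P (u \<oplus>\<^bsub>M\<^esub> v)"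
      "\<And>k n. k \<in> I \<times> J \<Longrightarrow> n \<in> carrier L \<Longrightarrow> P ((case k of (i, j) \<Rightarrow> \<lambda>l. inc i (inc' j l)) n)"
    show "P x" using x
    proof (induction x rule: M.induct)
      case (incl i n)
      \<comment> \<open>A second induction inside the i-th copy of N; \<open>inc i\<close> is
        additive, so it carries sums over.\<close>
      from incl(2) show ?case
        by (induction n rule: N.induct)
          (use P(3)[of "(i, _)"] incl(1) P(1,2) M.inc_closed z in \<open>auto simp: additive_add[OF M.inc_additive]\<close>)
    qed (use P in auto)
  next
    fix k assume "k \<in> I \<times> J"
    then obtain i j where k: "k = (i, j)" "i \<in> I" "j \<in> J" by auto
    show "additive L M (case k of (i, j) \<Rightarrow> \<lambda>l. inc i (inc' j l))"
      using additive_comp[OF N.inc_additive[OF k(3)] M.inc_additive[OF k(2)]] k(1) by simp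
    show "additive M L (case k of (i, j) \<Rightarrow> \<lambda>x. prj' j (prj i x))"
      using additive_comp[OF M.prj_additive[OF k(2)] N.prj_additive[OF k(3)]] k(1) by simp
    fix k' n assume "k' \<in> I \<times> J" "n \<in> carrier L"
    then show "(case k of (i, j) \<Rightarrow> \<lambda>x. prj' j (prj i x)) ((case k' of (i, j) \<Rightarrow> \<lambda>l. inc i (inc' j l)) n)
        = (if k = k' then n else \<zero>\<^bsub>L\<^esub>)"
      using k by (auto simp: M.prj_inc N.prj_inc N.inc_closed z' split: if_splits)
  qed
qed

lemma copower_reindex:
  assumes "copower M N I inc prj" "bij_betw h J I"
  shows "copower M N J (\<lambda>j. inc (h j)) (\<lambda>j. prj (h j))"
proof -
  interpret M: copower M N I inc prj by fact
  have h: "h j \<in> I" if "j \<in> J" for j using assms(2) that by (auto simp: bij_betw_def)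
  show ?thesis
  proof (intro copower.intro copower_axioms.intro M.M.abelian_group_axioms M.N.abelian_group_axioms)
    fix P x assume x: "x \<in> carrier M" and P: "P \<zero>\<^bsub>M\<^esub>"
      "\<And>u v. u \<in> carrier M \<Longrightarrow> v \<in> carrier M \<Longrightarrow> P u \<Longrightarrow> P v \<Longrightarrow> P (u \<oplus>\<^bsub>M\<^esub> v)"
      "\<And>j n. j \<in> J \<Longrightarrow> n \<in> carrier N \<Longrightarrow> P (inc (h j) n)"
    show "P x" using x
    proof (induction x rule: M.induct)
      case (incl i n) then show ?case using P(3) assms(2) by (metis bij_betw_def imageE)
    qed (use P in auto)
  next
    fix i j n assume "i \<in> J" "j \<in> J" "n \<in> carrier N"
    then show "prj (h i) (inc (h j) n) = (if i = j then n else \<zero>\<^bsub>N\<^esub>)"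
      using assms(2) h by (auto simp: M.prj_inc bij_betw_def inj_on_def)
  qed (auto simp: h M.inc_additive M.prj_additive)
qed

lemma copower_cong:
  assumes "copower M N I inc prj" "\<And>i n. i \<in> I \<Longrightarrow> n \<in> carrier N \<Longrightarrow> inc i n = inc' i n"
  shows "copower M N I inc' prj"
proof -
  interpret M: copower M N I inc prj by fact
  show ?thesis
  proof (intro copower.intro copower_axioms.intro M.M.abelian_group_axioms M.N.abelian_group_axioms)
    fix P x assume x: "x \<in> carrier M" and P: "P \<zero>\<^bsub>M\<^esub>"
      "\<And>u v. u \<in> carrier M \<Longrightarrow> v \<in> carrier M \<Longrightarrow> P u \<Longrightarrow> P v \<Longrightarrow> P (u \<oplus>\<^bsub>M\<^esub> v)"
      "\<And>j n. j \<in> I \<Longrightarrow> n \<in> carrier N \<Longrightarrow> P (inc' j n)"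
    show "P x" using x
      by (induction x rule: M.induct) (use P assms(2) in auto)
  next
    fix i assume "i \<in> I" then show "additive N M (inc' i)"
      by (intro additive_cong[OF M.inc_additive]) (auto simp: assms(2) M.N.abelian_monoid_axioms)
  qed (auto simp: M.prj_additive M.prj_inc simp flip: assms(2))
qed

lemma copower_transport:
  assumes "copower M N I inc prj" "abelian_group M'" "additive M M' f" "bij_betw f (carrier M) (carrier M')"
  shows "copower M' N I (\<lambda>i n. f (inc i n)) (\<lambda>i x. prj i (inv_into (carrier M) f x))"
proof -
  interpret M: copower M N I inc prj by fact
  interpret M': abelian_group M' by fact
  let ?g = "inv_into (carrier M) f"
  have inj: "inj_on f (carrier M)" and im: "f ` carrier M = carrier M'"
    using assms(4) by (auto simp: bij_betw_def)
  have g: "additive M' M ?g"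
  proof (rule additiveI)
    fix x y assume "x \<in> carrier M'" "y \<in> carrier M'"
    then obtain u v where "u \<in> carrier M" "v \<in> carrier M" "x = f u" "y = f v" using im by blast
    then show "?g (x \<oplus>\<^bsub>M'\<^esub> y) = ?g x \<oplus>\<^bsub>M\<^esub> ?g y"
      using inv_into_f_f[OF inj] additive_add[OF assms(3)] M.M.a_closed by metis
  qed (use im in \<open>auto intro: inv_into_into\<close>)
  show ?thesis
  proof (intro copower.intro copower_axioms.intro M'.abelian_group_axioms M.N.abelian_group_axioms)
    fix P x assume x: "x \<in> carrier M'" and P: "P \<zero>\<^bsub>M'\<^esub>"
      "\<And>u v. u \<in> carrier M' \<Longrightarrow> v \<in> carrier M' \<Longrightarrow> P u \<Longrightarrow> P v \<Longrightarrow> P (u \<oplus>\<^bsub>M'\<^esub> v)"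
      "\<And>j n. j \<in> I \<Longrightarrow> n \<in> carrier N \<Longrightarrow> P (f (inc j n))"
    obtain y where y: "y \<in> carrier M" "x = f y" using x im by blast
    have "P (f y)" using y(1)
      by (induction y rule: M.induct)
        (use P additive_zero[OF M.M.abelian_group_axioms M'.abelian_group_axioms assms(3)] in
          \<open>auto simp: additive_add[OF assms(3)] additive_closed[OF assms(3)]\<close>)
    then show "P x" using y by simp
  qed (auto simp: inv_into_f_f[OF inj] M.inc_closed M.prj_inc
        intro!: additive_comp[OF M.inc_additive assms(3)] additive_comp[OF g M.prj_additive])
qed

text \<open>The converse of \<open>copower_comp\<close>: if the copies of N in M can be grouped into
  blocks, each block being the image of one L, then M is a sum of copies of L. The decomposition of
  L may vary with i, which makes room for twists depending on a basis vector. Freeness over a small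
  ring is turned into freeness over a larger one in this way.\<close>

lemma copower_fuse:
  assumes "copower M N (I \<times> J) inc prj" and L: "\<And>i. i \<in> I \<Longrightarrow> copower L N J (inc' i) (prj' i)"
    and "abelian_group L"
    and f: "\<And>i. i \<in> I \<Longrightarrow> additive L M (f i)"
    and c: "\<And>i j n. \<lbrakk>i \<in> I; j \<in> J; n \<in> carrier N\<rbrakk> \<Longrightarrow> f i (inc' i j n) = inc (i, j) n"
  shows "\<exists>prj''. copower M L I f prj''"
proof -
  interpret M: copower M N "I \<times> J" inc prj by fact
  interpret L: abelian_group L by fact
  have pf: "prj (i', j) (f i l) = (if i' = i then prj' i j l else \<zero>\<^bsub>N\<^esub>)"
    if "i \<in> I" "i' \<in> I" "j \<in> J" "l \<in> carrier L" for i i' j l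
  proof -
    interpret L': copower L N J "inc' i" "prj' i" by (rule L[OF that(1)])
    show ?thesis
    proof (rule L'.hom_eq[OF M.N.abelian_group_axioms _ _ _ that(4)])
      show "additive L N (\<lambda>l. prj (i', j) (f i l))"
        using that by (intro additive_comp[OF f M.prj_additive]) auto
      show "additive L N (\<lambda>l. if i' = i then prj' i j l else \<zero>\<^bsub>N\<^esub>)"
        using that L'.prj_additive[OF that(3)] unfolding additive_def by auto
    qed (use that c in \<open>auto simp: M.prj_inc L'.prj_inc\<close>)
  qed
  \<comment> \<open>The components of x in block i are those of some element of L. Induction on x is
    the point: for an arbitrary family of components there need be no such element.\<close>
  have ex: "\<forall>i \<in> I. \<exists>l \<in> carrier L. \<forall>j \<in> J. prj' i j l = prj (i, j) x" if "x \<in> carrier M" for x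
    using that
  proof (induction x rule: M.induct)
    case zero
    show ?case
    proof
      fix i assume i: "i \<in> I"
      interpret L': copower L N J "inc' i" "prj' i" by (rule L[OF i])
      show "\<exists>l \<in> carrier L. \<forall>j \<in> J. prj' i j l = prj (i, j) \<zero>\<^bsub>M\<^esub>"
        using i by (intro bexI[of _ "\<zero>\<^bsub>L\<^esub>"])
          (auto simp: additive_zero[OF L.abelian_group_axioms M.N.abelian_group_axioms L'.prj_additive]
            additive_zero[OF M.M.abelian_group_axioms M.N.abelian_group_axioms M.prj_additive])
    qed
  next
    case (add u v)
    show ?case
    proof
      fix i assume i: "i \<in> I"
      interpret L': copower L N J "inc' i" "prj' i" by (rule L[OF i])
      obtain l m where lm: "l \<in> carrier L" "m \<in> carrier L" "\<forall>j \<in> J. prj' i j l = prj (i, j) u"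
        "\<forall>j \<in> J. prj' i j m = prj (i, j) v" using add i by blast
      then show "\<exists>l \<in> carrier L. \<forall>j \<in> J. prj' i j l = prj (i, j) (u \<oplus>\<^bsub>M\<^esub> v)"
        using i add(1,2) by (intro bexI[of _ "l \<oplus>\<^bsub>L\<^esub> m"])
          (auto simp: additive_add[OF L'.prj_additive] additive_add[OF M.prj_additive])
    qed
  next
    case (incl k n)
    then obtain i' j' where k: "k = (i', j')" "i' \<in> I" "j' \<in> J" by auto
    show ?case
    proof
      fix i assume i: "i \<in> I"
      interpret L': copower L N J "inc' i" "prj' i" by (rule L[OF i])
      show "\<exists>l \<in> carrier L. \<forall>j \<in> J. prj' i j l = prj (i, j) (inc k n)"
        using incl(2) k L'.inc_closed[OF k(3) incl(2)] L'.prj_inc[OF _ k(3) incl(2)]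
          additive_zero[OF L.abelian_group_axioms M.N.abelian_group_axioms L'.prj_additive]
        by (intro bexI[of _ "if i = i' then inc' i j' n else \<zero>\<^bsub>L\<^esub>"]) (auto simp: M.prj_inc i)
    qed
  qed
  \<comment> \<open>Uniqueness by \<open>L'.eqI\<close> makes the choice irrelevant and gives
    additivity of \<open>p i\<close>.\<close>
  define p where "p i x = (SOME l. l \<in> carrier L \<and> (\<forall>j \<in> J. prj' i j l = prj (i, j) x))" for i x
  have p: "p i x \<in> carrier L" "\<forall>j \<in> J. prj' i j (p i x) = prj (i, j) x" if "i \<in> I" "x \<in> carrier M" for i x
  proof -
    have "p i x \<in> carrier L \<and> (\<forall>j \<in> J. prj' i j (p i x) = prj (i, j) x)"
      unfolding p_def by (rule someI_ex) (use ex[OF that(2)] that(1) in blast)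
    then show "p i x \<in> carrier L" "\<forall>j \<in> J. prj' i j (p i x) = prj (i, j) x" by auto
  qed
  show ?thesis
  proof (intro exI[of _ p] copower.intro copower_axioms.intro M.M.abelian_group_axioms L.abelian_group_axioms f)
    fix i assume i: "i \<in> I"
    interpret L': copower L N J "inc' i" "prj' i" by (rule L[OF i])
    show "additive M L (p i)"
    proof (rule additiveI)
      fix x y assume "x \<in> carrier M" "y \<in> carrier M"
      then show "p i (x \<oplus>\<^bsub>M\<^esub> y) = p i x \<oplus>\<^bsub>L\<^esub> p i y"
        using p i by (intro L'.eqI) (auto simp: additive_add[OF L'.prj_additive] additive_add[OF M.prj_additive])
    qed (use p i in auto)
  next
    fix i i' l assume *: "i \<in> I" "i' \<in> I" "l \<in> carrier L"
    interpret L': copower L N J "inc' i" "prj' i" by (rule L[OF *(1)])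
    have fl: "f i' l \<in> carrier M" using additive_closed[OF f] * by auto
    show "p i (f i' l) = (if i = i' then l else \<zero>\<^bsub>L\<^esub>)"
      using * p[OF *(1) fl] additive_zero[OF L.abelian_group_axioms M.N.abelian_group_axioms L'.prj_additive]
      by (intro L'.eqI) (auto simp: pf)
  next
    fix P x assume x: "x \<in> carrier M" and P: "P \<zero>\<^bsub>M\<^esub>"
      "\<And>u v. u \<in> carrier M \<Longrightarrow> v \<in> carrier M \<Longrightarrow> P u \<Longrightarrow> P v \<Longrightarrow> P (u \<oplus>\<^bsub>M\<^esub> v)"
      "\<And>i l. i \<in> I \<Longrightarrow> l \<in> carrier L \<Longrightarrow> P (f i l)"
    show "P x" using x
    proof (induction x rule: M.induct)
      case (incl k n)
      then obtain i j where k: "k = (i, j)" "i \<in> I" "j \<in> J" by auto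
      interpret L': copower L N J "inc' i" "prj' i" by (rule L[OF k(2)])
      show ?case using P(3)[OF k(2) L'.inc_closed[OF k(3) incl(2)]] c k incl by simp
    qed (use P in auto)
  qed
qed

section \<open>Direct sums of copies of the ring as free modules\<close>

lemma copower_module_basis:
  assumes "copower M R I inc prj" "left_module R M"
    and e: "\<And>i. i \<in> I \<Longrightarrow> e i \<in> carrier M"
    and inc: "\<And>i r. i \<in> I \<Longrightarrow> r \<in> carrier R \<Longrightarrow> inc i r = r \<odot>\<^bsub>M\<^esub> e i"
  shows "\<exists>B. module_basis R M B"
proof -
  interpret M: copower M R I inc prj by fact
  interpret L: left_module R M by fact
  show ?thesis
  \<comment> \<open>A basis is a set, so the family e has to be injective. This can fail over the
    zero ring, where M is zero and the empty set is a basis.\<close>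
  proof (cases "\<one>\<^bsub>R\<^esub> = \<zero>\<^bsub>R\<^esub>")
    case True
    then have R0: "carrier R = {\<zero>\<^bsub>R\<^esub>}" using L.R.one_zeroD by auto
    have "module_basis R M {}"
      unfolding module_basis_def
      using M.zero_if_coefficients_trivial[OF R0] by (auto intro!: ex1I[of _ "\<lambda>x. undefined"])
    then show ?thesis by blast
  next
    case False
    have pe: "prj i (e j) = (if i = j then \<one>\<^bsub>R\<^esub> else \<zero>\<^bsub>R\<^esub>)" if "i \<in> I" "j \<in> I" for i j
      using M.prj_inc[OF that L.R.one_closed] inc[OF that(2) L.R.one_closed] L.smult_one[OF e[OF that(2)]] by simp
    have inj: "inj_on e I" using pe False by (metis inj_onI)
    let ?B = "e ` I" and ?k = "inv_into I e"
    have k: "?k (e i) = i" if "i \<in> I" for i using inv_into_f_f[OF inj that] .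
    have "\<exists>!c. c \<in> ?B \<rightarrow>\<^sub>E carrier R \<and> finite {b \<in> ?B. c b \<noteq> \<zero>\<^bsub>R\<^esub>} \<and>
      x = (\<Oplus>\<^bsub>M\<^esub>b \<in> {b \<in> ?B. c b \<noteq> \<zero>\<^bsub>R\<^esub>}. c b \<odot>\<^bsub>M\<^esub> b)" if x: "x \<in> carrier M" for x
    proof (rule ex1I)
      let ?c = "\<lambda>b \<in> ?B. prj (?k b) x"
      have s: "{b \<in> ?B. ?c b \<noteq> \<zero>\<^bsub>R\<^esub>} = e ` {i \<in> I. prj i x \<noteq> \<zero>\<^bsub>R\<^esub>}"
        using k by (auto simp: image_iff) (metis k)+
      have "x = (\<Oplus>\<^bsub>M\<^esub>i \<in> {i \<in> I. prj i x \<noteq> \<zero>\<^bsub>R\<^esub>}. ?c (e i) \<odot>\<^bsub>M\<^esub> e i)"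
        by (subst M.expansion[OF x], rule M.M.finsum_cong')
          (auto simp: k inc e M.prj_closed x intro!: L.smult_closed)
      also have "\<dots> = (\<Oplus>\<^bsub>M\<^esub>b \<in> e ` {i \<in> I. prj i x \<noteq> \<zero>\<^bsub>R\<^esub>}. ?c b \<odot>\<^bsub>M\<^esub> b)"
        by (rule M.M.add.finprod_reindex[symmetric])
          (use inj in \<open>auto simp: k e M.prj_closed x intro!: L.smult_closed intro: inj_on_subset\<close>)
      finally show "?c \<in> ?B \<rightarrow>\<^sub>E carrier R \<and> finite {b \<in> ?B. ?c b \<noteq> \<zero>\<^bsub>R\<^esub>} \<and>
          x = (\<Oplus>\<^bsub>M\<^esub>b \<in> {b \<in> ?B. ?c b \<noteq> \<zero>\<^bsub>R\<^esub>}. ?c b \<odot>\<^bsub>M\<^esub> b)"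
        unfolding s using M.finite_support[OF x] by (auto simp: k M.prj_closed x)
    next
      fix c assume c: "c \<in> ?B \<rightarrow>\<^sub>E carrier R \<and> finite {b \<in> ?B. c b \<noteq> \<zero>\<^bsub>R\<^esub>} \<and>
          x = (\<Oplus>\<^bsub>M\<^esub>b \<in> {b \<in> ?B. c b \<noteq> \<zero>\<^bsub>R\<^esub>}. c b \<odot>\<^bsub>M\<^esub> b)"
      have "c (e i) = prj i x" if i: "i \<in> I" for i
      proof -
        let ?s = "{b \<in> ?B. c b \<noteq> \<zero>\<^bsub>R\<^esub>}"
        have cc: "c b \<in> carrier R" if "b \<in> ?B" for b using c that by auto
        \<comment> \<open>Projecting the given expansion of x leaves only the coefficient of e i;
          this determines c.\<close>
        have "prj i x = (\<Oplus>\<^bsub>R\<^esub>b \<in> ?s. prj i (c b \<odot>\<^bsub>M\<^esub> b))"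
          by (subst conjunct2[OF conjunct2[OF c]],
              rule additive_finsum[OF M.M.abelian_group_axioms M.N.abelian_group_axioms M.prj_additive[OF i]])
            (use cc e in \<open>auto intro!: L.smult_closed\<close>)
        also have "\<dots> = (\<Oplus>\<^bsub>R\<^esub>b \<in> ?s. if e i = b then c b else \<zero>\<^bsub>R\<^esub>)"
          by (rule M.N.finsum_cong') (use cc i inj in \<open>auto simp: M.prj_inc simp flip: inc dest: inj_onD\<close>)
        also have "\<dots> = c (e i)"
        proof (cases "e i \<in> ?s")
          case True
          show ?thesis
            by (rule M.N.add.finprod_singleton[OF True]) (use c in auto)
        next
          case False
          then have "(\<Oplus>\<^bsub>R\<^esub>b \<in> ?s. if e i = b then c b else \<zero>\<^bsub>R\<^esub>) = \<zero>\<^bsub>R\<^esub>"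
            by (intro M.N.add.finprod_one_eqI) auto
          then show ?thesis using False i by auto
        qed
        finally show ?thesis by simp
      qed
      then show "c = (\<lambda>b \<in> ?B. prj (?k b) x)"
        using c k by (auto simp: fun_eq_iff PiE_def extensional_def)
    qed
    moreover have "?B \<subseteq> carrier M" using e by (intro image_subsetI)
    ultimately have "module_basis R M ?B" unfolding module_basis_def by (intro conjI ballI)
    then show ?thesis ..
  qed
qed

text \<open>The isomorphism matches coordinates: f x is the element of M' with the coordinates of x.
  Linear coordinates make f linear, and they are linear because each inclusion is multiplication
  onto a fixed vector.\<close>

lemma copower_left_module_iso:
  assumes "copower M R I inc prj" "left_module R M" "copower M' R I inc' prj'" "left_module R M'"
    and inc: "\<And>i r. i \<in> I \<Longrightarrow> r \<in> carrier R \<Longrightarrow> inc i r = r \<odot>\<^bsub>M\<^esub> e i" "\<And>i. i \<in> I \<Longrightarrow> e i \<in> carrier M"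
    and inc': "\<And>i r. i \<in> I \<Longrightarrow> r \<in> carrier R \<Longrightarrow> inc' i r = r \<odot>\<^bsub>M'\<^esub> e' i" "\<And>i. i \<in> I \<Longrightarrow> e' i \<in> carrier M'"
  shows "\<exists>f. f \<in> left_module_iso R M M'"
proof -
  interpret M: copower M R I inc prj by fact
  interpret L: left_module R M by fact
  interpret M': copower M' R I inc' prj' by fact
  interpret L': left_module R M' by fact
  have lin: "prj i (r \<odot>\<^bsub>M\<^esub> x) = r \<otimes>\<^bsub>R\<^esub> prj i x" if "i \<in> I" "r \<in> carrier R" "x \<in> carrier M" for i r x
  proof (rule M.hom_eq[OF M.N.abelian_group_axioms _ _ _ that(3)])
    show "additive M R (\<lambda>x. prj i (r \<odot>\<^bsub>M\<^esub> x))"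
      by (rule additive_comp[OF _ M.prj_additive[OF that(1)], of _ "\<lambda>x. r \<odot>\<^bsub>M\<^esub> x"])
        (auto intro!: additiveI L.smult_closed L.smult_r_distr that)
    show "additive M R (\<lambda>x. r \<otimes>\<^bsub>R\<^esub> prj i x)"
      by (rule additive_comp[OF M.prj_additive[OF that(1)], of _ "\<lambda>x. r \<otimes>\<^bsub>R\<^esub> x"])
        (auto intro!: additiveI L.R.r_distr that)
    fix j n assume "j \<in> I" "n \<in> carrier R"
    moreover have "r \<odot>\<^bsub>M\<^esub> inc j n = inc j (r \<otimes>\<^bsub>R\<^esub> n)" if "j \<in> I" "n \<in> carrier R" for j n
      using that inc \<open>r \<in> carrier R\<close> L.smult_assoc by simp
    ultimately show "prj i (r \<odot>\<^bsub>M\<^esub> inc j n) = r \<otimes>\<^bsub>R\<^esub> prj i (inc j n)"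
      using that by (simp add: M.prj_inc)
  qed
  have lin': "prj' i (r \<odot>\<^bsub>M'\<^esub> x) = r \<otimes>\<^bsub>R\<^esub> prj' i x" if "i \<in> I" "r \<in> carrier R" "x \<in> carrier M'" for i r x
  proof (rule M'.hom_eq[OF M.N.abelian_group_axioms _ _ _ that(3)])
    show "additive M' R (\<lambda>x. prj' i (r \<odot>\<^bsub>M'\<^esub> x))"
      by (rule additive_comp[OF _ M'.prj_additive[OF that(1)], of _ "\<lambda>x. r \<odot>\<^bsub>M'\<^esub> x"])
        (auto intro!: additiveI L'.smult_closed L'.smult_r_distr that)
    show "additive M' R (\<lambda>x. r \<otimes>\<^bsub>R\<^esub> prj' i x)"
      by (rule additive_comp[OF M'.prj_additive[OF that(1)], of _ "\<lambda>x. r \<otimes>\<^bsub>R\<^esub> x"])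
        (auto intro!: additiveI L.R.r_distr that)
    fix j n assume "j \<in> I" "n \<in> carrier R"
    moreover have "r \<odot>\<^bsub>M'\<^esub> inc' j n = inc' j (r \<otimes>\<^bsub>R\<^esub> n)" if "j \<in> I" "n \<in> carrier R" for j n
      using that inc' \<open>r \<in> carrier R\<close> L'.smult_assoc by simp
    ultimately show "prj' i (r \<odot>\<^bsub>M'\<^esub> inc' j n) = r \<otimes>\<^bsub>R\<^esub> prj' i (inc' j n)"
      using that by (simp add: M'.prj_inc)
  qed
  note z = additive_zero[OF M.M.abelian_group_axioms M.N.abelian_group_axioms M.prj_additive]
  note z' = additive_zero[OF M'.M.abelian_group_axioms M.N.abelian_group_axioms M'.prj_additive]
  have ex: "\<exists>y \<in> carrier M'. \<forall>i \<in> I. prj' i y = prj i x" if "x \<in> carrier M" for x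
    using that
  proof (induction x rule: M.induct)
    case zero show ?case by (rule bexI[of _ "\<zero>\<^bsub>M'\<^esub>"]) (auto simp: z z')
  next
    case (add u v)
    then obtain y w where "y \<in> carrier M'" "\<forall>i \<in> I. prj' i y = prj i u" "w \<in> carrier M'" "\<forall>i \<in> I. prj' i w = prj i v" by blast
    then show ?case
      using add(1,2) by (intro bexI[of _ "y \<oplus>\<^bsub>M'\<^esub> w"]) (auto simp: additive_add[OF M.prj_additive] additive_add[OF M'.prj_additive])
  next
    case (incl i n) then show ?case
      by (intro bexI[of _ "inc' i n"]) (auto simp: M.prj_inc M'.prj_inc M'.inc_closed)
  qed
  have ex': "\<exists>y \<in> carrier M. \<forall>i \<in> I. prj i y = prj' i x" if "x \<in> carrier M'" for x
    using that
  proof (induction x rule: M'.induct)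
    case zero show ?case by (rule bexI[of _ "\<zero>\<^bsub>M\<^esub>"]) (auto simp: z z')
  next
    case (add u v)
    then obtain y w where "y \<in> carrier M" "\<forall>i \<in> I. prj i y = prj' i u" "w \<in> carrier M" "\<forall>i \<in> I. prj i w = prj' i v" by blast
    then show ?case
      using add(1,2) by (intro bexI[of _ "y \<oplus>\<^bsub>M\<^esub> w"]) (auto simp: additive_add[OF M.prj_additive] additive_add[OF M'.prj_additive])
  next
    case (incl i n) then show ?case
      by (intro bexI[of _ "inc i n"]) (auto simp: M.prj_inc M'.prj_inc M.inc_closed)
  qed
  obtain f where f: "\<And>x. x \<in> carrier M \<Longrightarrow> f x \<in> carrier M'" "\<And>x i. x \<in> carrier M \<Longrightarrow> i \<in> I \<Longrightarrow> prj' i (f x) = prj i x"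
    using ex by metis
  have "f \<in> left_module_hom R M M'"
    unfolding left_module_hom_def
    by (auto simp: f lin lin' L.smult_closed L'.smult_closed additive_add[OF M.prj_additive]
        additive_add[OF M'.prj_additive] intro!: M'.eqI)
  moreover have "inj_on f (carrier M)" using f(2) by (intro inj_onI M.eqI) metis+
  moreover have "f ` carrier M = carrier M'"
  proof -
    have "y \<in> f ` carrier M" if y: "y \<in> carrier M'" for y
    proof -
      obtain x where "x \<in> carrier M" "\<forall>i \<in> I. prj i x = prj' i y"
        using ex'[OF y] by (elim bexE) (rule that)
      then show ?thesis using f y by (intro image_eqI[of _ _ x] M'.eqI) auto
    qed
    then show ?thesis using f(1) by (intro equalityI subsetI) auto
  qed
  ultimately show ?thesis unfolding left_module_iso_def bij_betw_def by (intro exI[of _ f]) simp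
qed

text \<open>Over a finite index set the product is the sum. T is described by its carrier, zero and
  addition, not by a construction, so that spaces of functions on G and \<open>bimodule_sum\<close>
  are both covered; the number of copies may vary with i.\<close>

lemma copower_product:
  assumes I: "finite I" and M: "\<And>i. i \<in> I \<Longrightarrow> copower (M i) N (J i) (inc i) (prj i)"
    and T: "abelian_group T" and N: "abelian_group N"
    and c: "carrier T = (\<Pi>\<^sub>E i \<in> I. carrier (M i))" "\<zero>\<^bsub>T\<^esub> = (\<lambda>i \<in> I. \<zero>\<^bsub>M i\<^esub>)"
    "\<And>x y. x \<oplus>\<^bsub>T\<^esub> y = (\<lambda>i \<in> I. x i \<oplus>\<^bsub>M i\<^esub> y i)"
  shows "copower T N (Sigma I J) (\<lambda>(i, j) n. \<lambda>i' \<in> I. if i' = i then inc i j n else \<zero>\<^bsub>M i'\<^esub>)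
    (\<lambda>(i, j) x. prj i j (x i))"
proof -
  interpret T: abelian_group T by fact
  interpret N: abelian_group N by fact
  define d where "d i m = (\<lambda>i' \<in> I. if i' = i then m else \<zero>\<^bsub>M i'\<^esub>)" for i m
  have Mg: "abelian_group (M i)" if "i \<in> I" for i using M[OF that] copower.axioms(1) by blast
  have Mz: "\<zero>\<^bsub>M i\<^esub> \<in> carrier (M i)" if "i \<in> I" for i
    using Mg[OF that] abelian_group.axioms(1) abelian_monoid.zero_closed by blast
  have Mr: "m \<oplus>\<^bsub>M i\<^esub> \<zero>\<^bsub>M i\<^esub> = m" "\<zero>\<^bsub>M i\<^esub> \<oplus>\<^bsub>M i\<^esub> m = m" if "i \<in> I" "m \<in> carrier (M i)" for i m
    using Mg[OF that(1)] that abelian_group.axioms(1) abelian_monoid.r_zero abelian_monoid.l_zero by metis+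
  have d: "additive (M i) T (d i)" if "i \<in> I" for i
    using that by (intro additiveI) (auto simp: c d_def Mz Mr fun_eq_iff)
  show ?thesis
  proof (intro copower.intro copower_axioms.intro T.abelian_group_axioms N.abelian_group_axioms)
    fix k assume "k \<in> Sigma I J"
    then obtain i j where k: "k = (i, j)" "i \<in> I" "j \<in> J i" by auto
    interpret Mi: copower "M i" N "J i" "inc i" "prj i" by (rule M[OF k(2)])
    show "additive N T (case k of (i, j) \<Rightarrow> \<lambda>n. \<lambda>i' \<in> I. if i' = i then inc i j n else \<zero>\<^bsub>M i'\<^esub>)"
      using additive_comp[OF Mi.inc_additive[OF k(3)] d[OF k(2)]] by (simp add: k d_def)
    show "additive T N (case k of (i, j) \<Rightarrow> \<lambda>x. prj i j (x i))"
      using additive_comp[OF _ Mi.prj_additive[OF k(3)], of T "\<lambda>x. x i"] k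
      by (auto simp: c additive_def)
    fix k' n assume "k' \<in> Sigma I J" and n: "n \<in> carrier N"
    then obtain i' j' where k': "k' = (i', j')" "i' \<in> I" "j' \<in> J i'" by auto
    show "(case k of (i, j) \<Rightarrow> \<lambda>x. prj i j (x i))
        ((case k' of (i, j) \<Rightarrow> \<lambda>n. \<lambda>i' \<in> I. if i' = i then inc i j n else \<zero>\<^bsub>M i'\<^esub>) n)
      = (if k = k' then n else \<zero>\<^bsub>N\<^esub>)"
    proof (cases "i' = i")
      case True
      then have "prj i j (inc i' j' n) = (if j = j' then n else \<zero>\<^bsub>N\<^esub>)"
        using k k' n Mi.prj_inc[of j j' n] by simp
      then show ?thesis using k k' True by simp
    qed (use k k' n in \<open>simp add: additive_zero[OF Mi.M.abelian_group_axioms N.abelian_group_axioms Mi.prj_additive]\<close>)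
  next
    fix P x assume x: "x \<in> carrier T" and P: "P \<zero>\<^bsub>T\<^esub>"
      "\<And>u v. u \<in> carrier T \<Longrightarrow> v \<in> carrier T \<Longrightarrow> P u \<Longrightarrow> P v \<Longrightarrow> P (u \<oplus>\<^bsub>T\<^esub> v)"
      "\<And>k n. k \<in> Sigma I J \<Longrightarrow> n \<in> carrier N \<Longrightarrow>
        P ((case k of (i, j) \<Rightarrow> \<lambda>n. \<lambda>i' \<in> I. if i' = i then inc i j n else \<zero>\<^bsub>M i'\<^esub>) n)"
    have Pd: "P (d i m)" if i: "i \<in> I" and m: "m \<in> carrier (M i)" for i m
    proof -
      interpret Mi: copower "M i" N "J i" "inc i" "prj i" by (rule M[OF i])
      show ?thesis using m
      proof (induction m rule: Mi.induct)
        case zero show ?case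
          using P(1) additive_zero[OF Mi.M.abelian_group_axioms T.abelian_group_axioms d[OF i]] by simp
      next
        case (add u v) then show ?case using P(2) additive_add[OF d[OF i]] additive_closed[OF d[OF i]] by simp
      next
        case (incl j n)
        have "d i (inc i j n) = (\<lambda>i' \<in> I. if i' = i then inc i j n else \<zero>\<^bsub>M i'\<^esub>)" by (simp only: d_def)
        then show ?case using P(3)[of "(i, j)" n] i incl by (simp only: case_prod_conv mem_Sigma_iff)
      qed
    qed
    \<comment> \<open>x is built up coordinate by coordinate: F is the set of coordinates already
      filled in, the others are zero.\<close>
    have "P (\<lambda>i \<in> I. if i \<in> F then x i else \<zero>\<^bsub>M i\<^esub>)" if "finite F" "F \<subseteq> I" for F
      using that
    proof (induction F rule: finite_induct)
      case empty then show ?case using P(1) by (simp add: c restrict_def)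
    next
      case (insert i F)
      have xc: "x i \<in> carrier (M i)" if "i \<in> I" for i using x that by (auto simp: c)
      have s: "(\<lambda>i' \<in> I. if i' \<in> insert i F then x i' else \<zero>\<^bsub>M i'\<^esub>)
        = d i (x i) \<oplus>\<^bsub>T\<^esub> (\<lambda>i \<in> I. if i \<in> F then x i else \<zero>\<^bsub>M i\<^esub>)"
        using insert.hyps insert.prems xc by (auto simp: c d_def fun_eq_iff Mr Mz)
      have t: "(\<lambda>i \<in> I. if i \<in> F then x i else \<zero>\<^bsub>M i\<^esub>) \<in> carrier T" by (auto simp: c xc Mz)
      have i: "i \<in> I" "F \<subseteq> I" using insert.prems by auto
      show ?case
        unfolding s
        by (rule P(2)[OF additive_closed[OF d[OF i(1)] xc[OF i(1)]] t Pd[OF i(1) xc[OF i(1)]] insert.IH[OF i(2)]])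
    qed
    from this[OF I order_refl] have "P (restrict x I)" by (simp cong: restrict_cong)
    then show "P x" using x by (simp add: c PiE_def extensional_restrict)
  qed
qed

lemma copower_functions:
  assumes "finite I" "abelian_group N" "abelian_group T" "carrier T = I \<rightarrow>\<^sub>E carrier N" "\<zero>\<^bsub>T\<^esub> = (\<lambda>i \<in> I. \<zero>\<^bsub>N\<^esub>)"
    "\<And>x y. x \<oplus>\<^bsub>T\<^esub> y = (\<lambda>i \<in> I. x i \<oplus>\<^bsub>N\<^esub> y i)"
  shows "copower T N I (\<lambda>i n. \<lambda>j \<in> I. if j = i then n else \<zero>\<^bsub>N\<^esub>) (\<lambda>i x. x i)"
proof -
  have 1: "copower N N {()} (\<lambda>_ n. n) (\<lambda>_ n. n)"
    by (intro copower.intro copower_axioms.intro assms(2)) (auto intro: additive_id)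
  have b: "bij_betw (\<lambda>i. (i, ())) I (Sigma I (\<lambda>_. {()}))" by (auto simp: bij_betw_def inj_on_def)
  show ?thesis
    using copower_reindex[OF copower_product[OF assms(1) 1 assms(3,2,4,5,6)] b] by simp
qed

section \<open>Bases of vector spaces\<close>

text \<open>Linear combinations are generated one summand at a time, so that finiteness needs no
  bookkeeping and statements about spans are proved by induction.\<close>

inductive_set lin_span :: "('k, 'x) ring_scheme \<Rightarrow> ('k, 'v, 'y) module_scheme \<Rightarrow> 'v set \<Rightarrow> 'v set"
  for K V X where
    zero: "\<zero>\<^bsub>V\<^esub> \<in> lin_span K V X"
  | step: "\<lbrakk>c \<in> carrier K; x \<in> X; y \<in> lin_span K V X\<rbrakk> \<Longrightarrow> c \<odot>\<^bsub>V\<^esub> x \<oplus>\<^bsub>V\<^esub> y \<in> lin_span K V X"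

lemma lin_span_mono:
  assumes "y \<in> lin_span K V X" "X \<subseteq> Y"
  shows "y \<in> lin_span K V Y"
  using assms(1) by induction (use assms(2) in \<open>auto intro: lin_span.intros\<close>)

text \<open>A combination uses finitely many vectors, and finitely many members of a chain are
  contained in the largest of them. This feeds the chain condition in Zorn's lemma.\<close>

lemma lin_span_Union_chain:
  assumes "y \<in> lin_span K V (\<Union>\<C>)" "subset.chain A \<C>" "\<C> \<noteq> {}"
  shows "\<exists>X \<in> \<C>. y \<in> lin_span K V X"
  using assms(1)
proof induction
  case zero then show ?case using assms(3) lin_span.zero by auto
next
  case (step c x y)
  then obtain X Y where XY: "X \<in> \<C>" "x \<in> X" "Y \<in> \<C>" "y \<in> lin_span K V Y" by blast
  then have "X \<subseteq> Y \<or> Y \<subseteq> X" using assms(2) by (auto simp: subset_chain_def)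
  then show ?case
  proof
    assume "X \<subseteq> Y" then show ?case using XY step by (intro bexI[of _ Y] lin_span.step) auto
  next
    assume "Y \<subseteq> X" then show ?case using XY step lin_span_mono[OF XY(4)]
      by (intro bexI[of _ X] lin_span.step) auto
  qed
qed

context module
begin

lemma lin_span_closed: "y \<in> lin_span R M X \<Longrightarrow> X \<subseteq> carrier M \<Longrightarrow> y \<in> carrier M"
  by (induction rule: lin_span.induct) auto

lemma lin_span_add:
  assumes "x \<in> lin_span R M X" "y \<in> lin_span R M X" "X \<subseteq> carrier M"
  shows "x \<oplus>\<^bsub>M\<^esub> y \<in> lin_span R M X"
  using assms(1)
proof induction
  case (step c x z)
  then have "c \<odot>\<^bsub>M\<^esub> x \<oplus>\<^bsub>M\<^esub> z \<oplus>\<^bsub>M\<^esub> y = c \<odot>\<^bsub>M\<^esub> x \<oplus>\<^bsub>M\<^esub> (z \<oplus>\<^bsub>M\<^esub> y)"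
    using assms lin_span_closed by (intro M.a_assoc) auto
  then show ?case using step lin_span.step by metis
qed (use assms lin_span_closed in auto)

lemma lin_span_smult:
  assumes "x \<in> lin_span R M X" "c \<in> carrier R" "X \<subseteq> carrier M"
  shows "c \<odot>\<^bsub>M\<^esub> x \<in> lin_span R M X"
  using assms(1)
proof induction
  case zero then show ?case using assms by (simp add: lin_span.zero)
next
  case (step d x y)
  then have "c \<odot>\<^bsub>M\<^esub> (d \<odot>\<^bsub>M\<^esub> x \<oplus>\<^bsub>M\<^esub> y) = (c \<otimes> d) \<odot>\<^bsub>M\<^esub> x \<oplus>\<^bsub>M\<^esub> c \<odot>\<^bsub>M\<^esub> y"
    using assms lin_span_closed by (simp add: smult_r_distr smult_assoc1 subset_iff)
  then show ?case using step assms lin_span.step[of "c \<otimes> d" R x X "c \<odot>\<^bsub>M\<^esub> y" M] by simp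
qed

lemma lin_span_self:
  assumes "x \<in> X" "X \<subseteq> carrier M"
  shows "x \<in> lin_span R M X"
  using lin_span.step[OF R.one_closed assms(1) lin_span.zero, of M] assms by (simp add: subset_iff)

lemma lin_span_insert:
  assumes "y \<in> lin_span R M (insert v X)" "v \<in> carrier M" "X \<subseteq> carrier M"
  shows "\<exists>c \<in> carrier R. \<exists>u \<in> lin_span R M X. y = c \<odot>\<^bsub>M\<^esub> v \<oplus>\<^bsub>M\<^esub> u"
  using assms(1)
proof induction
  case zero
  show ?case using assms by (intro bexI[of _ \<zero>] bexI[of _ "\<zero>\<^bsub>M\<^esub>"]) (auto simp: lin_span.zero)
next
  case (step d x y)
  then obtain c u where cu: "c \<in> carrier R" "u \<in> lin_span R M X" "y = c \<odot>\<^bsub>M\<^esub> v \<oplus>\<^bsub>M\<^esub> u" by auto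
  have uc: "u \<in> carrier M" using lin_span_closed cu(2) assms(3) .
  show ?case
  proof (cases "x = v")
    case True
    then have "d \<odot>\<^bsub>M\<^esub> x \<oplus>\<^bsub>M\<^esub> y = (d \<oplus> c) \<odot>\<^bsub>M\<^esub> v \<oplus>\<^bsub>M\<^esub> u"
      using cu step(1) uc assms by (simp add: smult_l_distr M.a_assoc)
    then show ?thesis using cu step by (intro bexI[of _ "d \<oplus> c"] bexI[of _ u]) auto
  next
    case False
    then have x: "x \<in> X" "x \<in> carrier M" using step assms by auto
    then have "d \<odot>\<^bsub>M\<^esub> x \<oplus>\<^bsub>M\<^esub> y = c \<odot>\<^bsub>M\<^esub> v \<oplus>\<^bsub>M\<^esub> (d \<odot>\<^bsub>M\<^esub> x \<oplus>\<^bsub>M\<^esub> u)"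
      using cu step(1) uc assms by (simp add: M.a_lcomm)
    then show ?thesis using cu step(1) x(1) lin_span.step by (intro bexI[of _ c] bexI[of _ "d \<odot>\<^bsub>M\<^esub> x \<oplus>\<^bsub>M\<^esub> u"])
  qed
qed

end

text \<open>A maximal independent set exists by Zorn's lemma and spans. The b-coordinate of x is
  defined as the unique c with x - c b in the span of B - {b}; additivity is then closure of the
  span under sums, without any comparison of finite expansions.\<close>

lemma vector_space_copower:
  assumes "field K" "module K V"
  shows "\<exists>B prj. B \<subseteq> carrier V \<and> copower V K B (\<lambda>b c. c \<odot>\<^bsub>V\<^esub> b) prj"
proof -
  interpret K: field K by fact
  interpret V: module K V by fact
  define A where "A = {B. B \<subseteq> carrier V \<and> (\<forall>b \<in> B. b \<notin> lin_span K V (B - {b}))}"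
  have "\<exists>B \<in> A. \<forall>X \<in> A. B \<subseteq> X \<longrightarrow> X = B"
  proof (rule subset_Zorn')
    fix \<C> assume ch: "subset.chain A \<C>"
    have "b \<notin> lin_span K V (\<Union>\<C> - {b})" if b: "b \<in> X" "X \<in> \<C>" for b X
    proof
      assume *: "b \<in> lin_span K V (\<Union>\<C> - {b})"
      \<comment> \<open>Deleting b from every member again gives a chain, so a dependency of b on
        the union without b already occurs inside one member.\<close>
      have ch': "subset.chain UNIV ((\<lambda>X. X - {b}) ` \<C>)" using ch by (auto simp: subset_chain_def)
      have "\<Union>\<C> - {b} = \<Union>((\<lambda>X. X - {b}) ` \<C>)" by auto
      then obtain Y where Y: "Y \<in> \<C>" "b \<in> lin_span K V (Y - {b})"
        using lin_span_Union_chain[OF _ ch', of b K V] * b by auto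
      have "X \<subseteq> Y \<or> Y \<subseteq> X" using ch Y b by (auto simp: subset_chain_def)
      \<comment> \<open>The larger of X and Y contains both b and the vectors of the dependency,
        which contradicts its independence.\<close>
      then obtain Z where Z: "Z \<in> \<C>" "b \<in> Z" "Y \<subseteq> Z" using Y b by blast
      then have "b \<in> lin_span K V (Z - {b})" using lin_span_mono[OF Y(2)] by blast
      then show False using Z ch by (auto simp: subset_chain_def A_def)
    qed
    then show "\<Union>\<C> \<in> A" using ch by (auto simp: subset_chain_def A_def)
  qed
  then obtain B where BA: "B \<in> A" and max: "\<And>X. X \<in> A \<Longrightarrow> B \<subseteq> X \<Longrightarrow> X = B" by auto
  then have B: "B \<subseteq> carrier V" and ind: "\<And>b. b \<in> B \<Longrightarrow> b \<notin> lin_span K V (B - {b})"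
    by (auto simp: A_def)
  \<comment> \<open>Division by a nonzero scalar: this is where inverses in K are used.\<close>
  have solve: "v \<in> lin_span K V X"
    if "c \<in> carrier K" "c \<noteq> \<zero>\<^bsub>K\<^esub>" "v \<in> carrier V" "X \<subseteq> carrier V" "c \<odot>\<^bsub>V\<^esub> v \<in> lin_span K V X" for c v X
  proof -
    have i: "inv\<^bsub>K\<^esub> c \<in> carrier K" "inv\<^bsub>K\<^esub> c \<otimes>\<^bsub>K\<^esub> c = \<one>\<^bsub>K\<^esub>" using K.field_Units that by auto
    have "inv\<^bsub>K\<^esub> c \<odot>\<^bsub>V\<^esub> (c \<odot>\<^bsub>V\<^esub> v) = v" using i that V.smult_assoc1[OF i(1) that(1,3)] by simp
    then show ?thesis using V.lin_span_smult[OF that(5) i(1) that(4)] by simp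
  qed
  have span: "v \<in> lin_span K V B" if v: "v \<in> carrier V" for v
  proof (rule ccontr)
    assume nv: "v \<notin> lin_span K V B"
    then have vB: "v \<notin> B" using V.lin_span_self B by blast
    have "insert v B \<in> A"
      unfolding A_def
    proof (intro CollectI conjI ballI)
      fix b assume b: "b \<in> insert v B"
      show "b \<notin> lin_span K V (insert v B - {b})"
      proof (cases "b = v")
        case True then show ?thesis using nv vB by simp
      next
        case False
        then have bB: "b \<in> B" and e: "insert v B - {b} = insert v (B - {b})" using b by auto
        show ?thesis
        proof
          assume "b \<in> lin_span K V (insert v B - {b})"
          then obtain c u where cu: "c \<in> carrier K" "u \<in> lin_span K V (B - {b})" "b = c \<odot>\<^bsub>V\<^esub> v \<oplus>\<^bsub>V\<^esub> u"
            using V.lin_span_insert[of b v "B - {b}"] v B e by auto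
          have uc: "u \<in> carrier V" using V.lin_span_closed[OF cu(2)] B by auto
          \<comment> \<open>If c were zero, b would depend on B - {b}. As c is invertible, v itself
            would lie in the span of B.\<close>
          have "c \<noteq> \<zero>\<^bsub>K\<^esub>" using cu ind[OF bB] v uc by auto
          moreover have "c \<odot>\<^bsub>V\<^esub> v = b \<oplus>\<^bsub>V\<^esub> (\<ominus>\<^bsub>K\<^esub> \<one>\<^bsub>K\<^esub>) \<odot>\<^bsub>V\<^esub> u"
            using cu(1,3) v uc by (simp add: V.smult_l_minus V.a_assoc V.r_neg)
          moreover have "b \<oplus>\<^bsub>V\<^esub> (\<ominus>\<^bsub>K\<^esub> \<one>\<^bsub>K\<^esub>) \<odot>\<^bsub>V\<^esub> u \<in> lin_span K V B"
            using lin_span_mono[OF cu(2) Diff_subset] V.lin_span_self[OF bB B] B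
            by (intro V.lin_span_add V.lin_span_smult) auto
          ultimately have "v \<in> lin_span K V B" using solve cu(1) v B by metis
          then show False using nv by simp
        qed
      qed
    qed (use v B in auto)
    from max[OF this] show False using vB by auto
  qed
  have coeff: "\<exists>!c. c \<in> carrier K \<and> x \<ominus>\<^bsub>V\<^esub> c \<odot>\<^bsub>V\<^esub> b \<in> lin_span K V (B - {b})"
    if b: "b \<in> B" and x: "x \<in> carrier V" for b x
  proof -
    have bc: "b \<in> carrier V" and B': "B - {b} \<subseteq> carrier V" using b B by auto
    have "insert b (B - {b}) = B" using b by auto
    then obtain c u where cu: "c \<in> carrier K" "u \<in> lin_span K V (B - {b})" "x = c \<odot>\<^bsub>V\<^esub> b \<oplus>\<^bsub>V\<^esub> u"
      using V.lin_span_insert[of x b "B - {b}"] span[OF x] bc B' by auto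
    have uc: "u \<in> carrier V" by (rule V.lin_span_closed[OF cu(2) B'])
    have xu: "x \<ominus>\<^bsub>V\<^esub> c \<odot>\<^bsub>V\<^esub> b = u"
      using cu uc bc by (simp add: V.minus_eq V.a_ac V.r_neg V.r_neg1)
    have un: "d = c" if d: "d \<in> carrier K" "x \<ominus>\<^bsub>V\<^esub> d \<odot>\<^bsub>V\<^esub> b \<in> lin_span K V (B - {b})" for d
    proof (rule ccontr)
      \<comment> \<open>Two different coefficients would put a nonzero multiple of b into the span
        of B - {b}, against independence.\<close>
      assume ne: "d \<noteq> c"
      let ?m = "\<ominus>\<^bsub>K\<^esub> \<one>\<^bsub>K\<^esub>"
      have xd: "x \<ominus>\<^bsub>V\<^esub> d \<odot>\<^bsub>V\<^esub> b = (c \<ominus>\<^bsub>K\<^esub> d) \<odot>\<^bsub>V\<^esub> b \<oplus>\<^bsub>V\<^esub> u"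
        using cu uc bc d(1) by (simp add: V.minus_eq K.minus_eq V.smult_l_distr V.smult_l_minus V.a_ac)
      have "(c \<ominus>\<^bsub>K\<^esub> d) \<odot>\<^bsub>V\<^esub> b = (x \<ominus>\<^bsub>V\<^esub> d \<odot>\<^bsub>V\<^esub> b) \<oplus>\<^bsub>V\<^esub> ?m \<odot>\<^bsub>V\<^esub> u"
        unfolding xd using cu(1) uc bc d(1) by (simp add: V.smult_l_minus V.a_assoc V.r_neg)
      moreover have "\<dots> \<in> lin_span K V (B - {b})"
        by (intro V.lin_span_add d V.lin_span_smult cu B') auto
      ultimately have "b \<in> lin_span K V (B - {b})"
        using solve[of "c \<ominus>\<^bsub>K\<^esub> d" b "B - {b}"] ne cu d bc B' K.sum_zero_eq_neg[of c "\<ominus>\<^bsub>K\<^esub> d"]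
        by (auto simp: K.minus_eq)
      then show False using ind[OF b] by simp
    qed
    show ?thesis
    proof (rule ex1I[of _ c])
      show "c \<in> carrier K \<and> x \<ominus>\<^bsub>V\<^esub> c \<odot>\<^bsub>V\<^esub> b \<in> lin_span K V (B - {b})" using cu(1,2) xu by simp
    qed (rule un; simp)
  qed
  define p where "p b x = (THE c. c \<in> carrier K \<and> x \<ominus>\<^bsub>V\<^esub> c \<odot>\<^bsub>V\<^esub> b \<in> lin_span K V (B - {b}))" for b x
  have p: "p b x \<in> carrier K" "x \<ominus>\<^bsub>V\<^esub> p b x \<odot>\<^bsub>V\<^esub> b \<in> lin_span K V (B - {b})" if "b \<in> B" "x \<in> carrier V" for b x
    using theI'[OF coeff[OF that]] unfolding p_def by auto
  have pI: "p b x = c" if "b \<in> B" "x \<in> carrier V" "c \<in> carrier K" "x \<ominus>\<^bsub>V\<^esub> c \<odot>\<^bsub>V\<^esub> b \<in> lin_span K V (B - {b})" for b x c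
    using the1_equality[OF coeff[OF that(1,2)], of c] that(3,4) unfolding p_def by blast
  have "copower V K B (\<lambda>b c. c \<odot>\<^bsub>V\<^esub> b) p"
  proof (intro copower.intro copower_axioms.intro V.abelian_group_axioms K.abelian_group_axioms)
    fix b assume b: "b \<in> B"
    then have bc: "b \<in> carrier V" using B by auto
    show "additive K V (\<lambda>c. c \<odot>\<^bsub>V\<^esub> b)" using bc by (intro additiveI) (auto simp: V.smult_l_distr)
    show "additive V K (p b)"
    proof (rule additiveI)
      fix x y assume xy: "x \<in> carrier V" "y \<in> carrier V"
      show "p b (x \<oplus>\<^bsub>V\<^esub> y) = p b x \<oplus>\<^bsub>K\<^esub> p b y"
      proof (rule pI)
        have "x \<oplus>\<^bsub>V\<^esub> y \<ominus>\<^bsub>V\<^esub> (p b x \<oplus>\<^bsub>K\<^esub> p b y) \<odot>\<^bsub>V\<^esub> b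
          = (x \<ominus>\<^bsub>V\<^esub> p b x \<odot>\<^bsub>V\<^esub> b) \<oplus>\<^bsub>V\<^esub> (y \<ominus>\<^bsub>V\<^esub> p b y \<odot>\<^bsub>V\<^esub> b)"
          using xy bc p[OF b] by (simp add: V.minus_eq V.smult_l_distr V.minus_add V.a_ac)
        then show "x \<oplus>\<^bsub>V\<^esub> y \<ominus>\<^bsub>V\<^esub> (p b x \<oplus>\<^bsub>K\<^esub> p b y) \<odot>\<^bsub>V\<^esub> b \<in> lin_span K V (B - {b})"
          using V.lin_span_add[OF p(2)[OF b xy(1)] p(2)[OF b xy(2)]] B by auto
      qed (use b xy p in auto)
    qed (use p b in auto)
    fix b' c assume b': "b' \<in> B" and c: "c \<in> carrier K"
    then have bc': "b' \<in> carrier V" using B by auto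
    show "p b (c \<odot>\<^bsub>V\<^esub> b') = (if b = b' then c else \<zero>\<^bsub>K\<^esub>)"
    proof (cases "b = b'")
      case True
      then show ?thesis using b c bc by (auto intro!: pI simp: V.minus_eq V.r_neg lin_span.zero)
    next
      case False
      have "c \<odot>\<^bsub>V\<^esub> b' \<in> lin_span K V (B - {b})"
        using False b' c B by (intro V.lin_span_smult V.lin_span_self) auto
      moreover have "c \<odot>\<^bsub>V\<^esub> b' \<ominus>\<^bsub>V\<^esub> \<zero>\<^bsub>K\<^esub> \<odot>\<^bsub>V\<^esub> b = c \<odot>\<^bsub>V\<^esub> b'"
        using c bc bc' V.r_neg[OF V.zero_closed] V.l_zero[OF V.a_inv_closed[OF V.zero_closed]]
        by (simp add: V.minus_eq del: V.l_zero)
      ultimately show ?thesis using False b c bc' by (simp add: pI)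
    qed
  next
    fix P x assume x: "x \<in> carrier V" and P: "P \<zero>\<^bsub>V\<^esub>"
      "\<And>u v. u \<in> carrier V \<Longrightarrow> v \<in> carrier V \<Longrightarrow> P u \<Longrightarrow> P v \<Longrightarrow> P (u \<oplus>\<^bsub>V\<^esub> v)"
      "\<And>b c. b \<in> B \<Longrightarrow> c \<in> carrier K \<Longrightarrow> P (c \<odot>\<^bsub>V\<^esub> b)"
    from span[OF x] show "P x"
    proof induction
      case (step c x y)
      then show ?case using P B V.lin_span_closed[OF step(3) B] by auto
    qed (rule P)
  qed
  then show ?thesis using B by blast
qed

section \<open>Graded vector spaces and homogeneous bases\<close>

locale graded_vector_space = K: field K + V: module K V
  for K :: "('k, 'x) ring_scheme" and V :: "('k, 'v, 'z) module_scheme" +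
  fixes G :: "('g, 'y) monoid_scheme" and gr :: "'g \<Rightarrow> 'v set"
  assumes finite_G: "finite (carrier G)" and graded: "graded_space K G V gr"
begin

abbreviation (input) "component \<equiv> homogeneous_component G V gr"

lemma homogeneous_submodule: "g \<in> carrier G \<Longrightarrow> submodule (gr g) K V"
  using graded by (simp add: graded_space_def)

lemma homogeneous_closed: "x \<in> gr g \<Longrightarrow> g \<in> carrier G \<Longrightarrow> x \<in> carrier V"
  using V.submoduleE(1)[OF homogeneous_submodule] by blast

lemma homogeneous_zero: "g \<in> carrier G \<Longrightarrow> \<zero>\<^bsub>V\<^esub> \<in> gr g"
  using subgroup.one_closed[OF submodule.axioms(1)[OF homogeneous_submodule]] by simp

lemma decomposition_ex1: "x \<in> carrier V \<Longrightarrow> \<exists>!f. homogeneous_decomposition G V gr x f"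
  using graded by (simp add: graded_space_def)

lemma component_decomposition: "x \<in> carrier V \<Longrightarrow> homogeneous_decomposition G V gr x (component x)"
  using theI'[OF decomposition_ex1] unfolding homogeneous_component_def .

lemma component_eqI:
  assumes "x \<in> carrier V" "homogeneous_decomposition G V gr x f"
  shows "component x = f"
  unfolding homogeneous_component_def by (rule the1_equality[OF decomposition_ex1]) (use assms in auto)

lemma component_homogeneous: "x \<in> carrier V \<Longrightarrow> g \<in> carrier G \<Longrightarrow> component x g \<in> gr g"
  using component_decomposition by (auto simp: homogeneous_decomposition_def)

lemma component_closed: "x \<in> carrier V \<Longrightarrow> g \<in> carrier G \<Longrightarrow> component x g \<in> carrier V"
  using component_homogeneous homogeneous_closed by blast

text \<open>Adding the decompositions of x and y gives a decomposition of the sum, and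
  decompositions are unique.\<close>

lemma component_additive:
  assumes g: "g \<in> carrier G"
  shows "additive V V (\<lambda>x. component x g)"
proof (rule additiveI)
  fix x y assume x: "x \<in> carrier V" "y \<in> carrier V"
  have "component (x \<oplus>\<^bsub>V\<^esub> y) = (\<lambda>g \<in> carrier G. component x g \<oplus>\<^bsub>V\<^esub> component y g)"
  proof (rule component_eqI)
    have "(\<Oplus>\<^bsub>V\<^esub>g \<in> carrier G. (\<lambda>g \<in> carrier G. component x g \<oplus>\<^bsub>V\<^esub> component y g) g)
      = (\<Oplus>\<^bsub>V\<^esub>g \<in> carrier G. component x g \<oplus>\<^bsub>V\<^esub> component y g)"
      by (rule V.finsum_cong') (use x component_closed in auto)
    also have "\<dots> = (\<Oplus>\<^bsub>V\<^esub>g \<in> carrier G. component x g) \<oplus>\<^bsub>V\<^esub> (\<Oplus>\<^bsub>V\<^esub>g \<in> carrier G. component y g)"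
      by (rule V.finsum_addf) (use x component_closed in auto)
    also have "\<dots> = x \<oplus>\<^bsub>V\<^esub> y" using component_decomposition x by (simp add: homogeneous_decomposition_def)
    finally show "homogeneous_decomposition G V gr (x \<oplus>\<^bsub>V\<^esub> y) (\<lambda>g \<in> carrier G. component x g \<oplus>\<^bsub>V\<^esub> component y g)"
      using component_homogeneous x V.submoduleE(5)[OF homogeneous_submodule] by (auto simp: homogeneous_decomposition_def)
  qed (use x in auto)
  then show "component (x \<oplus>\<^bsub>V\<^esub> y) g = component x g \<oplus>\<^bsub>V\<^esub> component y g" using g by simp
qed (rule component_closed[OF _ g])

lemma component_of_homogeneous:
  assumes "g \<in> carrier G" "x \<in> gr g" "g' \<in> carrier G"
  shows "component x g' = (if g' = g then x else \<zero>\<^bsub>V\<^esub>)"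
proof -
  have xc: "x \<in> carrier V" using homogeneous_closed assms by blast
  have "component x = (\<lambda>g' \<in> carrier G. if g' = g then x else \<zero>\<^bsub>V\<^esub>)"
  proof (rule component_eqI[OF xc])
    have "(\<Oplus>\<^bsub>V\<^esub>g' \<in> carrier G. (\<lambda>g' \<in> carrier G. if g' = g then x else \<zero>\<^bsub>V\<^esub>) g')
      = (\<Oplus>\<^bsub>V\<^esub>g' \<in> carrier G. if g = g' then x else \<zero>\<^bsub>V\<^esub>)"
      by (rule V.finsum_cong') (use xc in auto)
    also have "\<dots> = x" by (rule V.add.finprod_singleton) (use assms finite_G xc in auto)
    finally show "homogeneous_decomposition G V gr x (\<lambda>g' \<in> carrier G. if g' = g then x else \<zero>\<^bsub>V\<^esub>)"
      using assms homogeneous_zero by (auto simp: homogeneous_decomposition_def)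
  qed
  then show ?thesis using assms by simp
qed

text \<open>The right action of S on A \<otimes> C_i has an explicit formula on homogeneous
  elements; this reduces identities in C_i to them.\<close>

lemma homogeneous_induct [consumes 1, case_names zero add homogeneous]:
  assumes x: "x \<in> carrier V" and P: "P \<zero>\<^bsub>V\<^esub>"
    "\<And>u v. \<lbrakk>u \<in> carrier V; v \<in> carrier V; P u; P v\<rbrakk> \<Longrightarrow> P (u \<oplus>\<^bsub>V\<^esub> v)"
    "\<And>g y. \<lbrakk>g \<in> carrier G; y \<in> gr g\<rbrakk> \<Longrightarrow> P y"
  shows "P x"
proof -
  have "P (\<Oplus>\<^bsub>V\<^esub>g \<in> F. component x g)" if "finite F" "F \<subseteq> carrier G" for F
    using that
  proof (induction F rule: finite_induct)
    case (insert g F)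
    have s: "(\<Oplus>\<^bsub>V\<^esub>g \<in> insert g F. component x g) = component x g \<oplus>\<^bsub>V\<^esub> (\<Oplus>\<^bsub>V\<^esub>g \<in> F. component x g)"
      by (rule V.finsum_insert) (use insert x component_closed in \<open>auto simp: subset_iff\<close>)
    show ?case unfolding s
      by (rule P(2)) (use insert x component_homogeneous component_closed P(3) in
        \<open>auto simp: subset_iff intro!: V.finsum_closed\<close>)
  qed (simp add: P)
  from this[OF finite_G order_refl] show ?thesis
    using component_decomposition[OF x] by (simp add: homogeneous_decomposition_def)
qed

text \<open>Each graded piece receives its own basis. An index is a pair (degree, vector), so that
  the degree of a basis vector can later be read off as \<open>fst b\<close>.\<close>

lemma homogeneous_basis: "\<exists>B prj. B \<subseteq> Sigma (carrier G) gr \<and> copower V K B (\<lambda>(g, b) c. c \<odot>\<^bsub>V\<^esub> b) prj"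
proof -
  let ?V = "\<lambda>g. V\<lparr>carrier := gr g\<rparr>"
  have m: "module K (?V g)" if "g \<in> carrier G" for g
    using submodule.submodule_is_module[OF homogeneous_submodule[OF that] V.module_axioms] .
  have "\<forall>g \<in> carrier G. \<exists>B prj. B \<subseteq> gr g \<and> copower (?V g) K B (\<lambda>b c. c \<odot>\<^bsub>V\<^esub> b) prj"
    using vector_space_copower[OF K.field_axioms m] by simp
  then obtain B prj where B: "\<And>g. g \<in> carrier G \<Longrightarrow> B g \<subseteq> gr g"
    "\<And>g. g \<in> carrier G \<Longrightarrow> copower (?V g) K (B g) (\<lambda>b c. c \<odot>\<^bsub>V\<^esub> b) (prj g)"
    by metis
  \<comment> \<open>The coordinate at (g, b) first takes the component of degree g, then the
    coordinate inside that piece.\<close>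
  let ?p = "\<lambda>(g, b) x. prj g b (component x g)"
  have "copower V K (Sigma (carrier G) B) (\<lambda>(g, b) c. c \<odot>\<^bsub>V\<^esub> b) ?p"
  proof (intro copower.intro copower_axioms.intro V.abelian_group_axioms K.abelian_group_axioms)
    fix k assume "k \<in> Sigma (carrier G) B"
    then obtain g b where k: "k = (g, b)" "g \<in> carrier G" "b \<in> B g" by auto
    interpret g: copower "?V g" K "B g" "\<lambda>b c. c \<odot>\<^bsub>V\<^esub> b" "prj g" by (rule B(2)[OF k(2)])
    have bg: "b \<in> gr g" and bc: "b \<in> carrier V" using B(1)[OF k(2)] k homogeneous_closed by auto
    show "additive K V (case k of (g, b) \<Rightarrow> \<lambda>c. c \<odot>\<^bsub>V\<^esub> b)"
      using bc k by (intro additiveI) (auto simp: V.smult_l_distr)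
    show "additive V K (?p k)"
      using additive_comp[OF _ g.prj_additive[OF k(3)], of V "\<lambda>x. component x g"]
        component_homogeneous component_additive[OF k(2)] k by (simp add: additive_def)
    fix k' n assume "k' \<in> Sigma (carrier G) B" and n: "n \<in> carrier K"
    then obtain g' b' where k': "k' = (g', b')" "g' \<in> carrier G" "b' \<in> B g'" by auto
    have "b' \<in> gr g'" using B(1) k' by auto
    then have nb: "n \<odot>\<^bsub>V\<^esub> b' \<in> gr g'" using V.submoduleE(4)[OF homogeneous_submodule[OF k'(2)]] n by auto
    show "?p k ((case k' of (g, b) \<Rightarrow> \<lambda>c. c \<odot>\<^bsub>V\<^esub> b) n) = (if k = k' then n else \<zero>\<^bsub>K\<^esub>)"
    proof (cases "g = g'")
      case True
      then show ?thesis using component_of_homogeneous[OF k'(2) nb k(2)] k k' n g.prj_inc[OF k(3), of b' n] by auto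
    next
      case False
      then show ?thesis using component_of_homogeneous[OF k'(2) nb k(2)] k k' n
        additive_zero[OF g.M.abelian_group_axioms K.abelian_group_axioms g.prj_additive[OF k(3)]] by auto
    qed
  next
    fix P x assume x: "x \<in> carrier V" and P: "P \<zero>\<^bsub>V\<^esub>"
      "\<And>u v. u \<in> carrier V \<Longrightarrow> v \<in> carrier V \<Longrightarrow> P u \<Longrightarrow> P v \<Longrightarrow> P (u \<oplus>\<^bsub>V\<^esub> v)"
      "\<And>k n. k \<in> Sigma (carrier G) B \<Longrightarrow> n \<in> carrier K \<Longrightarrow> P ((case k of (g, b) \<Rightarrow> \<lambda>c. c \<odot>\<^bsub>V\<^esub> b) n)"
    have h: "P y" if g: "g \<in> carrier G" and y: "y \<in> gr g" for g y
    proof -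
      interpret g: copower "?V g" K "B g" "\<lambda>b c. c \<odot>\<^bsub>V\<^esub> b" "prj g" by (rule B(2)[OF g])
      have "y \<in> carrier (?V g)" using y by simp
      then show ?thesis
      proof (induction y rule: g.induct)
        case (add u v) then show ?case using P(2) homogeneous_closed[OF _ g] by simp
      next
        case (incl b n) then show ?case using P(3)[of "(g, b)" n] g by simp
      qed (use P(1) in simp)
    qed
    from x show "P x" by (induction x rule: homogeneous_induct) (use P h in auto)
  qed
  moreover have "Sigma (carrier G) B \<subseteq> Sigma (carrier G) gr" using B(1) by auto
  ultimately show ?thesis by blast
qed

end

section \<open>Tensor products of bimodules\<close>


lemma with_actions_simps [simp]:
  "carrier (with_actions M l r) = carrier M" "ring.add (with_actions M l r) = ring.add M"
  "\<zero>\<^bsub>with_actions M l r\<^esub> = \<zero>\<^bsub>M\<^esub>" "lact (with_actions M l r) = l" "ract (with_actions M l r) = r"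
  by (simp_all add: with_actions_def)


lemma with_smult_simps [simp]:
  "carrier (with_smult M s) = carrier M" "ring.add (with_smult M s) = ring.add M"
  "\<zero>\<^bsub>with_smult M s\<^esub> = \<zero>\<^bsub>M\<^esub>" "smult (with_smult M s) = s"
  by (simp_all add: with_smult_def)

lemma space_bimodule_simps [simp]:
  "carrier (space_bimodule V) = carrier V" "ring.add (space_bimodule V) = ring.add V"
  "\<zero>\<^bsub>space_bimodule V\<^esub> = \<zero>\<^bsub>V\<^esub>" "lact (space_bimodule V) = smult V"
  "ract (space_bimodule V) = (\<lambda>v c. c \<odot>\<^bsub>V\<^esub> v)"
  by (simp_all add: space_bimodule_def)

lemma regular_bimodule_simps [simp]:
  "carrier (regular_bimodule L) = carrier L" "ring.add (regular_bimodule L) = ring.add L"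
  "\<zero>\<^bsub>regular_bimodule L\<^esub> = \<zero>\<^bsub>L\<^esub>" "lact (regular_bimodule L) = monoid.mult L"
  "ract (regular_bimodule L) = monoid.mult L"
  by (simp_all add: regular_bimodule_def)

lemma tensor_simps [simp]:
  "carrier (tensor R M N) = carrier (tensor_group R M N)" "ring.add (tensor R M N) = ring.add (tensor_group R M N)"
  "\<zero>\<^bsub>tensor R M N\<^esub> = \<zero>\<^bsub>tensor_group R M N\<^esub>"
  by (simp_all add: tensor_def)

text \<open>Only the underlying groups enter, so a decomposition carries over between records that
  differ in their actions, such as \<open>TC i\<close> and \<open>PC i\<close>, or
  \<open>env_tensor\<close> and the enveloping algebra.\<close>

lemma copower_cong_structure:
  assumes "copower M N I inc prj"
    and e: "carrier M' = carrier M" "ring.add M' = ring.add M" "\<zero>\<^bsub>M'\<^esub> = \<zero>\<^bsub>M\<^esub>"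
      "carrier N' = carrier N" "ring.add N' = ring.add N" "\<zero>\<^bsub>N'\<^esub> = \<zero>\<^bsub>N\<^esub>"
  shows "copower M' N' I inc prj"
proof -
  interpret copower M N I inc prj by fact
  show ?thesis
  proof (intro copower.intro copower_axioms.intro abelian_group_cong[OF M.abelian_group_axioms]
      abelian_group_cong[OF N.abelian_group_axioms] e)
    fix i assume i: "i \<in> I"
    show "additive N' M' (inc i)" using inc_additive[OF i] by (simp add: additive_def e)
    show "additive M' N' (prj i)" using prj_additive[OF i] by (simp add: additive_def e)
  next
    fix P x assume "x \<in> carrier M'" "P \<zero>\<^bsub>M'\<^esub>"
      "\<And>u v. u \<in> carrier M' \<Longrightarrow> v \<in> carrier M' \<Longrightarrow> P u \<Longrightarrow> P v \<Longrightarrow> P (u \<oplus>\<^bsub>M'\<^esub> v)"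
      "\<And>i n. i \<in> I \<Longrightarrow> n \<in> carrier N' \<Longrightarrow> P (inc i n)"
    then show "P x" unfolding e by (rule generated)
  qed (simp_all add: e prj_inc)
qed

lemma add_pow_cong_structure:
  assumes "carrier N = carrier M" "ring.add N = ring.add M" "\<zero>\<^bsub>N\<^esub> = \<zero>\<^bsub>M\<^esub>"
  shows "[n] \<cdot>\<^bsub>N\<^esub> x = [(n :: int)] \<cdot>\<^bsub>M\<^esub> x"
  using assms by (simp add: add_pow_def int_pow_def nat_pow_def m_inv_def Let_def)

lemma tensor_lift_cong_structure:
  "carrier N = carrier M \<Longrightarrow> ring.add N = ring.add M \<Longrightarrow> \<zero>\<^bsub>N\<^esub> = \<zero>\<^bsub>M\<^esub> \<Longrightarrow> tensor_lift N f = tensor_lift M f"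
  by (simp add: tensor_lift_def finsum_cong_structure[of N M] add_pow_cong_structure[of N M] fun_eq_iff)

lemma tensor_lift_tensor [simp]: "tensor_lift (tensor R M N) f = tensor_lift (tensor_group R M N) f"
  by (rule tensor_lift_cong_structure) simp_all

definition left_linear ::
  "('r, 'x) ring_scheme \<Rightarrow> ('r, 'b, 'm, 'y) bimodule_scheme \<Rightarrow> ('r, 'c, 'n, 'z) bimodule_scheme \<Rightarrow> ('m \<Rightarrow> 'n) \<Rightarrow> bool"
  where "left_linear R M N f \<longleftrightarrow> additive M N f \<and>
    (\<forall>r \<in> carrier R. \<forall>x \<in> carrier M. f (lact M r x) = lact N r (f x))"

definition right_linear ::
  "('r, 'x) ring_scheme \<Rightarrow> ('a, 'r, 'm, 'y) bimodule_scheme \<Rightarrow> ('c, 'r, 'n, 'z) bimodule_scheme \<Rightarrow> ('m \<Rightarrow> 'n) \<Rightarrow> bool"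
  where "right_linear R M N f \<longleftrightarrow> additive M N f \<and>
    (\<forall>x \<in> carrier M. \<forall>r \<in> carrier R. f (ract M x r) = ract N (f x) r)"

lemma left_linear_id: "left_linear R M M (\<lambda>x. x)" by (simp add: left_linear_def additive_id)
lemma right_linear_id: "right_linear R M M (\<lambda>x. x)" by (simp add: right_linear_def additive_id)

lemma balanced_mapI:
  assumes "\<And>x y. \<lbrakk>x \<in> carrier M; y \<in> carrier N\<rbrakk> \<Longrightarrow> f x y \<in> carrier P"
    "\<And>x x' y. \<lbrakk>x \<in> carrier M; x' \<in> carrier M; y \<in> carrier N\<rbrakk> \<Longrightarrow> f (x \<oplus>\<^bsub>M\<^esub> x') y = f x y \<oplus>\<^bsub>P\<^esub> f x' y"
    "\<And>x y y'. \<lbrakk>x \<in> carrier M; y \<in> carrier N; y' \<in> carrier N\<rbrakk> \<Longrightarrow> f x (y \<oplus>\<^bsub>N\<^esub> y') = f x y \<oplus>\<^bsub>P\<^esub> f x y'"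
    "\<And>x r y. \<lbrakk>x \<in> carrier M; r \<in> carrier R; y \<in> carrier N\<rbrakk> \<Longrightarrow> f (ract M x r) y = f x (lact N r y)"
  shows "balanced_map R M N P f"
  using assms unfolding balanced_map_def by auto

locale bimodule_pair = M: bimodule R' R M + N: bimodule R T N
  for R' :: "('a, 'w) ring_scheme" and R :: "('r, 'x) ring_scheme" and T :: "('b, 'y) ring_scheme"
    and M :: "('a, 'r, 'm, 'u) bimodule_scheme" and N :: "('r, 'b, 'n, 'v) bimodule_scheme"
begin

sublocale td: tensor_data R M N
  by (intro tensor_data.intro tensor_data_axioms.intro M.M.abelian_group_axioms N.M.abelian_group_axioms)
    (simp_all add: M.ract_closed N.lact_closed)

abbreviation (input) "p \<equiv> pure_tensor R M N"

lemmas pure_closed = td.pure_closed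
lemmas tensor_abelian_group = td.T_abelian

lemma pure_add_left: "\<lbrakk>x \<in> carrier M; x' \<in> carrier M; y \<in> carrier N\<rbrakk> \<Longrightarrow> p (x \<oplus>\<^bsub>M\<^esub> x') y = p x y \<oplus>\<^bsub>tensor_group R M N\<^esub> p x' y"
  using td.pure_balanced unfolding balanced_map_def by blast

lemma pure_add_right: "\<lbrakk>x \<in> carrier M; y \<in> carrier N; y' \<in> carrier N\<rbrakk> \<Longrightarrow> p x (y \<oplus>\<^bsub>N\<^esub> y') = p x y \<oplus>\<^bsub>tensor_group R M N\<^esub> p x y'"
  using td.pure_balanced unfolding balanced_map_def by blast

lemma pure_balanced: "\<lbrakk>x \<in> carrier M; r \<in> carrier R; y \<in> carrier N\<rbrakk> \<Longrightarrow> p (ract M x r) y = p x (lact N r y)"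
  using td.pure_balanced unfolding balanced_map_def by blast

lemma pure_left_additive: "y \<in> carrier N \<Longrightarrow> additive M (tensor_group R M N) (\<lambda>x. p x y)"
  by (intro additiveI pure_closed pure_add_left)

lemma pure_right_additive: "x \<in> carrier M \<Longrightarrow> additive N (tensor_group R M N) (p x)"
  by (intro additiveI pure_closed pure_add_right)

lemma pure_zero_left: "y \<in> carrier N \<Longrightarrow> p \<zero>\<^bsub>M\<^esub> y = \<zero>\<^bsub>tensor_group R M N\<^esub>"
  using additive_zero[OF M.M.abelian_group_axioms tensor_abelian_group pure_left_additive] .

lemma pure_zero_right: "x \<in> carrier M \<Longrightarrow> p x \<zero>\<^bsub>N\<^esub> = \<zero>\<^bsub>tensor_group R M N\<^esub>"
  using additive_zero[OF N.M.abelian_group_axioms tensor_abelian_group pure_right_additive] .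

text \<open>The free abelian group is generated using differences, but no closure of P under
  negatives is assumed. Since -(x \<otimes> y) = (-x) \<otimes> y is again pure, the induction runs
  for z and -z simultaneously and needs only sums.\<close>

lemma tensor_induct [consumes 1, case_names zero add pure]:
  assumes X: "X \<in> carrier (tensor_group R M N)" and P0: "P \<zero>\<^bsub>tensor_group R M N\<^esub>"
    and Padd: "\<And>u v. \<lbrakk>u \<in> carrier (tensor_group R M N); v \<in> carrier (tensor_group R M N); P u; P v\<rbrakk>
      \<Longrightarrow> P (u \<oplus>\<^bsub>tensor_group R M N\<^esub> v)"
    and Pp: "\<And>x y. \<lbrakk>x \<in> carrier M; y \<in> carrier N\<rbrakk> \<Longrightarrow> P (p x y)"
  shows "P X"
proof -
  let ?T = "tensor_group R M N"
  let ?F = "free_Abelian_group (carrier M \<times> carrier N)"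
  let ?c = "\<lambda>z. tensor_kernel R M N #>\<^bsub>?F\<^esub> z"
  interpret c: group_hom ?F "add_monoid ?T" ?c
    by (intro group_hom.intro group_hom_axioms.intro td.F.is_group td.T.a_group homI)
       (auto simp: td.T_carrier td.T_add simp del: carrier_free_Abelian_group_iff)
  let ?Q = "\<lambda>z. P (?c z) \<and> P (\<ominus>\<^bsub>?T\<^esub> ?c z)"
  have c0: "?c 0 = \<zero>\<^bsub>?T\<^esub>" using c.hom_one by simp
  have "?Q z" if "Poly_Mapping.keys z \<subseteq> carrier M \<times> carrier N" for z
    using that
  proof (rule free_Abelian_group_induct)
    have "\<ominus>\<^bsub>?T\<^esub> \<zero>\<^bsub>?T\<^esub> = \<zero>\<^bsub>?T\<^esub>" using td.T.r_neg[OF td.T.zero_closed] by simp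
    then show "?Q 0" unfolding c0 by (simp only: P0)
  next
    fix a b assume ab: "Poly_Mapping.keys a \<subseteq> carrier M \<times> carrier N" "Poly_Mapping.keys b \<subseteq> carrier M \<times> carrier N"
      "?Q a" "?Q b"
    then have ac: "a \<in> carrier ?F" "b \<in> carrier ?F" by simp_all
    have cc: "?c a \<in> carrier ?T" "?c b \<in> carrier ?T" using ac by (auto simp: td.T_carrier simp del: carrier_free_Abelian_group_iff)

    have "a - b \<in> carrier ?F" by (rule td.diffc[OF ac])
    then have "?c (a - b) \<oplus>\<^bsub>?T\<^esub> ?c b = ?c a" using td.T_add[of "a - b" b] ac by (simp del: carrier_free_Abelian_group_iff)
    moreover have dc: "?c (a - b) \<in> carrier ?T" using \<open>a - b \<in> carrier ?F\<close> by (auto simp: td.T_carrier simp del: carrier_free_Abelian_group_iff)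
    ultimately have d: "?c (a - b) = ?c a \<oplus>\<^bsub>?T\<^esub> \<ominus>\<^bsub>?T\<^esub> ?c b"
      using cc by (metis td.T.a_assoc td.T.a_inv_closed td.T.r_neg td.T.r_zero)
    have "\<ominus>\<^bsub>?T\<^esub> ?c (a - b) = \<ominus>\<^bsub>?T\<^esub> ?c a \<oplus>\<^bsub>?T\<^esub> ?c b" unfolding d using cc by (simp add: td.T.minus_add)
    then show "?Q (a - b)" using d ab cc Padd by simp
  next
    fix q assume "q \<in> carrier M \<times> carrier N"
    then obtain x y where q: "q = (x, y)" "x \<in> carrier M" "y \<in> carrier N" by auto
    have "\<ominus>\<^bsub>?T\<^esub> p x y = p (\<ominus>\<^bsub>M\<^esub> x) y"
      using additive_a_inv[OF M.M.abelian_group_axioms tensor_abelian_group pure_left_additive[OF q(3)] q(2)] by simp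
    then show "?Q (frag_of q)" using Pp q by (simp add: pure_tensor_def)
  qed
  then show ?thesis using X unfolding td.T_carrier by auto
qed

lemma tensor_additive_eqI:
  assumes "abelian_group P" "additive (tensor_group R M N) P f" "additive (tensor_group R M N) P g"
    and "\<And>x y. \<lbrakk>x \<in> carrier M; y \<in> carrier N\<rbrakk> \<Longrightarrow> f (p x y) = g (p x y)"
    and "X \<in> carrier (tensor_group R M N)"
  shows "f X = g X"
  using td.tensor_hom_eq[OF assms(1)] assms(2-5) unfolding additive_iff_hom by blast

lemma lift_additive:
  "abelian_group P \<Longrightarrow> balanced_map R M N P f \<Longrightarrow> additive (tensor_group R M N) P (tensor_lift P f)"
  using td.tensor_lift_hom unfolding additive_iff_hom .

lemmas lift_pure = td.tensor_lift_pure

lemma lact_balanced: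
  "a \<in> carrier R' \<Longrightarrow> balanced_map R M N (tensor_group R M N) (\<lambda>x y. p (lact M a x) y)"
  by (intro balanced_mapI)
    (simp_all add: M.lact_closed N.lact_closed pure_closed M.lact_add_right pure_add_left pure_add_right M.lact_ract[symmetric] pure_balanced)

lemma ract_balanced:
  "b \<in> carrier T \<Longrightarrow> balanced_map R M N (tensor_group R M N) (\<lambda>x y. p x (ract N y b))"
  by (intro balanced_mapI)
    (simp_all add: M.ract_closed N.ract_closed pure_closed N.ract_add_left pure_add_left pure_add_right N.lact_ract pure_balanced)

lemma lact_pure: "\<lbrakk>a \<in> carrier R'; x \<in> carrier M; y \<in> carrier N\<rbrakk> \<Longrightarrow> lact (tensor R M N) a (p x y) = p (lact M a x) y"
  by (simp add: tensor_def lift_pure[OF tensor_abelian_group lact_balanced])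

lemma ract_pure: "\<lbrakk>b \<in> carrier T; x \<in> carrier M; y \<in> carrier N\<rbrakk> \<Longrightarrow> ract (tensor R M N) (p x y) b = p x (ract N y b)"
  by (simp add: tensor_def lift_pure[OF tensor_abelian_group ract_balanced])

lemma lact_additive: "a \<in> carrier R' \<Longrightarrow> additive (tensor_group R M N) (tensor_group R M N) (lact (tensor R M N) a)"
  using lift_additive[OF tensor_abelian_group lact_balanced] by (simp add: tensor_def)

lemma ract_additive: "b \<in> carrier T \<Longrightarrow> additive (tensor_group R M N) (tensor_group R M N) (\<lambda>t. ract (tensor R M N) t b)"
  using lift_additive[OF tensor_abelian_group ract_balanced] by (simp add: tensor_def)

lemma tensor_bimodule: "bimodule R' T (tensor R M N)"
proof (intro bimodule.intro bimodule_axioms.intro M.R.ring_axioms N.T.ring_axioms)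
  let ?T = "tensor_group R M N"
  note lc = additive_closed[OF lact_additive] and rc = additive_closed[OF ract_additive]
  show "abelian_group (tensor R M N)" by (rule abelian_group_cong[OF tensor_abelian_group]) simp_all
  fix a x assume a: "a \<in> carrier R'" and "x \<in> carrier (tensor R M N)"
  then have x: "x \<in> carrier ?T" by simp
  show "lact (tensor R M N) a x \<in> carrier (tensor R M N)" using lc a x by simp
  show "lact (tensor R M N) a (x \<oplus>\<^bsub>tensor R M N\<^esub> y) = lact (tensor R M N) a x \<oplus>\<^bsub>tensor R M N\<^esub> lact (tensor R M N) a y"
    if "y \<in> carrier (tensor R M N)" for y using additive_add[OF lact_additive[OF a] x, of y] that by simp
  show "lact (tensor R M N) (a \<oplus>\<^bsub>R'\<^esub> a') x = lact (tensor R M N) a x \<oplus>\<^bsub>tensor R M N\<^esub> lact (tensor R M N) a' x"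
    if a': "a' \<in> carrier R'" for a'
    using x
  proof (induction x rule: tensor_induct)
    case zero show ?case
      using a a' by (simp add: additive_zero[OF tensor_abelian_group tensor_abelian_group lact_additive])
  next
    case (add u v) then show ?case using a a' by (simp add: additive_add[OF lact_additive] lc td.T.a_ac)
  next
    case (pure x y) then show ?case
      using a a' by (simp add: lact_pure M.lact_add_left pure_add_left M.lact_closed)
  qed
  show "lact (tensor R M N) (a \<otimes>\<^bsub>R'\<^esub> a') x = lact (tensor R M N) a (lact (tensor R M N) a' x)"
    if a': "a' \<in> carrier R'" for a'
    by (rule tensor_additive_eqI[OF tensor_abelian_group lact_additive additive_comp[OF lact_additive lact_additive] _ x])
      (use a a' in \<open>auto simp: lact_pure M.lact_closed M.lact_mult\<close>)
  show "ract (tensor R M N) (lact (tensor R M N) a x) b = lact (tensor R M N) a (ract (tensor R M N) x b)"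
    if b: "b \<in> carrier T" for b
    by (rule tensor_additive_eqI[OF tensor_abelian_group additive_comp[OF lact_additive ract_additive] additive_comp[OF ract_additive lact_additive] _ x])
      (use a b in \<open>auto simp: lact_pure ract_pure M.lact_closed N.ract_closed\<close>)
next
  let ?T = "tensor_group R M N"
  note rc = additive_closed[OF ract_additive]
  fix b x assume "x \<in> carrier (tensor R M N)" and b: "b \<in> carrier T"
  then have x: "x \<in> carrier ?T" by simp
  show "ract (tensor R M N) x b \<in> carrier (tensor R M N)" using rc b x by simp
  show "ract (tensor R M N) (x \<oplus>\<^bsub>tensor R M N\<^esub> y) b = ract (tensor R M N) x b \<oplus>\<^bsub>tensor R M N\<^esub> ract (tensor R M N) y b"
    if "y \<in> carrier (tensor R M N)" for y using additive_add[OF ract_additive[OF b] x, of y] that by simp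
  show "ract (tensor R M N) x (b \<oplus>\<^bsub>T\<^esub> b') = ract (tensor R M N) x b \<oplus>\<^bsub>tensor R M N\<^esub> ract (tensor R M N) x b'"
    if b': "b' \<in> carrier T" for b'
    using x
  proof (induction x rule: tensor_induct)
    case zero show ?case
      using b b' by (simp add: additive_zero[OF tensor_abelian_group tensor_abelian_group ract_additive])
  next
    case (add u v) then show ?case using b b' by (simp add: additive_add[OF ract_additive] rc td.T.a_ac)
  next
    case (pure x y) then show ?case
      using b b' by (simp add: ract_pure N.ract_add_right pure_add_right N.ract_closed)
  qed
  show "ract (tensor R M N) x (b \<otimes>\<^bsub>T\<^esub> b') = ract (tensor R M N) (ract (tensor R M N) x b) b'"
    if b': "b' \<in> carrier T" for b'
    by (rule tensor_additive_eqI[OF tensor_abelian_group ract_additive additive_comp[OF ract_additive ract_additive] _ x])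
      (use b b' in \<open>auto simp: ract_pure N.ract_closed N.ract_mult\<close>)
next
  fix x assume "x \<in> carrier (tensor R M N)"
  then have x: "x \<in> carrier (tensor_group R M N)" by simp
  show "lact (tensor R M N) \<one>\<^bsub>R'\<^esub> x = x"
    by (rule tensor_additive_eqI[OF tensor_abelian_group lact_additive additive_id _ x]) (auto simp: lact_pure M.lact_one)
  show "ract (tensor R M N) x \<one>\<^bsub>T\<^esub> = x"
    by (rule tensor_additive_eqI[OF tensor_abelian_group ract_additive additive_id _ x]) (auto simp: ract_pure N.ract_one)
qed

text \<open>M \<otimes> R = M, summed over a basis of N: x \<otimes> y goes to x times the j-th
  coordinate of y. Freeness is asked of the left module N while M is arbitrary, so the result serves
  for A \<otimes> C_i, for D_j \<otimes> A and for tensor products of vector spaces.\<close>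

lemma tensor_copower_right:
  assumes N: "copower N R J inc prj" and f: "\<And>j. j \<in> J \<Longrightarrow> f j \<in> carrier N"
    and inc: "\<And>j r. j \<in> J \<Longrightarrow> r \<in> carrier R \<Longrightarrow> inc j r = lact N r (f j)"
  shows "copower (tensor R M N) M J (\<lambda>j m. p m (f j)) (\<lambda>j. tensor_lift M (\<lambda>m n. ract M m (prj j n)))"
proof -
  interpret C: copower N R J inc prj by fact
  \<comment> \<open>Left linearity of the coordinates, which \<open>copower\<close> does not record,
    is what makes the projection balanced; it follows from the form of the inclusions.\<close>
  have lin: "prj j (lact N r n) = r \<otimes>\<^bsub>R\<^esub> prj j n" if "j \<in> J" "r \<in> carrier R" "n \<in> carrier N" for j r n
  proof (rule C.hom_eq[OF copower.axioms(2)[OF N] _ _ _ that(3)])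
    show "additive N R (\<lambda>n. prj j (lact N r n))"
      by (rule additive_comp[OF _ C.prj_additive[OF that(1)]])
        (auto intro!: additiveI N.lact_closed N.lact_add_right that)
    show "additive N R (\<lambda>n. r \<otimes>\<^bsub>R\<^esub> prj j n)"
      by (rule additive_comp[OF C.prj_additive[OF that(1)], of _ "\<lambda>x. r \<otimes>\<^bsub>R\<^esub> x"])
        (auto intro!: additiveI M.T.r_distr that)
    fix i n assume i: "i \<in> J" "n \<in> carrier R"
    have "lact N r (inc i n) = inc i (r \<otimes>\<^bsub>R\<^esub> n)" using i that by (simp add: inc f N.lact_mult)
    then show "prj j (lact N r (inc i n)) = r \<otimes>\<^bsub>R\<^esub> prj j (inc i n)" using i that by (simp add: C.prj_inc)
  qed
  have bal: "balanced_map R M N M (\<lambda>m n. ract M m (prj j n))" if "j \<in> J" for j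
    by (rule balanced_mapI) (use that in \<open>simp_all add: M.ract_closed C.prj_closed M.ract_add_left
        additive_add[OF C.prj_additive] M.ract_add_right lin M.ract_mult\<close>)
  have pf: "prj j (f i) = (if j = i then \<one>\<^bsub>R\<^esub> else \<zero>\<^bsub>R\<^esub>)" if "i \<in> J" "j \<in> J" for i j
    using C.prj_inc[OF that(2,1) M.T.one_closed] inc[OF that(1) M.T.one_closed] N.lact_one[OF f[OF that(1)]] by simp
  have rz: "ract M m \<zero>\<^bsub>R\<^esub> = \<zero>\<^bsub>M\<^esub>" if "m \<in> carrier M" for m
    by (rule additive_zero[OF M.T.abelian_group_axioms M.M.abelian_group_axioms])
      (auto intro!: additiveI M.ract_closed M.ract_add_right that)
  show ?thesis
  proof (intro copower.intro copower_axioms.intro M.M.abelian_group_axioms)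
    show "abelian_group (tensor R M N)" using tensor_bimodule by (rule bimodule.axioms)
    fix j assume j: "j \<in> J"
    show "additive M (tensor R M N) (\<lambda>m. p m (f j))"
      using pure_left_additive[OF f[OF j]] by (simp add: additive_def)
    show "additive (tensor R M N) M (tensor_lift M (\<lambda>m n. ract M m (prj j n)))"
      using lift_additive[OF M.M.abelian_group_axioms bal[OF j]] by (simp add: additive_def)
    fix i m assume "i \<in> J" "m \<in> carrier M"
    then show "tensor_lift M (\<lambda>m n. ract M m (prj j n)) (p m (f i)) = (if j = i then m else \<zero>\<^bsub>M\<^esub>)"
      using j f by (simp add: lift_pure[OF M.M.abelian_group_axioms bal[OF j]] pf M.ract_one rz)
  next
    fix P X assume X: "X \<in> carrier (tensor R M N)" and P: "P \<zero>\<^bsub>tensor R M N\<^esub>"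
      "\<And>u v. u \<in> carrier (tensor R M N) \<Longrightarrow> v \<in> carrier (tensor R M N) \<Longrightarrow> P u \<Longrightarrow> P v \<Longrightarrow> P (u \<oplus>\<^bsub>tensor R M N\<^esub> v)"
      "\<And>j m. j \<in> J \<Longrightarrow> m \<in> carrier M \<Longrightarrow> P (p m (f j))"
    have "X \<in> carrier (tensor_group R M N)" using X by simp
    then show "P X"
    proof (induction X rule: tensor_induct)
      case (pure x y)
      from pure(2) show ?case
      proof (induction y rule: C.induct)
        case zero then show ?case using P(1) pure by (simp add: pure_zero_right)
      next
        case (add u v) then show ?case using P(2) pure by (simp add: pure_add_right pure_closed)
      next
        case (incl j r)
        then have "p x (inc j r) = p (ract M x r) (f j)" using pure(1) f by (simp add: inc pure_balanced)
        then show ?case using P(3) incl pure(1) M.ract_closed by simp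
      qed
    qed (use P in auto)
  qed
qed

text \<open>The mirror image, with M free as a right module. Applied to the right A-basis of A
  \<otimes> C_i it splits the columns of the double complex into copies of the complex D \<otimes>
  A.\<close>

lemma tensor_copower_left:
  assumes N: "copower M R J inc prj" and f: "\<And>j. j \<in> J \<Longrightarrow> f j \<in> carrier M"
    and inc: "\<And>j r. j \<in> J \<Longrightarrow> r \<in> carrier R \<Longrightarrow> inc j r = ract M (f j) r"
  shows "copower (tensor R M N) N J (\<lambda>j n. p (f j) n) (\<lambda>j. tensor_lift N (\<lambda>m n. lact N (prj j m) n))"
proof -
  interpret C: copower M R J inc prj by fact
  have lin: "prj j (ract M n r) = prj j n \<otimes>\<^bsub>R\<^esub> r" if "j \<in> J" "r \<in> carrier R" "n \<in> carrier M" for j r n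
  proof (rule C.hom_eq[OF copower.axioms(2)[OF N] _ _ _ that(3)])
    show "additive M R (\<lambda>n. prj j (ract M n r))"
      by (rule additive_comp[OF _ C.prj_additive[OF that(1)], of _ "\<lambda>n. ract M n r"])
        (auto intro!: additiveI M.ract_closed M.ract_add_left that)
    show "additive M R (\<lambda>n. prj j n \<otimes>\<^bsub>R\<^esub> r)"
      by (rule additive_comp[OF C.prj_additive[OF that(1)], of _ "\<lambda>x. x \<otimes>\<^bsub>R\<^esub> r"])
        (auto intro!: additiveI M.T.l_distr that)
    fix i n assume i: "i \<in> J" "n \<in> carrier R"
    have "ract M (inc i n) r = inc i (n \<otimes>\<^bsub>R\<^esub> r)" using i that by (simp add: inc f M.ract_mult)
    then show "prj j (ract M (inc i n) r) = prj j (inc i n) \<otimes>\<^bsub>R\<^esub> r" using i that by (simp add: C.prj_inc)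
  qed
  have bal: "balanced_map R M N N (\<lambda>m n. lact N (prj j m) n)" if "j \<in> J" for j
    by (rule balanced_mapI) (use that in \<open>simp_all add: N.lact_closed C.prj_closed N.lact_add_left
        additive_add[OF C.prj_additive] N.lact_add_right lin N.lact_mult\<close>)
  have pf: "prj j (f i) = (if j = i then \<one>\<^bsub>R\<^esub> else \<zero>\<^bsub>R\<^esub>)" if "i \<in> J" "j \<in> J" for i j
    using C.prj_inc[OF that(2,1) M.T.one_closed] inc[OF that(1) M.T.one_closed] M.ract_one[OF f[OF that(1)]] by simp
  have rz: "lact N \<zero>\<^bsub>R\<^esub> m = \<zero>\<^bsub>N\<^esub>" if "m \<in> carrier N" for m
    by (rule additive_zero[OF M.T.abelian_group_axioms N.M.abelian_group_axioms, of "\<lambda>r. lact N r m"])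
      (auto intro!: additiveI N.lact_closed N.lact_add_left that)
  show ?thesis
  proof (intro copower.intro copower_axioms.intro N.M.abelian_group_axioms)
    show "abelian_group (tensor R M N)" using tensor_bimodule by (rule bimodule.axioms)
    fix j assume j: "j \<in> J"
    show "additive N (tensor R M N) (p (f j))"
      using pure_right_additive[OF f[OF j]] by (simp add: additive_def)
    show "additive (tensor R M N) N (tensor_lift N (\<lambda>m n. lact N (prj j m) n))"
      using lift_additive[OF N.M.abelian_group_axioms bal[OF j]] by (simp add: additive_def)
    fix i m assume "i \<in> J" "m \<in> carrier N"
    then show "tensor_lift N (\<lambda>m n. lact N (prj j m) n) (p (f i) m) = (if j = i then m else \<zero>\<^bsub>N\<^esub>)"
      using j f by (simp add: lift_pure[OF N.M.abelian_group_axioms bal[OF j]] pf N.lact_one rz)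
  next
    fix P X assume X: "X \<in> carrier (tensor R M N)" and P: "P \<zero>\<^bsub>tensor R M N\<^esub>"
      "\<And>u v. u \<in> carrier (tensor R M N) \<Longrightarrow> v \<in> carrier (tensor R M N) \<Longrightarrow> P u \<Longrightarrow> P v \<Longrightarrow> P (u \<oplus>\<^bsub>tensor R M N\<^esub> v)"
      "\<And>j m. j \<in> J \<Longrightarrow> m \<in> carrier N \<Longrightarrow> P (p (f j) m)"
    have "X \<in> carrier (tensor_group R M N)" using X by simp
    then show "P X"
    proof (induction X rule: tensor_induct)
      case (pure x y)
      from pure(1) show ?case
      proof (induction x rule: C.induct)
        case zero then show ?case using P(1) pure by (simp add: pure_zero_left)
      next
        case (add u v) then show ?case using P(2) pure by (simp add: pure_add_left pure_closed)
      next
        case (incl j r)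
        then have "p (inc j r) y = p (f j) (lact N r y)" using pure(2) f by (simp add: inc pure_balanced)
        then show ?case using P(3) incl pure(2) N.lact_closed by simp
      qed
    qed (use P in auto)
  qed
qed

end

section \<open>Tensor products of maps and of direct sums\<close>

locale bimodule_pair_maps = M: bimodule_pair R' R T M N + M2: bimodule_pair R2' R T2 M2 N2
  for R' :: "('a, 'w) ring_scheme" and R :: "('r, 'x) ring_scheme" and T :: "('b, 'y) ring_scheme"
    and M :: "('a, 'r, 'm) bimodule" and N :: "('r, 'b, 'n) bimodule"
    and R2' :: "('a2, 'w2) ring_scheme" and T2 :: "('b2, 'y2) ring_scheme"
    and M2 :: "('a2, 'r, 'm2) bimodule" and N2 :: "('r, 'b2, 'n2) bimodule" +
  fixes f :: "'m \<Rightarrow> 'm2" and g :: "'n \<Rightarrow> 'n2"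
  assumes f: "right_linear R M M2 f" and g: "left_linear R N N2 g"
begin

lemma f_additive: "additive M M2 f" using f by (simp add: right_linear_def)
lemma g_additive: "additive N N2 g" using g by (simp add: left_linear_def)

lemma map_balanced: "balanced_map R M N (tensor_group R M2 N2) (\<lambda>x y. pure_tensor R M2 N2 (f x) (g y))"
  by (rule balanced_mapI)
    (use f g in \<open>simp_all add: left_linear_def right_linear_def M2.pure_closed additive_closed[OF f_additive] additive_closed[OF g_additive]
      additive_add[OF f_additive] additive_add[OF g_additive] M2.pure_add_left M2.pure_add_right M2.pure_balanced\<close>)

lemma map_additive: "additive (tensor R M N) (tensor R M2 N2) (tensor_map R M N M2 N2 f g)"
  using M.lift_additive[OF M2.tensor_abelian_group map_balanced] by (simp add: tensor_map_def additive_def)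

lemma map_pure:
  "\<lbrakk>x \<in> carrier M; y \<in> carrier N\<rbrakk> \<Longrightarrow>
    tensor_map R M N M2 N2 f g (pure_tensor R M N x y) = pure_tensor R M2 N2 (f x) (g y)"
  using M.lift_pure[OF M2.tensor_abelian_group map_balanced] by (simp add: tensor_map_def)

end

text \<open>Here both factors are sums of copies of other modules M0 and N0, which need not be the
  base ring. Linearity of inclusions and projections over the middle ring is what allows them to be
  tensored. It will split A \<otimes> A into copies of S \<otimes> S.\<close>

lemma tensor_copower:
  assumes "bimodule R' R M" "bimodule R T N" "bimodule R2' R M0" "bimodule R T2 N0"
    and M: "copower M M0 I inc prj" and N: "copower N N0 J inc' prj'"
    and lin: "\<And>i. i \<in> I \<Longrightarrow> right_linear R M0 M (inc i)" "\<And>i. i \<in> I \<Longrightarrow> right_linear R M M0 (prj i)"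
      "\<And>j. j \<in> J \<Longrightarrow> left_linear R N0 N (inc' j)" "\<And>j. j \<in> J \<Longrightarrow> left_linear R N N0 (prj' j)"
  shows "copower (tensor R M N) (tensor R M0 N0) (I \<times> J)
    (\<lambda>(i, j). tensor_map R M0 N0 M N (inc i) (inc' j)) (\<lambda>(i, j). tensor_map R M N M0 N0 (prj i) (prj' j))"
proof -
  interpret M: copower M M0 I inc prj by fact
  interpret N: copower N N0 J inc' prj' by fact
  interpret t: bimodule_pair R' R T M N by (intro bimodule_pair.intro assms)
  interpret t0: bimodule_pair R2' R T2 M0 N0 by (intro bimodule_pair.intro assms)
  note pi = bimodule_pair_maps.intro[OF t0.bimodule_pair_axioms t.bimodule_pair_axioms bimodule_pair_maps_axioms.intro, OF lin(1,3)]
  note pp = bimodule_pair_maps.intro[OF t.bimodule_pair_axioms t0.bimodule_pair_axioms bimodule_pair_maps_axioms.intro, OF lin(2,4)]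
  have ab: "abelian_group (tensor R M N)" "abelian_group (tensor R M0 N0)"
    using t.tensor_bimodule t0.tensor_bimodule bimodule.axioms(3) by blast+
  have ii: "additive (tensor R M0 N0) (tensor R M N) (tensor_map R M0 N0 M N (inc i) (inc' j))" if "i \<in> I" "j \<in> J" for i j
    by (rule bimodule_pair_maps.map_additive[OF pi[OF that]])
  have jj: "additive (tensor R M N) (tensor R M0 N0) (tensor_map R M N M0 N0 (prj i) (prj' j))" if "i \<in> I" "j \<in> J" for i j
    by (rule bimodule_pair_maps.map_additive[OF pp[OF that]])
  show ?thesis
  proof (intro copower.intro copower_axioms.intro ab)
    fix k assume "k \<in> I \<times> J"
    then obtain i j where k: "k = (i, j)" "i \<in> I" "j \<in> J" by auto
    show "additive (tensor R M0 N0) (tensor R M N) (case k of (i, j) \<Rightarrow> tensor_map R M0 N0 M N (inc i) (inc' j))"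
      using ii k by simp
    show "additive (tensor R M N) (tensor R M0 N0) (case k of (i, j) \<Rightarrow> tensor_map R M N M0 N0 (prj i) (prj' j))"
      using jj k by simp
    fix k' n assume "k' \<in> I \<times> J" and n: "n \<in> carrier (tensor R M0 N0)"
    then obtain i' j' where k': "k' = (i', j')" "i' \<in> I" "j' \<in> J" by auto
    have "tensor_map R M N M0 N0 (prj i) (prj' j) (tensor_map R M0 N0 M N (inc i') (inc' j') n)
        = (if k = k' then n else \<zero>\<^bsub>tensor R M0 N0\<^esub>)"
    proof (rule t0.tensor_additive_eqI[OF ab(2) _ _ _ n[unfolded tensor_simps]])
      show "additive (tensor_group R M0 N0) (tensor R M0 N0)
          (\<lambda>n. tensor_map R M N M0 N0 (prj i) (prj' j) (tensor_map R M0 N0 M N (inc i') (inc' j') n))"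
        using additive_comp[OF ii[OF k'(2,3)] jj[OF k(2,3)]] by (simp add: additive_def)
      show "additive (tensor_group R M0 N0) (tensor R M0 N0) (\<lambda>n. if k = k' then n else \<zero>\<^bsub>tensor R M0 N0\<^esub>)"
        by (simp add: additive_def t0.td.T.zero_closed)
      fix x y assume "x \<in> carrier M0" "y \<in> carrier N0"
      then show "tensor_map R M N M0 N0 (prj i) (prj' j) (tensor_map R M0 N0 M N (inc i') (inc' j') (pure_tensor R M0 N0 x y))
         = (if k = k' then pure_tensor R M0 N0 x y else \<zero>\<^bsub>tensor R M0 N0\<^esub>)"
        using k k' by (simp add: bimodule_pair_maps.map_pure[OF pi] bimodule_pair_maps.map_pure[OF pp]
            M.inc_closed N.inc_closed M.prj_inc N.prj_inc t0.pure_zero_left t0.pure_zero_right)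
    qed
    then show "(case k of (i, j) \<Rightarrow> tensor_map R M N M0 N0 (prj i) (prj' j))
        ((case k' of (i, j) \<Rightarrow> tensor_map R M0 N0 M N (inc i) (inc' j)) n)
      = (if k = k' then n else \<zero>\<^bsub>tensor R M0 N0\<^esub>)" using k k' by simp
  next
    fix P X assume X: "X \<in> carrier (tensor R M N)" and P: "P \<zero>\<^bsub>tensor R M N\<^esub>"
      "\<And>u v. u \<in> carrier (tensor R M N) \<Longrightarrow> v \<in> carrier (tensor R M N) \<Longrightarrow> P u \<Longrightarrow> P v \<Longrightarrow> P (u \<oplus>\<^bsub>tensor R M N\<^esub> v)"
      "\<And>k n. k \<in> I \<times> J \<Longrightarrow> n \<in> carrier (tensor R M0 N0) \<Longrightarrow> P ((case k of (i, j) \<Rightarrow> tensor_map R M0 N0 M N (inc i) (inc' j)) n)"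
    have "X \<in> carrier (tensor_group R M N)" using X by simp
    then show "P X"
    proof (induction X rule: t.tensor_induct)
      case (pure x y)
      note x = pure(1) and y = pure(2)
      from x show ?case
      proof (induction x rule: M.induct)
        case zero then show ?case using P(1) y by (simp add: t.pure_zero_left)
      next
        case (add u v) then show ?case using P(2) y by (simp add: t.pure_add_left t.pure_closed)
      next
        case (incl i m)
        note im = this
        from y show ?case
        proof (induction y rule: N.induct)
          case zero then show ?case using P(1) M.inc_closed[OF im] by (simp add: t.pure_zero_right)
        next
          case (add u v) then show ?case using P(2) M.inc_closed[OF im] by (simp add: t.pure_add_right t.pure_closed)
        next
          case (incl j n)
          then show ?case using P(3)[of "(i, j)" "pure_tensor R M0 N0 m n"] im
            by (simp add: bimodule_pair_maps.map_pure[OF pi] t0.pure_closed)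
        qed
      qed
    qed (use P in auto)
  qed
qed

text \<open>A \<open>copower\<close> records additivity only, but linear inclusions force linear
  projections, as one sees on the inclusions themselves.\<close>

lemma copower_prj_right_linear:
  assumes M: "copower M M0 I inc prj" and "bimodule R' R M" "bimodule R2' R M0"
    and inc: "\<And>i. i \<in> I \<Longrightarrow> right_linear R M0 M (inc i)" and j: "j \<in> I"
  shows "right_linear R M M0 (prj j)"
proof -
  interpret C: copower M M0 I inc prj by fact
  interpret M: bimodule R' R M by fact
  interpret M0: bimodule R2' R M0 by fact
  have z: "ract M0 \<zero>\<^bsub>M0\<^esub> r = \<zero>\<^bsub>M0\<^esub>" if "r \<in> carrier R" for r
    by (rule additive_zero[of M0 M0 "\<lambda>x. ract M0 x r"])
      (auto intro!: additiveI M0.ract_closed M0.ract_add_left that copower.axioms(2)[OF M])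
  have "prj j (ract M x r) = ract M0 (prj j x) r" if r: "r \<in> carrier R" and x: "x \<in> carrier M" for x r
  proof (rule C.hom_eq[OF copower.axioms(2)[OF M] _ _ _ x])
    show "additive M M0 (\<lambda>x. prj j (ract M x r))"
      by (rule additive_comp[OF _ C.prj_additive[OF j], of _ "\<lambda>x. ract M x r"])
        (auto intro!: additiveI M.ract_closed M.ract_add_left r)
    show "additive M M0 (\<lambda>x. ract M0 (prj j x) r)"
      by (rule additive_comp[OF C.prj_additive[OF j], of _ "\<lambda>x. ract M0 x r"])
        (auto intro!: additiveI M0.ract_closed M0.ract_add_left r)
    fix i n assume "i \<in> I" "n \<in> carrier M0"
    moreover from this have "ract M (inc i n) r = inc i (ract M0 n r)" using inc r by (simp add: right_linear_def)
    ultimately show "prj j (ract M (inc i n) r) = ract M0 (prj j (inc i n)) r"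
      using r j by (simp add: C.prj_inc M0.ract_closed z)
  qed
  then show ?thesis using C.prj_additive[OF j] by (simp add: right_linear_def)
qed

lemma copower_prj_left_linear:
  assumes M: "copower M M0 I inc prj" and "bimodule R R' M" "bimodule R R2' M0"
    and inc: "\<And>i. i \<in> I \<Longrightarrow> left_linear R M0 M (inc i)" and j: "j \<in> I"
  shows "left_linear R M M0 (prj j)"
proof -
  interpret C: copower M M0 I inc prj by fact
  interpret M: bimodule R R' M by fact
  interpret M0: bimodule R R2' M0 by fact
  have z: "lact M0 r \<zero>\<^bsub>M0\<^esub> = \<zero>\<^bsub>M0\<^esub>" if "r \<in> carrier R" for r
    by (rule additive_zero[of M0 M0])
      (auto intro!: additiveI M0.lact_closed M0.lact_add_right that copower.axioms(2)[OF M])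
  have "prj j (lact M r x) = lact M0 r (prj j x)" if r: "r \<in> carrier R" and x: "x \<in> carrier M" for x r
  proof (rule C.hom_eq[OF copower.axioms(2)[OF M] _ _ _ x])
    show "additive M M0 (\<lambda>x. prj j (lact M r x))"
      by (rule additive_comp[OF _ C.prj_additive[OF j]])
        (auto intro!: additiveI M.lact_closed M.lact_add_right r)
    show "additive M M0 (\<lambda>x. lact M0 r (prj j x))"
      by (rule additive_comp[OF C.prj_additive[OF j], of _ "lact M0 r"])
        (auto intro!: additiveI M0.lact_closed M0.lact_add_right r)
    fix i n assume "i \<in> I" "n \<in> carrier M0"
    moreover from this have "lact M r (inc i n) = inc i (lact M0 r n)" using inc r by (simp add: left_linear_def)
    ultimately show "prj j (lact M r (inc i n)) = lact M0 r (prj j (inc i n))"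
      using r j by (simp add: C.prj_inc M0.lact_closed z)
  qed
  then show ?thesis using C.prj_additive[OF j] by (simp add: left_linear_def)
qed

section \<open>Enveloping algebras\<close>

text \<open>The tensor product as a group depends on the inner actions alone. This identifies the
  \<Lambda> \<otimes> \<Lambda> underlying the enveloping algebra, formed from vector spaces, with
  the one formed from bimodules, which has outer actions.\<close>

lemma tensor_group_cong:
  assumes "carrier M = carrier M'" "ring.add M = ring.add M'" "ract M = ract M'"
    "carrier N = carrier N'" "ring.add N = ring.add N'" "lact N = lact N'"
  shows "tensor_group R M N = tensor_group R M' N'" "pure_tensor R M N = pure_tensor R M' N'"
proof -
  have "tensor_kernel R M N = tensor_kernel R M' N'"
    by (simp add: tensor_kernel_def tensor_relations_def assms)
  then show "tensor_group R M N = tensor_group R M' N'" "pure_tensor R M N = pure_tensor R M' N'"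
    by (simp_all add: tensor_group_def pure_tensor_def assms fun_eq_iff)
qed

lemma space_bimodule_bimodule:
  assumes "module K V"
  shows "bimodule K K (space_bimodule V)"
proof -
  interpret module K V by fact
  have ab: "abelian_group (space_bimodule V)" by (rule abelian_group_cong[OF M.abelian_group_axioms]) simp_all
  have "a \<odot>\<^bsub>V\<^esub> (b \<odot>\<^bsub>V\<^esub> x) = b \<odot>\<^bsub>V\<^esub> (a \<odot>\<^bsub>V\<^esub> x)" if "a \<in> carrier K" "b \<in> carrier K" "x \<in> carrier V" for a b x
    using that smult_assoc1[of a b x] smult_assoc1[of b a x] R.m_comm[of a b] by simp
  then show ?thesis
    by (intro bimodule.intro bimodule_axioms.intro R.ring_axioms ab)
      (simp_all add: smult_l_distr smult_r_distr smult_assoc1)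
qed

context algebra_over_field
begin

abbreviation (input) "left_copy \<equiv> with_actions L (monoid.mult L) (\<lambda>x c. c \<odot>\<^bsub>L\<^esub> x)"
abbreviation (input) "right_copy \<equiv> with_actions L (smult L) (monoid.mult L)"
abbreviation (input) "env_tensor \<equiv> tensor K left_copy right_copy"
abbreviation (input) "E \<equiv> enveloping_algebra K L"
abbreviation (input) "pe \<equiv> pure_tensor K (space_bimodule L) (space_bimodule L)"

lemmas L_abelian = ring.is_abelian_group[OF L.ring_axioms]
lemmas K_cring = domain.axioms(1)[OF field.axioms(1)[OF field_axioms]]
lemmas K_ring = cring.axioms(1)[OF K_cring]

lemma module_axioms': "module K L" by unfold_locales

lemma left_copy_bimodule: "bimodule L K left_copy"
proof -
  have ab: "abelian_group left_copy" by (rule abelian_group_cong[OF L_abelian]) simp_all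
  have "(a \<otimes>\<^bsub>K\<^esub> b) \<odot>\<^bsub>L\<^esub> x = b \<odot>\<^bsub>L\<^esub> (a \<odot>\<^bsub>L\<^esub> x)" if "a \<in> carrier K" "b \<in> carrier K" "x \<in> carrier L" for a b x
    using that smult_assoc1[of b a x] cring.cring_simprules(14)[OF K_cring, of a b] by simp
  then show ?thesis
    by (intro bimodule.intro bimodule_axioms.intro L.ring_axioms K_ring ab)
      (simp_all add: L.l_distr L.r_distr L.m_assoc smult_l_distr smult_r_distr smult_mult_right)
qed

lemma right_copy_bimodule: "bimodule K L right_copy"
proof -
  have ab: "abelian_group right_copy" by (rule abelian_group_cong[OF L_abelian]) simp_all
  show ?thesis
    by (intro bimodule.intro bimodule_axioms.intro L.ring_axioms K_ring ab)
      (simp_all add: L.l_distr L.r_distr L.m_assoc smult_l_distr smult_r_distr smult_mult_left smult_assoc1)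
qed

sublocale sp: bimodule_pair K K K "space_bimodule L" "space_bimodule L"
  by (intro bimodule_pair.intro space_bimodule_bimodule module_axioms')

sublocale cp: bimodule_pair L K L left_copy right_copy
  by (intro bimodule_pair.intro left_copy_bimodule right_copy_bimodule)

lemma env_tensor_eq:
  "tensor_group K left_copy right_copy = tensor_group K (space_bimodule L) (space_bimodule L)"
  "pure_tensor K left_copy right_copy = pe"
  by (rule tensor_group_cong; simp)+

lemma env_simps [simp]:
  "carrier E = carrier (tensor_group K (space_bimodule L) (space_bimodule L))"
  "ring.add E = ring.add (tensor_group K (space_bimodule L) (space_bimodule L))"
  "\<zero>\<^bsub>E\<^esub> = \<zero>\<^bsub>tensor_group K (space_bimodule L) (space_bimodule L)\<^esub>"
  "\<one>\<^bsub>E\<^esub> = pe \<one>\<^bsub>L\<^esub> \<one>\<^bsub>L\<^esub>"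
  by (simp_all add: enveloping_algebra_def Let_def)

lemma pe_closed: "\<lbrakk>a \<in> carrier L; b \<in> carrier L\<rbrakk> \<Longrightarrow> pe a b \<in> carrier (tensor_group K (space_bimodule L) (space_bimodule L))"
  using sp.pure_closed by simp

lemma smult_eq_mult: "\<lbrakk>c \<in> carrier K; a \<in> carrier L\<rbrakk> \<Longrightarrow> (c \<odot>\<^bsub>L\<^esub> \<one>\<^bsub>L\<^esub>) \<otimes>\<^bsub>L\<^esub> a = c \<odot>\<^bsub>L\<^esub> a"
  and smult_eq_mult': "\<lbrakk>c \<in> carrier K; a \<in> carrier L\<rbrakk> \<Longrightarrow> a \<otimes>\<^bsub>L\<^esub> (c \<odot>\<^bsub>L\<^esub> \<one>\<^bsub>L\<^esub>) = c \<odot>\<^bsub>L\<^esub> a"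
  by (simp_all add: smult_mult_left smult_mult_right)

lemma central_tensor:
  assumes "bimodule L R M" "bimodule R L N"
    and c: "\<And>c x y. \<lbrakk>c \<in> carrier K; x \<in> carrier M; y \<in> carrier N\<rbrakk> \<Longrightarrow>
      pure_tensor R M N (lact M (c \<odot>\<^bsub>L\<^esub> \<one>\<^bsub>L\<^esub>) x) y = pure_tensor R M N x (ract N y (c \<odot>\<^bsub>L\<^esub> \<one>\<^bsub>L\<^esub>))"
  shows "central_bimodule K L (tensor R M N)"
proof -
  interpret t: bimodule_pair L R L M N by (intro bimodule_pair.intro assms)
  show ?thesis
  proof (intro central_bimodule.intro central_bimodule_axioms.intro t.tensor_bimodule algebra_over_field_axioms)
    fix c x assume *: "c \<in> carrier K" "x \<in> carrier (tensor R M N)"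
    then have x: "x \<in> carrier (tensor_group R M N)" and cc: "c \<odot>\<^bsub>L\<^esub> \<one>\<^bsub>L\<^esub> \<in> carrier L" by simp_all
    show "lact (tensor R M N) (c \<odot>\<^bsub>L\<^esub> \<one>\<^bsub>L\<^esub>) x = ract (tensor R M N) x (c \<odot>\<^bsub>L\<^esub> \<one>\<^bsub>L\<^esub>)"
      by (rule t.tensor_additive_eqI[OF t.tensor_abelian_group t.lact_additive[OF cc] t.ract_additive[OF cc] _ x])
        (use * cc c in \<open>simp add: t.lact_pure t.ract_pure\<close>)
  qed
qed

lemma env_tensor_central: "central_bimodule K L env_tensor"
proof (rule central_tensor[OF left_copy_bimodule right_copy_bimodule])
  fix c x y assume "c \<in> carrier K" "x \<in> carrier left_copy" "y \<in> carrier right_copy"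
  then show "pure_tensor K left_copy right_copy (lact left_copy (c \<odot>\<^bsub>L\<^esub> \<one>\<^bsub>L\<^esub>) x) y
      = pure_tensor K left_copy right_copy x (ract right_copy y (c \<odot>\<^bsub>L\<^esub> \<one>\<^bsub>L\<^esub>))"
    using cp.pure_balanced[of x c y] by (simp add: smult_eq_mult smult_eq_mult')
qed

end

section \<open>The action of the enveloping algebra on a central bimodule\<close>

context central_bimodule
begin

definition env_act :: "('a, 'a) tensor \<Rightarrow> 'm \<Rightarrow> 'm"
  where "env_act t x = tensor_lift M (\<lambda>a b. lact M a (ract M x b)) t"

lemma env_act_balanced:
  assumes "x \<in> carrier M"
  shows "balanced_map K (space_bimodule L) (space_bimodule L) M (\<lambda>a b. lact M a (ract M x b))"
proof (rule balanced_mapI)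
  fix a c b assume "a \<in> carrier (space_bimodule L)" "c \<in> carrier K" "b \<in> carrier (space_bimodule L)"
  then have *: "a \<in> carrier L" "c \<in> carrier K" "b \<in> carrier L" and c: "c \<odot>\<^bsub>L\<^esub> \<one>\<^bsub>L\<^esub> \<in> carrier L" by simp_all
  \<comment> \<open>Moving c from a to b means passing it through x; this is centrality of the
    bimodule.\<close>
  have "lact M (a \<otimes>\<^bsub>L\<^esub> (c \<odot>\<^bsub>L\<^esub> \<one>\<^bsub>L\<^esub>)) (ract M x b) = lact M a (ract M x (b \<otimes>\<^bsub>L\<^esub> (c \<odot>\<^bsub>L\<^esub> \<one>\<^bsub>L\<^esub>)))"
    using * c assms by (simp add: lact_mult ract_mult ract_closed central del: smult_eq_mult')
  then show "lact M (ract (space_bimodule L) a c) (ract M x b) = lact M a (ract M x (lact (space_bimodule L) c b))"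
    using * by (simp add: smult_eq_mult')
qed (use assms in \<open>simp_all add: lact_closed ract_closed lact_add_left lact_add_right ract_add_right\<close>)

lemma env_act_pure:
  "\<lbrakk>a \<in> carrier L; b \<in> carrier L; x \<in> carrier M\<rbrakk> \<Longrightarrow>
    env_act (pure_tensor K (space_bimodule L) (space_bimodule L) a b) x = lact M a (ract M x b)"
  unfolding env_act_def using sp.lift_pure[OF M.abelian_group_axioms env_act_balanced] by simp

lemma env_act_additive_left: "x \<in> carrier M \<Longrightarrow> additive E M (\<lambda>t. env_act t x)"
  unfolding env_act_def using sp.lift_additive[OF M.abelian_group_axioms env_act_balanced] by (simp add: additive_def)

lemma env_act_additive_right:
  assumes "t \<in> carrier E"
  shows "additive M M (env_act t)"
proof (rule additiveI)
  fix x assume "x \<in> carrier M" then show "env_act t x \<in> carrier M"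
    using additive_closed[OF env_act_additive_left assms] by simp
next
  fix x y assume xy: "x \<in> carrier M" "y \<in> carrier M"
  have t: "t \<in> carrier (tensor_group K (space_bimodule L) (space_bimodule L))" using assms by simp
  note z = additive_zero[OF abelian_group_cong[OF sp.tensor_abelian_group] M.abelian_group_axioms env_act_additive_left, OF env_simps(1-3)]
  note ad = additive_add[OF env_act_additive_left] additive_closed[OF env_act_additive_left]
  show "env_act t (x \<oplus>\<^bsub>M\<^esub> y) = env_act t x \<oplus>\<^bsub>M\<^esub> env_act t y"
    using t
  proof (induction t rule: sp.tensor_induct)
    case zero then show ?case using xy z by simp
  next
    case (add u v)
    then show ?case using xy ad[of _ u] ad[of _ v] by (simp add: M.a_ac)
  next
    case (pure a b) then show ?case using xy
      by (simp add: env_act_pure ract_add_left lact_add_right ract_closed)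
  qed
qed

lemmas env_act_closed = additive_closed[OF env_act_additive_right]

end

context algebra_over_field
begin

interpretation W: central_bimodule K L env_tensor by (rule env_tensor_central)

lemma env_abelian_group: "abelian_group E"
  by (rule abelian_group_cong[OF sp.tensor_abelian_group]) simp_all

text \<open>The product (a \<otimes> b)(c \<otimes> d) = ac \<otimes> db is a (c \<otimes> d) b, the
  action on the bimodule \<Lambda> \<otimes> \<Lambda>. The ring axioms thereby become properties of
  this action; associativity is \<open>env_act_mult\<close> for this bimodule.\<close>

lemma env_mult:
  assumes X: "X \<in> carrier E" and Y: "Y \<in> carrier E"
  shows "X \<otimes>\<^bsub>E\<^esub> Y = W.env_act X Y"
proof -
  let ?T = "tensor_group K (space_bimodule L) (space_bimodule L)"
  have Y': "Y \<in> carrier env_tensor" "Y \<in> carrier ?T" and X': "X \<in> carrier ?T"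
    using X Y by (simp_all add: env_tensor_eq)
  have bal: "balanced_map K (space_bimodule L) (space_bimodule L) ?T (\<lambda>c d. pe (a \<otimes>\<^bsub>L\<^esub> c) (d \<otimes>\<^bsub>L\<^esub> b))"
    if "a \<in> carrier L" "b \<in> carrier L" for a b
  proof (rule balanced_mapI)
    fix x r y assume *: "x \<in> carrier (space_bimodule L)" "r \<in> carrier K" "y \<in> carrier (space_bimodule L)"
    then show "pe (a \<otimes>\<^bsub>L\<^esub> ract (space_bimodule L) x r) (y \<otimes>\<^bsub>L\<^esub> b) = pe (a \<otimes>\<^bsub>L\<^esub> x) (lact (space_bimodule L) r y \<otimes>\<^bsub>L\<^esub> b)"
      using that sp.pure_balanced[of "a \<otimes>\<^bsub>L\<^esub> x" r "y \<otimes>\<^bsub>L\<^esub> b"] by (simp add: smult_mult_left smult_mult_right)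
  qed (use that sp.pure_add_left sp.pure_add_right in \<open>simp_all add: pe_closed L.l_distr L.r_distr\<close>)
  have inner: "tensor_lift ?T (\<lambda>c d. pe (a \<otimes>\<^bsub>L\<^esub> c) (d \<otimes>\<^bsub>L\<^esub> b)) Y = lact env_tensor a (ract env_tensor Y b)"
    if ab: "a \<in> carrier L" "b \<in> carrier L" for a b
  proof (rule sp.tensor_additive_eqI[OF sp.tensor_abelian_group sp.lift_additive[OF sp.tensor_abelian_group bal[OF ab]] _ _ Y'(2)])
    show "additive ?T ?T (\<lambda>Y. lact env_tensor a (ract env_tensor Y b))"
      using additive_comp[OF cp.ract_additive[OF ab(2)] cp.lact_additive[OF ab(1)]] by (simp add: env_tensor_eq)
    fix x y assume "x \<in> carrier (space_bimodule L)" "y \<in> carrier (space_bimodule L)"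
    then show "tensor_lift ?T (\<lambda>c d. pe (a \<otimes>\<^bsub>L\<^esub> c) (d \<otimes>\<^bsub>L\<^esub> b)) (pe x y) = lact env_tensor a (ract env_tensor (pe x y) b)"
      using sp.lift_pure[OF sp.tensor_abelian_group bal[OF ab]] ab cp.lact_pure[of a] cp.ract_pure[of b]
      by (simp add: env_tensor_eq)
  qed

  note balW = W.env_act_balanced[OF Y'(1)]
  have balT: "balanced_map K (space_bimodule L) (space_bimodule L) ?T (\<lambda>a b. lact env_tensor a (ract env_tensor Y b))"
    using balW by (simp add: balanced_map_def env_tensor_eq)
  have balI: "balanced_map K (space_bimodule L) (space_bimodule L) ?T
      (\<lambda>a b. tensor_lift ?T (\<lambda>c d. pe (a \<otimes>\<^bsub>L\<^esub> c) (d \<otimes>\<^bsub>L\<^esub> b)) Y)"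
    using balT unfolding balanced_map_def by (simp add: inner)
  have "tensor_lift ?T (\<lambda>a b. tensor_lift ?T (\<lambda>c d. pe (a \<otimes>\<^bsub>L\<^esub> c) (d \<otimes>\<^bsub>L\<^esub> b)) Y) X
    = tensor_lift ?T (\<lambda>a b. lact env_tensor a (ract env_tensor Y b)) X"
    by (rule sp.tensor_additive_eqI[OF sp.tensor_abelian_group sp.lift_additive[OF sp.tensor_abelian_group balI]
          sp.lift_additive[OF sp.tensor_abelian_group balT] _ X'])
      (simp add: sp.lift_pure[OF sp.tensor_abelian_group balI] sp.lift_pure[OF sp.tensor_abelian_group balT] inner)
  then show ?thesis by (simp add: enveloping_algebra_def Let_def W.env_act_def env_tensor_eq)
qed

lemma env_mult_pure:
  "\<lbrakk>a \<in> carrier L; b \<in> carrier L; c \<in> carrier L; d \<in> carrier L\<rbrakk> \<Longrightarrow>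
    pe a b \<otimes>\<^bsub>E\<^esub> pe c d = pe (a \<otimes>\<^bsub>L\<^esub> c) (d \<otimes>\<^bsub>L\<^esub> b)"
  using W.env_act_pure[of a b "pe c d"] pe_closed cp.lact_pure[of a] cp.ract_pure[of b]
  by (simp add: env_mult env_tensor_eq)

lemma env_mult_closed: "\<lbrakk>X \<in> carrier E; Y \<in> carrier E\<rbrakk> \<Longrightarrow> X \<otimes>\<^bsub>E\<^esub> Y \<in> carrier E"
  using W.env_act_closed[of X Y] by (simp add: env_mult env_tensor_eq)

lemma env_mult_additive_left: "Y \<in> carrier E \<Longrightarrow> additive E E (\<lambda>X. X \<otimes>\<^bsub>E\<^esub> Y)"
  using W.env_act_additive_left[of Y] sp.tensor_abelian_group abelian_group.axioms(1) abelian_monoid.a_closed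
  by (auto simp: additive_def env_mult env_tensor_eq)

lemma env_mult_additive_right: "X \<in> carrier E \<Longrightarrow> additive E E (\<lambda>Y. X \<otimes>\<^bsub>E\<^esub> Y)"
  using W.env_act_additive_right[of X] sp.tensor_abelian_group abelian_group.axioms(1) abelian_monoid.a_closed
  by (auto simp: additive_def env_mult env_tensor_eq)

end

context central_bimodule
begin

text \<open>Proved for an arbitrary central bimodule before the enveloping algebra is known to be a
  ring, since its associativity is the instance \<Lambda> \<otimes> \<Lambda>.\<close>

lemma env_act_mult:
  assumes X: "X \<in> carrier E" and Y: "Y \<in> carrier E" and x: "x \<in> carrier M"
  shows "env_act (X \<otimes>\<^bsub>E\<^esub> Y) x = env_act X (env_act Y x)"
proof -
  let ?T = "tensor_group K (space_bimodule L) (space_bimodule L)"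
  have T: "additive E M f = additive ?T M f" "additive M E g = additive M ?T g" for f g by (simp_all add: additive_def)
  have X': "X \<in> carrier ?T" and Y': "Y \<in> carrier ?T" using X Y by simp_all
  have 1: "env_act (pe a b \<otimes>\<^bsub>E\<^esub> Y) x = env_act (pe a b) (env_act Y x)" if ab: "a \<in> carrier L" "b \<in> carrier L" for a b
  proof (rule sp.tensor_additive_eqI[OF M.abelian_group_axioms _ _ _ Y'])
    have p: "pe a b \<in> carrier E" using pe_closed ab by simp
    show "additive ?T M (\<lambda>Y. env_act (pe a b \<otimes>\<^bsub>E\<^esub> Y) x)"
      using additive_comp[OF env_mult_additive_right[OF p] env_act_additive_left[OF x]] by (simp add: T)
    show "additive ?T M (\<lambda>Y. env_act (pe a b) (env_act Y x))"
      using additive_comp[OF env_act_additive_left[OF x] env_act_additive_right[OF p]] by (simp add: T)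
    fix c d assume "c \<in> carrier (space_bimodule L)" "d \<in> carrier (space_bimodule L)"
    then show "env_act (pe a b \<otimes>\<^bsub>E\<^esub> pe c d) x = env_act (pe a b) (env_act (pe c d) x)"
      using ab x by (simp add: env_mult_pure env_act_pure lact_mult ract_mult lact_closed ract_closed lact_ract)
  qed
  show ?thesis
  proof (rule sp.tensor_additive_eqI[OF M.abelian_group_axioms _ _ _ X'])
    show "additive ?T M (\<lambda>X. env_act (X \<otimes>\<^bsub>E\<^esub> Y) x)"
      using additive_comp[OF env_mult_additive_left[OF Y] env_act_additive_left[OF x]] by (simp add: T)
    show "additive ?T M (\<lambda>X. env_act X (env_act Y x))"
      using env_act_additive_left[OF env_act_closed[OF Y x]] by (simp add: T)
  qed (use 1 in simp)
qed

end

context algebra_over_field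
begin

interpretation W: central_bimodule K L env_tensor by (rule env_tensor_central)

lemma enveloping_algebra_ring: "ring E"
proof (rule ringI)
  show "abelian_group E" by (rule env_abelian_group)
  show "monoid E"
  proof (rule monoidI)
    show "\<one>\<^bsub>E\<^esub> \<in> carrier E" by (simp add: pe_closed)
    fix X Y Z assume XYZ: "X \<in> carrier E" "Y \<in> carrier E" "Z \<in> carrier E"
    have Z: "Z \<in> carrier env_tensor" using XYZ by (simp add: env_tensor_eq)
    show "X \<otimes>\<^bsub>E\<^esub> Y \<otimes>\<^bsub>E\<^esub> Z = X \<otimes>\<^bsub>E\<^esub> (Y \<otimes>\<^bsub>E\<^esub> Z)"
      using W.env_act_mult[OF XYZ(1,2) Z] XYZ env_mult_closed env_mult by metis
  next
    fix X assume X: "X \<in> carrier E"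
    then have X': "X \<in> carrier (tensor_group K (space_bimodule L) (space_bimodule L))"
      and X'': "X \<in> carrier env_tensor" by (simp_all add: env_tensor_eq)
    have o: "pe \<one>\<^bsub>L\<^esub> \<one>\<^bsub>L\<^esub> \<in> carrier E" by (simp add: pe_closed)
    show "\<one>\<^bsub>E\<^esub> \<otimes>\<^bsub>E\<^esub> X = X"
      by (rule sp.tensor_additive_eqI[OF sp.tensor_abelian_group _ _ _ X'])
        (use env_mult_additive_right[OF o] in \<open>simp_all add: additive_def env_mult_pure\<close>)
    show "X \<otimes>\<^bsub>E\<^esub> \<one>\<^bsub>E\<^esub> = X"
      by (rule sp.tensor_additive_eqI[OF sp.tensor_abelian_group _ _ _ X'])
        (use env_mult_additive_left[OF o] in \<open>simp_all add: additive_def env_mult_pure\<close>)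
  qed (rule env_mult_closed)
  show "(X \<oplus>\<^bsub>E\<^esub> Y) \<otimes>\<^bsub>E\<^esub> Z = X \<otimes>\<^bsub>E\<^esub> Z \<oplus>\<^bsub>E\<^esub> Y \<otimes>\<^bsub>E\<^esub> Z" "Z \<otimes>\<^bsub>E\<^esub> (X \<oplus>\<^bsub>E\<^esub> Y) = Z \<otimes>\<^bsub>E\<^esub> X \<oplus>\<^bsub>E\<^esub> Z \<otimes>\<^bsub>E\<^esub> Y"
    if "X \<in> carrier E" "Y \<in> carrier E" "Z \<in> carrier E" for X Y Z
    using additive_add[OF env_mult_additive_left[OF that(3)] that(1,2)]
      additive_add[OF env_mult_additive_right[OF that(3)] that(1,2)] by simp_all
qed

end

lemma env_module_simps [simp]:
  "carrier (env_module M) = carrier M" "ring.add (env_module M) = ring.add M" "\<zero>\<^bsub>env_module M\<^esub> = \<zero>\<^bsub>M\<^esub>"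
  by (simp_all add: env_module_def)

context central_bimodule
begin

lemma env_module_smult: "t \<odot>\<^bsub>env_module M\<^esub> x = env_act t x"
  by (simp add: env_module_def env_act_def)

lemma env_module_left_module: "left_module E (env_module M)"
proof -
  have "abelian_group (env_module M)" by (rule abelian_group_cong[OF M.abelian_group_axioms]) simp_all
  moreover have "env_act \<one>\<^bsub>E\<^esub> x = x" if "x \<in> carrier M" for x
    using that by (simp add: env_act_pure ract_one lact_one)
  ultimately show ?thesis
    using additive_add[OF env_act_additive_left] additive_add[OF env_act_additive_right] env_act_closed env_act_mult
    by (intro left_module.intro left_module_axioms.intro enveloping_algebra_ring)
      (simp_all add: env_module_smult del: env_simps(4))
qed

end

section \<open>Homomorphisms over the enveloping algebra\<close>

definition bimodule_hom ::
  "('a, 'x) ring_scheme \<Rightarrow> ('a, 'a, 'm, 'y) bimodule_scheme \<Rightarrow> ('a, 'a, 'n, 'z) bimodule_scheme \<Rightarrow> ('m \<Rightarrow> 'n) \<Rightarrow> bool"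
  where "bimodule_hom R M N f \<longleftrightarrow> left_linear R M N f \<and> right_linear R M N f"

text \<open>Putting a = 1 or b = 1 in a \<otimes> b recovers the two one-sided actions; conversely
  pure tensors generate additively. Linearity over the enveloping algebra can thus be tested with
  the two one-sided actions.\<close>

lemma left_module_hom_env_module:
  assumes "central_bimodule K L M" "central_bimodule K L N"
  shows "f \<in> left_module_hom (enveloping_algebra K L) (env_module M) (env_module N) \<longleftrightarrow> bimodule_hom L M N f"
proof -
  interpret M: central_bimodule K L M by fact
  interpret N: central_bimodule K L N by fact
  note s = M.env_module_smult N.env_module_smult
  show ?thesis
  proof
    assume f: "f \<in> left_module_hom (enveloping_algebra K L) (env_module M) (env_module N)"
    then have add: "additive M N f" by (auto simp: left_module_hom_def additive_def)
    have fp: "f (lact M a (ract M x b)) = lact N a (ract N (f x) b)"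
      if "a \<in> carrier L" "b \<in> carrier L" "x \<in> carrier M" for a b x
    proof -
      have "f (M.env_act (pure_tensor K (space_bimodule L) (space_bimodule L) a b) x)
        = N.env_act (pure_tensor K (space_bimodule L) (space_bimodule L) a b) (f x)"
        using f that M.pe_closed by (simp add: left_module_hom_def s)
      then show ?thesis
        using that additive_closed[OF add] by (simp add: M.env_act_pure N.env_act_pure)
    qed
    show "bimodule_hom L M N f"
      unfolding bimodule_hom_def left_linear_def right_linear_def
      using fp[of _ "\<one>\<^bsub>L\<^esub>"] fp[of "\<one>\<^bsub>L\<^esub>"] additive_closed[OF add]
      by (simp add: add M.ract_one N.ract_one M.lact_one N.lact_one M.ract_closed N.ract_closed)
  next
    assume f: "bimodule_hom L M N f"
    then have add: "additive M N f" by (simp add: bimodule_hom_def left_linear_def)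
    have "f (M.env_act t x) = N.env_act t (f x)"
      if "t \<in> carrier (enveloping_algebra K L)" and x: "x \<in> carrier M" for t x
    proof (rule M.sp.tensor_additive_eqI[OF N.M.abelian_group_axioms])
      show "t \<in> carrier (tensor_group K (space_bimodule L) (space_bimodule L))" using that by simp
      show "additive (tensor_group K (space_bimodule L) (space_bimodule L)) N (\<lambda>t. f (M.env_act t x))"
        using additive_comp[OF M.env_act_additive_left[OF x] add] by (simp add: additive_def)
      show "additive (tensor_group K (space_bimodule L) (space_bimodule L)) N (\<lambda>t. N.env_act t (f x))"
        using N.env_act_additive_left[OF additive_closed[OF add x]] by (simp add: additive_def)
    qed (use f x additive_closed[OF add x] in \<open>simp add: M.env_act_pure N.env_act_pure bimodule_hom_def left_linear_def right_linear_def
        M.ract_closed\<close>)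
    then show "f \<in> left_module_hom (enveloping_algebra K L) (env_module M) (env_module N)"
      using add by (auto simp: left_module_hom_def s additive_def)
  qed
qed

lemma central_regular_bimodule:
  assumes "algebra_over_field K L"
  shows "central_bimodule K L (regular_bimodule L)"
proof -
  interpret algebra_over_field K L by fact
  have "abelian_group (regular_bimodule L)" by (rule abelian_group_cong[OF L_abelian]) simp_all
  then show ?thesis
    by (intro central_bimodule.intro central_bimodule_axioms.intro bimodule.intro bimodule_axioms.intro
        L.ring_axioms algebra_over_field_axioms)
      (simp_all add: L.l_distr L.r_distr L.m_assoc smult_eq_mult smult_eq_mult')
qed

lemma central_bimodule_tensor:
  assumes "central_bimodule K L M" "central_bimodule K L N"
  shows "central_bimodule K L (tensor L M N)"
proof -
  interpret M: central_bimodule K L M by fact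
  interpret N: central_bimodule K L N by fact
  interpret t: bimodule_pair L L L M N by (intro bimodule_pair.intro M.bimodule_axioms N.bimodule_axioms)
  show ?thesis
    by (rule M.central_tensor[OF M.bimodule_axioms N.bimodule_axioms])
      (simp add: M.central t.pure_balanced N.central)
qed

section \<open>Bimodules of the form \<Lambda> \<otimes> V \<otimes> \<Lambda>\<close>

context algebra_over_field
begin

lemma two_sided_bimodules:
  assumes "bimodule K K V"
  shows "bimodule_pair L K K left_copy V" "bimodule_pair L K L (tensor K left_copy V) right_copy"
proof -
  show 1: "bimodule_pair L K K left_copy V" by (intro bimodule_pair.intro left_copy_bimodule assms)
  show "bimodule_pair L K L (tensor K left_copy V) right_copy"
    by (intro bimodule_pair.intro bimodule_pair.tensor_bimodule[OF 1] right_copy_bimodule)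
qed

lemma two_sided_central:
  assumes "bimodule K K V" "\<And>c v. \<lbrakk>c \<in> carrier K; v \<in> carrier V\<rbrakk> \<Longrightarrow> lact V c v = ract V v c"
  shows "central_bimodule K L (two_sided_tensor K L V)"
proof -
  interpret i: bimodule_pair L K K left_copy V by (rule two_sided_bimodules[OF assms(1)])
  interpret o: bimodule_pair L K L "tensor K left_copy V" right_copy by (rule two_sided_bimodules[OF assms(1)])
  show ?thesis
    unfolding two_sided_tensor_def
  proof (rule central_tensor[OF i.tensor_bimodule right_copy_bimodule])
    fix c x y assume c: "c \<in> carrier K" and x: "x \<in> carrier (tensor K left_copy V)" and y: "y \<in> carrier right_copy"
    have x': "x \<in> carrier (tensor_group K left_copy V)" using x by simp
    have cc: "c \<odot>\<^bsub>L\<^esub> \<one>\<^bsub>L\<^esub> \<in> carrier L" using c by simp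
    \<comment> \<open>The scalar travels from the left factor into V, through V by the assumption on
      V, and then by the outer tensor product into the right factor.\<close>
    have "lact (tensor K left_copy V) (c \<odot>\<^bsub>L\<^esub> \<one>\<^bsub>L\<^esub>) x = ract (tensor K left_copy V) x c"
    proof (rule i.tensor_additive_eqI[OF i.tensor_abelian_group i.lact_additive[OF cc] i.ract_additive[OF c] _ x'])
      fix a v assume a: "a \<in> carrier left_copy" and v: "v \<in> carrier V"
      then show "lact (tensor K left_copy V) (c \<odot>\<^bsub>L\<^esub> \<one>\<^bsub>L\<^esub>) (pure_tensor K left_copy V a v)
          = ract (tensor K left_copy V) (pure_tensor K left_copy V a v) c"
        using c cc i.pure_balanced[OF a c v] i.lact_pure[OF cc a v] i.ract_pure[OF c a v] assms(2)
        by (simp add: smult_eq_mult)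
    qed
    moreover have "pure_tensor K (tensor K left_copy V) right_copy (ract (tensor K left_copy V) x c) y
        = pure_tensor K (tensor K left_copy V) right_copy x (c \<odot>\<^bsub>L\<^esub> y)"
      using o.pure_balanced[OF x c y] by simp
    ultimately show "pure_tensor K (tensor K left_copy V) right_copy (lact (tensor K left_copy V) (c \<odot>\<^bsub>L\<^esub> \<one>\<^bsub>L\<^esub>) x) y
        = pure_tensor K (tensor K left_copy V) right_copy x (ract right_copy y (c \<odot>\<^bsub>L\<^esub> \<one>\<^bsub>L\<^esub>))"
      using c y by (simp add: smult_eq_mult')
  qed
qed

definition two_sided_pure :: "('k, 'k, 'v) bimodule \<Rightarrow> 'a \<Rightarrow> 'v \<Rightarrow> 'a \<Rightarrow> (('a, 'v) tensor, 'a) tensor"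
  where "two_sided_pure V a v b =
    pure_tensor K (tensor K left_copy V) right_copy (pure_tensor K left_copy V a v) b"

text \<open>\<Lambda> \<otimes> V is a sum of copies of \<Lambda> indexed by a basis of V, and
  tensoring with \<Lambda> on the right gives copies of \<Lambda> \<otimes> \<Lambda>, which is the
  enveloping algebra. The rest identifies the inclusions with multiplication onto 1 \<otimes> e_i
  \<otimes> 1.\<close>

lemma two_sided_copower:
  assumes V: "bimodule K K V" "\<And>c v. \<lbrakk>c \<in> carrier K; v \<in> carrier V\<rbrakk> \<Longrightarrow> lact V c v = ract V v c"
    and B: "copower V K I inc prj" and e: "\<And>i. i \<in> I \<Longrightarrow> e i \<in> carrier V"
    and inc: "\<And>i c. i \<in> I \<Longrightarrow> c \<in> carrier K \<Longrightarrow> inc i c = lact V c (e i)"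
  shows "\<exists>prj'. copower (two_sided_tensor K L V) E I
    (\<lambda>i t. t \<odot>\<^bsub>env_module (two_sided_tensor K L V)\<^esub> two_sided_pure V \<one>\<^bsub>L\<^esub> (e i) \<one>\<^bsub>L\<^esub>) prj'"
    and "\<And>v. v \<in> carrier V \<Longrightarrow> two_sided_pure V \<one>\<^bsub>L\<^esub> v \<one>\<^bsub>L\<^esub> \<in> carrier (two_sided_tensor K L V)"
proof -
  interpret i: bimodule_pair L K K left_copy V by (rule two_sided_bimodules[OF V(1)])
  interpret o: bimodule_pair L K L "tensor K left_copy V" right_copy by (rule two_sided_bimodules[OF V(1)])
  interpret Z: central_bimodule K L "two_sided_tensor K L V" by (rule two_sided_central[OF V])
  have z: "two_sided_tensor K L V = tensor K (tensor K left_copy V) right_copy" by (simp add: two_sided_tensor_def)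
  show uc: "two_sided_pure V \<one>\<^bsub>L\<^esub> v \<one>\<^bsub>L\<^esub> \<in> carrier (two_sided_tensor K L V)" if "v \<in> carrier V" for v
    unfolding two_sided_pure_def z using that by (auto intro!: o.pure_closed i.pure_closed)
  define p1 where "p1 = (\<lambda>i. tensor_lift left_copy (\<lambda>m n. ract left_copy m (prj i n)))"
  have c1: "copower (tensor K left_copy V) left_copy I (\<lambda>i l. pure_tensor K left_copy V l (e i)) p1"
    unfolding p1_def by (rule i.tensor_copower_right[OF B e inc])
  have l1: "right_linear K left_copy (tensor K left_copy V) (\<lambda>l. pure_tensor K left_copy V l (e i))" if "i \<in> I" for i
    using i.pure_left_additive[OF e[OF that]] i.ract_pure[of _ _ "e i"] i.pure_balanced[of _ _ "e i"] e[OF that] V(2)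
    by (simp add: right_linear_def additive_def)
  have l2: "right_linear K (tensor K left_copy V) left_copy (p1 i)" if "i \<in> I" for i
    by (rule copower_prj_right_linear[OF c1 i.tensor_bimodule left_copy_bimodule l1 that])
  \<comment> \<open>The right factor is kept whole, as a sum of one copy of itself.\<close>
  have triv: "copower right_copy right_copy {()} (\<lambda>_ x. x) (\<lambda>_ x. x)"
    by (intro copower.intro copower_axioms.intro) (auto intro: additive_id cp.N.M.abelian_group_axioms)
  have c2: "copower (two_sided_tensor K L V) env_tensor (I \<times> {()})
      (\<lambda>(i, j). tensor_map K left_copy right_copy (tensor K left_copy V) right_copy (\<lambda>l. pure_tensor K left_copy V l (e i)) (\<lambda>x. x))
      (\<lambda>(i, j). tensor_map K (tensor K left_copy V) right_copy left_copy right_copy (p1 i) (\<lambda>x. x))"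
    unfolding z
    by (rule tensor_copower[OF i.tensor_bimodule right_copy_bimodule left_copy_bimodule right_copy_bimodule c1 triv l1 l2])
      (auto intro: left_linear_id)
  have b: "bij_betw (\<lambda>i. (i, ())) I (I \<times> {()})" by (auto simp: bij_betw_def inj_on_def)
  define p2 where "p2 = (\<lambda>i. tensor_map K (tensor K left_copy V) right_copy left_copy right_copy (p1 i) (\<lambda>x. x))"
  have c3: "copower (two_sided_tensor K L V) env_tensor I
      (\<lambda>i. tensor_map K left_copy right_copy (tensor K left_copy V) right_copy (\<lambda>l. pure_tensor K left_copy V l (e i)) (\<lambda>x. x)) p2"
    unfolding p2_def using copower_reindex[OF c2 b] by simp
  have c4: "copower (two_sided_tensor K L V) E I
      (\<lambda>i. tensor_map K left_copy right_copy (tensor K left_copy V) right_copy (\<lambda>l. pure_tensor K left_copy V l (e i)) (\<lambda>x. x)) p2"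
    by (rule copower_cong_structure[OF c3]) (simp_all add: env_tensor_eq)
  have "copower (two_sided_tensor K L V) E I
    (\<lambda>i t. t \<odot>\<^bsub>env_module (two_sided_tensor K L V)\<^esub> two_sided_pure V \<one>\<^bsub>L\<^esub> (e i) \<one>\<^bsub>L\<^esub>) p2"
  proof (rule copower_cong[OF c4])
    fix k t assume k: "k \<in> I" and "t \<in> carrier E"
    then have t: "t \<in> carrier (tensor_group K (space_bimodule L) (space_bimodule L))" by simp
    interpret m: bimodule_pair_maps L K L left_copy right_copy L L "tensor K left_copy V" right_copy
        "\<lambda>l. pure_tensor K left_copy V l (e k)" "\<lambda>x. x"
      by (intro bimodule_pair_maps.intro bimodule_pair_maps_axioms.intro l1 k left_linear_id
          cp.bimodule_pair_axioms o.bimodule_pair_axioms)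
    show "tensor_map K left_copy right_copy (tensor K left_copy V) right_copy (\<lambda>l. pure_tensor K left_copy V l (e k)) (\<lambda>x. x) t
      = t \<odot>\<^bsub>env_module (two_sided_tensor K L V)\<^esub> two_sided_pure V \<one>\<^bsub>L\<^esub> (e k) \<one>\<^bsub>L\<^esub>"
      unfolding Z.env_module_smult
    proof (rule sp.tensor_additive_eqI[OF Z.M.abelian_group_axioms _ _ _ t])
      show "additive (tensor_group K (space_bimodule L) (space_bimodule L)) (two_sided_tensor K L V)
          (tensor_map K left_copy right_copy (tensor K left_copy V) right_copy (\<lambda>l. pure_tensor K left_copy V l (e k)) (\<lambda>x. x))"
        using m.map_additive by (simp add: additive_def z env_tensor_eq)
      show "additive (tensor_group K (space_bimodule L) (space_bimodule L)) (two_sided_tensor K L V)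
          (\<lambda>t. Z.env_act t (two_sided_pure V \<one>\<^bsub>L\<^esub> (e k) \<one>\<^bsub>L\<^esub>))"
        using Z.env_act_additive_left[OF uc[OF e[OF k]]] by (simp add: additive_def)
      fix a b assume "a \<in> carrier (space_bimodule L)" "b \<in> carrier (space_bimodule L)"
      then have ab: "a \<in> carrier L" "b \<in> carrier L" by simp_all
      have pc: "pure_tensor K left_copy V a (e k) \<in> carrier (tensor K left_copy V)" if "a \<in> carrier L" for a
        using i.pure_closed[of a "e k"] that e[OF k] by simp
      have "tensor_map K left_copy right_copy (tensor K left_copy V) right_copy (\<lambda>l. pure_tensor K left_copy V l (e k)) (\<lambda>x. x) (pe a b)
        = pure_tensor K (tensor K left_copy V) right_copy (pure_tensor K left_copy V a (e k)) b"
        using m.map_pure[of a b] ab by (simp add: env_tensor_eq)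
      also have "\<dots> = lact (two_sided_tensor K L V) a (ract (two_sided_tensor K L V) (two_sided_pure V \<one>\<^bsub>L\<^esub> (e k) \<one>\<^bsub>L\<^esub>) b)"
        unfolding z two_sided_pure_def
        using o.ract_pure[OF ab(2) pc[OF L.one_closed]] o.lact_pure[OF ab(1) pc[OF L.one_closed]]
          i.lact_pure[OF ab(1), of "\<one>\<^bsub>L\<^esub>" "e k"] ab e[OF k] by simp
      also have "\<dots> = Z.env_act (pe a b) (two_sided_pure V \<one>\<^bsub>L\<^esub> (e k) \<one>\<^bsub>L\<^esub>)"
        using Z.env_act_pure[OF ab uc[OF e[OF k]]] by simp
      finally show "tensor_map K left_copy right_copy (tensor K left_copy V) right_copy (\<lambda>l. pure_tensor K left_copy V l (e k)) (\<lambda>x. x) (pe a b)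
        = Z.env_act (pe a b) (two_sided_pure V \<one>\<^bsub>L\<^esub> (e k) \<one>\<^bsub>L\<^esub>)" .
    qed
  qed
  then show "\<exists>prj'. copower (two_sided_tensor K L V) E I
    (\<lambda>i t. t \<odot>\<^bsub>env_module (two_sided_tensor K L V)\<^esub> two_sided_pure V \<one>\<^bsub>L\<^esub> (e i) \<one>\<^bsub>L\<^esub>) prj'"
    by (intro exI)
qed

end

section \<open>Total complexes of double complexes with exact columns\<close>

text \<open>Maps are numbered by the position where they end: \<open>H i j\<close> starts at (i + 1,
  j), \<open>V i j\<close> at (i, j + 1), \<open>d i\<close> at i + 1. The sign is contained in V,
  so squares anticommute and the total differential is a plain sum. Exactness is a statement about
  additive groups, so no ring occurs.\<close>

locale exact_column_double_complex =
  fixes X :: "nat \<Rightarrow> nat \<Rightarrow> ('m, 'x) ring_scheme" and H :: "nat \<Rightarrow> nat \<Rightarrow> 'm \<Rightarrow> 'm" and V :: "nat \<Rightarrow> nat \<Rightarrow> 'm \<Rightarrow> 'm"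
    and P :: "nat \<Rightarrow> ('p, 'y) ring_scheme" and d :: "nat \<Rightarrow> 'p \<Rightarrow> 'p" and \<eta> :: "nat \<Rightarrow> 'm \<Rightarrow> 'p"
    and N :: "('n, 'z) ring_scheme" and \<epsilon> :: "'p \<Rightarrow> 'n"
  assumes X_abelian: "abelian_group (X i j)" and P_abelian: "abelian_group (P i)" and N_abelian: "abelian_group N"
    and H_additive: "additive (X (Suc i) j) (X i j) (H i j)"
    and V_additive: "additive (X i (Suc j)) (X i j) (V i j)"
    and \<eta>_additive: "additive (X i 0) (P i) (\<eta> i)"
    and d_additive: "additive (P (Suc i)) (P i) (d i)"
    and \<epsilon>_additive: "additive (P 0) N \<epsilon>"
    and HH: "x \<in> carrier (X (Suc (Suc i)) j) \<Longrightarrow> H i j (H (Suc i) j x) = \<zero>\<^bsub>X i j\<^esub>"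
    and HV: "x \<in> carrier (X (Suc i) (Suc j)) \<Longrightarrow> H i j (V (Suc i) j x) \<oplus>\<^bsub>X i j\<^esub> V i j (H i (Suc j) x) = \<zero>\<^bsub>X i j\<^esub>"
    and \<eta>H: "x \<in> carrier (X (Suc i) 0) \<Longrightarrow> \<eta> i (H i 0 x) = d i (\<eta> (Suc i) x)"
    and V_exact: "V i (Suc j) ` carrier (X i (Suc (Suc j))) = {x \<in> carrier (X i (Suc j)). V i j x = \<zero>\<^bsub>X i j\<^esub>}"
    and V_\<eta>_exact: "V i 0 ` carrier (X i (Suc 0)) = {x \<in> carrier (X i 0). \<eta> i x = \<zero>\<^bsub>P i\<^esub>}"
    and \<eta>_surj: "\<eta> i ` carrier (X i 0) = carrier (P i)"
    and d_exact: "d (Suc i) ` carrier (P (Suc (Suc i))) = {x \<in> carrier (P (Suc i)). d i x = \<zero>\<^bsub>P i\<^esub>}"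
    and d_\<epsilon>_exact: "d 0 ` carrier (P (Suc 0)) = {x \<in> carrier (P 0). \<epsilon> x = \<zero>\<^bsub>N\<^esub>}"
    and \<epsilon>_surj: "\<epsilon> ` carrier (P 0) = carrier N"
begin

definition total :: "nat \<Rightarrow> (nat \<times> nat \<Rightarrow> 'm) set"
  where "total n = (\<Pi>\<^sub>E (i, j) \<in> {(i, j). i + j = n}. carrier (X i j))"

text \<open>Numbered by the degree of its target: it leads from degree n + 1 to degree n.\<close>

definition diff :: "nat \<Rightarrow> (nat \<times> nat \<Rightarrow> 'm) \<Rightarrow> nat \<times> nat \<Rightarrow> 'm"
  where "diff n x = (\<lambda>(i, j) \<in> {(i, j). i + j = n}. H i j (x (Suc i, j)) \<oplus>\<^bsub>X i j\<^esub> V i j (x (i, Suc j)))"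

text \<open>Cycles of the augmented column: at height 0 the outgoing map is the augmentation \<eta>.
  This lets one chase treat all heights alike.\<close>

definition vertical_cycle :: "nat \<Rightarrow> nat \<Rightarrow> 'm \<Rightarrow> bool"
  where "vertical_cycle i j y \<longleftrightarrow> y \<in> carrier (X i j) \<and>
    (case j of 0 \<Rightarrow> \<eta> i y = \<zero>\<^bsub>P i\<^esub> | Suc j' \<Rightarrow> V i j' y = \<zero>\<^bsub>X i j'\<^esub>)"

lemma vertical_cycle_boundary: "vertical_cycle i j y \<Longrightarrow> \<exists>z \<in> carrier (X i (Suc j)). V i j z = y"
proof (cases j)
  case 0
  assume "vertical_cycle i j y"
  then have "y \<in> V i 0 ` carrier (X i (Suc 0))" using 0 unfolding V_\<eta>_exact by (simp add: vertical_cycle_def)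
  then show ?thesis using 0 by auto
next
  case (Suc j')
  assume "vertical_cycle i j y"
  then have "y \<in> V i (Suc j') ` carrier (X i (Suc (Suc j')))" using Suc unfolding V_exact by (simp add: vertical_cycle_def)
  then show ?thesis using Suc by auto
qed

lemmas H_closed = additive_closed[OF H_additive]
lemmas V_closed = additive_closed[OF V_additive]
lemmas \<eta>_closed = additive_closed[OF \<eta>_additive]

lemma total_closed: "x \<in> total n \<Longrightarrow> i + j = n \<Longrightarrow> x (i, j) \<in> carrier (X i j)"
  unfolding total_def by (drule PiE_mem[of _ _ _ "(i, j)"]) auto

lemma totalI:
  "(\<And>i j. i + j = n \<Longrightarrow> x (i, j) \<in> carrier (X i j)) \<Longrightarrow> x \<in> extensional {(i, j). i + j = n} \<Longrightarrow> x \<in> total n"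
  unfolding total_def by (auto simp: PiE_def)

lemma total_eqI: "x \<in> total n \<Longrightarrow> y \<in> total n \<Longrightarrow> (\<And>i j. i + j = n \<Longrightarrow> x (i, j) = y (i, j)) \<Longrightarrow> x = y"
  unfolding total_def by (rule PiE_ext) auto

lemma diff_eq: "i + j = n \<Longrightarrow> diff n x (i, j) = H i j (x (Suc i, j)) \<oplus>\<^bsub>X i j\<^esub> V i j (x (i, Suc j))"
  by (simp add: diff_def)

lemma X_add_closed: "a \<in> carrier (X i j) \<Longrightarrow> b \<in> carrier (X i j) \<Longrightarrow> a \<oplus>\<^bsub>X i j\<^esub> b \<in> carrier (X i j)"
  by (rule abelian_monoid.a_closed[OF abelian_group.axioms(1)[OF X_abelian]])

lemma diff_closed:
  assumes "x \<in> total (Suc n)"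
  shows "diff n x \<in> total n"
proof (rule totalI)
  fix i j assume "i + j = n"
  then show "diff n x (i, j) \<in> carrier (X i j)"
    by (simp add: diff_eq) (intro X_add_closed H_closed V_closed total_closed[OF assms]; simp)
qed (simp add: diff_def)

lemma V_V: "x \<in> carrier (X i (Suc (Suc j))) \<Longrightarrow> V i j (V i (Suc j) x) = \<zero>\<^bsub>X i j\<^esub>"
  using V_exact[of i j] by blast

lemma \<eta>_V: "x \<in> carrier (X i (Suc 0)) \<Longrightarrow> \<eta> i (V i 0 x) = \<zero>\<^bsub>P i\<^esub>"
  using V_\<eta>_exact[of i] by blast

lemma diff_diff:
  assumes x: "x \<in> total (Suc (Suc n))" and ij: "i + j = n"
  shows "diff n (diff (Suc n) x) (i, j) = \<zero>\<^bsub>X i j\<^esub>"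
proof -
  interpret Xij: abelian_group "X i j" by (rule X_abelian)
  let ?a = "x (Suc (Suc i), j)" and ?b = "x (Suc i, Suc j)" and ?c = "x (i, Suc (Suc j))"
  have c: "?a \<in> carrier (X (Suc (Suc i)) j)" "?b \<in> carrier (X (Suc i) (Suc j))" "?c \<in> carrier (X i (Suc (Suc j)))"
    using total_closed[OF x] ij by auto
  have cc: "H (Suc i) j ?a \<in> carrier (X (Suc i) j)" "V (Suc i) j ?b \<in> carrier (X (Suc i) j)"
    "H i (Suc j) ?b \<in> carrier (X i (Suc j))" "V i (Suc j) ?c \<in> carrier (X i (Suc j))"
    using c H_closed V_closed by auto
  have "diff n (diff (Suc n) x) (i, j)
    = H i j (H (Suc i) j ?a \<oplus>\<^bsub>X (Suc i) j\<^esub> V (Suc i) j ?b) \<oplus>\<^bsub>X i j\<^esub> V i j (H i (Suc j) ?b \<oplus>\<^bsub>X i (Suc j)\<^esub> V i (Suc j) ?c)"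
    using ij by (simp add: diff_eq)
  also have "\<dots> = (\<zero>\<^bsub>X i j\<^esub> \<oplus>\<^bsub>X i j\<^esub> H i j (V (Suc i) j ?b)) \<oplus>\<^bsub>X i j\<^esub> (V i j (H i (Suc j) ?b) \<oplus>\<^bsub>X i j\<^esub> \<zero>\<^bsub>X i j\<^esub>)"
    using cc c by (simp add: additive_add[OF H_additive] additive_add[OF V_additive] HH V_V)
  also have "\<dots> = \<zero>\<^bsub>X i j\<^esub>" using HV[OF c(2)] cc H_closed V_closed by simp
  finally show ?thesis .
qed

text \<open>One diagram chase for all degrees, including degree 0, where the condition
  \<open>cycle0\<close> takes over. The entry of y at (m + 1, 0) comes from exactness of P; each
  further entry up the diagonal corrects the error left by the previous one, using exactness of a
  column.\<close>

lemma boundary_ex: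
  assumes x: "x \<in> total m"
    and cycle: "\<And>i j. Suc (i + j) = m \<Longrightarrow> H i j (x (Suc i, j)) \<oplus>\<^bsub>X i j\<^esub> V i j (x (i, Suc j)) = \<zero>\<^bsub>X i j\<^esub>"
    and cycle0: "m = 0 \<Longrightarrow> \<epsilon> (\<eta> 0 (x (0, 0))) = \<zero>\<^bsub>N\<^esub>"
  shows "\<exists>y \<in> total (Suc m). diff m y = x"
proof -
  note min = additive_minus[OF X_abelian X_abelian]
  \<comment> \<open>The image in P of the lowest entry is a cycle: for m > 0 the vertical
    contribution to the cycle condition at (m - 1, 0) dies under \<eta>.\<close>
  have "\<eta> m (x (m, 0)) \<in> d m ` carrier (P (Suc m))"
  proof (cases m)
    case 0
    then show ?thesis using d_\<epsilon>_exact cycle0 \<eta>_closed[OF total_closed[OF x, of 0 0]] by simp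
  next
    case (Suc n)
    interpret P: abelian_group "P n" by (rule P_abelian)
    have xc: "x (Suc n, 0) \<in> carrier (X (Suc n) 0)" "x (n, Suc 0) \<in> carrier (X n (Suc 0))"
      using total_closed[OF x] Suc by auto
    have "d n (\<eta> (Suc n) (x (Suc n, 0))) = \<eta> n (H n 0 (x (Suc n, 0)))" using \<eta>H xc by simp
    also have "\<dots> = \<eta> n (H n 0 (x (Suc n, 0))) \<oplus>\<^bsub>P n\<^esub> \<eta> n (V n 0 (x (n, Suc 0)))"
      using \<eta>_V[OF xc(2)] \<eta>_closed H_closed xc by simp
    also have "\<dots> = \<eta> n (H n 0 (x (Suc n, 0)) \<oplus>\<^bsub>X n 0\<^esub> V n 0 (x (n, Suc 0)))"
      using additive_add[OF \<eta>_additive] H_closed V_closed xc by simp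
    also have "\<dots> = \<zero>\<^bsub>P n\<^esub>" using cycle[of n 0] Suc additive_zero[OF X_abelian P_abelian \<eta>_additive] by simp
    finally show ?thesis using Suc d_exact[of n] \<eta>_closed[OF xc(1)] by simp
  qed
  then obtain q where q: "q \<in> carrier (P (Suc m))" "d m q = \<eta> m (x (m, 0))" by auto
  then obtain z where z: "z \<in> carrier (X (Suc m) 0)" "\<eta> (Suc m) z = q" using \<eta>_surj[of "Suc m"] by (metis imageE)
  \<comment> \<open>What remains of x at (m - k, k) after subtracting the horizontal image of the
    entry w at (m - k + 1, k); the next entry of y must have it as vertical image.\<close>
  define res where "res k w = x (m - k, k) \<ominus>\<^bsub>X (m - k) k\<^esub> H (m - k) k w" for k w
  have xk: "x (m - k, k) \<in> carrier (X (m - k) k)" if "k \<le> m" for k using total_closed[OF x] that by simp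
  have rc: "res k w \<in> carrier (X (m - k) k)" if "k \<le> m" "w \<in> carrier (X (Suc m - k) k)" for k w
  proof -
    interpret Xk: abelian_group "X (m - k) k" by (rule X_abelian)
    show ?thesis using xk[OF that(1)] that H_closed by (simp add: res_def Suc_diff_le)
  qed
  have res0: "vertical_cycle m 0 (res 0 z)"
  proof -
    interpret P: abelian_group "P m" by (rule P_abelian)
    have "\<eta> m (res 0 z) = \<eta> m (x (m, 0)) \<ominus>\<^bsub>P m\<^esub> \<eta> m (H m 0 z)"
      using additive_minus[OF X_abelian P_abelian \<eta>_additive xk[of 0, simplified] H_closed[OF z(1)]]
      by (simp add: res_def)
    also have "\<dots> = \<zero>\<^bsub>P m\<^esub>"
      using \<eta>H[OF z(1)] z q \<eta>_closed[OF xk[of 0, simplified]] by (simp add: P.minus_eq P.r_neg)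
    finally show ?thesis using rc[of 0 z] z by (simp add: vertical_cycle_def)
  qed
  \<comment> \<open>\<open>s j\<close> is the entry of y at (m + 1 - j, j). The last stage k = m + 1
    fills position (0, m + 1), where no cycle condition remains; hence the guard k \<le> m.\<close>
  have "\<exists>s. (\<forall>j \<le> k. s j \<in> carrier (X (Suc m - j) j)) \<and>
      (\<forall>j < k. x (m - j, j) = H (m - j) j (s j) \<oplus>\<^bsub>X (m - j) j\<^esub> V (m - j) j (s (Suc j))) \<and>
      (k \<le> m \<longrightarrow> vertical_cycle (m - k) k (res k (s k)))" if "k \<le> Suc m" for k
    using that
  proof (induction k)
    case 0
    show ?case by (rule exI[of _ "\<lambda>_. z"]) (use z res0 in auto)
  next
    case (Suc k)
    then obtain s where s: "\<forall>j \<le> k. s j \<in> carrier (X (Suc m - j) j)"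
      "\<forall>j < k. x (m - j, j) = H (m - j) j (s j) \<oplus>\<^bsub>X (m - j) j\<^esub> V (m - j) j (s (Suc j))"
      "vertical_cycle (m - k) k (res k (s k))" by auto
    have km: "k \<le> m" using Suc by simp
    obtain w where w: "w \<in> carrier (X (m - k) (Suc k))" "V (m - k) k w = res k (s k)"
      using vertical_cycle_boundary[OF s(3)] by auto
    interpret Xk: abelian_group "X (m - k) k" by (rule X_abelian)
    have sk: "s k \<in> carrier (X (Suc (m - k)) k)" using s(1) km by (auto simp: Suc_diff_le)
    have Hk: "H (m - k) k (s k) \<in> carrier (X (m - k) k)" using H_closed[OF sk] .
    have eqk: "x (m - k, k) = H (m - k) k (s k) \<oplus>\<^bsub>X (m - k) k\<^esub> V (m - k) k w"
      using xk[OF km] Hk unfolding w(2) res_def by (simp add: Xk.minus_eq Xk.a_lcomm Xk.r_neg)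
    \<comment> \<open>V x(i, k + 1) = -H x(i + 1, k) = -H V w, the second equality because H H
      vanishes on \<open>s k\<close>, and -H V w = V H w by anticommutativity; so V kills x(i, k +
      1) - H w.\<close>
    have "vertical_cycle (m - Suc k) (Suc k) (res (Suc k) w)" if k: "Suc k \<le> m"
    proof -
      define i where "i = m - Suc k"
      have i: "m - k = Suc i" "Suc (i + k) = m" using k by (auto simp: i_def)
      interpret Xi: abelian_group "X i k" by (rule X_abelian)
      have w': "w \<in> carrier (X (Suc i) (Suc k))" and sk': "s k \<in> carrier (X (Suc (Suc i)) k)" using w(1) sk i by simp_all
      have xc: "x (i, Suc k) \<in> carrier (X i (Suc k))" "x (Suc i, k) \<in> carrier (X (Suc i) k)"
        using total_closed[OF x] i by auto
      let ?v = "V i k (x (i, Suc k))" and ?h = "H i k (x (Suc i, k))" and ?u = "V i k (H i (Suc k) w)" and ?t = "H i k (V (Suc i) k w)"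
      have cl: "?v \<in> carrier (X i k)" "?h \<in> carrier (X i k)" "?u \<in> carrier (X i k)" "?t \<in> carrier (X i k)"
        using xc w' by (auto intro!: V_closed H_closed)
      have "?h = H i k (H (Suc i) k (s k) \<oplus>\<^bsub>X (Suc i) k\<^esub> V (Suc i) k w)"
        using eqk unfolding i(1) by simp
      also have "\<dots> = \<zero>\<^bsub>X i k\<^esub> \<oplus>\<^bsub>X i k\<^esub> ?t"
        using additive_add[OF H_additive H_closed[OF sk'] V_closed[OF w']] HH[OF sk'] by simp
      finally have ht: "?h = ?t" using cl by simp
      have "?v = \<ominus>\<^bsub>X i k\<^esub> ?h" using cycle[OF i(2)] cl Xi.minus_equality[of ?v ?h] by (simp add: Xi.a_comm)
      moreover have "?u = \<ominus>\<^bsub>X i k\<^esub> ?t" using HV[OF w'] cl Xi.minus_equality[of ?u ?t] by (simp add: Xi.a_comm)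
      ultimately have uv: "?v = ?u" using ht by simp
      have "V i k (res (Suc k) w) = ?v \<ominus>\<^bsub>X i k\<^esub> ?u"
        using additive_minus[OF X_abelian X_abelian V_additive xc(1) H_closed[OF w']] by (simp add: res_def i_def)
      then have "V i k (res (Suc k) w) = \<zero>\<^bsub>X i k\<^esub>" using uv cl by (simp add: Xi.minus_eq Xi.r_neg)
      moreover have "res (Suc k) w \<in> carrier (X i (Suc k))"
        using rc[OF k, of w] w(1) by (simp add: i_def)
      ultimately show ?thesis by (simp add: vertical_cycle_def i_def)
    qed
    moreover have "(s(Suc k := w)) j \<in> carrier (X (Suc m - j) j)" if "j \<le> Suc k" for j
      using that s(1) w(1) by (cases "j = Suc k") auto
    moreover have "x (m - j, j) = H (m - j) j ((s(Suc k := w)) j) \<oplus>\<^bsub>X (m - j) j\<^esub> V (m - j) j ((s(Suc k := w)) (Suc j))"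
      if "j < Suc k" for j
      using that s(2) eqk by (cases "j = k") auto
    ultimately show ?case by (intro exI[of _ "s(Suc k := w)"]) auto
  qed
  from this[of "Suc m"] obtain s where s: "\<And>j. j \<le> Suc m \<Longrightarrow> s j \<in> carrier (X (Suc m - j) j)"
    "\<And>j. j < Suc m \<Longrightarrow> x (m - j, j) = H (m - j) j (s j) \<oplus>\<^bsub>X (m - j) j\<^esub> V (m - j) j (s (Suc j))" by auto
  let ?y = "\<lambda>(i, j) \<in> {(i, j). i + j = Suc m}. s j"
  have y: "?y \<in> total (Suc m)"
  proof (rule totalI)
    fix i j assume "i + j = Suc m"
    then have "i = Suc m - j" "j \<le> Suc m" by auto
    then show "?y (i, j) \<in> carrier (X i j)" using s(1)[of j] by auto
  qed auto
  have "diff m ?y = x"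
  proof (rule total_eqI[OF diff_closed[OF y] x])
    fix i j assume ij: "i + j = m"
    then have "i = m - j" "j < Suc m" by auto
    then show "diff m ?y (i, j) = x (i, j)" using s(2)[of j] ij by (simp add: diff_eq)
  qed
  with y show ?thesis by blast
qed

lemma total_exact:
  "diff (Suc n) ` total (Suc (Suc n)) = {x \<in> total (Suc n). diff n x = (\<lambda>(i, j) \<in> {(i, j). i + j = n}. \<zero>\<^bsub>X i j\<^esub>)}"
proof (intro equalityI subsetI)
  fix x assume "x \<in> diff (Suc n) ` total (Suc (Suc n))"
  then obtain y where y: "y \<in> total (Suc (Suc n))" "x = diff (Suc n) y" by auto
  have "diff n (diff (Suc n) y) = (\<lambda>(i, j) \<in> {(i, j). i + j = n}. \<zero>\<^bsub>X i j\<^esub>)"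
  proof (rule extensionalityI[of _ "{(i, j). i + j = n}"])
    fix k assume "k \<in> {(i, j). i + j = n}"
    then obtain i j where k: "k = (i, j)" "i + j = n" by auto
    then show "diff n (diff (Suc n) y) k = (\<lambda>(i, j) \<in> {(i, j). i + j = n}. \<zero>\<^bsub>X i j\<^esub>) k"
      using diff_diff[OF y(1) k(2)] by simp
  qed (simp_all add: diff_def)
  then show "x \<in> {x \<in> total (Suc n). diff n x = (\<lambda>(i, j) \<in> {(i, j). i + j = n}. \<zero>\<^bsub>X i j\<^esub>)}"
    using y diff_closed by simp
next
  fix x assume "x \<in> {x \<in> total (Suc n). diff n x = (\<lambda>(i, j) \<in> {(i, j). i + j = n}. \<zero>\<^bsub>X i j\<^esub>)}"
  then have x: "x \<in> total (Suc n)" and 0: "diff n x = (\<lambda>(i, j) \<in> {(i, j). i + j = n}. \<zero>\<^bsub>X i j\<^esub>)" by auto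
  have "\<exists>y \<in> total (Suc (Suc n)). diff (Suc n) y = x"
  proof (rule boundary_ex[OF x])
    fix i j assume "Suc (i + j) = Suc n"
    then have ij: "i + j = n" by simp
    show "H i j (x (Suc i, j)) \<oplus>\<^bsub>X i j\<^esub> V i j (x (i, Suc j)) = \<zero>\<^bsub>X i j\<^esub>"
      using fun_cong[OF 0, of "(i, j)"] ij by (simp add: diff_eq)
  qed simp
  then show "x \<in> diff (Suc n) ` total (Suc (Suc n))" by auto
qed

lemma total_augmentation_exact:
  "diff 0 ` total (Suc 0) = {x \<in> total 0. \<epsilon> (\<eta> 0 (x (0, 0))) = \<zero>\<^bsub>N\<^esub>}"
proof (intro equalityI subsetI)
  fix x assume "x \<in> diff 0 ` total (Suc 0)"
  then obtain y where y: "y \<in> total (Suc 0)" "x = diff 0 y" by auto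
  interpret P: abelian_group "P 0" by (rule P_abelian)
  have c: "y (Suc 0, 0) \<in> carrier (X (Suc 0) 0)" "y (0, Suc 0) \<in> carrier (X 0 (Suc 0))" using total_closed[OF y(1)] by auto
  have "\<eta> 0 (x (0, 0)) = d 0 (\<eta> (Suc 0) (y (Suc 0, 0)))"
    using c y additive_add[OF \<eta>_additive H_closed[OF c(1)] V_closed[OF c(2)]] \<eta>_V[OF c(2)] \<eta>H[OF c(1)]
      additive_closed[OF d_additive \<eta>_closed[OF c(1)]]
    by (simp add: diff_eq)
  moreover have "\<epsilon> (d 0 (\<eta> (Suc 0) (y (Suc 0, 0)))) = \<zero>\<^bsub>N\<^esub>" using d_\<epsilon>_exact \<eta>_closed[OF c(1)] by blast
  ultimately show "x \<in> {x \<in> total 0. \<epsilon> (\<eta> 0 (x (0, 0))) = \<zero>\<^bsub>N\<^esub>}" using diff_closed y by simp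
next
  fix x assume "x \<in> {x \<in> total 0. \<epsilon> (\<eta> 0 (x (0, 0))) = \<zero>\<^bsub>N\<^esub>}"
  then have "\<exists>y \<in> total (Suc 0). diff 0 y = x" by (intro boundary_ex) auto
  then show "x \<in> diff 0 ` total (Suc 0)" by auto
qed

lemma total_augmentation_surj: "(\<lambda>x. \<epsilon> (\<eta> 0 (x (0, 0)))) ` total 0 = carrier N"
proof (intro equalityI subsetI)
  fix x assume "x \<in> (\<lambda>x. \<epsilon> (\<eta> 0 (x (0, 0)))) ` total 0"
  then show "x \<in> carrier N" by (auto intro!: additive_closed[OF \<epsilon>_additive] \<eta>_closed total_closed)
next
  fix x assume "x \<in> carrier N"
  then obtain q where "q \<in> carrier (P 0)" "x = \<epsilon> q" using \<epsilon>_surj by auto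
  moreover from this obtain y where "y \<in> carrier (X 0 0)" "q = \<eta> 0 y" using \<eta>_surj[of 0] by auto
  ultimately show "x \<in> (\<lambda>x. \<epsilon> (\<eta> 0 (x (0, 0)))) ` total 0"
    by (intro image_eqI[of _ _ "\<lambda>(i, j) \<in> {(i, j). i + j = 0}. y"]) (auto intro!: totalI)
qed

end

section \<open>Skew group algebras\<close>

lemma group_algebra_simps [simp]:
  "carrier (group_algebra K G) = carrier G \<rightarrow>\<^sub>E carrier K"
  "\<zero>\<^bsub>group_algebra K G\<^esub> = (\<lambda>x \<in> carrier G. \<zero>\<^bsub>K\<^esub>)"
  "\<one>\<^bsub>group_algebra K G\<^esub> = group_elt K G \<one>\<^bsub>G\<^esub>"
  by (simp_all add: group_algebra_def group_elt_def)

context group_acting_on_algebra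
begin

abbreviation (input) "A\<^sub>r \<equiv> skew_as_A_kG S G act"
abbreviation (input) "A\<^sub>l \<equiv> skew_as_S_A K S G act"

text \<open>The element s \<otimes> g of A. These elements generate A additively, and identities in
  A are checked on them.\<close>

definition skew_elt :: "'g \<Rightarrow> 's \<Rightarrow> 'g \<Rightarrow> 's"
  where "skew_elt g s = (\<lambda>x \<in> carrier G. if x = g then s else \<zero>\<^bsub>S\<^esub>)"

lemma A_simps [simp]:
  "carrier A = carrier G \<rightarrow>\<^sub>E carrier S" "\<zero>\<^bsub>A\<^esub> = (\<lambda>x \<in> carrier G. \<zero>\<^bsub>S\<^esub>)" "\<one>\<^bsub>A\<^esub> = skew_elt \<one>\<^bsub>G\<^esub> \<one>\<^bsub>S\<^esub>"
  by (simp_all add: skew_group_algebra_def skew_elt_def)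

lemma A_add: "x \<oplus>\<^bsub>A\<^esub> y = (\<lambda>g \<in> carrier G. x g \<oplus>\<^bsub>S\<^esub> y g)"
  and A_smult: "c \<odot>\<^bsub>A\<^esub> x = (\<lambda>g \<in> carrier G. c \<odot>\<^bsub>S\<^esub> x g)"
  by (simp_all add: skew_group_algebra_def)

lemmas G_closed = group.inv_closed[OF group_axioms] monoid.m_closed[OF group.is_monoid[OF group_axioms]]
  monoid.one_closed[OF group.is_monoid[OF group_axioms]]
lemmas G_assoc = monoid.m_assoc[OF group.is_monoid[OF group_axioms]]
lemmas S_ring = L.ring_axioms

lemma act_act: "\<lbrakk>g \<in> carrier G; h \<in> carrier G; s \<in> carrier S\<rbrakk> \<Longrightarrow> act (g \<otimes>\<^bsub>G\<^esub> h) s = act g (act h s)"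
  using composition_rule by simp

lemma act_one: "s \<in> carrier S \<Longrightarrow> act \<one>\<^bsub>G\<^esub> s = s"
  using id_eq_one by (metis restrict_apply)

lemma act_mult: "\<lbrakk>g \<in> carrier G; s \<in> carrier S; t \<in> carrier S\<rbrakk> \<Longrightarrow> act g (s \<otimes>\<^bsub>S\<^esub> t) = act g s \<otimes>\<^bsub>S\<^esub> act g t"
  using ring_hom_mult[OF act_ring_hom] by simp

lemma act_add: "\<lbrakk>g \<in> carrier G; s \<in> carrier S; t \<in> carrier S\<rbrakk> \<Longrightarrow> act g (s \<oplus>\<^bsub>S\<^esub> t) = act g s \<oplus>\<^bsub>S\<^esub> act g t"
  using ring_hom_add[OF act_ring_hom] by simp

lemma act_ring_one: "g \<in> carrier G \<Longrightarrow> act g \<one>\<^bsub>S\<^esub> = \<one>\<^bsub>S\<^esub>"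
  using ring_hom_one[OF act_ring_hom] by simp

lemma act_additive: "g \<in> carrier G \<Longrightarrow> additive S S (act g)"
  by (intro additiveI act_closed act_add)

lemma act_inv: "\<lbrakk>g \<in> carrier G; s \<in> carrier S\<rbrakk> \<Longrightarrow> act g (act (inv\<^bsub>G\<^esub> g) s) = s"
  and act_inv': "\<lbrakk>g \<in> carrier G; s \<in> carrier S\<rbrakk> \<Longrightarrow> act (inv\<^bsub>G\<^esub> g) (act g s) = s"
  by (simp_all add: act_act[symmetric] group.inv_closed[OF group_axioms] group.r_inv[OF group_axioms]
      group.l_inv[OF group_axioms] act_one)

lemma skew_elt_closed: "s \<in> carrier S \<Longrightarrow> skew_elt g s \<in> carrier A"
  by (auto simp: skew_elt_def)

lemma A_copower: "copower A S (carrier G) skew_elt (\<lambda>g a. a g)"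
  unfolding skew_elt_def[abs_def]
  by (rule copower_functions[OF finite_group S_ab abelian_group_A]) (simp_all add: A_add)

lemma skew_elt_additive: "g \<in> carrier G \<Longrightarrow> additive S A (skew_elt g)"
  using copower.inc_additive[OF A_copower] .

lemma skew_elt_mult:
  "\<lbrakk>g \<in> carrier G; h \<in> carrier G; s \<in> carrier S; t \<in> carrier S\<rbrakk> \<Longrightarrow>
    skew_elt g s \<otimes>\<^bsub>A\<^esub> skew_elt h t = skew_elt (g \<otimes>\<^bsub>G\<^esub> h) (s \<otimes>\<^bsub>S\<^esub> act g t)"
  using skew_mult[of s t g h]
  by (simp add: skew_tensor_elt skew_elt_def G_closed act_closed)

lemma A_mult_apply:
  "x \<in> carrier G \<Longrightarrow> (a \<otimes>\<^bsub>A\<^esub> b) x = (\<Oplus>\<^bsub>S\<^esub>g \<in> carrier G. a g \<otimes>\<^bsub>S\<^esub> act g (b (inv\<^bsub>G\<^esub> g \<otimes>\<^bsub>G\<^esub> x)))"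
  by (simp add: skew_group_algebra_def)

lemma A_apply: "a \<in> carrier A \<Longrightarrow> g \<in> carrier G \<Longrightarrow> a g \<in> carrier S" by auto

lemma A_mult_closed: "\<lbrakk>a \<in> carrier A; b \<in> carrier A\<rbrakk> \<Longrightarrow> a \<otimes>\<^bsub>A\<^esub> b \<in> carrier A"
  by (auto simp: skew_group_algebra_def intro!: abelian_monoid.finsum_closed[OF abelian_group.axioms(1)[OF S_ab]]
      L.m_closed act_closed G_closed)

lemma A_mult_additive_left: "b \<in> carrier A \<Longrightarrow> additive A A (\<lambda>a. a \<otimes>\<^bsub>A\<^esub> b)"
proof (rule additiveI)
  fix a a' assume b: "b \<in> carrier A" and a: "a \<in> carrier A" "a' \<in> carrier A"
  have "((a \<oplus>\<^bsub>A\<^esub> a') \<otimes>\<^bsub>A\<^esub> b) x = (a \<otimes>\<^bsub>A\<^esub> b \<oplus>\<^bsub>A\<^esub> a' \<otimes>\<^bsub>A\<^esub> b) x" if x: "x \<in> carrier G" for x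
  proof -
    have *: "additive S S (\<lambda>s. s \<otimes>\<^bsub>S\<^esub> t)" if "t \<in> carrier S" for t
      by (rule additiveI) (use that L.l_distr in auto)
    have "additive A S (\<lambda>a. a g \<otimes>\<^bsub>S\<^esub> act g (b (inv\<^bsub>G\<^esub> g \<otimes>\<^bsub>G\<^esub> x)))" if g: "g \<in> carrier G" for g
    proof -
      have gx: "inv\<^bsub>G\<^esub> g \<otimes>\<^bsub>G\<^esub> x \<in> carrier G" using g x G_closed by auto
      show ?thesis
        by (rule additive_comp[OF copower.prj_additive[OF A_copower g] *[OF act_closed[OF g A_apply[OF b gx]]]])
    qed
    then have "additive A S (\<lambda>a. \<Oplus>\<^bsub>S\<^esub>g \<in> carrier G. a g \<otimes>\<^bsub>S\<^esub> act g (b (inv\<^bsub>G\<^esub> g \<otimes>\<^bsub>G\<^esub> x)))"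
      by (rule finsum_additive[OF S_ab])
    from additive_add[OF this a] show ?thesis by (simp add: A_mult_apply A_add x)
  qed
  then show "(a \<oplus>\<^bsub>A\<^esub> a') \<otimes>\<^bsub>A\<^esub> b = a \<otimes>\<^bsub>A\<^esub> b \<oplus>\<^bsub>A\<^esub> a' \<otimes>\<^bsub>A\<^esub> b"
    by (intro extensionalityI[of _ "carrier G"]) (auto simp: skew_group_algebra_def)
qed (rule A_mult_closed)

lemma A_mult_additive_right: "a \<in> carrier A \<Longrightarrow> additive A A (\<lambda>b. a \<otimes>\<^bsub>A\<^esub> b)"
proof (rule additiveI)
  fix b b' assume a: "a \<in> carrier A" and b: "b \<in> carrier A" "b' \<in> carrier A"
  have "(a \<otimes>\<^bsub>A\<^esub> (b \<oplus>\<^bsub>A\<^esub> b')) x = (a \<otimes>\<^bsub>A\<^esub> b \<oplus>\<^bsub>A\<^esub> a \<otimes>\<^bsub>A\<^esub> b') x" if x: "x \<in> carrier G" for x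
  proof -
    have *: "additive S S (\<lambda>t. s \<otimes>\<^bsub>S\<^esub> t)" if "s \<in> carrier S" for s
      by (rule additiveI) (use that L.r_distr in auto)
    have "additive A S (\<lambda>b. a g \<otimes>\<^bsub>S\<^esub> act g (b (inv\<^bsub>G\<^esub> g \<otimes>\<^bsub>G\<^esub> x)))" if g: "g \<in> carrier G" for g
    proof -
      have gx: "inv\<^bsub>G\<^esub> g \<otimes>\<^bsub>G\<^esub> x \<in> carrier G" using g x G_closed by auto
      show ?thesis
        by (rule additive_comp[OF additive_comp[OF copower.prj_additive[OF A_copower gx] act_additive[OF g]] *[OF A_apply[OF a g]]])
    qed
    then have "additive A S (\<lambda>b. \<Oplus>\<^bsub>S\<^esub>g \<in> carrier G. a g \<otimes>\<^bsub>S\<^esub> act g (b (inv\<^bsub>G\<^esub> g \<otimes>\<^bsub>G\<^esub> x)))"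
      by (rule finsum_additive[OF S_ab])
    from additive_add[OF this b] show ?thesis by (simp add: A_mult_apply A_add x)
  qed
  then show "a \<otimes>\<^bsub>A\<^esub> (b \<oplus>\<^bsub>A\<^esub> b') = a \<otimes>\<^bsub>A\<^esub> b \<oplus>\<^bsub>A\<^esub> a \<otimes>\<^bsub>A\<^esub> b'"
    by (intro extensionalityI[of _ "carrier G"]) (auto simp: skew_group_algebra_def)
qed (rule A_mult_closed)

lemma A_eqI:
  assumes "abelian_group P" "additive A P f" "additive A P f'"
    "\<And>g s. \<lbrakk>g \<in> carrier G; s \<in> carrier S\<rbrakk> \<Longrightarrow> f (skew_elt g s) = f' (skew_elt g s)" "a \<in> carrier A"
  shows "f a = f' a"
  using copower.hom_eq[OF A_copower assms] by simp

text \<open>The product is additive in each variable, so associativity and the unit laws are checked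
  on elements s \<otimes> g, where they follow from (r \<otimes> g)(s \<otimes> h) = r (^g s)
  \<otimes> gh and the properties of a group action.\<close>

lemma A_ring: "ring A"
proof (rule ringI[OF abelian_group_A monoidI])
  show one: "\<one>\<^bsub>A\<^esub> \<in> carrier A" by (simp add: skew_elt_closed del: A_simps(1))
  fix a b c assume a: "a \<in> carrier A" and b: "b \<in> carrier A" and c: "c \<in> carrier A"
  note [simp del] = A_simps(1)
  show "a \<otimes>\<^bsub>A\<^esub> b \<otimes>\<^bsub>A\<^esub> c = a \<otimes>\<^bsub>A\<^esub> (b \<otimes>\<^bsub>A\<^esub> c)"
  proof (rule A_eqI[OF abelian_group_A _ _ _ a])
    show "additive A A (\<lambda>a. a \<otimes>\<^bsub>A\<^esub> b \<otimes>\<^bsub>A\<^esub> c)"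
      by (rule additive_comp[OF A_mult_additive_left[OF b] A_mult_additive_left[OF c]])
    show "additive A A (\<lambda>a. a \<otimes>\<^bsub>A\<^esub> (b \<otimes>\<^bsub>A\<^esub> c))" by (rule A_mult_additive_left[OF A_mult_closed[OF b c]])
    fix g s assume g: "g \<in> carrier G" and s: "s \<in> carrier S"
    note e = skew_elt_closed[OF s, of g]
    show "skew_elt g s \<otimes>\<^bsub>A\<^esub> b \<otimes>\<^bsub>A\<^esub> c = skew_elt g s \<otimes>\<^bsub>A\<^esub> (b \<otimes>\<^bsub>A\<^esub> c)"
    proof (rule A_eqI[OF abelian_group_A _ _ _ b])
      show "additive A A (\<lambda>b. skew_elt g s \<otimes>\<^bsub>A\<^esub> b \<otimes>\<^bsub>A\<^esub> c)"
        by (rule additive_comp[OF A_mult_additive_right[OF e] A_mult_additive_left[OF c]])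
      show "additive A A (\<lambda>b. skew_elt g s \<otimes>\<^bsub>A\<^esub> (b \<otimes>\<^bsub>A\<^esub> c))"
        by (rule additive_comp[OF A_mult_additive_left[OF c] A_mult_additive_right[OF e]])
      fix h t assume h: "h \<in> carrier G" and t: "t \<in> carrier S"
      note e' = skew_elt_closed[OF t, of h]
      show "skew_elt g s \<otimes>\<^bsub>A\<^esub> skew_elt h t \<otimes>\<^bsub>A\<^esub> c = skew_elt g s \<otimes>\<^bsub>A\<^esub> (skew_elt h t \<otimes>\<^bsub>A\<^esub> c)"
      proof (rule A_eqI[OF abelian_group_A _ _ _ c])
        show "additive A A (\<lambda>c. skew_elt g s \<otimes>\<^bsub>A\<^esub> skew_elt h t \<otimes>\<^bsub>A\<^esub> c)"
          by (rule A_mult_additive_right[OF A_mult_closed[OF e e']])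
        show "additive A A (\<lambda>c. skew_elt g s \<otimes>\<^bsub>A\<^esub> (skew_elt h t \<otimes>\<^bsub>A\<^esub> c))"
          by (rule additive_comp[OF A_mult_additive_right[OF e'] A_mult_additive_right[OF e]])
      qed (use g s h t in \<open>simp add: skew_elt_mult G_closed act_closed act_act act_mult L.m_assoc G_assoc\<close>)
    qed
  qed
next
  fix a assume a: "a \<in> carrier A"
  have one: "skew_elt \<one>\<^bsub>G\<^esub> \<one>\<^bsub>S\<^esub> \<in> carrier A" by (rule skew_elt_closed) simp
  note l = group.is_monoid[OF group_axioms, THEN monoid.l_one] group.is_monoid[OF group_axioms, THEN monoid.r_one]
  show "\<one>\<^bsub>A\<^esub> \<otimes>\<^bsub>A\<^esub> a = a" unfolding A_simps(3)
    by (rule A_eqI[OF abelian_group_A A_mult_additive_right[OF one] additive_id _ a])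
      (simp add: skew_elt_mult act_one act_closed G_closed l)
  show "a \<otimes>\<^bsub>A\<^esub> \<one>\<^bsub>A\<^esub> = a" unfolding A_simps(3)
    by (rule A_eqI[OF abelian_group_A A_mult_additive_left[OF one] additive_id _ a])
      (simp add: skew_elt_mult act_ring_one G_closed l)
qed (use A_mult_closed additive_add[OF A_mult_additive_left] additive_add[OF A_mult_additive_right] in blast)+

lemma A_algebra: "algebra_over_field K A"
proof (intro algebra_over_field.intro algebra_over_field_axioms.intro A_ring field_axioms)
  show m: "module K A"
  proof (rule moduleI[OF K_cring abelian_group_A])
    fix c x assume "c \<in> carrier K" "x \<in> carrier A"
    then show "c \<odot>\<^bsub>A\<^esub> x \<in> carrier A" by (auto simp: A_smult)
  next
    fix c d x assume "c \<in> carrier K" "d \<in> carrier K" "x \<in> carrier A"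
    then show "(c \<oplus>\<^bsub>K\<^esub> d) \<odot>\<^bsub>A\<^esub> x = c \<odot>\<^bsub>A\<^esub> x \<oplus>\<^bsub>A\<^esub> d \<odot>\<^bsub>A\<^esub> x"
      by (auto simp: A_smult A_add fun_eq_iff intro!: smult_l_distr)
  next
    fix c x y assume "c \<in> carrier K" "x \<in> carrier A" "y \<in> carrier A"
    then show "c \<odot>\<^bsub>A\<^esub> (x \<oplus>\<^bsub>A\<^esub> y) = c \<odot>\<^bsub>A\<^esub> x \<oplus>\<^bsub>A\<^esub> c \<odot>\<^bsub>A\<^esub> y"
      by (auto simp: A_smult A_add fun_eq_iff intro!: smult_r_distr)
  next
    fix c d x assume "c \<in> carrier K" "d \<in> carrier K" "x \<in> carrier A"
    then show "(c \<otimes>\<^bsub>K\<^esub> d) \<odot>\<^bsub>A\<^esub> x = c \<odot>\<^bsub>A\<^esub> (d \<odot>\<^bsub>A\<^esub> x)"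
      by (auto simp: A_smult A_add fun_eq_iff intro!: smult_assoc1)
  next
    fix x assume "x \<in> carrier A"
    then show "\<one>\<^bsub>K\<^esub> \<odot>\<^bsub>A\<^esub> x = x"
      by (auto simp: A_smult fun_eq_iff PiE_def extensional_def Pi_def)
  qed
  fix c x y assume c: "c \<in> carrier K" and x: "x \<in> carrier A" and y: "y \<in> carrier A"
  have sm: "additive A A (smult A c)"
    by (rule additiveI; rule module.smult_closed[OF m c] module.smult_r_distr[OF m c]; assumption)
  have se: "c \<odot>\<^bsub>A\<^esub> skew_elt g s = skew_elt g (c \<odot>\<^bsub>S\<^esub> s)" if "g \<in> carrier G" "s \<in> carrier S" for g s
    using that c by (auto simp: A_smult skew_elt_def fun_eq_iff)
  show "(c \<odot>\<^bsub>A\<^esub> x) \<otimes>\<^bsub>A\<^esub> y = c \<odot>\<^bsub>A\<^esub> (x \<otimes>\<^bsub>A\<^esub> y)"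
  proof (rule A_eqI[OF abelian_group_A additive_comp[OF sm A_mult_additive_left[OF y]] additive_comp[OF A_mult_additive_left[OF y] sm] _ x])
    fix g s assume gs: "g \<in> carrier G" "s \<in> carrier S"
    have cs: "c \<odot>\<^bsub>S\<^esub> s \<in> carrier S" using c gs by simp
    show "c \<odot>\<^bsub>A\<^esub> skew_elt g s \<otimes>\<^bsub>A\<^esub> y = c \<odot>\<^bsub>A\<^esub> (skew_elt g s \<otimes>\<^bsub>A\<^esub> y)"
      unfolding se[OF gs]
      by (rule A_eqI[OF abelian_group_A A_mult_additive_right[OF skew_elt_closed[OF cs]]
            additive_comp[OF A_mult_additive_right[OF skew_elt_closed[OF gs(2)]] sm] _ y])
        (use gs c in \<open>simp add: skew_elt_mult se G_closed act_closed smult_mult_left\<close>)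
  qed
  show "x \<otimes>\<^bsub>A\<^esub> (c \<odot>\<^bsub>A\<^esub> y) = c \<odot>\<^bsub>A\<^esub> (x \<otimes>\<^bsub>A\<^esub> y)"
  proof (rule A_eqI[OF abelian_group_A additive_comp[OF sm A_mult_additive_right[OF x]] additive_comp[OF A_mult_additive_right[OF x] sm] _ y])
    fix g s assume gs: "g \<in> carrier G" "s \<in> carrier S"
    have cs: "c \<odot>\<^bsub>S\<^esub> s \<in> carrier S" using c gs by simp
    show "x \<otimes>\<^bsub>A\<^esub> (c \<odot>\<^bsub>A\<^esub> skew_elt g s) = c \<odot>\<^bsub>A\<^esub> (x \<otimes>\<^bsub>A\<^esub> skew_elt g s)"
      unfolding se[OF gs]
      by (rule A_eqI[OF abelian_group_A A_mult_additive_left[OF skew_elt_closed[OF cs]]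
            additive_comp[OF A_mult_additive_left[OF skew_elt_closed[OF gs(2)]] sm] _ x])
        (use gs c in \<open>simp add: skew_elt_mult se G_closed act_closed act_linear smult_mult_right\<close>)
  qed
qed

lemma A_smult_elt: "\<lbrakk>c \<in> carrier K; g \<in> carrier G; s \<in> carrier S\<rbrakk> \<Longrightarrow> c \<odot>\<^bsub>A\<^esub> skew_elt g s = skew_elt g (c \<odot>\<^bsub>S\<^esub> s)"
  by (auto simp: A_smult skew_elt_def fun_eq_iff)

lemma group_elt_closed: "group_elt K G g \<in> carrier kG"
  by (auto simp: group_elt_def)

lemma kG_add: "x \<oplus>\<^bsub>kG\<^esub> y = (\<lambda>g \<in> carrier G. x g \<oplus>\<^bsub>K\<^esub> y g)"
  and kG_smult: "c \<odot>\<^bsub>kG\<^esub> x = (\<lambda>g \<in> carrier G. c \<otimes>\<^bsub>K\<^esub> x g)"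
  by (simp_all add: group_algebra_def)

lemma kG_copower: "copower kG K (carrier G) (\<lambda>g c. c \<odot>\<^bsub>kG\<^esub> group_elt K G g) (\<lambda>g b. b g)"
proof -
  have "copower kG K (carrier G) (\<lambda>i n. \<lambda>j \<in> carrier G. if j = i then n else \<zero>\<^bsub>K\<^esub>) (\<lambda>g b. b g)"
    by (rule copower_functions[OF finite_group K_ab abelian_group_kG]) (simp_all add: kG_add)
  then show ?thesis
  proof (rule copower_cong)
    fix i n assume "i \<in> carrier G" "n \<in> carrier K"
    then show "(\<lambda>j \<in> carrier G. if j = i then n else \<zero>\<^bsub>K\<^esub>) = n \<odot>\<^bsub>kG\<^esub> group_elt K G i"
      using cring.cring_simprules(12)[OF K_cring] K_ring
      by (auto simp: kG_smult group_elt_def fun_eq_iff ring.ring_simprules semiring.semiring_simprules)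
  qed
qed

text \<open>A module over A amounts to an action of S and an action of G with g (s t) = (^g s)(g t).
  Stated for bare functions \<open>sa\<close> and \<open>ga\<close>, this yields the left action on
  D_j \<otimes> A. The last conclusion is the formula on generators, from which the unit law and
  associativity follow.\<close>

lemma skew_left_action:
  assumes T: "abelian_group T"
    and s_add: "\<And>s. s \<in> carrier S \<Longrightarrow> additive T T (sa s)" "\<And>t. t \<in> carrier T \<Longrightarrow> additive S T (\<lambda>s. sa s t)"
    and s_mult: "\<And>s s' t. \<lbrakk>s \<in> carrier S; s' \<in> carrier S; t \<in> carrier T\<rbrakk> \<Longrightarrow> sa (s \<otimes>\<^bsub>S\<^esub> s') t = sa s (sa s' t)"
    and s_one: "\<And>t. t \<in> carrier T \<Longrightarrow> sa \<one>\<^bsub>S\<^esub> t = t"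
    and g_add: "\<And>g. g \<in> carrier G \<Longrightarrow> additive T T (ga g)"
    and g_mult: "\<And>g h t. \<lbrakk>g \<in> carrier G; h \<in> carrier G; t \<in> carrier T\<rbrakk> \<Longrightarrow> ga (g \<otimes>\<^bsub>G\<^esub> h) t = ga g (ga h t)"
    and g_one: "\<And>t. t \<in> carrier T \<Longrightarrow> ga \<one>\<^bsub>G\<^esub> t = t"
    and gs: "\<And>g s t. \<lbrakk>g \<in> carrier G; s \<in> carrier S; t \<in> carrier T\<rbrakk> \<Longrightarrow> ga g (sa s t) = sa (act g s) (ga g t)"
  defines "l \<equiv> \<lambda>a t. \<Oplus>\<^bsub>T\<^esub>g \<in> carrier G. sa (a g) (ga g t)"
  shows "\<And>a. a \<in> carrier A \<Longrightarrow> additive T T (l a)" "\<And>t. t \<in> carrier T \<Longrightarrow> additive A T (\<lambda>a. l a t)"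
    "\<And>a b t. \<lbrakk>a \<in> carrier A; b \<in> carrier A; t \<in> carrier T\<rbrakk> \<Longrightarrow> l (a \<otimes>\<^bsub>A\<^esub> b) t = l a (l b t)"
    "\<And>t. t \<in> carrier T \<Longrightarrow> l \<one>\<^bsub>A\<^esub> t = t"
    "\<And>g s t. \<lbrakk>g \<in> carrier G; s \<in> carrier S; t \<in> carrier T\<rbrakk> \<Longrightarrow> l (skew_elt g s) t = sa s (ga g t)"
proof -
  interpret T: abelian_group T by fact
  note [simp del] = A_simps(1)
  show l1: "additive T T (l a)" if "a \<in> carrier A" for a
    unfolding l_def by (intro finsum_additive[OF T] additive_comp[OF g_add s_add(1)] A_apply[OF that])
  show l2: "additive A T (\<lambda>a. l a t)" if "t \<in> carrier T" for t
    unfolding l_def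
    by (intro finsum_additive[OF T] additive_comp[OF copower.prj_additive[OF A_copower]
          s_add(2)[OF additive_closed[OF g_add that]]])
  have z: "sa \<zero>\<^bsub>S\<^esub> t = \<zero>\<^bsub>T\<^esub>" if "t \<in> carrier T" for t
    using additive_zero[OF S_ab T s_add(2)[OF that]] .
  show le: "l (skew_elt g s) t = sa s (ga g t)" if "g \<in> carrier G" "s \<in> carrier S" "t \<in> carrier T" for g s t
  proof -
    have c: "sa s' (ga h t) \<in> carrier T" if "h \<in> carrier G" "s' \<in> carrier S" for h s'
      using additive_closed[OF s_add(1) additive_closed[OF g_add]] that \<open>t \<in> carrier T\<close> by blast
    have "l (skew_elt g s) t = sa (skew_elt g s g) (ga g t)"
      unfolding l_def
      by (rule finsum_delta[OF T.abelian_monoid_axioms finite_group])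
        (use that in \<open>auto simp: skew_elt_def z additive_closed[OF g_add] intro!: c\<close>)
    then show ?thesis using that by (simp add: skew_elt_def)
  qed
  show "l \<one>\<^bsub>A\<^esub> t = t" if "t \<in> carrier T" for t
    using le[of "\<one>\<^bsub>G\<^esub>" "\<one>\<^bsub>S\<^esub>" t] that by (simp add: g_one s_one G_closed)
  show "l (a \<otimes>\<^bsub>A\<^esub> b) t = l a (l b t)" if a: "a \<in> carrier A" and b: "b \<in> carrier A" and t: "t \<in> carrier T" for a b t
  proof (rule A_eqI[OF T _ _ _ a])
    show "additive A T (\<lambda>a. l (a \<otimes>\<^bsub>A\<^esub> b) t)" by (rule additive_comp[OF A_mult_additive_left[OF b] l2[OF t]])
    show "additive A T (\<lambda>a. l a (l b t))" by (rule l2[OF additive_closed[OF l1[OF b] t]])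
    fix g s assume g: "g \<in> carrier G" and s: "s \<in> carrier S"
    note e = skew_elt_closed[OF s, of g]
    show "l (skew_elt g s \<otimes>\<^bsub>A\<^esub> b) t = l (skew_elt g s) (l b t)"
    proof (rule A_eqI[OF T _ _ _ b])
      show "additive A T (\<lambda>b. l (skew_elt g s \<otimes>\<^bsub>A\<^esub> b) t)"
        by (rule additive_comp[OF A_mult_additive_right[OF e] l2[OF t]])
      show "additive A T (\<lambda>b. l (skew_elt g s) (l b t))" by (rule additive_comp[OF l2[OF t] l1[OF e]])
      fix h s' assume "h \<in> carrier G" "s' \<in> carrier S"
      then show "l (skew_elt g s \<otimes>\<^bsub>A\<^esub> skew_elt h s') t = l (skew_elt g s) (l (skew_elt h s') t)"
        using g s t additive_closed[OF g_add] additive_closed[OF s_add(1)]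
        by (simp add: skew_elt_mult le G_closed act_closed s_mult g_mult gs)
    qed
  qed
qed

text \<open>On the right the compatibility reads (t g) s = (t (^g s)) g, since g s = (^g s) g in A.
  Used for A \<otimes> C_i, where S acts through the grading and G through C_i.\<close>

lemma skew_right_action:
  assumes T: "abelian_group T"
    and s_add: "\<And>s. s \<in> carrier S \<Longrightarrow> additive T T (\<lambda>t. sa t s)" "\<And>t. t \<in> carrier T \<Longrightarrow> additive S T (sa t)"
    and s_mult: "\<And>s s' t. \<lbrakk>s \<in> carrier S; s' \<in> carrier S; t \<in> carrier T\<rbrakk> \<Longrightarrow> sa t (s \<otimes>\<^bsub>S\<^esub> s') = sa (sa t s) s'"
    and s_one: "\<And>t. t \<in> carrier T \<Longrightarrow> sa t \<one>\<^bsub>S\<^esub> = t"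
    and g_add: "\<And>g. g \<in> carrier G \<Longrightarrow> additive T T (\<lambda>t. ga t g)"
    and g_mult: "\<And>g h t. \<lbrakk>g \<in> carrier G; h \<in> carrier G; t \<in> carrier T\<rbrakk> \<Longrightarrow> ga t (g \<otimes>\<^bsub>G\<^esub> h) = ga (ga t g) h"
    and g_one: "\<And>t. t \<in> carrier T \<Longrightarrow> ga t \<one>\<^bsub>G\<^esub> = t"
    and gs: "\<And>g s t. \<lbrakk>g \<in> carrier G; s \<in> carrier S; t \<in> carrier T\<rbrakk> \<Longrightarrow> sa (ga t g) s = ga (sa t (act g s)) g"
  defines "r \<equiv> \<lambda>t a. \<Oplus>\<^bsub>T\<^esub>g \<in> carrier G. ga (sa t (a g)) g"
  shows "\<And>a. a \<in> carrier A \<Longrightarrow> additive T T (\<lambda>t. r t a)" "\<And>t. t \<in> carrier T \<Longrightarrow> additive A T (r t)"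
    "\<And>a b t. \<lbrakk>a \<in> carrier A; b \<in> carrier A; t \<in> carrier T\<rbrakk> \<Longrightarrow> r t (a \<otimes>\<^bsub>A\<^esub> b) = r (r t a) b"
    "\<And>t. t \<in> carrier T \<Longrightarrow> r t \<one>\<^bsub>A\<^esub> = t"
    "\<And>g s t. \<lbrakk>g \<in> carrier G; s \<in> carrier S; t \<in> carrier T\<rbrakk> \<Longrightarrow> r t (skew_elt g s) = ga (sa t s) g"
proof -
  interpret T: abelian_group T by fact
  note [simp del] = A_simps(1)
  show r1: "additive T T (\<lambda>t. r t a)" if "a \<in> carrier A" for a
    unfolding r_def
  proof (rule finsum_additive[OF T])
    fix g assume g: "g \<in> carrier G"
    show "additive T T (\<lambda>t. ga (sa t (a g)) g)"
      by (rule additive_comp[OF s_add(1)[OF A_apply[OF that g]] g_add[OF g]])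
  qed
  show r2: "additive A T (r t)" if "t \<in> carrier T" for t
    unfolding r_def
  proof (rule finsum_additive[OF T])
    fix g assume g: "g \<in> carrier G"
    show "additive A T (\<lambda>a. ga (sa t (a g)) g)"
      by (rule additive_comp[OF additive_comp[OF copower.prj_additive[OF A_copower g] s_add(2)[OF that]] g_add[OF g]])
  qed
  have z: "ga (sa t \<zero>\<^bsub>S\<^esub>) g = \<zero>\<^bsub>T\<^esub>" if "t \<in> carrier T" "g \<in> carrier G" for t g
    using additive_zero[OF S_ab T s_add(2)[OF that(1)]] additive_zero[OF T T g_add[OF that(2)]] by simp
  show re: "r t (skew_elt g s) = ga (sa t s) g" if "g \<in> carrier G" "s \<in> carrier S" "t \<in> carrier T" for g s t
  proof -
    have c: "ga (sa t s') h \<in> carrier T" if "h \<in> carrier G" "s' \<in> carrier S" for h s'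
      using additive_closed[OF g_add additive_closed[OF s_add(1)]] that \<open>t \<in> carrier T\<close> by blast
    have "r t (skew_elt g s) = ga (sa t (skew_elt g s g)) g"
      unfolding r_def
      by (rule finsum_delta[OF T.abelian_monoid_axioms finite_group])
        (use that in \<open>auto simp: skew_elt_def z intro!: c\<close>)
    then show ?thesis using that by (simp add: skew_elt_def)
  qed
  show "r t \<one>\<^bsub>A\<^esub> = t" if "t \<in> carrier T" for t
    using re[of "\<one>\<^bsub>G\<^esub>" "\<one>\<^bsub>S\<^esub>" t] that by (simp add: g_one s_one G_closed)
  show "r t (a \<otimes>\<^bsub>A\<^esub> b) = r (r t a) b" if a: "a \<in> carrier A" and b: "b \<in> carrier A" and t: "t \<in> carrier T" for a b t
  proof (rule A_eqI[OF T _ _ _ a])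
    show "additive A T (\<lambda>a. r t (a \<otimes>\<^bsub>A\<^esub> b))" by (rule additive_comp[OF A_mult_additive_left[OF b] r2[OF t]])
    show "additive A T (\<lambda>a. r (r t a) b)" by (rule additive_comp[OF r2[OF t] r1[OF b]])
    fix g s assume g: "g \<in> carrier G" and s: "s \<in> carrier S"
    note e = skew_elt_closed[OF s, of g]
    show "r t (skew_elt g s \<otimes>\<^bsub>A\<^esub> b) = r (r t (skew_elt g s)) b"
    proof (rule A_eqI[OF T _ _ _ b])
      show "additive A T (\<lambda>b. r t (skew_elt g s \<otimes>\<^bsub>A\<^esub> b))"
        by (rule additive_comp[OF A_mult_additive_right[OF e] r2[OF t]])
      show "additive A T (r (r t (skew_elt g s)))" by (rule r2[OF additive_closed[OF r1[OF e] t]])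
      fix h s' assume "h \<in> carrier G" "s' \<in> carrier S"
      then show "r t (skew_elt g s \<otimes>\<^bsub>A\<^esub> skew_elt h s') = r (r t (skew_elt g s)) (skew_elt h s')"
        using g s t additive_closed[OF g_add] additive_closed[OF s_add(1)]
        by (simp add: skew_elt_mult re G_closed act_closed s_mult g_mult gs)
    qed
  qed
qed

section \<open>The map from the group algebra to A, and A as a free module\<close>

definition kG_in_A :: "('g \<Rightarrow> 'k) \<Rightarrow> 'g \<Rightarrow> 's"
  where "kG_in_A = skew_tensor S G \<one>\<^bsub>S\<^esub>"

lemma skew_tensor_kG_one: "s \<in> carrier S \<Longrightarrow> skew_tensor S G s \<one>\<^bsub>kG\<^esub> = skew_elt \<one>\<^bsub>G\<^esub> s"
  by (simp add: skew_tensor_elt skew_elt_def G_closed)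

lemma kG_in_A_additive: "additive kG A kG_in_A"
  unfolding kG_in_A_def
  using bal unfolding balanced_map_def sb by (auto simp: additive_def)

lemma kG_in_A_elt: "\<lbrakk>c \<in> carrier K; g \<in> carrier G\<rbrakk> \<Longrightarrow> kG_in_A (c \<odot>\<^bsub>kG\<^esub> group_elt K G g) = skew_elt g (c \<odot>\<^bsub>S\<^esub> \<one>\<^bsub>S\<^esub>)"
proof -
  assume c: "c \<in> carrier K" "g \<in> carrier G"
  interpret K: ring K by (rule K_ring)
  show ?thesis
    using c by (auto simp: kG_in_A_def skew_tensor_def skew_elt_def kG_smult group_elt_def fun_eq_iff)
qed

lemma group_elt_mult: "\<lbrakk>g \<in> carrier G; h \<in> carrier G\<rbrakk> \<Longrightarrow>
    group_elt K G g \<otimes>\<^bsub>kG\<^esub> group_elt K G h = group_elt K G (g \<otimes>\<^bsub>G\<^esub> h)"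
proof -
  assume gh: "g \<in> carrier G" "h \<in> carrier G"
  interpret K: ring K by (rule K_ring)
  have "(\<Oplus>\<^bsub>K\<^esub>y \<in> carrier G. group_elt K G g y \<otimes>\<^bsub>K\<^esub> group_elt K G h (inv\<^bsub>G\<^esub> y \<otimes>\<^bsub>G\<^esub> x))
    = (if x = g \<otimes>\<^bsub>G\<^esub> h then \<one>\<^bsub>K\<^esub> else \<zero>\<^bsub>K\<^esub>)" if x: "x \<in> carrier G" for x
  proof -
    have "(\<Oplus>\<^bsub>K\<^esub>y \<in> carrier G. group_elt K G g y \<otimes>\<^bsub>K\<^esub> group_elt K G h (inv\<^bsub>G\<^esub> y \<otimes>\<^bsub>G\<^esub> x))
      = group_elt K G g g \<otimes>\<^bsub>K\<^esub> group_elt K G h (inv\<^bsub>G\<^esub> g \<otimes>\<^bsub>G\<^esub> x)"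
      by (rule finsum_delta) (use gh x finite_group abelian_group.axioms(1)[OF K_ab] G_closed in \<open>auto simp: group_elt_def\<close>)
    moreover have "inv\<^bsub>G\<^esub> g \<otimes>\<^bsub>G\<^esub> x = h \<longleftrightarrow> x = g \<otimes>\<^bsub>G\<^esub> h"
      using gh x by (metis group.inv_solve_left[OF group_axioms])
    ultimately show ?thesis using gh x G_closed by (auto simp: group_elt_def)
  qed
  then show ?thesis by (auto simp: group_algebra_def group_elt_def fun_eq_iff)
qed

lemma kG_eqI:
  assumes "abelian_group P" "additive kG P f" "additive kG P f'"
    "\<And>g c. \<lbrakk>g \<in> carrier G; c \<in> carrier K\<rbrakk> \<Longrightarrow> f (c \<odot>\<^bsub>kG\<^esub> group_elt K G g) = f' (c \<odot>\<^bsub>kG\<^esub> group_elt K G g)" "b \<in> carrier kG"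
  shows "f b = f' b"
  using copower.hom_eq[OF kG_copower assms] by simp

context
  assumes kG: "algebra_over_field K kG"
begin

interpretation kG: algebra_over_field K kG by (rule kG)

text \<open>By additivity it suffices to multiply scalar multiples of group elements. That kG is an
  algebra is an assumption of this context; it is supplied later by the resolution C, whose terms
  are central bimodules over kG.\<close>

lemma kG_in_A_mult:
  assumes b: "b \<in> carrier kG" and b': "b' \<in> carrier kG"
  shows "kG_in_A (b \<otimes>\<^bsub>kG\<^esub> b') = kG_in_A b \<otimes>\<^bsub>A\<^esub> kG_in_A b'"
proof -
  note [simp del] = A_simps(1) group_algebra_simps(1)
  note u = kG_in_A_additive
  have r: "additive kG kG (\<lambda>b. b \<otimes>\<^bsub>kG\<^esub> b')" if "b' \<in> carrier kG" for b'
    using that by (intro additiveI kG.L.m_closed kG.L.l_distr)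
  have l: "additive kG kG (\<lambda>b'. b \<otimes>\<^bsub>kG\<^esub> b')" if "b \<in> carrier kG" for b
    using that by (intro additiveI kG.L.m_closed kG.L.r_distr)
  note c = additive_closed[OF u]
  show ?thesis
  proof (rule kG_eqI[OF abelian_group_A additive_comp[OF r[OF b'] u] additive_comp[OF u A_mult_additive_left[OF c[OF b']]] _ b])
    fix g x assume gx: "g \<in> carrier G" "x \<in> carrier K"
    then have e: "x \<odot>\<^bsub>kG\<^esub> group_elt K G g \<in> carrier kG" using group_elt_closed by simp
    show "kG_in_A (x \<odot>\<^bsub>kG\<^esub> group_elt K G g \<otimes>\<^bsub>kG\<^esub> b') = kG_in_A (x \<odot>\<^bsub>kG\<^esub> group_elt K G g) \<otimes>\<^bsub>A\<^esub> kG_in_A b'"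
    proof (rule kG_eqI[OF abelian_group_A additive_comp[OF l[OF e] u] additive_comp[OF u A_mult_additive_right[OF c[OF e]]] _ b'])
      fix h y assume hy: "h \<in> carrier G" "y \<in> carrier K"
      have "x \<odot>\<^bsub>kG\<^esub> group_elt K G g \<otimes>\<^bsub>kG\<^esub> (y \<odot>\<^bsub>kG\<^esub> group_elt K G h) = (x \<otimes>\<^bsub>K\<^esub> y) \<odot>\<^bsub>kG\<^esub> group_elt K G (g \<otimes>\<^bsub>G\<^esub> h)"
        using gx hy group_elt_closed group_elt_mult kG.smult_assoc1[of y x "group_elt K G (g \<otimes>\<^bsub>G\<^esub> h)"]
          cring.cring_simprules(14)[OF K_cring, of x y]
        by (simp add: kG.smult_mult_left kG.smult_mult_right)
      then show "kG_in_A (x \<odot>\<^bsub>kG\<^esub> group_elt K G g \<otimes>\<^bsub>kG\<^esub> (y \<odot>\<^bsub>kG\<^esub> group_elt K G h))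
        = kG_in_A (x \<odot>\<^bsub>kG\<^esub> group_elt K G g) \<otimes>\<^bsub>A\<^esub> kG_in_A (y \<odot>\<^bsub>kG\<^esub> group_elt K G h)"
        using gx hy K_ring
        by (simp add: kG_in_A_elt skew_elt_mult G_closed act_linear act_ring_one smult_mult_left smult_assoc1
            monoid.m_closed[OF ring.is_monoid])
    qed
  qed
qed

lemma kG_in_A_one: "kG_in_A \<one>\<^bsub>kG\<^esub> = \<one>\<^bsub>A\<^esub>"
  using skew_tensor_kG_one[of "\<one>\<^bsub>S\<^esub>"] by (simp add: kG_in_A_def)

lemma A_r_bimodule: "bimodule A kG A\<^sub>r"
proof -
  note [simp del] = A_simps(1) group_algebra_simps(1)
  interpret A: ring A by (rule A_ring)
  have s: "carrier A\<^sub>r = carrier A" "ring.add A\<^sub>r = ring.add A" "\<zero>\<^bsub>A\<^sub>r\<^esub> = \<zero>\<^bsub>A\<^esub>" "lact A\<^sub>r = monoid.mult A"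
    "ract A\<^sub>r = (\<lambda>a b. a \<otimes>\<^bsub>A\<^esub> kG_in_A b)"
    by (simp_all add: skew_as_A_kG_def Let_def kG_in_A_def)
  have ab: "abelian_group A\<^sub>r" by (rule abelian_group_cong[OF abelian_group_A]) (simp_all add: s)
  show ?thesis
    by (intro bimodule.intro bimodule_axioms.intro A_ring kG.L.ring_axioms ab)
      (simp_all add: s A.l_distr A.r_distr A.m_assoc additive_closed[OF kG_in_A_additive] kG_in_A_mult kG_in_A_one
        additive_add[OF kG_in_A_additive] del: A_simps(3) group_algebra_simps(3))
qed

end

lemma A_l_bimodule: "bimodule S A A\<^sub>l"
proof -
  note [simp del] = A_simps(1) group_algebra_simps
  interpret A: ring A by (rule A_ring)
  have s: "carrier A\<^sub>l = carrier A" "ring.add A\<^sub>l = ring.add A" "\<zero>\<^bsub>A\<^sub>l\<^esub> = \<zero>\<^bsub>A\<^esub>" "ract A\<^sub>l = monoid.mult A"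
    "\<And>s a. s \<in> carrier S \<Longrightarrow> lact A\<^sub>l s a = skew_elt \<one>\<^bsub>G\<^esub> s \<otimes>\<^bsub>A\<^esub> a"
    by (simp_all add: skew_as_S_A_def Let_def skew_tensor_kG_one)
  have ab: "abelian_group A\<^sub>l" by (rule abelian_group_cong[OF abelian_group_A]) (simp_all add: s)
  note e = G_closed(3)
  have m: "skew_elt \<one>\<^bsub>G\<^esub> (x \<otimes>\<^bsub>S\<^esub> y) = skew_elt \<one>\<^bsub>G\<^esub> x \<otimes>\<^bsub>A\<^esub> skew_elt \<one>\<^bsub>G\<^esub> y" if "x \<in> carrier S" "y \<in> carrier S" for x y
    using that by (simp add: skew_elt_mult e act_one monoid.l_one[OF group.is_monoid[OF group_axioms]])
  have "skew_elt \<one>\<^bsub>G\<^esub> \<one>\<^bsub>S\<^esub> \<otimes>\<^bsub>A\<^esub> a = a" if "a \<in> carrier A" for a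
    using A.l_one[OF that] by simp
  then show ?thesis
    by (intro bimodule.intro bimodule_axioms.intro A_ring S_ring ab)
      (simp_all add: s A.l_distr A.r_distr A.m_assoc m skew_elt_closed additive_add[OF skew_elt_additive[OF e]] del: A_simps(3))
qed

lemma A_l_copower: "copower A\<^sub>l S (carrier G) (\<lambda>g s. lact A\<^sub>l s (skew_elt g \<one>\<^bsub>S\<^esub>)) (\<lambda>g a. a g)"
proof -
  have "copower A\<^sub>l S (carrier G) skew_elt (\<lambda>g a. a g)"
    by (rule copower_cong_structure[OF A_copower]) (simp_all add: skew_as_S_A_def Let_def)
  then show ?thesis
  proof (rule copower_cong)
    fix g s assume "g \<in> carrier G" "s \<in> carrier S"
    then show "skew_elt g s = lact A\<^sub>l s (skew_elt g \<one>\<^bsub>S\<^esub>)"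
      using skew_tensor_kG_one[of s]
      by (simp add: skew_as_S_A_def Let_def skew_elt_mult G_closed act_ring_one monoid.l_one[OF group.is_monoid[OF group_axioms]])
  qed
qed

text \<open>As a right kG-module A = S \<otimes> kG is free on the s \<otimes> 1 with s running
  through a k-basis of S, whence the bare existence statement. Over S on the left the group elements
  serve as a basis, see \<open>A_l_copower\<close>.\<close>

lemma A_r_copower: "\<exists>B prj. B \<subseteq> carrier S \<and>
    copower A\<^sub>r kG B (\<lambda>s b. ract A\<^sub>r (skew_elt \<one>\<^bsub>G\<^esub> s) b) prj"
proof -
  obtain B prj where B: "B \<subseteq> carrier S" and "copower S K B (\<lambda>b c. c \<odot>\<^bsub>S\<^esub> b) prj"
    using vector_space_copower[OF field_axioms module_axioms'] by auto
  then interpret C: copower S K B "\<lambda>b c. c \<odot>\<^bsub>S\<^esub> b" prj by simp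
  \<comment> \<open>Coordinates are taken pointwise: each value a g is expanded in the basis of
    S.\<close>
  let ?p = "\<lambda>s a. \<lambda>g \<in> carrier G. prj s (a g)"
  have r: "ract A\<^sub>r (skew_elt \<one>\<^bsub>G\<^esub> s) b = skew_tensor S G s b" if s: "s \<in> carrier S" and b: "b \<in> carrier kG" for s b
  proof -
    have st: "additive kG A (skew_tensor S G s)"
      using bal s unfolding balanced_map_def sb by (auto simp: additive_def)
    note e = skew_elt_closed[OF s, of "\<one>\<^bsub>G\<^esub>"]
    have "skew_elt \<one>\<^bsub>G\<^esub> s \<otimes>\<^bsub>A\<^esub> kG_in_A b = skew_tensor S G s b"
    proof (rule kG_eqI[OF abelian_group_A additive_comp[OF kG_in_A_additive A_mult_additive_right[OF e]] st _ b])
      fix g c assume gc: "g \<in> carrier G" "c \<in> carrier K"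
      interpret K: ring K by (rule K_ring)
      have "skew_tensor S G s (c \<odot>\<^bsub>kG\<^esub> group_elt K G g) = skew_elt g (c \<odot>\<^bsub>S\<^esub> s)"
        using gc s by (auto simp: skew_tensor_def skew_elt_def kG_smult group_elt_def fun_eq_iff)
      then show "skew_elt \<one>\<^bsub>G\<^esub> s \<otimes>\<^bsub>A\<^esub> kG_in_A (c \<odot>\<^bsub>kG\<^esub> group_elt K G g) = skew_tensor S G s (c \<odot>\<^bsub>kG\<^esub> group_elt K G g)"
        using gc s by (simp add: kG_in_A_elt skew_elt_mult G_closed act_one smult_mult_right
            monoid.l_one[OF group.is_monoid[OF group_axioms]])
    qed
    then show ?thesis by (simp add: skew_as_A_kG_def Let_def kG_in_A_def)
  qed
  have st_add: "additive kG A\<^sub>r (skew_tensor S G s)" if "s \<in> carrier S" for s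
    using bal that unfolding balanced_map_def sb by (auto simp: additive_def skew_as_A_kG_def Let_def)
  have s: "carrier A\<^sub>r = carrier A" "ring.add A\<^sub>r = ring.add A" "\<zero>\<^bsub>A\<^sub>r\<^esub> = \<zero>\<^bsub>A\<^esub>"
    by (simp_all add: skew_as_A_kG_def Let_def)
  have ab: "abelian_group A\<^sub>r" by (rule abelian_group_cong[OF abelian_group_A]) (simp_all add: s)
  have "copower A\<^sub>r kG B (skew_tensor S G) ?p"
  proof (intro copower.intro copower_axioms.intro ab abelian_group_kG)
    fix b assume b: "b \<in> B"
    then show "additive kG A\<^sub>r (skew_tensor S G b)" using B st_add by auto
    show "additive A\<^sub>r kG (?p b)"
    proof (rule additiveI)
      fix x y assume "x \<in> carrier A\<^sub>r" "y \<in> carrier A\<^sub>r"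
      then have "x g \<in> carrier S" "y g \<in> carrier S" if "g \<in> carrier G" for g using that by (auto simp: s)
      then show "?p b (x \<oplus>\<^bsub>A\<^sub>r\<^esub> y) = ?p b x \<oplus>\<^bsub>kG\<^esub> ?p b y"
        using b by (auto simp: s A_add kG_add fun_eq_iff additive_add[OF C.prj_additive])
    qed (use b C.prj_closed in \<open>auto simp: s\<close>)
    fix b' n assume b': "b' \<in> B" and n: "n \<in> carrier kG"
    have "prj b (n g \<odot>\<^bsub>S\<^esub> b') = (if b = b' then n g else \<zero>\<^bsub>K\<^esub>)" if "g \<in> carrier G" for g
      using C.prj_inc[OF b b', of "n g"] PiE_mem[OF n[unfolded group_algebra_simps] that] by simp
    then show "?p b (skew_tensor S G b' n) = (if b = b' then n else \<zero>\<^bsub>kG\<^esub>)"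
      using n by (auto simp: skew_tensor_def fun_eq_iff PiE_def extensional_def)
  next
    fix P x assume x: "x \<in> carrier A\<^sub>r" and P: "P \<zero>\<^bsub>A\<^sub>r\<^esub>"
      "\<And>u v. u \<in> carrier A\<^sub>r \<Longrightarrow> v \<in> carrier A\<^sub>r \<Longrightarrow> P u \<Longrightarrow> P v \<Longrightarrow> P (u \<oplus>\<^bsub>A\<^sub>r\<^esub> v)"
      "\<And>b n. b \<in> B \<Longrightarrow> n \<in> carrier kG \<Longrightarrow> P (skew_tensor S G b n)"
    have "x \<in> carrier A" using x by (simp only: s)
    then show "P x"
    proof (induction x rule: copower.induct[OF A_copower, consumes 1, case_names zero add incl])
      case (add u v) then show ?case using P(2) unfolding s by simp
    next
      case (incl g t)
      note g = incl(1)
      from incl(2) show ?case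
      proof (induction t rule: C.induct)
        case zero
        have "skew_elt g \<zero>\<^bsub>S\<^esub> = \<zero>\<^bsub>A\<^esub>" using additive_zero[OF S_ab abelian_group_A skew_elt_additive[OF g]] .
        then show ?case using P(1) unfolding s by (simp only:)
      next
        case (add u v)
        then show ?case using P(2) skew_elt_closed unfolding s by (simp add: additive_add[OF skew_elt_additive[OF g]] del: A_simps)
      next
        case (incl b c)
        interpret K: ring K by (rule K_ring)
        have "skew_elt g (c \<odot>\<^bsub>S\<^esub> b) = skew_tensor S G b (c \<odot>\<^bsub>kG\<^esub> group_elt K G g)"
          using incl g B by (auto simp: skew_tensor_def skew_elt_def kG_smult group_elt_def fun_eq_iff)
        moreover have "c \<odot>\<^bsub>kG\<^esub> group_elt K G g \<in> carrier kG" using incl by (auto simp: kG_smult group_elt_def)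
        ultimately show ?case using P(3) incl by simp
      qed
    qed (use P(1) in \<open>simp only: s\<close>)
  qed
  then have "copower A\<^sub>r kG B (\<lambda>s b. ract A\<^sub>r (skew_elt \<one>\<^bsub>G\<^esub> s) b) ?p"
    by (rule copower_cong) (use B r in auto)
  then show ?thesis using B by blast
qed

end

section \<open>The induced bimodules\<close>

locale resolution_pair = group_acting_on_algebra K S G act + C: graded_resolution_of_kG K G C gC dC \<epsilon>C C' gC'
    + D: equivariant_resolution K S G act D aD dD \<epsilon>D D'
  for K :: "'k ring" and S :: "('k, 's) module" and G :: "'g monoid" and act :: "'g \<Rightarrow> 's \<Rightarrow> 's"
    and C :: "nat \<Rightarrow> ('g \<Rightarrow> 'k, 'g \<Rightarrow> 'k, 'c) bimodule" and gC :: "nat \<Rightarrow> 'g \<Rightarrow> 'c set"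
    and dC :: "nat \<Rightarrow> 'c \<Rightarrow> 'c" and \<epsilon>C :: "'c \<Rightarrow> 'g \<Rightarrow> 'k"
    and C' :: "nat \<Rightarrow> ('k, 'v) module" and gC' :: "nat \<Rightarrow> 'g \<Rightarrow> 'v set"
    and D :: "nat \<Rightarrow> ('s, 's, 'd) bimodule" and aD :: "nat \<Rightarrow> ('g \<Rightarrow> 'k) \<Rightarrow> 'd \<Rightarrow> 'd"
    and dD :: "nat \<Rightarrow> 'd \<Rightarrow> 'd" and \<epsilon>D :: "'d \<Rightarrow> 's"
    and D' :: "nat \<Rightarrow> ('k, 'w) module"
begin

declare A_simps(1) [simp del] group_algebra_simps(1) [simp del]

lemma C_central: "central_bimodule K kG (C i)"
  using C.C_resolution by (simp add: free_env_resolution_def)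

lemma kG_algebra: "algebra_over_field K kG"
  using C_central by (rule central_bimodule.axioms)

sublocale kG: algebra_over_field K kG by (rule kG_algebra)
sublocale A: algebra_over_field K A by (rule A_algebra)
sublocale CB: central_bimodule K kG "C i" for i by (rule C_central)

abbreviation (input) "C_space i \<equiv> with_smult (C i) (\<lambda>c. lact (C i) (c \<odot>\<^bsub>kG\<^esub> \<one>\<^bsub>kG\<^esub>))"

sublocale CV: graded_vector_space K "C_space i" G "gC i" for i
  using C.C_graded[of i] finite_group field_axioms
  by (intro graded_vector_space.intro graded_vector_space_axioms.intro) (auto simp: graded_space_def)

text \<open>The action of S is defined with homogeneous components in the bimodule C_i, whereas the
  grading assumption concerns the vector space on the same group; both use the same sums.\<close>

lemma C_component_eq: "homogeneous_component G (C i) (gC i) = homogeneous_component G (C_space i) (gC i)"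
proof -
  have "finsum (C i) f (carrier G) = finsum (C_space i) f (carrier G)" for f :: "'g \<Rightarrow> 'c"
    by (rule finsum_cong_structure) simp_all
  then show ?thesis unfolding homogeneous_component_def homogeneous_decomposition_def by (simp only:)
qed

lemmas C_component_additive = CV.component_additive[folded C_component_eq]
  and C_component_homogeneous = CV.component_homogeneous[folded C_component_eq]
  and C_component_of_homogeneous = CV.component_of_homogeneous[folded C_component_eq]

lemma C_homogeneous_closed: "x \<in> gC i h \<Longrightarrow> h \<in> carrier G \<Longrightarrow> x \<in> carrier (C i)"
  using CV.homogeneous_closed by simp

lemma group_elt_one_act: "x \<in> carrier (C i) \<Longrightarrow> lact (C i) (group_elt K G \<one>\<^bsub>G\<^esub>) x = x"
  "x \<in> carrier (C i) \<Longrightarrow> ract (C i) x (group_elt K G \<one>\<^bsub>G\<^esub>) = x"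
  using CB.lact_one CB.ract_one by simp_all

lemma homogeneous_lact:
  assumes "g \<in> carrier G" "h \<in> carrier G" "x \<in> gC i h"
  shows "lact (C i) (group_elt K G g) x \<in> gC i (g \<otimes>\<^bsub>G\<^esub> h)"
proof -
  have "ract (C i) (lact (C i) (group_elt K G g) x) (group_elt K G \<one>\<^bsub>G\<^esub>) \<in> gC i (g \<otimes>\<^bsub>G\<^esub> h \<otimes>\<^bsub>G\<^esub> \<one>\<^bsub>G\<^esub>)"
    using C.C_graded_actions[OF assms(1,2) G_closed(3), of i] assms(3) by blast
  then show ?thesis
    using assms C_homogeneous_closed[OF assms(3,2)] group_elt_closed
    by (simp add: group_elt_one_act CB.lact_closed G_closed monoid.r_one[OF group.is_monoid[OF group_axioms]])
qed

lemma homogeneous_ract: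
  assumes "l \<in> carrier G" "h \<in> carrier G" "x \<in> gC i h"
  shows "ract (C i) x (group_elt K G l) \<in> gC i (h \<otimes>\<^bsub>G\<^esub> l)"
proof -
  have "ract (C i) (lact (C i) (group_elt K G \<one>\<^bsub>G\<^esub>) x) (group_elt K G l) \<in> gC i (\<one>\<^bsub>G\<^esub> \<otimes>\<^bsub>G\<^esub> h \<otimes>\<^bsub>G\<^esub> l)"
    using C.C_graded_actions[OF G_closed(3) assms(2,1), of i] assms(3) by blast
  then show ?thesis
    using assms C_homogeneous_closed[OF assms(3,2)]
    by (simp add: group_elt_one_act G_closed monoid.l_one[OF group.is_monoid[OF group_axioms]])
qed

lemma homogeneous_scalar:
  assumes "c \<in> carrier K" "h \<in> carrier G" "x \<in> gC i h"
  shows "lact (C i) (c \<odot>\<^bsub>kG\<^esub> \<one>\<^bsub>kG\<^esub>) x \<in> gC i h"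
  using CV.V.submoduleE(4)[OF CV.homogeneous_submodule[OF assms(2)] assms(1,3)] by simp

text \<open>Separates the scalar, which preserves degrees, from the group element, which shifts
  them.\<close>

lemma lact_kG_generator:
  assumes "c \<in> carrier K" "g \<in> carrier G" "x \<in> carrier (C i)"
  shows "lact (C i) (c \<odot>\<^bsub>kG\<^esub> group_elt K G g) x = lact (C i) (c \<odot>\<^bsub>kG\<^esub> \<one>\<^bsub>kG\<^esub>) (lact (C i) (group_elt K G g) x)"
proof -
  have "c \<odot>\<^bsub>kG\<^esub> group_elt K G g = (c \<odot>\<^bsub>kG\<^esub> \<one>\<^bsub>kG\<^esub>) \<otimes>\<^bsub>kG\<^esub> group_elt K G g"
    using kG.smult_eq_mult[OF assms(1) group_elt_closed] by simp
  moreover have "c \<odot>\<^bsub>kG\<^esub> \<one>\<^bsub>kG\<^esub> \<in> carrier kG" using assms group_elt_closed by simp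
  ultimately show ?thesis using assms group_elt_closed CB.lact_mult[of "c \<odot>\<^bsub>kG\<^esub> \<one>\<^bsub>kG\<^esub>" "group_elt K G g" x] by (simp del: group_algebra_simps)
qed

lemma homogeneous_lact_generator:
  assumes "c \<in> carrier K" "g \<in> carrier G" "h \<in> carrier G" "x \<in> gC i h"
  shows "lact (C i) (c \<odot>\<^bsub>kG\<^esub> group_elt K G g) x \<in> gC i (g \<otimes>\<^bsub>G\<^esub> h)"
  using lact_kG_generator[OF assms(1,2) C_homogeneous_closed[OF assms(4,3)]]
    homogeneous_scalar[OF assms(1) _ homogeneous_lact[OF assms(2,3,4)]] assms G_closed by simp

subsection \<open>The bimodules induced from the group algebra\<close>

abbreviation (input) "TC i \<equiv> tensor kG A\<^sub>r (C i)"
abbreviation (input) "pc i \<equiv> pure_tensor kG A\<^sub>r (C i)"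
abbreviation (input) "PC i \<equiv> kG_induced K S G act (C i) (gC i)"

lemma A_r_sel [simp]: "carrier A\<^sub>r = carrier A" "ring.add A\<^sub>r = ring.add A" "\<zero>\<^bsub>A\<^sub>r\<^esub> = \<zero>\<^bsub>A\<^esub>" "lact A\<^sub>r = monoid.mult A"
  "ract A\<^sub>r = (\<lambda>a b. a \<otimes>\<^bsub>A\<^esub> kG_in_A b)"
  by (simp_all add: skew_as_A_kG_def Let_def kG_in_A_def)

sublocale tC: bimodule_pair A kG kG A\<^sub>r "C i" for i
  by (intro bimodule_pair.intro A_r_bimodule kG_algebra CB.bimodule_axioms)

lemma TC_abelian: "abelian_group (TC i)"
  using tC.tensor_bimodule by (rule bimodule.axioms)

text \<open>Decomposing the second factor shows that pure tensors with homogeneous second factor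
  generate; on these the right action of S is explicit.\<close>

lemma PC_induct [consumes 1, case_names zero add pure]:
  assumes "X \<in> carrier (TC i)" "P \<zero>\<^bsub>TC i\<^esub>"
    "\<And>u v. \<lbrakk>u \<in> carrier (TC i); v \<in> carrier (TC i); P u; P v\<rbrakk> \<Longrightarrow> P (u \<oplus>\<^bsub>TC i\<^esub> v)"
    "\<And>a h x. \<lbrakk>a \<in> carrier A; h \<in> carrier G; x \<in> gC i h\<rbrakk> \<Longrightarrow> P (pc i a x)"
  shows "P X"
  using assms(1)[unfolded tensor_simps]
proof (induction X rule: tC.tensor_induct)
  case (pure a x)
  have "x \<in> carrier (C_space i)" using pure by simp
  then show ?case
  proof (induction x rule: CV.homogeneous_induct)
    case zero show ?case using assms(2) tC.pure_zero_right pure by simp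
  next
    case (add u v)
    then show ?case using assms(3) tC.pure_add_right[OF pure(1), of u i v] tC.pure_closed[OF pure(1)] by simp
  next
    case (homogeneous g y) then show ?case using assms(4) pure by simp
  qed
qed (use assms(2,3) in simp_all)

lemma PC_eqI:
  assumes "abelian_group N" "additive (TC i) N f" "additive (TC i) N f'"
    "\<And>a h x. \<lbrakk>a \<in> carrier A; h \<in> carrier G; x \<in> gC i h\<rbrakk> \<Longrightarrow> f (pc i a x) = f' (pc i a x)" "X \<in> carrier (TC i)"
  shows "f X = f' X"
  using assms(5)
proof (induction X rule: PC_induct)
  case zero show ?case
    using additive_zero[OF TC_abelian assms(1,2)] additive_zero[OF TC_abelian assms(1,3)] by (simp only:)
next
  case (add u v)
  show ?case unfolding additive_add[OF assms(2) add(1,2)] additive_add[OF assms(3) add(1,2)] add(3,4) ..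
qed (rule assms(4))

text \<open>The balanced map behind the right action of S. Summing over all degrees makes it
  meaningful for every x; for homogeneous x one term survives.\<close>

definition right_S_map :: "nat \<Rightarrow> 's \<Rightarrow> ('g \<Rightarrow> 's) \<Rightarrow> 'c \<Rightarrow> ('g \<Rightarrow> 's, 'c) tensor"
  where "right_S_map i s a x = (\<Oplus>\<^bsub>tensor_group kG A\<^sub>r (C i)\<^esub>g \<in> carrier G.
    pc i (a \<otimes>\<^bsub>A\<^esub> skew_tensor S G (act g s) \<one>\<^bsub>kG\<^esub>) (homogeneous_component G (C i) (gC i) x g))"

lemma right_S_map_homogeneous:
  assumes s: "s \<in> carrier S" and a: "a \<in> carrier A" and h: "h \<in> carrier G" and x: "x \<in> gC i h"
  shows "right_S_map i s a x = pc i (a \<otimes>\<^bsub>A\<^esub> skew_elt \<one>\<^bsub>G\<^esub> (act h s)) x"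
proof -
  have c: "a \<otimes>\<^bsub>A\<^esub> skew_elt \<one>\<^bsub>G\<^esub> (act g s) \<in> carrier A" if "g \<in> carrier G" for g
    using that s a by (intro A_mult_closed skew_elt_closed act_closed)
  note xc = C_homogeneous_closed[OF x h]
  have cc: "homogeneous_component G (C i) (gC i) x g \<in> carrier (C i)" if "g \<in> carrier G" for g
    using C_homogeneous_closed[OF C_component_homogeneous] xc that by simp
  have "right_S_map i s a x = pc i (a \<otimes>\<^bsub>A\<^esub> skew_tensor S G (act h s) \<one>\<^bsub>kG\<^esub>) (homogeneous_component G (C i) (gC i) x h)"
    unfolding right_S_map_def
  proof (rule finsum_delta[OF abelian_group.axioms(1)[OF tC.tensor_abelian_group] finite_group h])
    fix g assume g: "g \<in> carrier G"
    show "pc i (a \<otimes>\<^bsub>A\<^esub> skew_tensor S G (act g s) \<one>\<^bsub>kG\<^esub>) (homogeneous_component G (C i) (gC i) x g) \<in> carrier (tensor_group kG A\<^sub>r (C i))"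
      using tC.pure_closed c[OF g] cc[OF g] s g by (simp add: skew_tensor_kG_one[simplified] act_closed)
    assume "g \<noteq> h"
    then show "pc i (a \<otimes>\<^bsub>A\<^esub> skew_tensor S G (act g s) \<one>\<^bsub>kG\<^esub>) (homogeneous_component G (C i) (gC i) x g) = \<zero>\<^bsub>tensor_group kG A\<^sub>r (C i)\<^esub>"
      using tC.pure_zero_right c[OF g] s g C_component_of_homogeneous[OF h x g]
      by (simp add: skew_tensor_kG_one[simplified] act_closed)
  qed
  then show ?thesis
    using C_component_of_homogeneous[OF h x h] s h by (simp add: skew_tensor_kG_one[simplified] act_closed)
qed

lemma right_S_map_additive_right:
  assumes s: "s \<in> carrier S" and a: "a \<in> carrier A"
  shows "additive (C i) (tensor_group kG A\<^sub>r (C i)) (right_S_map i s a)"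
  unfolding right_S_map_def
proof (rule finsum_additive[OF tC.tensor_abelian_group])
  fix g assume g: "g \<in> carrier G"
  have "a \<otimes>\<^bsub>A\<^esub> skew_tensor S G (act g s) \<one>\<^bsub>kG\<^esub> \<in> carrier A\<^sub>r"
    using g s a by (simp add: skew_tensor_kG_one[simplified] act_closed A_mult_closed skew_elt_closed)
  moreover have "additive (C i) (C i) (\<lambda>x. homogeneous_component G (C i) (gC i) x g)"
    using C_component_additive[OF g, of i] by (simp add: additive_def)
  ultimately show "additive (C i) (tensor_group kG A\<^sub>r (C i))
      (\<lambda>x. pc i (a \<otimes>\<^bsub>A\<^esub> skew_tensor S G (act g s) \<one>\<^bsub>kG\<^esub>) (homogeneous_component G (C i) (gC i) x g))"
    by (intro additive_comp[OF _ tC.pure_right_additive])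
qed

lemma right_S_map_additive_left:
  assumes s: "s \<in> carrier S" and x: "x \<in> carrier (C i)"
  shows "additive A (tensor_group kG A\<^sub>r (C i)) (\<lambda>a. right_S_map i s a x)"
  unfolding right_S_map_def
proof (rule finsum_additive[OF tC.tensor_abelian_group])
  fix g assume g: "g \<in> carrier G"
  have "skew_tensor S G (act g s) \<one>\<^bsub>kG\<^esub> \<in> carrier A"
    using g s by (simp add: skew_tensor_kG_one[simplified] act_closed skew_elt_closed)
  moreover have "homogeneous_component G (C i) (gC i) x g \<in> carrier (C i)"
    using C_homogeneous_closed[OF C_component_homogeneous] x g by simp
  then have "additive A (tensor_group kG A\<^sub>r (C i)) (\<lambda>a. pc i a (homogeneous_component G (C i) (gC i) x g))"
    using tC.pure_left_additive by (simp add: additive_def)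
  ultimately show "additive A (tensor_group kG A\<^sub>r (C i))
      (\<lambda>a. pc i (a \<otimes>\<^bsub>A\<^esub> skew_tensor S G (act g s) \<one>\<^bsub>kG\<^esub>) (homogeneous_component G (C i) (gC i) x g))"
    using additive_comp[OF A_mult_additive_left] by blast
qed

text \<open>This is the well-definedness of the right S-action over kG. Everything is additive in b
  and x, so b may be taken as a multiple of g and x as homogeneous of degree h. Then g x has degree
  gh, and the two twists match because (1 \<otimes> g)(^h s \<otimes> 1) = (^(gh) s \<otimes> 1)(1
  \<otimes> g).\<close>

lemma right_S_map_balanced:
  assumes s: "s \<in> carrier S"
  shows "balanced_map kG A\<^sub>r (C i) (tensor_group kG A\<^sub>r (C i)) (right_S_map i s)"
proof (rule balanced_mapI)
  fix a b x assume "a \<in> carrier A\<^sub>r" and b: "b \<in> carrier kG" and x: "x \<in> carrier (C i)"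
  then have a: "a \<in> carrier A" by simp
  note ar = right_S_map_additive_right[OF s] and al = right_S_map_additive_left[OF s]
  have uc: "kG_in_A b \<in> carrier A" if "b \<in> carrier kG" for b using additive_closed[OF kG_in_A_additive that] .
  have lb: "additive kG (C i) (\<lambda>b. lact (C i) b x)" if "x \<in> carrier (C i)" for x
    using that by (intro additiveI CB.lact_closed CB.lact_add_left)
  have lx: "additive (C i) (C i) (lact (C i) b)" if "b \<in> carrier kG" for b
    using that by (intro additiveI CB.lact_closed CB.lact_add_right)
  have "right_S_map i s (a \<otimes>\<^bsub>A\<^esub> kG_in_A b) x = right_S_map i s a (lact (C i) b x)"
  proof (rule kG_eqI[OF tC.tensor_abelian_group _ _ _ b])
    show "additive kG (tensor_group kG A\<^sub>r (C i)) (\<lambda>b. right_S_map i s (a \<otimes>\<^bsub>A\<^esub> kG_in_A b) x)"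
      by (rule additive_comp[OF additive_comp[OF kG_in_A_additive A_mult_additive_right[OF a]] al[OF x]])
    show "additive kG (tensor_group kG A\<^sub>r (C i)) (\<lambda>b. right_S_map i s a (lact (C i) b x))"
      by (rule additive_comp[OF lb[OF x] ar[OF a]])
    fix g c assume g: "g \<in> carrier G" and c: "c \<in> carrier K"
    let ?b = "c \<odot>\<^bsub>kG\<^esub> group_elt K G g"
    have bc: "?b \<in> carrier kG" using c group_elt_closed by simp
    have xs: "x \<in> carrier (C_space i)" using x by simp
    have aub: "a \<otimes>\<^bsub>A\<^esub> kG_in_A ?b \<in> carrier A" using A_mult_closed a uc[OF bc] by blast
    note f1 = ar[OF aub, of i] and f2 = additive_comp[OF lx[OF bc] ar[OF a]]
    show "right_S_map i s (a \<otimes>\<^bsub>A\<^esub> kG_in_A ?b) x = right_S_map i s a (lact (C i) ?b x)"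
      using xs
    proof (induction x rule: CV.homogeneous_induct)
      case zero
      have "right_S_map i s (a \<otimes>\<^bsub>A\<^esub> kG_in_A ?b) \<zero>\<^bsub>C i\<^esub> = right_S_map i s a (lact (C i) ?b \<zero>\<^bsub>C i\<^esub>)"
        unfolding additive_zero[OF CB.M.abelian_group_axioms tC.tensor_abelian_group f1]
          additive_zero[OF CB.M.abelian_group_axioms tC.tensor_abelian_group f2] ..
      then show ?case by simp
    next
      case (add u v)
      have uv: "u \<in> carrier (C i)" "v \<in> carrier (C i)" using add by simp_all
      have "right_S_map i s (a \<otimes>\<^bsub>A\<^esub> kG_in_A ?b) (u \<oplus>\<^bsub>C i\<^esub> v) = right_S_map i s a (lact (C i) ?b (u \<oplus>\<^bsub>C i\<^esub> v))"
        unfolding additive_add[OF f1 uv] additive_add[OF f2 uv] add(3,4) ..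
      then show ?case by simp
    next
      case (homogeneous h y)
      note yc = C_homogeneous_closed[OF homogeneous(2,1)]
      have e: "skew_elt \<one>\<^bsub>G\<^esub> (act (g \<otimes>\<^bsub>G\<^esub> h) s) \<in> carrier A" "skew_elt \<one>\<^bsub>G\<^esub> (act h s) \<in> carrier A"
        using s g homogeneous(1) by (auto intro!: skew_elt_closed act_closed G_closed)
      have sw: "kG_in_A ?b \<otimes>\<^bsub>A\<^esub> skew_elt \<one>\<^bsub>G\<^esub> (act h s) = skew_elt \<one>\<^bsub>G\<^esub> (act (g \<otimes>\<^bsub>G\<^esub> h) s) \<otimes>\<^bsub>A\<^esub> kG_in_A ?b"
        using c g s homogeneous(1)
        by (simp add: kG_in_A_elt skew_elt_mult G_closed act_closed act_one act_act smult_mult_left smult_mult_right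
            monoid.l_one[OF group.is_monoid[OF group_axioms]] monoid.r_one[OF group.is_monoid[OF group_axioms]])
      have "right_S_map i s (a \<otimes>\<^bsub>A\<^esub> kG_in_A ?b) y = pc i (a \<otimes>\<^bsub>A\<^esub> skew_elt \<one>\<^bsub>G\<^esub> (act (g \<otimes>\<^bsub>G\<^esub> h) s) \<otimes>\<^bsub>A\<^esub> kG_in_A ?b) y"
        unfolding right_S_map_homogeneous[OF s aub homogeneous]
        using sw A.L.m_assoc[OF a uc[OF bc] e(2)] A.L.m_assoc[OF a e(1) uc[OF bc]] by simp
      also have "\<dots> = pc i (a \<otimes>\<^bsub>A\<^esub> skew_elt \<one>\<^bsub>G\<^esub> (act (g \<otimes>\<^bsub>G\<^esub> h) s)) (lact (C i) ?b y)"
        using tC.pure_balanced[OF _ bc yc, of "a \<otimes>\<^bsub>A\<^esub> skew_elt \<one>\<^bsub>G\<^esub> (act (g \<otimes>\<^bsub>G\<^esub> h) s)"] A_mult_closed[OF a e(1)] by simp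
      also have "\<dots> = right_S_map i s a (lact (C i) ?b y)"
        using right_S_map_homogeneous[OF s a _ homogeneous_lact_generator[OF c g homogeneous]] G_closed g homogeneous(1) by simp
      finally show ?case .
    qed
  qed
  then show "right_S_map i s (ract A\<^sub>r a b) x = right_S_map i s a (lact (C i) b x)" by simp
qed (use additive_closed[OF right_S_map_additive_right[OF s]] additive_add[OF right_S_map_additive_right[OF s]]
    additive_add[OF right_S_map_additive_left[OF s]] in simp_all)

abbreviation (input) "right_S i \<equiv> kG_induced_right_S K S G act (C i) (gC i)"

lemma right_S_eq: "right_S i t s = tensor_lift (tensor_group kG A\<^sub>r (C i)) (right_S_map i s) t"
  by (simp add: kG_induced_right_S_def Let_def right_S_map_def[abs_def])

lemma right_S_additive: "s \<in> carrier S \<Longrightarrow> additive (TC i) (TC i) (\<lambda>t. right_S i t s)"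
  using tC.lift_additive[OF tC.tensor_abelian_group right_S_map_balanced] by (simp add: right_S_eq additive_def)

lemma right_S_pure:
  "\<lbrakk>s \<in> carrier S; a \<in> carrier A; h \<in> carrier G; x \<in> gC i h\<rbrakk> \<Longrightarrow>
    right_S i (pc i a x) s = pc i (a \<otimes>\<^bsub>A\<^esub> skew_elt \<one>\<^bsub>G\<^esub> (act h s)) x"
  using tC.lift_pure[OF tC.tensor_abelian_group right_S_map_balanced, of s a x] C_homogeneous_closed[of x i h]
  by (simp add: right_S_eq right_S_map_homogeneous)

lemma TC_ract_pure:
  "\<lbrakk>g \<in> carrier G; a \<in> carrier A; x \<in> carrier (C i)\<rbrakk> \<Longrightarrow>
    ract (TC i) (pc i a x) (group_elt K G g) = pc i a (ract (C i) x (group_elt K G g))"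
  using tC.ract_pure[OF group_elt_closed] by simp

lemma TC_ract_additive: "additive (TC i) (TC i) (\<lambda>t. ract (TC i) t (group_elt K G g))"
  using tC.ract_additive[OF group_elt_closed] by (simp add: additive_def)

lemma pc_closed: "a \<in> carrier A \<Longrightarrow> x \<in> carrier (C i) \<Longrightarrow> pc i a x \<in> carrier (TC i)"
  using tC.pure_closed by simp

lemma right_S_additive_right:
  assumes t: "t \<in> carrier (TC i)"
  shows "additive S (TC i) (right_S i t)"
proof (rule additiveI)
  fix s assume "s \<in> carrier S"
  then show "right_S i t s \<in> carrier (TC i)" using additive_closed[OF right_S_additive t] by blast
next
  fix s s' assume s: "s \<in> carrier S" "s' \<in> carrier S"
  then have ss: "s \<oplus>\<^bsub>S\<^esub> s' \<in> carrier S" by (rule L.ring_simprules(1))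
  interpret T: abelian_group "TC i" by (rule TC_abelian)
  note c = additive_closed[OF right_S_additive]
  show "right_S i t (s \<oplus>\<^bsub>S\<^esub> s') = right_S i t s \<oplus>\<^bsub>TC i\<^esub> right_S i t s'"
  proof (rule PC_eqI[OF TC_abelian right_S_additive[OF ss] _ _ t])
    show "additive (TC i) (TC i) (\<lambda>t. right_S i t s \<oplus>\<^bsub>TC i\<^esub> right_S i t s')"
    proof (rule additiveI)
      fix x y assume xy: "x \<in> carrier (TC i)" "y \<in> carrier (TC i)"
      show "right_S i (x \<oplus>\<^bsub>TC i\<^esub> y) s \<oplus>\<^bsub>TC i\<^esub> right_S i (x \<oplus>\<^bsub>TC i\<^esub> y) s'
        = right_S i x s \<oplus>\<^bsub>TC i\<^esub> right_S i x s' \<oplus>\<^bsub>TC i\<^esub> (right_S i y s \<oplus>\<^bsub>TC i\<^esub> right_S i y s')"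
        unfolding additive_add[OF right_S_additive[OF s(1)] xy] additive_add[OF right_S_additive[OF s(2)] xy]
        using c[OF s(1) xy(1)] c[OF s(1) xy(2)] c[OF s(2) xy(1)] c[OF s(2) xy(2)]
        by (simp add: T.a_ac del: tensor_simps)
    qed (intro T.a_closed c s)
    fix a h x assume *: "a \<in> carrier A" "h \<in> carrier G" "x \<in> gC i h"
    then have ac: "act h s \<in> carrier S" "act h s' \<in> carrier S" using s act_closed by auto
    note e = skew_elt_closed[OF ac(1), of "\<one>\<^bsub>G\<^esub>"] skew_elt_closed[OF ac(2), of "\<one>\<^bsub>G\<^esub>"]
    have "a \<otimes>\<^bsub>A\<^esub> skew_elt \<one>\<^bsub>G\<^esub> (act h (s \<oplus>\<^bsub>S\<^esub> s')) = a \<otimes>\<^bsub>A\<^esub> skew_elt \<one>\<^bsub>G\<^esub> (act h s) \<oplus>\<^bsub>A\<^esub> a \<otimes>\<^bsub>A\<^esub> skew_elt \<one>\<^bsub>G\<^esub> (act h s')"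
      using * s by (simp add: act_add additive_add[OF skew_elt_additive[OF G_closed(3)] ac] additive_add[OF A_mult_additive_right e])
    then show "right_S i (pc i a x) (s \<oplus>\<^bsub>S\<^esub> s') = right_S i (pc i a x) s \<oplus>\<^bsub>TC i\<^esub> right_S i (pc i a x) s'"
      using * s ss e tC.pure_add_left[of "a \<otimes>\<^bsub>A\<^esub> skew_elt \<one>\<^bsub>G\<^esub> (act h s)" "a \<otimes>\<^bsub>A\<^esub> skew_elt \<one>\<^bsub>G\<^esub> (act h s')" x i]
        C_homogeneous_closed A_mult_closed by (simp add: right_S_pure)
  qed
qed

lemma right_S_mult:
  assumes s: "s \<in> carrier S" "s' \<in> carrier S" and t: "t \<in> carrier (TC i)"
  shows "right_S i t (s \<otimes>\<^bsub>S\<^esub> s') = right_S i (right_S i t s) s'"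
proof (rule PC_eqI[OF TC_abelian right_S_additive additive_comp[OF right_S_additive[OF s(1)] right_S_additive[OF s(2)]] _ t])
  show "s \<otimes>\<^bsub>S\<^esub> s' \<in> carrier S" using s by simp
  fix a h x assume *: "a \<in> carrier A" "h \<in> carrier G" "x \<in> gC i h"
  then have ac: "act h s \<in> carrier S" "act h s' \<in> carrier S" using s act_closed by auto
  note e = skew_elt_closed[OF ac(1), of "\<one>\<^bsub>G\<^esub>"] skew_elt_closed[OF ac(2), of "\<one>\<^bsub>G\<^esub>"]
  have "skew_elt \<one>\<^bsub>G\<^esub> (act h (s \<otimes>\<^bsub>S\<^esub> s')) = skew_elt \<one>\<^bsub>G\<^esub> (act h s) \<otimes>\<^bsub>A\<^esub> skew_elt \<one>\<^bsub>G\<^esub> (act h s')"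
    using * s ac by (simp add: skew_elt_mult G_closed act_one act_mult monoid.l_one[OF group.is_monoid[OF group_axioms]])
  then show "right_S i (pc i a x) (s \<otimes>\<^bsub>S\<^esub> s') = right_S i (right_S i (pc i a x) s) s'"
    using * s e A_mult_closed A.L.m_assoc by (simp add: right_S_pure)
qed

lemma right_S_one: "t \<in> carrier (TC i) \<Longrightarrow> right_S i t \<one>\<^bsub>S\<^esub> = t"
  by (rule PC_eqI[OF TC_abelian right_S_additive additive_id])
    (simp_all add: right_S_pure act_ring_one A.L.r_one[simplified])

text \<open>For x of degree h the element x g has degree hg, so s acts on it through ^(hg) s = ^h
  (^g s).\<close>

lemma right_S_ract:
  assumes g: "g \<in> carrier G" and s: "s \<in> carrier S" and t: "t \<in> carrier (TC i)"
  shows "right_S i (ract (TC i) t (group_elt K G g)) s = ract (TC i) (right_S i t (act g s)) (group_elt K G g)"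
proof (rule PC_eqI[OF TC_abelian additive_comp[OF TC_ract_additive right_S_additive[OF s]]
      additive_comp[OF right_S_additive[OF act_closed[OF g s]] TC_ract_additive] _ t])
  fix a h x assume *: "a \<in> carrier A" "h \<in> carrier G" "x \<in> gC i h"
  note xc = C_homogeneous_closed[OF *(3,2)]
  have "a \<otimes>\<^bsub>A\<^esub> skew_elt \<one>\<^bsub>G\<^esub> (act h (act g s)) \<in> carrier A"
    using * g s by (intro A_mult_closed skew_elt_closed act_closed)
  then show "right_S i (ract (TC i) (pc i a x) (group_elt K G g)) s
    = ract (TC i) (right_S i (pc i a x) (act g s)) (group_elt K G g)"
    using * g s xc right_S_pure[OF s *(1) _ homogeneous_ract[OF g *(2,3)]]
    by (simp add: TC_ract_pure right_S_pure G_closed act_closed act_act)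
qed

lemma PC_sel [simp]: "carrier (PC i) = carrier (TC i)" "ring.add (PC i) = ring.add (TC i)" "\<zero>\<^bsub>PC i\<^esub> = \<zero>\<^bsub>TC i\<^esub>"
  "lact (PC i) = lact (TC i)"
  "ract (PC i) t a = (\<Oplus>\<^bsub>TC i\<^esub>g \<in> carrier G. ract (TC i) (right_S i t (a g)) (group_elt K G g))"
  by (simp_all add: kG_induced_def Let_def)

lemma TC_ract_group_elt:
  "\<lbrakk>g \<in> carrier G; h \<in> carrier G; t \<in> carrier (TC i)\<rbrakk> \<Longrightarrow>
    ract (TC i) t (group_elt K G (g \<otimes>\<^bsub>G\<^esub> h)) = ract (TC i) (ract (TC i) t (group_elt K G g)) (group_elt K G h)"
  "t \<in> carrier (TC i) \<Longrightarrow> ract (TC i) t (group_elt K G \<one>\<^bsub>G\<^esub>) = t"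
  using bimodule.ract_mult[OF tC.tensor_bimodule, of t i "group_elt K G g" "group_elt K G h"]
    bimodule.ract_one[OF tC.tensor_bimodule, of t i] group_elt_closed
  by (simp_all add: group_elt_mult)

lemma PC_right_action1:
  "a \<in> carrier A \<Longrightarrow> additive (TC i) (TC i) (\<lambda>t. ract (PC i) t a)"
  unfolding PC_sel(5)
  by (rule skew_right_action(1)[where T = "TC i" and sa = "right_S i" and ga = "\<lambda>t g. ract (TC i) t (group_elt K G g)"];
      (rule TC_abelian right_S_additive right_S_additive_right right_S_mult right_S_one TC_ract_additive
        TC_ract_group_elt right_S_ract; assumption)?)

lemma PC_right_action2:
  "t \<in> carrier (TC i) \<Longrightarrow> additive A (TC i) (ract (PC i) t)"
  unfolding PC_sel(5)
  by (rule skew_right_action(2)[where T = "TC i" and sa = "right_S i" and ga = "\<lambda>t g. ract (TC i) t (group_elt K G g)"];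
      (rule TC_abelian right_S_additive right_S_additive_right right_S_mult right_S_one TC_ract_additive
        TC_ract_group_elt right_S_ract; assumption)?)

lemma PC_right_action3:
  "\<lbrakk>a \<in> carrier A; b \<in> carrier A; t \<in> carrier (TC i)\<rbrakk> \<Longrightarrow>
    ract (PC i) t (a \<otimes>\<^bsub>A\<^esub> b) = ract (PC i) (ract (PC i) t a) b"
  unfolding PC_sel(5)
  by (rule skew_right_action(3)[where T = "TC i" and sa = "right_S i" and ga = "\<lambda>t g. ract (TC i) t (group_elt K G g)"];
      (rule TC_abelian right_S_additive right_S_additive_right right_S_mult right_S_one TC_ract_additive
        TC_ract_group_elt right_S_ract; assumption)?)

lemma PC_right_action4:
  "t \<in> carrier (TC i) \<Longrightarrow> ract (PC i) t \<one>\<^bsub>A\<^esub> = t"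
  unfolding PC_sel(5)
  by (rule skew_right_action(4)[where T = "TC i" and sa = "right_S i" and ga = "\<lambda>t g. ract (TC i) t (group_elt K G g)"];
      (rule TC_abelian right_S_additive right_S_additive_right right_S_mult right_S_one TC_ract_additive
        TC_ract_group_elt right_S_ract; assumption)?)

lemma PC_ract_elt:
  "\<lbrakk>g \<in> carrier G; s \<in> carrier S; t \<in> carrier (TC i)\<rbrakk> \<Longrightarrow>
    ract (PC i) t (skew_elt g s) = ract (TC i) (right_S i t s) (group_elt K G g)"
  unfolding PC_sel(5)
  by (rule skew_right_action(5)[where T = "TC i" and sa = "right_S i" and ga = "\<lambda>t g. ract (TC i) t (group_elt K G g)"];
      (rule TC_abelian right_S_additive right_S_additive_right right_S_mult right_S_one TC_ract_additive
        TC_ract_group_elt right_S_ract; assumption)?)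

lemmas PC_right_action = PC_right_action1 PC_right_action2 PC_right_action3 PC_right_action4

lemma PC_ract_pure:
  assumes "g \<in> carrier G" "s \<in> carrier S" "a \<in> carrier A" "h \<in> carrier G" "x \<in> gC i h"
  shows "ract (PC i) (pc i a x) (skew_elt g s)
    = pc i (a \<otimes>\<^bsub>A\<^esub> skew_elt \<one>\<^bsub>G\<^esub> (act h s)) (ract (C i) x (group_elt K G g))"
  using PC_ract_elt[OF assms(1,2) pc_closed[OF assms(3) C_homogeneous_closed[OF assms(5,4)]]] assms
    TC_ract_pure[OF assms(1) A_mult_closed[OF assms(3) skew_elt_closed[OF act_closed[OF assms(4,2)]]] C_homogeneous_closed[OF assms(5,4)]]
  by (simp add: right_S_pure del: PC_sel(5))

lemma PC_bimodule: "bimodule A A (PC i)"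
proof -
  interpret T: bimodule A kG "TC i" by (rule tC.tensor_bimodule)
  note r = PC_right_action
  have ab: "abelian_group (PC i)" by (rule abelian_group_cong[OF TC_abelian[of i]]) simp_all
  \<comment> \<open>On b \<otimes> x the left action multiplies b from the left and the twist
    multiplies b from the right, so associativity of A suffices.\<close>
  have comm: "ract (PC i) (lact (TC i) a' t) a = lact (TC i) a' (ract (PC i) t a)"
    if a': "a' \<in> carrier A" and a: "a \<in> carrier A" and t: "t \<in> carrier (TC i)" for a a' t
  proof -
    have la: "additive (TC i) (TC i) (lact (TC i) a')" using tC.lact_additive[OF a'] by (simp add: additive_def)
    show ?thesis
    proof (rule A_eqI[OF TC_abelian _ _ _ a])
      show "additive A (TC i) (ract (PC i) (lact (TC i) a' t))" by (rule r(2)[OF additive_closed[OF la t]])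
      show "additive A (TC i) (\<lambda>a. lact (TC i) a' (ract (PC i) t a))" by (rule additive_comp[OF r(2)[OF t] la])
      fix g s assume gs: "g \<in> carrier G" "s \<in> carrier S"
      note e = skew_elt_closed[OF gs(2), of g]
      show "ract (PC i) (lact (TC i) a' t) (skew_elt g s) = lact (TC i) a' (ract (PC i) t (skew_elt g s))"
      proof (rule PC_eqI[OF TC_abelian additive_comp[OF la r(1)[OF e]] additive_comp[OF r(1)[OF e] la] _ t])
        fix b h x assume *: "b \<in> carrier A" "h \<in> carrier G" "x \<in> gC i h"
        note xc = C_homogeneous_closed[OF *(3,2)]
        have l: "lact (TC i) a' (pc i b y) = pc i (a' \<otimes>\<^bsub>A\<^esub> b) y" if "y \<in> carrier (C i)" "b \<in> carrier A" for y b
          using tC.lact_pure[OF a' _ that(1), of b] that(2) by simp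
        have e1: "skew_elt \<one>\<^bsub>G\<^esub> (act h s) \<in> carrier A" using gs * by (intro skew_elt_closed act_closed)
        have xr: "ract (C i) x (group_elt K G g) \<in> carrier (C i)" using CB.ract_closed xc group_elt_closed by blast
        show "ract (PC i) (lact (TC i) a' (pc i b x)) (skew_elt g s) = lact (TC i) a' (ract (PC i) (pc i b x) (skew_elt g s))"
          unfolding l[OF xc *(1)] PC_ract_pure[OF gs A_mult_closed[OF a' *(1)] *(2,3)] PC_ract_pure[OF gs *]
            l[OF xr A_mult_closed[OF *(1) e1]] A.L.m_assoc[OF a' *(1) e1] ..
      qed
    qed
  qed
  show ?thesis
  proof (intro bimodule.intro bimodule_axioms.intro A_ring ab)
    fix x b y b' assume x: "x \<in> carrier (PC i)" and b: "b \<in> carrier A" and b': "b' \<in> carrier A"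
    have x': "x \<in> carrier (TC i)" using x by simp
    show "ract (PC i) x b \<in> carrier (PC i)" using additive_closed[OF r(2)[OF x'] b] by (simp del: PC_sel(5))
    show "ract (PC i) x (b \<oplus>\<^bsub>A\<^esub> b') = ract (PC i) x b \<oplus>\<^bsub>PC i\<^esub> ract (PC i) x b'"
      using additive_add[OF r(2)[OF x'] b b'] by (simp del: PC_sel(5))
    show "ract (PC i) (x \<oplus>\<^bsub>PC i\<^esub> y) b = ract (PC i) x b \<oplus>\<^bsub>PC i\<^esub> ract (PC i) y b" if "y \<in> carrier (PC i)"
      using additive_add[OF r(1)[OF b] x', of y] that by (simp del: PC_sel(5))
    show "ract (PC i) x (b \<otimes>\<^bsub>A\<^esub> b') = ract (PC i) (ract (PC i) x b) b'" using r(3)[OF b b' x'] .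
    show "ract (PC i) (lact (PC i) b' x) b = lact (PC i) b' (ract (PC i) x b)"
      using comm[OF b' b x'] by (simp del: PC_sel(5))
  qed (simp_all add: T.lact_closed[simplified] T.lact_add_left[simplified] T.lact_add_right[simplified] T.lact_mult[simplified]
      T.lact_one[unfolded tensor_simps] r(4)[unfolded tensor_simps] del: PC_sel(5) A_simps(3))
qed

lemma scalar_one_A: "c \<in> carrier K \<Longrightarrow> c \<odot>\<^bsub>A\<^esub> \<one>\<^bsub>A\<^esub> = skew_elt \<one>\<^bsub>G\<^esub> (c \<odot>\<^bsub>S\<^esub> \<one>\<^bsub>S\<^esub>)"
  by (simp add: A_smult_elt G_closed)

lemma PC_central: "central_bimodule K A (PC i)"
proof (intro central_bimodule.intro central_bimodule_axioms.intro PC_bimodule A_algebra)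
  fix c t assume c: "c \<in> carrier K" and "t \<in> carrier (PC i)"
  then have t: "t \<in> carrier (TC i)" by simp
  have cs: "c \<odot>\<^bsub>S\<^esub> \<one>\<^bsub>S\<^esub> \<in> carrier S" using c by simp
  note e = skew_elt_closed[OF cs, of "\<one>\<^bsub>G\<^esub>"]
  have la: "additive (TC i) (TC i) (lact (TC i) (skew_elt \<one>\<^bsub>G\<^esub> (c \<odot>\<^bsub>S\<^esub> \<one>\<^bsub>S\<^esub>)))"
    using tC.lact_additive[OF e] by (simp add: additive_def)
  have "lact (TC i) (skew_elt \<one>\<^bsub>G\<^esub> (c \<odot>\<^bsub>S\<^esub> \<one>\<^bsub>S\<^esub>)) t = ract (PC i) t (skew_elt \<one>\<^bsub>G\<^esub> (c \<odot>\<^bsub>S\<^esub> \<one>\<^bsub>S\<^esub>))"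
  proof (rule PC_eqI[OF TC_abelian la PC_right_action1[OF e] _ t])
    fix a h x assume *: "a \<in> carrier A" "h \<in> carrier G" "x \<in> gC i h"
    note xc = C_homogeneous_closed[OF *(3,2)]
    \<comment> \<open>Scalars are fixed by G, so the twist by the degree disappears.\<close>
    have ac: "act h (c \<odot>\<^bsub>S\<^esub> \<one>\<^bsub>S\<^esub>) = c \<odot>\<^bsub>S\<^esub> \<one>\<^bsub>S\<^esub>" using c * by (simp add: act_linear act_ring_one)
    have "skew_elt \<one>\<^bsub>G\<^esub> (c \<odot>\<^bsub>S\<^esub> \<one>\<^bsub>S\<^esub>) \<otimes>\<^bsub>A\<^esub> a = a \<otimes>\<^bsub>A\<^esub> skew_elt \<one>\<^bsub>G\<^esub> (c \<odot>\<^bsub>S\<^esub> \<one>\<^bsub>S\<^esub>)"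
      using A.smult_eq_mult[OF c *(1)] A.smult_eq_mult'[OF c *(1)] unfolding scalar_one_A[OF c] by simp
    then show "lact (TC i) (skew_elt \<one>\<^bsub>G\<^esub> (c \<odot>\<^bsub>S\<^esub> \<one>\<^bsub>S\<^esub>)) (pc i a x) = ract (PC i) (pc i a x) (skew_elt \<one>\<^bsub>G\<^esub> (c \<odot>\<^bsub>S\<^esub> \<one>\<^bsub>S\<^esub>))"
      unfolding PC_ract_pure[OF G_closed(3) cs *] ac group_elt_one_act(2)[OF xc]
      using tC.lact_pure[OF e _ xc, of a] * by simp
  qed
  then show "lact (PC i) (c \<odot>\<^bsub>A\<^esub> \<one>\<^bsub>A\<^esub>) t = ract (PC i) t (c \<odot>\<^bsub>A\<^esub> \<one>\<^bsub>A\<^esub>)"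
    unfolding scalar_one_A[OF c] by (simp del: PC_sel(5))
qed

end

section \<open>Unpacking a free resolution into bimodule maps\<close>

lemma free_env_resolutionD:
  assumes "free_env_resolution K L M d \<epsilon> N"
  shows "bimodule_hom L (M (Suc n)) (M n) (d (Suc n))" "bimodule_hom L (M 0) N \<epsilon>"
    "\<epsilon> ` carrier (M 0) = carrier N" "d (Suc 0) ` carrier (M (Suc 0)) = {x \<in> carrier (M 0). \<epsilon> x = \<zero>\<^bsub>N\<^esub>}"
    "d (Suc (Suc n)) ` carrier (M (Suc (Suc n))) = {x \<in> carrier (M (Suc n)). d (Suc n) x = \<zero>\<^bsub>M n\<^esub>}"
  using assms left_module_hom_env_module[of K L "M (Suc n)" "M n" "d (Suc n)"] left_module_hom_env_module[of K L "M 0" N \<epsilon>]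
  unfolding free_env_resolution_def free_resolution_def by simp_all

lemma bimodule_homD:
  assumes "bimodule_hom R M N f"
  shows "additive M N f" "\<And>r x. \<lbrakk>r \<in> carrier R; x \<in> carrier M\<rbrakk> \<Longrightarrow> f (lact M r x) = lact N r (f x)"
    "\<And>r x. \<lbrakk>r \<in> carrier R; x \<in> carrier M\<rbrakk> \<Longrightarrow> f (ract M x r) = ract N (f x) r"
    "left_linear R M N f" "right_linear R M N f"
  using assms by (auto simp: bimodule_hom_def left_linear_def right_linear_def)

context resolution_pair
begin

subsection \<open>The bimodules induced from the algebra\<close>

lemma D_central: "central_bimodule K S (D j)"
  using D.D_resolution by (simp add: free_env_resolution_def)

sublocale DB: central_bimodule K S "D j" for j by (rule D_central)

abbreviation (input) "gact j g \<equiv> aD j (group_elt K G g)"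

lemma aD_module:
  "\<lbrakk>b \<in> carrier kG; y \<in> carrier (D j)\<rbrakk> \<Longrightarrow> aD j b y \<in> carrier (D j)"
  "\<lbrakk>b \<in> carrier kG; y \<in> carrier (D j); z \<in> carrier (D j)\<rbrakk> \<Longrightarrow> aD j b (y \<oplus>\<^bsub>D j\<^esub> z) = aD j b y \<oplus>\<^bsub>D j\<^esub> aD j b z"
  "\<lbrakk>b \<in> carrier kG; b' \<in> carrier kG; y \<in> carrier (D j)\<rbrakk> \<Longrightarrow> aD j (b \<otimes>\<^bsub>kG\<^esub> b') y = aD j b (aD j b' y)"
  "y \<in> carrier (D j) \<Longrightarrow> aD j \<one>\<^bsub>kG\<^esub> y = y"
  using left_module.smult_closed[OF D.D_kG_module[of j]] left_module.smult_r_distr[OF D.D_kG_module[of j]]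
    left_module.smult_assoc[OF D.D_kG_module[of j]] left_module.smult_one[OF D.D_kG_module[of j]]
  by (simp_all del: group_algebra_simps)

lemma gact_additive: "additive (D j) (D j) (gact j g)"
  by (intro additiveI aD_module group_elt_closed)

lemmas gact_closed = additive_closed[OF gact_additive]

lemma gact_mult: "\<lbrakk>g \<in> carrier G; h \<in> carrier G; y \<in> carrier (D j)\<rbrakk> \<Longrightarrow> gact j (g \<otimes>\<^bsub>G\<^esub> h) y = gact j g (gact j h y)"
  by (simp add: aD_module(3) group_elt_closed flip: group_elt_mult)

lemma gact_one: "y \<in> carrier (D j) \<Longrightarrow> gact j \<one>\<^bsub>G\<^esub> y = y"
  using aD_module(4) by simp

text \<open>Comes from the module structure over A provided by \<open>D_compatible\<close>: apply
  its associativity to (1 \<otimes> g)(s \<otimes> 1) = ^g s \<otimes> g.\<close>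

lemma gact_lact:
  assumes g: "g \<in> carrier G" and s: "s \<in> carrier S" and y: "y \<in> carrier (D j)"
  shows "gact j g (lact (D j) s y) = lact (D j) (act g s) (gact j g y)"
proof -
  obtain m where m: "left_module A (with_smult (D j) m)"
    and me: "\<forall>s \<in> carrier S. \<forall>b \<in> carrier kG. \<forall>y \<in> carrier (D j). m (skew_tensor S G s b) y = lact (D j) s (aD j b y)"
    using D.D_compatible[of j] by auto
  have m1: "m (skew_elt h t) z = lact (D j) t (gact j h z)" if "t \<in> carrier S" "h \<in> carrier G" "z \<in> carrier (D j)" for t h z
    using me that group_elt_closed by (simp add: skew_tensor_elt[folded skew_elt_def, symmetric])
  have e: "skew_elt g \<one>\<^bsub>S\<^esub> \<in> carrier A" "skew_elt \<one>\<^bsub>G\<^esub> s \<in> carrier A" using s by (simp_all add: skew_elt_closed)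
  have "m (skew_elt g \<one>\<^bsub>S\<^esub> \<otimes>\<^bsub>A\<^esub> skew_elt \<one>\<^bsub>G\<^esub> s) y = m (skew_elt g \<one>\<^bsub>S\<^esub>) (m (skew_elt \<one>\<^bsub>G\<^esub> s) y)"
    using left_module.smult_assoc[OF m e] y by simp
  then show ?thesis
    using g s y by (simp add: skew_elt_mult G_closed m1 gact_one DB.lact_closed DB.lact_one act_closed gact_closed
        monoid.r_one[OF group.is_monoid[OF group_axioms]])
qed

lemma gact_ract:
  "\<lbrakk>g \<in> carrier G; s \<in> carrier S; y \<in> carrier (D j)\<rbrakk> \<Longrightarrow> gact j g (ract (D j) y s) = ract (D j) (gact j g y) (act g s)"
  using D.D_right_compatible by simp

abbreviation (input) "TD j \<equiv> tensor S (D j) A\<^sub>l"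
abbreviation (input) "pd j \<equiv> pure_tensor S (D j) A\<^sub>l"
abbreviation (input) "QD j \<equiv> S_induced K S G act (D j) (aD j)"

lemma A_l_sel [simp]: "carrier A\<^sub>l = carrier A" "ring.add A\<^sub>l = ring.add A" "\<zero>\<^bsub>A\<^sub>l\<^esub> = \<zero>\<^bsub>A\<^esub>" "ract A\<^sub>l = monoid.mult A"
  "s \<in> carrier S \<Longrightarrow> lact A\<^sub>l s a = skew_elt \<one>\<^bsub>G\<^esub> s \<otimes>\<^bsub>A\<^esub> a"
  using skew_tensor_kG_one[of s] by (simp_all add: skew_as_S_A_def Let_def)

sublocale tD: bimodule_pair S S A "D j" A\<^sub>l for j
  by (intro bimodule_pair.intro A_l_bimodule DB.bimodule_axioms)

lemma TD_abelian: "abelian_group (TD j)"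
  using tD.tensor_bimodule by (rule bimodule.axioms)

lemma TD_eqI:
  assumes "abelian_group N" "additive (TD j) N f" "additive (TD j) N f'"
    "\<And>y a. \<lbrakk>y \<in> carrier (D j); a \<in> carrier A\<rbrakk> \<Longrightarrow> f (pd j y a) = f' (pd j y a)" "X \<in> carrier (TD j)"
  shows "f X = f' X"
  using tD.tensor_additive_eqI[of N j f f' X] assms by (simp add: additive_def)

lemma pd_closed: "y \<in> carrier (D j) \<Longrightarrow> a \<in> carrier A \<Longrightarrow> pd j y a \<in> carrier (TD j)"
  using tD.pure_closed by simp

lemma skew_tensor_one_elt: "g \<in> carrier G \<Longrightarrow> skew_tensor S G \<one>\<^bsub>S\<^esub> (group_elt K G g) = skew_elt g \<one>\<^bsub>S\<^esub>"
  by (simp add: skew_tensor_elt skew_elt_def)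

abbreviation (input) "left_G j \<equiv> S_induced_left_G K S G act (D j) (aD j)"

text \<open>Moving s across the tensor sign: g (y s) = (g y)(^g s) by \<open>gact_ract\<close>, and
  (^g s) g = g s in A. Here the compatibility of G with the right action of S on D_j is
  used.\<close>

lemma left_G_balanced:
  assumes g: "g \<in> carrier G"
  shows "balanced_map S (D j) A\<^sub>l (tensor_group S (D j) A\<^sub>l)
    (\<lambda>y a. pd j (gact j g y) (skew_tensor S G \<one>\<^bsub>S\<^esub> (group_elt K G g) \<otimes>\<^bsub>A\<^esub> a))"
proof -
  have e: "skew_elt g \<one>\<^bsub>S\<^esub> \<in> carrier A" by (simp add: skew_elt_closed)
  show ?thesis
    unfolding skew_tensor_one_elt[OF g]
  proof (rule balanced_mapI)
    fix y s a assume y: "y \<in> carrier (D j)" and s: "s \<in> carrier S" and "a \<in> carrier A\<^sub>l"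
    then have a: "a \<in> carrier A" by simp
    note ea = A_mult_closed[OF e a]
    have e1: "skew_elt \<one>\<^bsub>G\<^esub> (act g s) \<in> carrier A" "skew_elt \<one>\<^bsub>G\<^esub> s \<in> carrier A" using s g by (simp_all add: skew_elt_closed act_closed)
    have "pd j (gact j g (ract (D j) y s)) (skew_elt g \<one>\<^bsub>S\<^esub> \<otimes>\<^bsub>A\<^esub> a)
      = pd j (gact j g y) (skew_elt \<one>\<^bsub>G\<^esub> (act g s) \<otimes>\<^bsub>A\<^esub> (skew_elt g \<one>\<^bsub>S\<^esub> \<otimes>\<^bsub>A\<^esub> a))"
      using tD.pure_balanced[OF gact_closed[OF y, of g] act_closed[OF g s], of "skew_elt g \<one>\<^bsub>S\<^esub> \<otimes>\<^bsub>A\<^esub> a"] ea g s y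
      by (simp add: gact_ract act_closed)
    also have "skew_elt \<one>\<^bsub>G\<^esub> (act g s) \<otimes>\<^bsub>A\<^esub> (skew_elt g \<one>\<^bsub>S\<^esub> \<otimes>\<^bsub>A\<^esub> a) = skew_elt g \<one>\<^bsub>S\<^esub> \<otimes>\<^bsub>A\<^esub> (skew_elt \<one>\<^bsub>G\<^esub> s \<otimes>\<^bsub>A\<^esub> a)"
      unfolding A.L.m_assoc[OF e1(1) e a, symmetric] A.L.m_assoc[OF e e1(2) a, symmetric]
      using g s by (simp add: skew_elt_mult G_closed act_closed act_one act_ring_one monoid.l_one[OF group.is_monoid[OF group_axioms]]
          monoid.r_one[OF group.is_monoid[OF group_axioms]])
    finally show "pd j (gact j g (ract (D j) y s)) (skew_elt g \<one>\<^bsub>S\<^esub> \<otimes>\<^bsub>A\<^esub> a)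
      = pd j (gact j g y) (skew_elt g \<one>\<^bsub>S\<^esub> \<otimes>\<^bsub>A\<^esub> lact A\<^sub>l s a)" using s by simp
  qed (use e tD.pure_add_left tD.pure_add_right tD.pure_closed in
      \<open>simp_all add: A_mult_closed gact_closed additive_add[OF gact_additive] additive_add[OF A_mult_additive_right]\<close>)
qed

lemma left_G_eq: "left_G j g = tensor_lift (tensor_group S (D j) A\<^sub>l)
    (\<lambda>y a. pd j (gact j g y) (skew_tensor S G \<one>\<^bsub>S\<^esub> (group_elt K G g) \<otimes>\<^bsub>A\<^esub> a))"
  by (simp add: S_induced_left_G_def Let_def fun_eq_iff)

lemma left_G_additive: "g \<in> carrier G \<Longrightarrow> additive (TD j) (TD j) (left_G j g)"
  using tD.lift_additive[OF tD.tensor_abelian_group left_G_balanced] by (simp add: left_G_eq additive_def)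

lemma left_G_pure:
  "\<lbrakk>g \<in> carrier G; y \<in> carrier (D j); a \<in> carrier A\<rbrakk> \<Longrightarrow>
    left_G j g (pd j y a) = pd j (gact j g y) (skew_elt g \<one>\<^bsub>S\<^esub> \<otimes>\<^bsub>A\<^esub> a)"
  using tD.lift_pure[OF tD.tensor_abelian_group left_G_balanced] by (simp add: S_induced_left_G_def Let_def skew_tensor_one_elt)

lemma TD_lact_pure:
  "\<lbrakk>s \<in> carrier S; y \<in> carrier (D j); a \<in> carrier A\<rbrakk> \<Longrightarrow> lact (TD j) s (pd j y a) = pd j (lact (D j) s y) a"
  using tD.lact_pure by simp

lemma TD_ract_pure:
  "\<lbrakk>b \<in> carrier A; y \<in> carrier (D j); a \<in> carrier A\<rbrakk> \<Longrightarrow> ract (TD j) (pd j y a) b = pd j y (a \<otimes>\<^bsub>A\<^esub> b)"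
  using tD.ract_pure by simp

lemma TD_lact_additive: "s \<in> carrier S \<Longrightarrow> additive (TD j) (TD j) (lact (TD j) s)"
  using tD.lact_additive by (simp add: additive_def)

lemma TD_ract_additive: "b \<in> carrier A \<Longrightarrow> additive (TD j) (TD j) (\<lambda>t. ract (TD j) t b)"
  using tD.ract_additive by (simp add: additive_def)

lemma TD_lact_additive_left: "t \<in> carrier (TD j) \<Longrightarrow> additive S (TD j) (\<lambda>s. lact (TD j) s t)"
  by (intro additiveI bimodule.lact_closed[OF tD.tensor_bimodule] bimodule.lact_add_left[OF tD.tensor_bimodule])

lemma left_G_mult:
  assumes "g \<in> carrier G" "h \<in> carrier G" "t \<in> carrier (TD j)"
  shows "left_G j (g \<otimes>\<^bsub>G\<^esub> h) t = left_G j g (left_G j h t)"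
proof (rule TD_eqI[OF TD_abelian left_G_additive additive_comp[OF left_G_additive left_G_additive] _ assms(3)])
  fix y a assume ya: "y \<in> carrier (D j)" "a \<in> carrier A"
  have e: "skew_elt h \<one>\<^bsub>S\<^esub> \<in> carrier A" "skew_elt g \<one>\<^bsub>S\<^esub> \<in> carrier A" by (simp_all add: skew_elt_closed)
  have "skew_elt (g \<otimes>\<^bsub>G\<^esub> h) \<one>\<^bsub>S\<^esub> = skew_elt g \<one>\<^bsub>S\<^esub> \<otimes>\<^bsub>A\<^esub> skew_elt h \<one>\<^bsub>S\<^esub>"
    using assms by (simp add: skew_elt_mult act_ring_one)
  then show "left_G j (g \<otimes>\<^bsub>G\<^esub> h) (pd j y a) = left_G j g (left_G j h (pd j y a))"
    using assms ya e by (simp add: left_G_pure G_closed gact_closed A_mult_closed gact_mult A.L.m_assoc)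
qed (use assms G_closed in auto)

lemma left_G_one: "t \<in> carrier (TD j) \<Longrightarrow> left_G j \<one>\<^bsub>G\<^esub> t = t"
  by (rule TD_eqI[OF TD_abelian left_G_additive additive_id])
    (simp_all add: left_G_pure G_closed gact_one A.L.l_one[unfolded A_simps(3)])

lemma left_G_lact:
  assumes "g \<in> carrier G" "s \<in> carrier S" "t \<in> carrier (TD j)"
  shows "left_G j g (lact (TD j) s t) = lact (TD j) (act g s) (left_G j g t)"
  by (rule TD_eqI[OF TD_abelian additive_comp[OF TD_lact_additive left_G_additive] additive_comp[OF left_G_additive TD_lact_additive] _ assms(3)])
    (use assms in \<open>simp_all add: act_closed left_G_pure TD_lact_pure DB.lact_closed gact_closed gact_lact A_mult_closed skew_elt_closed\<close>)

lemma QD_sel [simp]: "carrier (QD j) = carrier (TD j)" "ring.add (QD j) = ring.add (TD j)" "\<zero>\<^bsub>QD j\<^esub> = \<zero>\<^bsub>TD j\<^esub>"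
  "ract (QD j) = ract (TD j)" "lact (QD j) a t = (\<Oplus>\<^bsub>TD j\<^esub>g \<in> carrier G. lact (TD j) (a g) (left_G j g t))"
  by (simp_all add: S_induced_def Let_def)

lemma TD_lact_mult_one:
  "\<lbrakk>s \<in> carrier S; s' \<in> carrier S; t \<in> carrier (TD j)\<rbrakk> \<Longrightarrow> lact (TD j) (s \<otimes>\<^bsub>S\<^esub> s') t = lact (TD j) s (lact (TD j) s' t)"
  "t \<in> carrier (TD j) \<Longrightarrow> lact (TD j) \<one>\<^bsub>S\<^esub> t = t"
  using bimodule.lact_mult[OF tD.tensor_bimodule] bimodule.lact_one[OF tD.tensor_bimodule] by blast+

lemma QD_left_action1:
  "a \<in> carrier A \<Longrightarrow> additive (TD j) (TD j) (lact (QD j) a)"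
  unfolding QD_sel(5)[abs_def]
  by (rule skew_left_action(1)[where T = "TD j" and sa = "lact (TD j)" and ga = "left_G j"];
      (rule TD_abelian TD_lact_additive TD_lact_additive_left TD_lact_mult_one left_G_additive left_G_mult left_G_one left_G_lact; assumption)?)

lemma QD_left_action2:
  "t \<in> carrier (TD j) \<Longrightarrow> additive A (TD j) (\<lambda>a. lact (QD j) a t)"
  unfolding QD_sel(5)
  by (rule skew_left_action(2)[where T = "TD j" and sa = "lact (TD j)" and ga = "left_G j"];
      (rule TD_abelian TD_lact_additive TD_lact_additive_left TD_lact_mult_one left_G_additive left_G_mult left_G_one left_G_lact; assumption)?)

lemma QD_left_action3:
  "\<lbrakk>a \<in> carrier A; b \<in> carrier A; t \<in> carrier (TD j)\<rbrakk> \<Longrightarrow> lact (QD j) (a \<otimes>\<^bsub>A\<^esub> b) t = lact (QD j) a (lact (QD j) b t)"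
  unfolding QD_sel(5)
  by (rule skew_left_action(3)[where T = "TD j" and sa = "lact (TD j)" and ga = "left_G j"];
      (rule TD_abelian TD_lact_additive TD_lact_additive_left TD_lact_mult_one left_G_additive left_G_mult left_G_one left_G_lact; assumption)?)

lemma QD_left_action4:
  "t \<in> carrier (TD j) \<Longrightarrow> lact (QD j) \<one>\<^bsub>A\<^esub> t = t"
  unfolding QD_sel(5)
  by (rule skew_left_action(4)[where T = "TD j" and sa = "lact (TD j)" and ga = "left_G j"];
      (rule TD_abelian TD_lact_additive TD_lact_additive_left TD_lact_mult_one left_G_additive left_G_mult left_G_one left_G_lact; assumption)?)

lemma QD_lact_elt:
  "\<lbrakk>g \<in> carrier G; s \<in> carrier S; t \<in> carrier (TD j)\<rbrakk> \<Longrightarrow> lact (QD j) (skew_elt g s) t = lact (TD j) s (left_G j g t)"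
  unfolding QD_sel(5)
  by (rule skew_left_action(5)[where T = "TD j" and sa = "lact (TD j)" and ga = "left_G j"];
      (rule TD_abelian TD_lact_additive TD_lact_additive_left TD_lact_mult_one left_G_additive left_G_mult left_G_one left_G_lact; assumption)?)

lemma QD_lact_pure:
  assumes "g \<in> carrier G" "s \<in> carrier S" "y \<in> carrier (D j)" "a \<in> carrier A"
  shows "lact (QD j) (skew_elt g s) (pd j y a) = pd j (lact (D j) s (gact j g y)) (skew_elt g \<one>\<^bsub>S\<^esub> \<otimes>\<^bsub>A\<^esub> a)"
  using assms QD_lact_elt[OF assms(1,2) pd_closed[OF assms(3,4)]]
  by (simp add: left_G_pure TD_lact_pure gact_closed A_mult_closed skew_elt_closed del: QD_sel(5))

lemma QD_bimodule: "bimodule A A (QD j)"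
proof -
  interpret T: bimodule S A "TD j" by (rule tD.tensor_bimodule)
  note r1 = QD_left_action1[of _ j] and r2 = QD_left_action2[of _ j] and r3 = QD_left_action3[of _ _ _ j] and r4 = QD_left_action4[of _ j]
  have ab: "abelian_group (QD j)" by (rule abelian_group_cong[OF TD_abelian[of j]]) simp_all
  have comm: "ract (TD j) (lact (QD j) a t) a' = lact (QD j) a (ract (TD j) t a')"
    if a': "a' \<in> carrier A" and a: "a \<in> carrier A" and t: "t \<in> carrier (TD j)" for a a' t
  proof (rule A_eqI[OF TD_abelian additive_comp[OF r2[OF t] TD_ract_additive[OF a']] r2[OF additive_closed[OF TD_ract_additive[OF a'] t]] _ a])
    fix g s assume gs: "g \<in> carrier G" "s \<in> carrier S"
    note e = skew_elt_closed[OF gs(2), of g]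
    show "ract (TD j) (lact (QD j) (skew_elt g s) t) a' = lact (QD j) (skew_elt g s) (ract (TD j) t a')"
    proof (rule TD_eqI[OF TD_abelian additive_comp[OF r1[OF e] TD_ract_additive[OF a']] additive_comp[OF TD_ract_additive[OF a'] r1[OF e]] _ t])
      fix y b assume yb: "y \<in> carrier (D j)" "b \<in> carrier A"
      have e1: "skew_elt g \<one>\<^bsub>S\<^esub> \<in> carrier A" by (simp add: skew_elt_closed)
      have l: "lact (D j) s (gact j g y) \<in> carrier (D j)" using gs yb by (simp add: DB.lact_closed gact_closed)
      show "ract (TD j) (lact (QD j) (skew_elt g s) (pd j y b)) a' = lact (QD j) (skew_elt g s) (ract (TD j) (pd j y b) a')"
        unfolding QD_lact_pure[OF gs yb] TD_ract_pure[OF a' yb] TD_ract_pure[OF a' l A_mult_closed[OF e1 yb(2)]]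
          QD_lact_pure[OF gs yb(1) A_mult_closed[OF yb(2) a']] A.L.m_assoc[OF e1 yb(2) a'] ..
    qed
  qed
  show ?thesis
  proof (intro bimodule.intro bimodule_axioms.intro A_ring ab)
    fix x b y b' assume x: "x \<in> carrier (QD j)" and b: "b \<in> carrier A" and b': "b' \<in> carrier A"
    have x': "x \<in> carrier (TD j)" using x by simp
    show "lact (QD j) b x \<in> carrier (QD j)" using additive_closed[OF r2[OF x'] b] by (simp del: QD_sel(5))
    show "lact (QD j) (b \<oplus>\<^bsub>A\<^esub> b') x = lact (QD j) b x \<oplus>\<^bsub>QD j\<^esub> lact (QD j) b' x"
      using additive_add[OF r2[OF x'] b b'] by (simp del: QD_sel(5))
    show "lact (QD j) b (x \<oplus>\<^bsub>QD j\<^esub> y) = lact (QD j) b x \<oplus>\<^bsub>QD j\<^esub> lact (QD j) b y" if "y \<in> carrier (QD j)"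
      using additive_add[OF r1[OF b] x', of y] that by (simp del: QD_sel(5))
    show "lact (QD j) (b \<otimes>\<^bsub>A\<^esub> b') x = lact (QD j) b (lact (QD j) b' x)" using r3[OF b b' x'] .
    show "ract (QD j) (lact (QD j) b' x) b = lact (QD j) b' (ract (QD j) x b)"
      using comm[OF b b' x'] by (simp del: QD_sel(5))
  qed (simp_all add: T.ract_closed[unfolded tensor_simps] T.ract_add_left[unfolded tensor_simps] T.ract_add_right[unfolded tensor_simps]
      T.ract_mult[unfolded tensor_simps] T.ract_one[unfolded tensor_simps] r4[unfolded tensor_simps] del: QD_sel(5) A_simps(3))
qed

lemma QD_central: "central_bimodule K A (QD j)"
proof (intro central_bimodule.intro central_bimodule_axioms.intro QD_bimodule A_algebra)
  fix c t assume c: "c \<in> carrier K" and "t \<in> carrier (QD j)"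
  then have t: "t \<in> carrier (TD j)" by simp
  have cs: "c \<odot>\<^bsub>S\<^esub> \<one>\<^bsub>S\<^esub> \<in> carrier S" using c by simp
  note e = skew_elt_closed[OF cs, of "\<one>\<^bsub>G\<^esub>"]
  have "lact (QD j) (skew_elt \<one>\<^bsub>G\<^esub> (c \<odot>\<^bsub>S\<^esub> \<one>\<^bsub>S\<^esub>)) t = ract (TD j) t (skew_elt \<one>\<^bsub>G\<^esub> (c \<odot>\<^bsub>S\<^esub> \<one>\<^bsub>S\<^esub>))"
  proof (rule TD_eqI[OF TD_abelian QD_left_action1[OF e] TD_ract_additive[OF e] _ t])
    fix y a assume ya: "y \<in> carrier (D j)" "a \<in> carrier A"
    have "skew_elt \<one>\<^bsub>G\<^esub> (c \<odot>\<^bsub>S\<^esub> \<one>\<^bsub>S\<^esub>) \<otimes>\<^bsub>A\<^esub> a = a \<otimes>\<^bsub>A\<^esub> skew_elt \<one>\<^bsub>G\<^esub> (c \<odot>\<^bsub>S\<^esub> \<one>\<^bsub>S\<^esub>)"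
      using A.smult_eq_mult[OF c ya(2)] A.smult_eq_mult'[OF c ya(2)] unfolding scalar_one_A[OF c] by simp
    moreover have "pd j (lact (D j) (c \<odot>\<^bsub>S\<^esub> \<one>\<^bsub>S\<^esub>) y) a = pd j y (skew_elt \<one>\<^bsub>G\<^esub> (c \<odot>\<^bsub>S\<^esub> \<one>\<^bsub>S\<^esub>) \<otimes>\<^bsub>A\<^esub> a)"
      using tD.pure_balanced[OF ya(1) cs, of a] ya cs DB.central[OF c ya(1)] by simp
    ultimately show "lact (QD j) (skew_elt \<one>\<^bsub>G\<^esub> (c \<odot>\<^bsub>S\<^esub> \<one>\<^bsub>S\<^esub>)) (pd j y a) = ract (TD j) (pd j y a) (skew_elt \<one>\<^bsub>G\<^esub> (c \<odot>\<^bsub>S\<^esub> \<one>\<^bsub>S\<^esub>))"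
      unfolding QD_lact_pure[OF G_closed(3) cs ya] TD_ract_pure[OF e ya]
      using gact_one[OF ya(1)] A.L.l_one[OF ya(2)] by simp
  qed
  then show "lact (QD j) (c \<odot>\<^bsub>A\<^esub> \<one>\<^bsub>A\<^esub>) t = ract (QD j) t (c \<odot>\<^bsub>A\<^esub> \<one>\<^bsub>A\<^esub>)"
    unfolding scalar_one_A[OF c] by (simp del: QD_sel(5))
qed

text \<open>Right linearity is tested where the action is explicit, on homogeneous tensors and
  elements s \<otimes> g. The condition involves the degree h, so it is here that the grading of a
  differential enters.\<close>

lemma PC_right_linearI:
  assumes N: "bimodule A A N" and f: "additive (PC i) N f"
    and r: "\<And>a h x g s. \<lbrakk>a \<in> carrier A; h \<in> carrier G; x \<in> gC i h; g \<in> carrier G; s \<in> carrier S\<rbrakk> \<Longrightarrow>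
      f (pc i (a \<otimes>\<^bsub>A\<^esub> skew_elt \<one>\<^bsub>G\<^esub> (act h s)) (ract (C i) x (group_elt K G g))) = ract N (f (pc i a x)) (skew_elt g s)"
  shows "right_linear A (PC i) N f"
proof -
  interpret N: bimodule A A N by fact
  have f': "additive (TC i) N f" using f by (simp add: additive_def)
  have ra: "additive N N (\<lambda>x. ract N x a)" if "a \<in> carrier A" for a
    using that by (intro additiveI N.ract_closed N.ract_add_left)
  have rb: "additive A N (ract N x)" if "x \<in> carrier N" for x
    using that by (intro additiveI N.ract_closed N.ract_add_right)
  have "f (ract (PC i) t a) = ract N (f t) a" if t: "t \<in> carrier (TC i)" and a: "a \<in> carrier A" for t a
  proof (rule A_eqI[OF N.M.abelian_group_axioms additive_comp[OF PC_right_action2[OF t] f'] rb[OF additive_closed[OF f' t]] _ a])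
    fix g s assume gs: "g \<in> carrier G" "s \<in> carrier S"
    note e = skew_elt_closed[OF gs(2), of g]
    show "f (ract (PC i) t (skew_elt g s)) = ract N (f t) (skew_elt g s)"
      by (rule PC_eqI[OF N.M.abelian_group_axioms additive_comp[OF PC_right_action1[OF e] f'] additive_comp[OF f' ra[OF e]] _ t])
        (simp only: PC_ract_pure gs r)
  qed
  then show ?thesis using f by (simp add: right_linear_def del: PC_sel(5))
qed

lemma QD_left_linearI:
  assumes N: "bimodule A A N" and f: "additive (QD j) N f"
    and r: "\<And>y a g s. \<lbrakk>y \<in> carrier (D j); a \<in> carrier A; g \<in> carrier G; s \<in> carrier S\<rbrakk> \<Longrightarrow>
      f (pd j (lact (D j) s (gact j g y)) (skew_elt g \<one>\<^bsub>S\<^esub> \<otimes>\<^bsub>A\<^esub> a)) = lact N (skew_elt g s) (f (pd j y a))"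
  shows "left_linear A (QD j) N f"
proof -
  interpret N: bimodule A A N by fact
  have f': "additive (TD j) N f" using f by (simp add: additive_def)
  have ra: "additive N N (lact N a)" if "a \<in> carrier A" for a
    using that by (intro additiveI N.lact_closed N.lact_add_right)
  have rb: "additive A N (\<lambda>a. lact N a x)" if "x \<in> carrier N" for x
    using that by (intro additiveI N.lact_closed N.lact_add_left)
  have "f (lact (QD j) a t) = lact N a (f t)" if t: "t \<in> carrier (TD j)" and a: "a \<in> carrier A" for t a
  proof (rule A_eqI[OF N.M.abelian_group_axioms additive_comp[OF QD_left_action2[OF t] f'] rb[OF additive_closed[OF f' t]] _ a])
    fix g s assume gs: "g \<in> carrier G" "s \<in> carrier S"
    note e = skew_elt_closed[OF gs(2), of g]
    show "f (lact (QD j) (skew_elt g s) t) = lact N (skew_elt g s) (f t)"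
      by (rule TD_eqI[OF N.M.abelian_group_axioms additive_comp[OF QD_left_action1[OF e] f'] additive_comp[OF f' ra[OF e]] _ t])
        (simp only: QD_lact_pure gs r)
  qed
  then show ?thesis using f by (simp add: left_linear_def del: QD_sel(5))
qed

subsection \<open>The induced resolutions\<close>

lemmas C_res = free_env_resolutionD[OF C.C_resolution]
lemmas D_res = free_env_resolutionD[OF D.D_resolution]

abbreviation (input) "dP i \<equiv> kG_induced_map K S G act (C i) (C (i - 1)) (dC i)"
abbreviation (input) "\<epsilon>P \<equiv> kG_induced_aug K S G act (C 0) \<epsilon>C"
abbreviation (input) "dQ j \<equiv> S_induced_map K S G act (D j) (D (j - 1)) (dD j)"
abbreviation (input) "\<epsilon>Q \<equiv> S_induced_aug K S G act (D 0) \<epsilon>D"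

sublocale mC: bimodule_pair_maps A kG kG A\<^sub>r "C (Suc i)" A kG A\<^sub>r "C i" "\<lambda>a. a" "dC (Suc i)" for i
  by (intro bimodule_pair_maps.intro bimodule_pair_maps_axioms.intro tC.bimodule_pair_axioms right_linear_id
      bimodule_homD(4)[OF C_res(1)])

lemma regular_kG: "bimodule kG kG (regular_bimodule kG)"
  using central_regular_bimodule[OF kG_algebra] by (rule central_bimodule.axioms)

lemma regular_S: "bimodule S S (regular_bimodule S)"
  using central_regular_bimodule[OF algebra_over_field_axioms] by (rule central_bimodule.axioms)

lemma regular_A: "bimodule A A (regular_bimodule A)"
  using central_regular_bimodule[OF A_algebra] by (rule central_bimodule.axioms)

sublocale rC: bimodule_pair A kG kG A\<^sub>r "regular_bimodule kG"
  by (intro bimodule_pair.intro A_r_bimodule kG_algebra regular_kG)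

sublocale eC: bimodule_pair_maps A kG kG A\<^sub>r "C 0" A kG A\<^sub>r "regular_bimodule kG" "\<lambda>a. a" \<epsilon>C
  by (intro bimodule_pair_maps.intro bimodule_pair_maps_axioms.intro tC.bimodule_pair_axioms rC.bimodule_pair_axioms
      right_linear_id bimodule_homD(4)[OF C_res(2)])

lemma dP_pure: "\<lbrakk>a \<in> carrier A; x \<in> carrier (C (Suc i))\<rbrakk> \<Longrightarrow> dP (Suc i) (pc (Suc i) a x) = pc i a (dC (Suc i) x)"
  using mC.map_pure by (simp add: kG_induced_map_def)

lemma dP_additive: "additive (PC (Suc i)) (PC i) (dP (Suc i))"
  using mC.map_additive by (simp add: kG_induced_map_def additive_def)

lemma dP_hom: "bimodule_hom A (PC (Suc i)) (PC i) (dP (Suc i))"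
proof -
  note d = bimodule_homD[OF C_res(1)]
  note dc = additive_closed[OF d(1)]
  have dadd: "additive (TC (Suc i)) (TC i) (dP (Suc i))" using dP_additive[of i] by (simp add: additive_def)
  have la: "additive (TC i) (TC i) (lact (TC i) a)" if "a \<in> carrier A" for a i
    using tC.lact_additive[OF that] by (simp add: additive_def)
  have "dP (Suc i) (lact (TC (Suc i)) a t) = lact (TC i) a (dP (Suc i) t)"
    if a: "a \<in> carrier A" and t: "t \<in> carrier (TC (Suc i))" for a t
  proof (rule PC_eqI[OF TC_abelian additive_comp[OF la[OF a] dadd] additive_comp[OF dadd la[OF a]] _ t])
    fix b h x assume *: "b \<in> carrier A" "h \<in> carrier G" "x \<in> gC (Suc i) h"
    note xc = C_homogeneous_closed[OF *(3,2)]
    have l: "lact (TC k) a (pc k b y) = pc k (a \<otimes>\<^bsub>A\<^esub> b) y" if "y \<in> carrier (C k)" for k y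
      using tC.lact_pure[OF a _ that, of b] * by simp
    show "dP (Suc i) (lact (TC (Suc i)) a (pc (Suc i) b x)) = lact (TC i) a (dP (Suc i) (pc (Suc i) b x))"
      unfolding l[OF xc] dP_pure[OF *(1) xc] dP_pure[OF A_mult_closed[OF a *(1)] xc] l[OF dc[OF xc]] ..
  qed
  then have "left_linear A (PC (Suc i)) (PC i) (dP (Suc i))" using dP_additive by (simp add: left_linear_def)
  moreover have "right_linear A (PC (Suc i)) (PC i) (dP (Suc i))"
  proof (rule PC_right_linearI[OF PC_bimodule dP_additive])
    fix a h x g s assume *: "a \<in> carrier A" "h \<in> carrier G" "x \<in> gC (Suc i) h" "g \<in> carrier G" "s \<in> carrier S"
    note xc = C_homogeneous_closed[OF *(3,2)]
    \<comment> \<open>d x has the degree h of x, so that s is twisted in the same way before and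
      after applying d.\<close>
    have dx: "dC (Suc i) x \<in> gC i h" using C.dC_graded[OF *(2), of i] *(3) by blast
    have e: "a \<otimes>\<^bsub>A\<^esub> skew_elt \<one>\<^bsub>G\<^esub> (act h s) \<in> carrier A" using * by (intro A_mult_closed skew_elt_closed act_closed)
    show "dP (Suc i) (pc (Suc i) (a \<otimes>\<^bsub>A\<^esub> skew_elt \<one>\<^bsub>G\<^esub> (act h s)) (ract (C (Suc i)) x (group_elt K G g)))
      = ract (PC i) (dP (Suc i) (pc (Suc i) a x)) (skew_elt g s)"
      unfolding dP_pure[OF *(1) xc] dP_pure[OF e CB.ract_closed[OF xc group_elt_closed]]
        PC_ract_pure[OF *(4,5,1,2) dx] d(3)[OF group_elt_closed xc] ..
  qed
  ultimately show ?thesis by (simp add: bimodule_hom_def)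
qed

lemma kG_aug_balanced: "balanced_map kG A\<^sub>r (regular_bimodule kG) A (\<lambda>a b. a \<otimes>\<^bsub>A\<^esub> kG_in_A b)"
  by (rule balanced_mapI)
    (simp_all add: A_mult_closed additive_closed[OF kG_in_A_additive] A.L.l_distr A.L.r_distr
      additive_add[OF kG_in_A_additive] kG_in_A_mult[OF kG_algebra] A.L.m_assoc)

lemma \<epsilon>P_eq: "\<epsilon>P = (\<lambda>t. tensor_lift A (\<lambda>a b. a \<otimes>\<^bsub>A\<^esub> kG_in_A b)
    (tensor_map kG A\<^sub>r (C 0) A\<^sub>r (regular_bimodule kG) (\<lambda>a. a) \<epsilon>C t))"
  by (simp add: kG_induced_aug_def kG_induced_map_def kG_in_A_def Let_def fun_eq_iff)

lemma \<epsilon>P_additive: "additive (PC 0) (regular_bimodule A) \<epsilon>P"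
  unfolding \<epsilon>P_eq
  using additive_comp[OF eC.map_additive, of "regular_bimodule A"] rC.lift_additive[OF abelian_group_A kG_aug_balanced]
  by (simp add: additive_def)

lemma \<epsilon>C_closed: "x \<in> carrier (C 0) \<Longrightarrow> \<epsilon>C x \<in> carrier kG"
  using additive_closed[OF bimodule_homD(1)[OF C_res(2)]] by simp

lemma \<epsilon>P_pure: "\<lbrakk>a \<in> carrier A; x \<in> carrier (C 0)\<rbrakk> \<Longrightarrow> \<epsilon>P (pc 0 a x) = a \<otimes>\<^bsub>A\<^esub> kG_in_A (\<epsilon>C x)"
  using eC.map_pure[of a x] rC.lift_pure[OF abelian_group_A kG_aug_balanced, of a "\<epsilon>C x"]
  by (simp add: \<epsilon>P_eq \<epsilon>C_closed)

lemma \<epsilon>P_hom: "bimodule_hom A (PC 0) (regular_bimodule A) \<epsilon>P"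
proof -
  note d = bimodule_homD[OF C_res(2)]
  have uc: "kG_in_A (\<epsilon>C x) \<in> carrier A" if "x \<in> carrier (C 0)" for x
    using additive_closed[OF kG_in_A_additive \<epsilon>C_closed[OF that]] .
  have eadd: "additive (TC 0) A \<epsilon>P" using \<epsilon>P_additive by (simp add: additive_def)
  have la: "additive (TC 0) (TC 0) (lact (TC 0) a)" if "a \<in> carrier A" for a
    using tC.lact_additive[OF that] by (simp add: additive_def)
  have "\<epsilon>P (lact (TC 0) a t) = a \<otimes>\<^bsub>A\<^esub> \<epsilon>P t"
    if a: "a \<in> carrier A" and t: "t \<in> carrier (TC 0)" for a t
  proof (rule PC_eqI[OF abelian_group_A additive_comp[OF la[OF a] eadd] additive_comp[OF eadd A_mult_additive_right[OF a]] _ t])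
    fix b h x assume *: "b \<in> carrier A" "h \<in> carrier G" "x \<in> gC 0 h"
    note xc = C_homogeneous_closed[OF *(3,2)]
    have l: "lact (TC 0) a (pc 0 b x) = pc 0 (a \<otimes>\<^bsub>A\<^esub> b) x"
      using tC.lact_pure[OF a _ xc, of b] * by simp
    show "\<epsilon>P (lact (TC 0) a (pc 0 b x)) = a \<otimes>\<^bsub>A\<^esub> \<epsilon>P (pc 0 b x)"
      unfolding l \<epsilon>P_pure[OF *(1) xc] \<epsilon>P_pure[OF A_mult_closed[OF a *(1)] xc] A.L.m_assoc[OF a *(1) uc[OF xc]] ..
  qed
  then have "left_linear A (PC 0) (regular_bimodule A) \<epsilon>P" using \<epsilon>P_additive by (simp add: left_linear_def)
  moreover have "right_linear A (PC 0) (regular_bimodule A) \<epsilon>P"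
  proof (rule PC_right_linearI[OF regular_A \<epsilon>P_additive])
    fix a h x g s assume *: "a \<in> carrier A" "h \<in> carrier G" "x \<in> gC 0 h" "g \<in> carrier G" "s \<in> carrier S"
    note xc = C_homogeneous_closed[OF *(3,2)]
    \<comment> \<open>The augmentation of x is a multiple c h of its degree; commuting s past h in A
      produces the same twist ^h s as the right action does.\<close>
    have "\<epsilon>C x \<in> group_algebra_grading K G h" using C.\<epsilon>C_graded[OF *(2)] *(3) by blast
    then obtain c where c: "c \<in> carrier K" "\<epsilon>C x = c \<odot>\<^bsub>kG\<^esub> group_elt K G h" by (auto simp: group_algebra_grading_def)
    have e1: "skew_elt \<one>\<^bsub>G\<^esub> (act h s) \<in> carrier A" "skew_elt g s \<in> carrier A" "skew_elt h (c \<odot>\<^bsub>S\<^esub> \<one>\<^bsub>S\<^esub>) \<in> carrier A"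
      using * c by (auto intro!: skew_elt_closed act_closed)
    have r: "\<epsilon>C (ract (C 0) x (group_elt K G g)) = c \<odot>\<^bsub>kG\<^esub> group_elt K G (h \<otimes>\<^bsub>G\<^esub> g)"
      using d(3)[OF group_elt_closed xc] c *(2,4) group_elt_closed
      by (simp add: kG.smult_mult_left group_elt_mult)
    have "skew_elt \<one>\<^bsub>G\<^esub> (act h s) \<otimes>\<^bsub>A\<^esub> skew_elt (h \<otimes>\<^bsub>G\<^esub> g) (c \<odot>\<^bsub>S\<^esub> \<one>\<^bsub>S\<^esub>) = skew_elt h (c \<odot>\<^bsub>S\<^esub> \<one>\<^bsub>S\<^esub>) \<otimes>\<^bsub>A\<^esub> skew_elt g s"
      using * c by (simp add: skew_elt_mult G_closed act_closed act_one smult_mult_left smult_mult_right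
          monoid.l_one[OF group.is_monoid[OF group_axioms]])
    then show "\<epsilon>P (pc 0 (a \<otimes>\<^bsub>A\<^esub> skew_elt \<one>\<^bsub>G\<^esub> (act h s)) (ract (C 0) x (group_elt K G g)))
      = ract (regular_bimodule A) (\<epsilon>P (pc 0 a x)) (skew_elt g s)"
      using * c e1 \<epsilon>P_pure[OF A_mult_closed[OF *(1) e1(1)] CB.ract_closed[OF xc group_elt_closed]] \<epsilon>P_pure[OF *(1) xc]
        A.L.m_assoc[OF *(1) e1(3) e1(2)] A.L.m_assoc[OF *(1) e1(1) skew_elt_closed]
      by (simp add: r kG_in_A_elt G_closed)
  qed
  ultimately show ?thesis by (simp add: bimodule_hom_def)
qed

text \<open>A is free as a right kG-module, so A \<otimes> C is, as a complex of groups, a sum of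
  copies of C indexed by a k-basis of S, and its augmentation is a sum of copies of that of
  C.\<close>

lemma P_exact:
  "\<epsilon>P ` carrier (PC 0) = carrier A"
  "dP (Suc 0) ` carrier (PC (Suc 0)) = {x \<in> carrier (PC 0). \<epsilon>P x = \<zero>\<^bsub>A\<^esub>}"
  "dP (Suc (Suc i)) ` carrier (PC (Suc (Suc i))) = {x \<in> carrier (PC (Suc i)). dP (Suc i) x = \<zero>\<^bsub>PC i\<^esub>}"
proof -
  obtain B prj where B: "B \<subseteq> carrier S" and cB: "copower A\<^sub>r kG B (\<lambda>s b. ract A\<^sub>r (skew_elt \<one>\<^bsub>G\<^esub> s) b) prj"
    using A_r_copower by auto
  have e: "skew_elt \<one>\<^bsub>G\<^esub> s \<in> carrier A\<^sub>r" if "s \<in> B" for s using that B by (auto intro: skew_elt_closed)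
  note t = tC.tensor_copower_left[OF cB e refl]
  have cP: "\<exists>prj. copower (PC i) (C i) B (\<lambda>s. pc i (skew_elt \<one>\<^bsub>G\<^esub> s)) prj" for i
    by (rule exI, rule copower_cong_structure[OF t]) simp_all
  then obtain pP where cP: "\<And>i. copower (PC i) (C i) B (\<lambda>s. pc i (skew_elt \<one>\<^bsub>G\<^esub> s)) (pP i)" by metis
  have cA: "copower A (regular_bimodule kG) B (\<lambda>s b. ract A\<^sub>r (skew_elt \<one>\<^bsub>G\<^esub> s) b) prj"
    by (rule copower_cong_structure[OF cB]) simp_all
  have d: "dP (Suc i) (pc (Suc i) (skew_elt \<one>\<^bsub>G\<^esub> s) x) = pc i (skew_elt \<one>\<^bsub>G\<^esub> s) (dC (Suc i) x)"
    if "s \<in> B" "x \<in> carrier (C (Suc i))" for s x i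
    using dP_pure[OF _ that(2)] e[OF that(1)] by simp
  have eps: "\<epsilon>P (pc 0 (skew_elt \<one>\<^bsub>G\<^esub> s) x) = ract A\<^sub>r (skew_elt \<one>\<^bsub>G\<^esub> s) (\<epsilon>C x)" if "s \<in> B" "x \<in> carrier (C 0)" for s x
    using \<epsilon>P_pure[OF _ that(2)] e[OF that(1)] by simp
  have eadd: "additive (PC 0) A \<epsilon>P" using \<epsilon>P_additive by (simp add: additive_def)
  note dadd = bimodule_homD(1)[OF C_res(1)] and epsadd = bimodule_homD(1)[OF C_res(2)]
  show "\<epsilon>P ` carrier (PC 0) = carrier A"
    by (rule copower_surj[OF cP cA eadd eps C_res(3)])
  show "dP (Suc 0) ` carrier (PC (Suc 0)) = {x \<in> carrier (PC 0). \<epsilon>P x = \<zero>\<^bsub>A\<^esub>}"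
    by (rule copower_exact[OF cP cP cA dP_additive dadd eadd epsadd d eps C_res(4)])
  show "dP (Suc (Suc i)) ` carrier (PC (Suc (Suc i))) = {x \<in> carrier (PC (Suc i)). dP (Suc i) x = \<zero>\<^bsub>PC i\<^esub>}"
    by (rule copower_exact[OF cP cP cP dP_additive dadd dP_additive dadd d d C_res(5)])
qed

sublocale mD: bimodule_pair_maps S S A "D (Suc j)" A\<^sub>l S A "D j" A\<^sub>l "dD (Suc j)" "\<lambda>a. a" for j
  by (intro bimodule_pair_maps.intro bimodule_pair_maps_axioms.intro tD.bimodule_pair_axioms left_linear_id
      bimodule_homD(5)[OF D_res(1)])

sublocale rD: bimodule_pair S S A "regular_bimodule S" A\<^sub>l
  by (intro bimodule_pair.intro A_l_bimodule regular_S)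

sublocale eD: bimodule_pair_maps S S A "D 0" A\<^sub>l S A "regular_bimodule S" A\<^sub>l \<epsilon>D "\<lambda>a. a"
  by (intro bimodule_pair_maps.intro bimodule_pair_maps_axioms.intro tD.bimodule_pair_axioms rD.bimodule_pair_axioms
      left_linear_id bimodule_homD(5)[OF D_res(2)])

lemma dQ_pure: "\<lbrakk>y \<in> carrier (D (Suc j)); a \<in> carrier A\<rbrakk> \<Longrightarrow> dQ (Suc j) (pd (Suc j) y a) = pd j (dD (Suc j) y) a"
  using mD.map_pure by (simp add: S_induced_map_def)

lemma dQ_additive: "additive (QD (Suc j)) (QD j) (dQ (Suc j))"
  using mD.map_additive by (simp add: S_induced_map_def additive_def)

lemma dD_gact:
  assumes "y \<in> carrier (D (Suc j))"
  shows "dD (Suc j) (gact (Suc j) g y) = gact j g (dD (Suc j) y)"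
  using D.dD_equivariant[of j] assms group_elt_closed[of g] by (simp add: left_module_hom_def)

lemma dQ_hom: "bimodule_hom A (QD (Suc j)) (QD j) (dQ (Suc j))"
proof -
  note d = bimodule_homD[OF D_res(1)]
  note dc = additive_closed[OF d(1)]
  have dadd: "additive (TD (Suc j)) (TD j) (dQ (Suc j))" using dQ_additive[of j] by (simp add: additive_def)
  have "dQ (Suc j) (ract (TD (Suc j)) t a) = ract (TD j) (dQ (Suc j) t) a"
    if a: "a \<in> carrier A" and t: "t \<in> carrier (TD (Suc j))" for a t
    by (rule TD_eqI[OF TD_abelian additive_comp[OF TD_ract_additive[OF a] dadd] additive_comp[OF dadd TD_ract_additive[OF a]] _ t])
      (simp only: TD_ract_pure[OF a] dQ_pure dc A_mult_closed a)
  then have "right_linear A (QD (Suc j)) (QD j) (dQ (Suc j))" using dQ_additive by (simp add: right_linear_def)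
  moreover have "left_linear A (QD (Suc j)) (QD j) (dQ (Suc j))"
  proof (rule QD_left_linearI[OF QD_bimodule dQ_additive])
    fix y a g s assume *: "y \<in> carrier (D (Suc j))" "a \<in> carrier A" "g \<in> carrier G" "s \<in> carrier S"
    have e: "skew_elt g \<one>\<^bsub>S\<^esub> \<otimes>\<^bsub>A\<^esub> a \<in> carrier A" using * by (intro A_mult_closed skew_elt_closed) auto
    show "dQ (Suc j) (pd (Suc j) (lact (D (Suc j)) s (gact (Suc j) g y)) (skew_elt g \<one>\<^bsub>S\<^esub> \<otimes>\<^bsub>A\<^esub> a))
      = lact (QD j) (skew_elt g s) (dQ (Suc j) (pd (Suc j) y a))"
      unfolding dQ_pure[OF *(1,2)] QD_lact_pure[OF *(3,4) dc[OF *(1)] *(2)]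
        dQ_pure[OF DB.lact_closed[OF *(4) gact_closed[OF *(1)]] e] d(2)[OF *(4) gact_closed[OF *(1)]] dD_gact[OF *(1)] ..
  qed
  ultimately show ?thesis by (simp add: bimodule_hom_def)
qed

lemma S_aug_balanced: "balanced_map S (regular_bimodule S) A\<^sub>l A (\<lambda>s a. skew_tensor S G s \<one>\<^bsub>kG\<^esub> \<otimes>\<^bsub>A\<^esub> a)"
proof (rule balanced_mapI)
  fix x r y assume *: "x \<in> carrier (regular_bimodule S)" "r \<in> carrier S" "y \<in> carrier A\<^sub>l"
  then have c: "x \<in> carrier S" "y \<in> carrier A" by simp_all
  have e: "skew_elt \<one>\<^bsub>G\<^esub> x \<in> carrier A" "skew_elt \<one>\<^bsub>G\<^esub> r \<in> carrier A" using c * by (auto intro: skew_elt_closed)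
  have "skew_elt \<one>\<^bsub>G\<^esub> (x \<otimes>\<^bsub>S\<^esub> r) = skew_elt \<one>\<^bsub>G\<^esub> x \<otimes>\<^bsub>A\<^esub> skew_elt \<one>\<^bsub>G\<^esub> r"
    using c * by (simp add: skew_elt_mult G_closed act_one monoid.l_one[OF group.is_monoid[OF group_axioms]])
  then show "skew_tensor S G (ract (regular_bimodule S) x r) \<one>\<^bsub>kG\<^esub> \<otimes>\<^bsub>A\<^esub> y = skew_tensor S G x \<one>\<^bsub>kG\<^esub> \<otimes>\<^bsub>A\<^esub> lact A\<^sub>l r y"
    using c * A.L.m_assoc[OF e c(2)] by (simp add: skew_tensor_kG_one[unfolded group_algebra_simps])
qed (simp_all add: skew_tensor_kG_one[unfolded group_algebra_simps] A_mult_closed skew_elt_closed A.L.l_distr A.L.r_distr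
    additive_add[OF skew_elt_additive[OF G_closed(3)]])

lemma \<epsilon>Q_eq: "\<epsilon>Q = (\<lambda>t. tensor_lift A (\<lambda>s a. skew_tensor S G s \<one>\<^bsub>kG\<^esub> \<otimes>\<^bsub>A\<^esub> a)
    (tensor_map S (D 0) A\<^sub>l (regular_bimodule S) A\<^sub>l \<epsilon>D (\<lambda>a. a) t))"
  by (simp add: S_induced_aug_def S_induced_map_def Let_def fun_eq_iff)

lemma \<epsilon>Q_additive: "additive (QD 0) (regular_bimodule A) \<epsilon>Q"
  unfolding \<epsilon>Q_eq
  using additive_comp[OF eD.map_additive, of "regular_bimodule A"] rD.lift_additive[OF abelian_group_A S_aug_balanced]
  by (simp add: additive_def)

lemma \<epsilon>D_closed: "y \<in> carrier (D 0) \<Longrightarrow> \<epsilon>D y \<in> carrier S"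
  using additive_closed[OF bimodule_homD(1)[OF D_res(2)]] by simp

lemma \<epsilon>Q_pure: "\<lbrakk>y \<in> carrier (D 0); a \<in> carrier A\<rbrakk> \<Longrightarrow> \<epsilon>Q (pd 0 y a) = skew_elt \<one>\<^bsub>G\<^esub> (\<epsilon>D y) \<otimes>\<^bsub>A\<^esub> a"
  using eD.map_pure[of y a] rD.lift_pure[OF abelian_group_A S_aug_balanced, of "\<epsilon>D y" a]
  by (simp add: \<epsilon>Q_eq \<epsilon>D_closed skew_tensor_kG_one[unfolded group_algebra_simps])

lemma \<epsilon>D_gact:
  assumes y: "y \<in> carrier (D 0)" and g: "g \<in> carrier G"
  shows "\<epsilon>D (gact 0 g y) = act g (\<epsilon>D y)"
proof -
  have "\<epsilon>D (gact 0 g y) = (\<Oplus>\<^bsub>S\<^esub>h \<in> carrier G. group_elt K G g h \<odot>\<^bsub>S\<^esub> act h (\<epsilon>D y))"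
    using D.\<epsilon>D_equivariant y group_elt_closed[of g] by (simp add: left_module_hom_def)
  also have "\<dots> = group_elt K G g g \<odot>\<^bsub>S\<^esub> act g (\<epsilon>D y)"
    by (rule finsum_delta[OF abelian_group.axioms(1)[OF S_ab] finite_group g])
      (use y \<epsilon>D_closed act_closed ring.ring_simprules(6)[OF K_ring] ring.ring_simprules(2)[OF K_ring] in \<open>auto simp: group_elt_def\<close>)
  also have "\<dots> = act g (\<epsilon>D y)" using g act_closed \<epsilon>D_closed[OF y] by (simp add: group_elt_def)
  finally show ?thesis .
qed

lemma \<epsilon>Q_hom: "bimodule_hom A (QD 0) (regular_bimodule A) \<epsilon>Q"
proof -
  note d = bimodule_homD[OF D_res(2)]
  have dc: "skew_elt \<one>\<^bsub>G\<^esub> (\<epsilon>D y) \<in> carrier A" if "y \<in> carrier (D 0)" for y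
    using \<epsilon>D_closed[OF that] by (rule skew_elt_closed)
  have dadd: "additive (TD 0) A \<epsilon>Q" using \<epsilon>Q_additive by (simp add: additive_def)
  have "\<epsilon>Q (ract (TD 0) t a) = \<epsilon>Q t \<otimes>\<^bsub>A\<^esub> a"
    if a: "a \<in> carrier A" and t: "t \<in> carrier (TD 0)" for a t
    by (rule TD_eqI[OF abelian_group_A additive_comp[OF TD_ract_additive[OF a] dadd] additive_comp[OF dadd A_mult_additive_left[OF a]] _ t])
      (simp only: TD_ract_pure[OF a] \<epsilon>Q_pure dc A_mult_closed a A.L.m_assoc)
  then have "right_linear A (QD 0) (regular_bimodule A) \<epsilon>Q" using \<epsilon>Q_additive by (simp add: right_linear_def)
  moreover have "left_linear A (QD 0) (regular_bimodule A) \<epsilon>Q"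
  proof (rule QD_left_linearI[OF regular_A \<epsilon>Q_additive])
    fix y a g s assume *: "y \<in> carrier (D 0)" "a \<in> carrier A" "g \<in> carrier G" "s \<in> carrier S"
    have e: "skew_elt g \<one>\<^bsub>S\<^esub> \<in> carrier A" "skew_elt g s \<in> carrier A" using * by (auto intro!: skew_elt_closed)
    note ec = \<epsilon>D_closed[OF *(1)]
    have l: "\<epsilon>D (lact (D 0) s (gact 0 g y)) = s \<otimes>\<^bsub>S\<^esub> act g (\<epsilon>D y)"
      using d(2)[OF *(4) gact_closed[OF *(1)]] \<epsilon>D_gact[OF *(1,3)] by simp
    have m: "skew_elt \<one>\<^bsub>G\<^esub> (s \<otimes>\<^bsub>S\<^esub> act g (\<epsilon>D y)) \<otimes>\<^bsub>A\<^esub> skew_elt g \<one>\<^bsub>S\<^esub> = skew_elt g s \<otimes>\<^bsub>A\<^esub> skew_elt \<one>\<^bsub>G\<^esub> (\<epsilon>D y)"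
      using * ec by (simp add: skew_elt_mult G_closed act_closed act_one monoid.l_one[OF group.is_monoid[OF group_axioms]]
          monoid.r_one[OF group.is_monoid[OF group_axioms]])
    have sc: "skew_elt \<one>\<^bsub>G\<^esub> (s \<otimes>\<^bsub>S\<^esub> act g (\<epsilon>D y)) \<in> carrier A" using * ec by (intro skew_elt_closed L.m_closed act_closed)
    show "\<epsilon>Q (pd 0 (lact (D 0) s (gact 0 g y)) (skew_elt g \<one>\<^bsub>S\<^esub> \<otimes>\<^bsub>A\<^esub> a))
      = lact (regular_bimodule A) (skew_elt g s) (\<epsilon>Q (pd 0 y a))"
      unfolding \<epsilon>Q_pure[OF *(1,2)] \<epsilon>Q_pure[OF DB.lact_closed[OF *(4) gact_closed[OF *(1)]] A_mult_closed[OF e(1) *(2)]] l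
        A.L.m_assoc[OF sc e(1) *(2), symmetric] m
      using A.L.m_assoc[OF e(2) dc[OF *(1)] *(2)] by simp
  qed
  ultimately show ?thesis by (simp add: bimodule_hom_def)
qed

lemma QD_copower: "\<exists>prj. copower (QD j) (D j) (carrier G) (\<lambda>g y. pd j y (skew_elt g \<one>\<^bsub>S\<^esub>)) prj"
proof -
  have e: "skew_elt g \<one>\<^bsub>S\<^esub> \<in> carrier A\<^sub>l" if "g \<in> carrier G" for g by (simp add: skew_elt_closed)
  show ?thesis
    by (rule exI, rule copower_cong_structure[OF tD.tensor_copower_right[OF A_l_copower e refl]]) simp_all
qed

text \<open>Likewise D \<otimes> A is a sum of copies of D indexed by G, as A is free as a left
  S-module on the group elements.\<close>

lemma Q_exact:
  "\<epsilon>Q ` carrier (QD 0) = carrier A"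
  "dQ (Suc 0) ` carrier (QD (Suc 0)) = {x \<in> carrier (QD 0). \<epsilon>Q x = \<zero>\<^bsub>A\<^esub>}"
  "dQ (Suc (Suc j)) ` carrier (QD (Suc (Suc j))) = {x \<in> carrier (QD (Suc j)). dQ (Suc j) x = \<zero>\<^bsub>QD j\<^esub>}"
proof -
  obtain pQ where cQ: "\<And>j. copower (QD j) (D j) (carrier G) (\<lambda>g y. pd j y (skew_elt g \<one>\<^bsub>S\<^esub>)) (pQ j)"
    using QD_copower by metis
  have cA: "copower A (regular_bimodule S) (carrier G) skew_elt (\<lambda>g a. a g)"
    by (rule copower_cong_structure[OF A_copower]) simp_all
  have e: "skew_elt g \<one>\<^bsub>S\<^esub> \<in> carrier A" for g by (simp add: skew_elt_closed)
  have d: "dQ (Suc j) (pd (Suc j) y (skew_elt g \<one>\<^bsub>S\<^esub>)) = pd j (dD (Suc j) y) (skew_elt g \<one>\<^bsub>S\<^esub>)"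
    if "g \<in> carrier G" "y \<in> carrier (D (Suc j))" for g y j
    using dQ_pure[OF that(2) e] .
  have eps: "\<epsilon>Q (pd 0 y (skew_elt g \<one>\<^bsub>S\<^esub>)) = skew_elt g (\<epsilon>D y)" if "g \<in> carrier G" "y \<in> carrier (D 0)" for g y
    using \<epsilon>Q_pure[OF that(2) e] that \<epsilon>D_closed[OF that(2)]
    by (simp add: skew_elt_mult G_closed act_one monoid.l_one[OF group.is_monoid[OF group_axioms]])
  have eadd: "additive (QD 0) A \<epsilon>Q" using \<epsilon>Q_additive by (simp add: additive_def)
  note dadd = bimodule_homD(1)[OF D_res(1)] and epsadd = bimodule_homD(1)[OF D_res(2)]
  show "\<epsilon>Q ` carrier (QD 0) = carrier A"
    by (rule copower_surj[OF cQ cA eadd eps D_res(3)])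
  show "dQ (Suc 0) ` carrier (QD (Suc 0)) = {x \<in> carrier (QD 0). \<epsilon>Q x = \<zero>\<^bsub>A\<^esub>}"
    by (rule copower_exact[OF cQ cQ cA dQ_additive dadd eadd epsadd d eps D_res(4)])
  show "dQ (Suc (Suc j)) ` carrier (QD (Suc (Suc j))) = {x \<in> carrier (QD (Suc j)). dQ (Suc j) x = \<zero>\<^bsub>QD j\<^esub>}"
    by (rule copower_exact[OF cQ cQ cQ dQ_additive dadd dQ_additive dadd d d D_res(5)])
qed

end

text \<open>An automorphism of N is put into each inclusion and its inverse into the projection. The
  automorphisms will be s \<mapsto> ^(g|b|) s and their inverses.\<close>

lemma copower_twist:
  assumes "copower M N I inc prj"
    and \<alpha>: "\<And>i. i \<in> I \<Longrightarrow> additive N N (\<alpha> i)" and \<beta>: "\<And>i. i \<in> I \<Longrightarrow> additive N N (\<beta> i)"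
    and inv: "\<And>i n. \<lbrakk>i \<in> I; n \<in> carrier N\<rbrakk> \<Longrightarrow> \<alpha> i (\<beta> i n) = n" "\<And>i n. \<lbrakk>i \<in> I; n \<in> carrier N\<rbrakk> \<Longrightarrow> \<beta> i (\<alpha> i n) = n"
  shows "copower M N I (\<lambda>i n. inc i (\<alpha> i n)) (\<lambda>i x. \<beta> i (prj i x))"
proof -
  interpret M: copower M N I inc prj by fact
  show ?thesis
  proof (intro copower.intro copower_axioms.intro M.M.abelian_group_axioms M.N.abelian_group_axioms)
    fix i assume i: "i \<in> I"
    show "additive N M (\<lambda>n. inc i (\<alpha> i n))" by (rule additive_comp[OF \<alpha>[OF i] M.inc_additive[OF i]])
    show "additive M N (\<lambda>x. \<beta> i (prj i x))" by (rule additive_comp[OF M.prj_additive[OF i] \<beta>[OF i]])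
    fix j n assume j: "j \<in> I" and n: "n \<in> carrier N"
    have "\<beta> i \<zero>\<^bsub>N\<^esub> = \<zero>\<^bsub>N\<^esub>" using additive_zero[OF M.N.abelian_group_axioms M.N.abelian_group_axioms \<beta>[OF i]] .
    then show "\<beta> i (prj i (inc j (\<alpha> j n))) = (if i = j then n else \<zero>\<^bsub>N\<^esub>)"
      using M.prj_inc[OF i j additive_closed[OF \<alpha>[OF j] n]] inv(2)[OF j n] by simp
  next
    fix P x assume x: "x \<in> carrier M" and P: "P \<zero>\<^bsub>M\<^esub>"
      "\<And>u v. u \<in> carrier M \<Longrightarrow> v \<in> carrier M \<Longrightarrow> P u \<Longrightarrow> P v \<Longrightarrow> P (u \<oplus>\<^bsub>M\<^esub> v)"
      "\<And>i n. i \<in> I \<Longrightarrow> n \<in> carrier N \<Longrightarrow> P (inc i (\<alpha> i n))"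
    from x show "P x"
    proof (induction x rule: M.induct)
      case (incl i n)
      show ?case using P(3)[OF incl(1) additive_closed[OF \<beta>[OF incl(1)] incl(2)]] inv(1)[OF incl] by simp
    qed (use P in auto)
  qed
qed

text \<open>The isomorphism \<phi> carries the basis 1 \<otimes> v_b \<otimes> 1 to a basis x_b of
  M. The vectors are given as a function v of the index, because the indices coming from
  \<open>homogeneous_basis\<close> carry the degree as well.\<close>

lemma env_copower_transport:
  assumes "algebra_over_field K L" "module K V" "central_bimodule K L M"
    and B: "copower V K B (\<lambda>b c. c \<odot>\<^bsub>V\<^esub> v b) prj" and v: "\<And>b. b \<in> B \<Longrightarrow> v b \<in> carrier V"
    and \<phi>: "\<phi> \<in> left_module_iso (enveloping_algebra K L) (env_module (two_sided_tensor K L (space_bimodule V))) (env_module M)"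
  defines "x \<equiv> \<lambda>b. \<phi> (algebra_over_field.two_sided_pure K L (space_bimodule V) \<one>\<^bsub>L\<^esub> (v b) \<one>\<^bsub>L\<^esub>)"
  shows "\<exists>prj. copower M (enveloping_algebra K L) B (\<lambda>b t. t \<odot>\<^bsub>env_module M\<^esub> x b) prj"
    and "\<And>b. b \<in> B \<Longrightarrow> x b \<in> carrier M"
proof -
  interpret L: algebra_over_field K L by fact
  interpret M: central_bimodule K L M by fact
  let ?Z = "two_sided_tensor K L (space_bimodule V)"
  let ?E = "enveloping_algebra K L"
  note V = space_bimodule_bimodule[OF \<open>module K V\<close>]
  interpret Z: central_bimodule K L ?Z by (rule L.two_sided_central[OF V]) simp
  have B': "copower (space_bimodule V) K B (\<lambda>b c. c \<odot>\<^bsub>V\<^esub> v b) prj" by (rule copower_cong_structure[OF B]) simp_all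
  have v': "v b \<in> carrier (space_bimodule V)" if "b \<in> B" for b using v[OF that] by simp
  obtain p where p: "copower ?Z ?E B (\<lambda>b t. t \<odot>\<^bsub>env_module ?Z\<^esub> L.two_sided_pure (space_bimodule V) \<one>\<^bsub>L\<^esub> (v b) \<one>\<^bsub>L\<^esub>) p"
    using L.two_sided_copower(1)[OF V _ B', of v] v' by auto
  have uc: "L.two_sided_pure (space_bimodule V) \<one>\<^bsub>L\<^esub> (v b) \<one>\<^bsub>L\<^esub> \<in> carrier ?Z" if "b \<in> B" for b
    using L.two_sided_copower(2)[OF V _ B', of v "v b"] v' that by simp
  have h: "\<phi> \<in> left_module_hom ?E (env_module ?Z) (env_module M)" and bij: "bij_betw \<phi> (carrier ?Z) (carrier M)"
    using \<phi> by (simp_all add: left_module_iso_def)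
  have add: "additive ?Z M \<phi>"
    using h left_module_hom_env_module[OF Z.central_bimodule_axioms M.central_bimodule_axioms] bimodule_homD(1) by blast
  show xc: "x b \<in> carrier M" if "b \<in> B" for b
    using additive_closed[OF add uc[OF that]] by (simp add: x_def)
  have "copower M ?E B (\<lambda>b t. t \<odot>\<^bsub>env_module M\<^esub> x b) (\<lambda>i y. p i (inv_into (carrier ?Z) \<phi> y))"
  proof (rule copower_cong[OF copower_transport[OF p M.M.abelian_group_axioms add bij]])
    fix b t assume "b \<in> B" "t \<in> carrier ?E"
    then show "\<phi> (t \<odot>\<^bsub>env_module ?Z\<^esub> L.two_sided_pure (space_bimodule V) \<one>\<^bsub>L\<^esub> (v b) \<one>\<^bsub>L\<^esub>) = t \<odot>\<^bsub>env_module M\<^esub> x b"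
      using h uc unfolding left_module_hom_def x_def by simp
  qed
  then show "\<exists>prj. copower M ?E B (\<lambda>b t. t \<odot>\<^bsub>env_module M\<^esub> x b) prj" by (intro exI)
qed

section \<open>Finite direct sums of bimodules\<close>

lemma bimodule_sum_simps [simp]:
  "carrier (bimodule_sum I M) = (\<Pi>\<^sub>E i \<in> I. carrier (M i))" "\<zero>\<^bsub>bimodule_sum I M\<^esub> = (\<lambda>i \<in> I. \<zero>\<^bsub>M i\<^esub>)"
  "x \<oplus>\<^bsub>bimodule_sum I M\<^esub> y = (\<lambda>i \<in> I. x i \<oplus>\<^bsub>M i\<^esub> y i)"
  "lact (bimodule_sum I M) a x = (\<lambda>i \<in> I. lact (M i) a (x i))"
  "ract (bimodule_sum I M) x b = (\<lambda>i \<in> I. ract (M i) (x i) b)"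
  by (simp_all add: bimodule_sum_def)

lemma bimodule_sum_central:
  assumes M: "\<And>i. i \<in> I \<Longrightarrow> central_bimodule K L (M i)" and L: "algebra_over_field K L"
  shows "central_bimodule K L (bimodule_sum I M)"
proof -
  interpret L: algebra_over_field K L by fact
  note B = central_bimodule.axioms(2)[OF M]
  note ab = bimodule.axioms(3)[OF B]
  note f = abelian_monoid.a_closed[OF abelian_group.axioms(1)[OF ab]] abelian_monoid.zero_closed[OF abelian_group.axioms(1)[OF ab]]
    abelian_monoid.a_assoc[OF abelian_group.axioms(1)[OF ab]] abelian_monoid.a_comm[OF abelian_group.axioms(1)[OF ab]]
    abelian_monoid.l_zero[OF abelian_group.axioms(1)[OF ab]]
  have "abelian_group (bimodule_sum I M)"
  proof (rule abelian_groupI)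
    fix x assume x: "x \<in> carrier (bimodule_sum I M)"
    show "\<exists>y \<in> carrier (bimodule_sum I M). y \<oplus>\<^bsub>bimodule_sum I M\<^esub> x = \<zero>\<^bsub>bimodule_sum I M\<^esub>"
    proof (rule bexI[where x = "\<lambda>i \<in> I. \<ominus>\<^bsub>M i\<^esub> x i"])
      show "(\<lambda>i \<in> I. \<ominus>\<^bsub>M i\<^esub> x i) \<oplus>\<^bsub>bimodule_sum I M\<^esub> x = \<zero>\<^bsub>bimodule_sum I M\<^esub>"
        using x by (auto simp: fun_eq_iff intro!: abelian_group.l_neg[OF ab])
      show "(\<lambda>i \<in> I. \<ominus>\<^bsub>M i\<^esub> x i) \<in> carrier (bimodule_sum I M)"
        using x by (auto intro!: abelian_group.a_inv_closed[OF ab])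
    qed
    show "\<zero>\<^bsub>bimodule_sum I M\<^esub> \<oplus>\<^bsub>bimodule_sum I M\<^esub> x = x"
      using x by (auto simp: fun_eq_iff PiE_def extensional_def Pi_def abelian_monoid.l_zero[OF abelian_group.axioms(1)[OF ab]])
  next
    fix x y assume xy: "x \<in> carrier (bimodule_sum I M)" "y \<in> carrier (bimodule_sum I M)"
    then show "x \<oplus>\<^bsub>bimodule_sum I M\<^esub> y \<in> carrier (bimodule_sum I M)" by (auto intro!: f)
    show "x \<oplus>\<^bsub>bimodule_sum I M\<^esub> y = y \<oplus>\<^bsub>bimodule_sum I M\<^esub> x" using xy by (auto simp: fun_eq_iff intro!: f)
    fix z assume "z \<in> carrier (bimodule_sum I M)"
    then show "x \<oplus>\<^bsub>bimodule_sum I M\<^esub> y \<oplus>\<^bsub>bimodule_sum I M\<^esub> z = x \<oplus>\<^bsub>bimodule_sum I M\<^esub> (y \<oplus>\<^bsub>bimodule_sum I M\<^esub> z)"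
      using xy by (auto simp: fun_eq_iff intro!: f)
  qed (auto intro!: f)
  then show ?thesis
    by (intro central_bimodule.intro central_bimodule_axioms.intro bimodule.intro bimodule_axioms.intro L.L.ring_axioms L)
      (auto simp: fun_eq_iff PiE_def extensional_def Pi_def bimodule.lact_closed[OF B] bimodule.ract_closed[OF B]
        bimodule.lact_add_left[OF B] bimodule.lact_add_right[OF B] bimodule.lact_mult[OF B] bimodule.lact_one[OF B]
        bimodule.ract_add_left[OF B] bimodule.ract_add_right[OF B] bimodule.ract_mult[OF B] bimodule.ract_one[OF B]
        bimodule.lact_ract[OF B] central_bimodule.central[OF M])
qed

lemma bimodule_hom_component:
  "i \<in> I \<Longrightarrow> bimodule_hom L (bimodule_sum I M) (M i) (\<lambda>x. x i)"
  by (auto simp: bimodule_hom_def left_linear_def right_linear_def additive_def)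

lemma bimodule_sum_copower:
  assumes L: "algebra_over_field K L" and I: "finite I" and M: "\<And>i. i \<in> I \<Longrightarrow> central_bimodule K L (M i)"
    and c: "\<And>i. i \<in> I \<Longrightarrow> copower (M i) (enveloping_algebra K L) (J i) (\<lambda>j t. t \<odot>\<^bsub>env_module (M i)\<^esub> e i j) (prj i)"
    and e: "\<And>i j. \<lbrakk>i \<in> I; j \<in> J i\<rbrakk> \<Longrightarrow> e i j \<in> carrier (M i)"
  shows "free_module (enveloping_algebra K L) (env_module (bimodule_sum I M))"
proof -
  interpret L: algebra_over_field K L by fact
  let ?E = "enveloping_algebra K L"
  let ?T = "bimodule_sum I M"
  interpret T: central_bimodule K L ?T by (rule bimodule_sum_central[OF M L])
  define b where "b = (\<lambda>(i, j). \<lambda>i' \<in> I. if i' = i then e i j else \<zero>\<^bsub>M i'\<^esub>)"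
  have zc: "\<zero>\<^bsub>M i\<^esub> \<in> carrier (M i)" if "i \<in> I" for i
    using bimodule.axioms(3)[OF central_bimodule.axioms(2)[OF M[OF that]]] abelian_group.axioms(1) abelian_monoid.zero_closed by blast
  have bc: "b k \<in> carrier ?T" if "k \<in> Sigma I J" for k using that e zc by (auto simp: b_def)
  \<comment> \<open>Projections are bimodule maps, so the enveloping algebra acts componentwise;
    this turns the inclusions of the summands into multiplication onto the vectors
    \<open>b k\<close>.\<close>
  have comp: "(t \<odot>\<^bsub>env_module ?T\<^esub> z) i = t \<odot>\<^bsub>env_module (M i)\<^esub> z i" if "i \<in> I" "t \<in> carrier ?E" "z \<in> carrier ?T" for i t z
  proof -
    have "(\<lambda>x. x i) \<in> left_module_hom ?E (env_module ?T) (env_module (M i))"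
      using left_module_hom_env_module[OF T.central_bimodule_axioms M[OF that(1)]] bimodule_hom_component[OF that(1), of L M] by blast
    then show ?thesis using that by (simp add: left_module_hom_def)
  qed
  have "copower ?T ?E (Sigma I J) (\<lambda>(i, j) n. \<lambda>i' \<in> I. if i' = i then n \<odot>\<^bsub>env_module (M i)\<^esub> e i j else \<zero>\<^bsub>M i'\<^esub>) (\<lambda>(i, j) x. prj i j (x i))"
    by (rule copower_product[OF I c T.M.abelian_group_axioms L.env_abelian_group]) simp_all
  then have "copower ?T ?E (Sigma I J) (\<lambda>k t. t \<odot>\<^bsub>env_module ?T\<^esub> b k) (\<lambda>(i, j) x. prj i j (x i))"
  proof (rule copower_cong)
    fix k t assume k: "k \<in> Sigma I J" and t: "t \<in> carrier ?E"
    obtain i j where ij: "k = (i, j)" "i \<in> I" "j \<in> J i" using k by auto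
    have tb: "t \<odot>\<^bsub>env_module ?T\<^esub> b k \<in> carrier ?T"
      using left_module.smult_closed[OF T.env_module_left_module t] bc[OF k] by simp
    have "(\<lambda>i' \<in> I. if i' = i then t \<odot>\<^bsub>env_module (M i)\<^esub> e i j else \<zero>\<^bsub>M i'\<^esub>) = t \<odot>\<^bsub>env_module ?T\<^esub> b k"
    proof (rule extensionalityI[of _ I])
      fix i' assume i': "i' \<in> I"
      interpret Mi: central_bimodule K L "M i'" by (rule M[OF i'])
      have "t \<odot>\<^bsub>env_module (M i')\<^esub> \<zero>\<^bsub>M i'\<^esub> = \<zero>\<^bsub>M i'\<^esub>"
        unfolding Mi.env_module_smult
        by (rule additive_zero[OF Mi.M.abelian_group_axioms Mi.M.abelian_group_axioms Mi.env_act_additive_right[OF t]])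
      then show "(\<lambda>i' \<in> I. if i' = i then t \<odot>\<^bsub>env_module (M i)\<^esub> e i j else \<zero>\<^bsub>M i'\<^esub>) i' = (t \<odot>\<^bsub>env_module ?T\<^esub> b k) i'"
        unfolding comp[OF i' t bc[OF k]] using i' by (simp add: b_def ij)
    qed (use tb in \<open>auto simp: PiE_def\<close>)
    then show "(case k of (i, j) \<Rightarrow> \<lambda>n. \<lambda>i' \<in> I. if i' = i then n \<odot>\<^bsub>env_module (M i)\<^esub> e i j else \<zero>\<^bsub>M i'\<^esub>) t
      = t \<odot>\<^bsub>env_module ?T\<^esub> b k" by (simp add: ij)
  qed
  then have "copower (env_module ?T) ?E (Sigma I J) (\<lambda>k t. t \<odot>\<^bsub>env_module ?T\<^esub> b k) (\<lambda>(i, j) x. prj i j (x i))"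
    by (rule copower_cong_structure) (simp_all add: fun_eq_iff)
  then show ?thesis
    unfolding free_module_def using T.env_module_left_module bc
      copower_module_basis[of "env_module ?T" ?E "Sigma I J" _ _ b] by simp
qed

section \<open>Linearity of tensor products of maps, and signs\<close>

lemma tensor_map_left_linear:
  assumes "bimodule_pair_maps R' R T M N R' T2 M2 N2 f g" and lin: "left_linear R' M M2 f"
  shows "left_linear R' (tensor R M N) (tensor R M2 N2) (tensor_map R M N M2 N2 f g)"
proof -
  interpret bimodule_pair_maps R' R T M N R' T2 M2 N2 f g by fact
  have "tensor_map R M N M2 N2 f g (lact (tensor R M N) r t) = lact (tensor R M2 N2) r (tensor_map R M N M2 N2 f g t)"
    if r: "r \<in> carrier R'" and t: "t \<in> carrier (tensor R M N)" for r t
  proof (rule M.tensor_additive_eqI[OF M2.tensor_abelian_group _ _ _ t[unfolded tensor_simps]])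
    have m: "additive (tensor_group R M N) (tensor_group R M2 N2) (tensor_map R M N M2 N2 f g)"
      using map_additive by (simp add: additive_def)
    show "additive (tensor_group R M N) (tensor_group R M2 N2) (\<lambda>t. tensor_map R M N M2 N2 f g (lact (tensor R M N) r t))"
      by (rule additive_comp[OF M.lact_additive[OF r] m])
    show "additive (tensor_group R M N) (tensor_group R M2 N2) (\<lambda>t. lact (tensor R M2 N2) r (tensor_map R M N M2 N2 f g t))"
      by (rule additive_comp[OF m M2.lact_additive[OF r]])
  qed (use lin r in \<open>simp add: M.lact_pure M2.lact_pure map_pure M.M.lact_closed additive_closed[OF f_additive]
      additive_closed[OF g_additive] left_linear_def\<close>)
  then show ?thesis using map_additive by (simp add: left_linear_def)
qed

lemma tensor_map_right_linear:
  assumes "bimodule_pair_maps R' R T M N R2' T M2 N2 f g" and lin: "right_linear T N N2 g"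
  shows "right_linear T (tensor R M N) (tensor R M2 N2) (tensor_map R M N M2 N2 f g)"
proof -
  interpret bimodule_pair_maps R' R T M N R2' T M2 N2 f g by fact
  have "tensor_map R M N M2 N2 f g (ract (tensor R M N) t r) = ract (tensor R M2 N2) (tensor_map R M N M2 N2 f g t) r"
    if r: "r \<in> carrier T" and t: "t \<in> carrier (tensor R M N)" for r t
  proof (rule M.tensor_additive_eqI[OF M2.tensor_abelian_group _ _ _ t[unfolded tensor_simps]])
    have m: "additive (tensor_group R M N) (tensor_group R M2 N2) (tensor_map R M N M2 N2 f g)"
      using map_additive by (simp add: additive_def)
    show "additive (tensor_group R M N) (tensor_group R M2 N2) (\<lambda>t. tensor_map R M N M2 N2 f g (ract (tensor R M N) t r))"
      by (rule additive_comp[OF M.ract_additive[OF r] m])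
    show "additive (tensor_group R M N) (tensor_group R M2 N2) (\<lambda>t. ract (tensor R M2 N2) (tensor_map R M N M2 N2 f g t) r)"
      by (rule additive_comp[OF m M2.ract_additive[OF r]])
  qed (use lin r in \<open>simp add: M.ract_pure M2.ract_pure map_pure M.N.ract_closed additive_closed[OF f_additive]
      additive_closed[OF g_additive] right_linear_def\<close>)
  then show ?thesis using map_additive by (simp add: right_linear_def)
qed

lemma (in abelian_group) add_pow_sign:
  assumes "x \<in> carrier G"
  shows "[((- 1 :: int) ^ i)] \<cdot> x = (if even i then x else \<ominus> x)"
proof -
  have "[(1 :: int)] \<cdot> x = x" "[(- 1 :: int)] \<cdot> x = \<ominus> x"
    using assms by (simp_all add: add_pow_def int_pow_def2 a_inv_def)
  then show ?thesis by (cases "even i") simp_all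
qed

context resolution_pair
begin

subsection \<open>Homogeneous and equivariant bases\<close>

text \<open>The degree of x_b = \<phi> (1 \<otimes> v \<otimes> 1) is that of v, since 1 \<in> kG
  has degree 1 and \<phi> respects the induced grading. The k-basis of C'_i is kept in the
  conclusion for the comparison with A \<otimes> C'_i \<otimes> D'_j \<otimes> A.\<close>

lemma C_basis: "\<exists>B x p. (\<forall>b \<in> B. fst b \<in> carrier G \<and> x b \<in> gC i (fst b)) \<and>
    copower (C i) (enveloping_algebra K kG) B (\<lambda>b t. t \<odot>\<^bsub>env_module (C i)\<^esub> x b) p \<and>
    (\<exists>q. copower (C' i) K B (\<lambda>b c. c \<odot>\<^bsub>C' i\<^esub> snd b) q) \<and> (\<forall>b \<in> B. snd b \<in> carrier (C' i))"
proof -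
  have m: "module K (C' i)" using C.C'_graded[of i] by (simp add: graded_space_def)
  interpret V: graded_vector_space K "C' i" G "gC' i"
    by (intro graded_vector_space.intro graded_vector_space_axioms.intro field_axioms m finite_group C.C'_graded)
  obtain B q where B: "B \<subseteq> Sigma (carrier G) (gC' i)" and "copower (C' i) K B (\<lambda>(g, b) c. c \<odot>\<^bsub>C' i\<^esub> b) q"
    using V.homogeneous_basis by auto
  then have q: "copower (C' i) K B (\<lambda>b c. c \<odot>\<^bsub>C' i\<^esub> snd b) q" by (simp add: case_prod_unfold)
  have B': "fst b \<in> carrier G" "snd b \<in> gC' i (fst b)" "snd b \<in> carrier (C' i)" if "b \<in> B" for b
    using B that V.homogeneous_closed by auto
  let ?V = "space_bimodule (C' i)"
  obtain \<phi> where \<phi>: "\<phi> \<in> left_module_iso (enveloping_algebra K kG) (env_module (two_sided_tensor K kG ?V)) (env_module (C i))"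
    and gr: "\<forall>g \<in> carrier G. \<phi> ` two_sided_grading K G kG (group_algebra_grading K G) ?V (gC' i) g = gC i g"
    using C.C_free[of i] by auto
  define x where "x b = \<phi> (kG.two_sided_pure ?V \<one>\<^bsub>kG\<^esub> (snd b) \<one>\<^bsub>kG\<^esub>)" for b :: "'g \<times> 'v"
  have "\<exists>p. copower (C i) (enveloping_algebra K kG) B (\<lambda>b t. t \<odot>\<^bsub>env_module (C i)\<^esub> x b) p"
    using env_copower_transport(1)[OF kG_algebra m C_central q _ \<phi>] B' unfolding x_def by blast
  moreover have "x b \<in> gC i (fst b)" if b: "b \<in> B" for b
  proof -
    let ?L1 = "with_actions kG (monoid.mult kG) (\<lambda>x c. c \<odot>\<^bsub>kG\<^esub> x)" and ?L2 = "with_actions kG (smult kG) (monoid.mult kG)"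
    let ?o = "group_elt K G \<one>\<^bsub>G\<^esub>"
    note one = group.is_monoid[OF group_axioms, THEN monoid.r_one] group.is_monoid[OF group_axioms, THEN monoid.l_one]
    have "?o = \<one>\<^bsub>K\<^esub> \<odot>\<^bsub>kG\<^esub> ?o" using kG.smult_one[OF group_elt_closed] by simp
    then have o: "?o \<in> group_algebra_grading K G \<one>\<^bsub>G\<^esub>"
      using ring.ring_simprules(6)[OF K_ring] unfolding group_algebra_grading_def by blast
    \<comment> \<open>First 1 \<otimes> v, of degree 1 |v|, and then (1 \<otimes> v) \<otimes> 1, of
      degree |v| 1.\<close>
    have "pure_tensor K ?L1 ?V ?o (snd b) \<in> tensor_grading K G ?L1 (group_algebra_grading K G) ?V (gC' i) (fst b)"
      unfolding tensor_grading_def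
      by (rule generate.incl, rule CollectI, rule exI[of _ "\<one>\<^bsub>G\<^esub>"], rule exI[of _ "fst b"], rule exI[of _ ?o], rule exI[of _ "snd b"])
        (use o B'[OF b] G_closed one in simp)
    note s = this
    have "pure_tensor K (tensor K ?L1 ?V) ?L2 (pure_tensor K ?L1 ?V ?o (snd b)) ?o
        \<in> tensor_grading K G (tensor K ?L1 ?V) (tensor_grading K G ?L1 (group_algebra_grading K G) ?V (gC' i))
          ?L2 (group_algebra_grading K G) (fst b)"
      unfolding tensor_grading_def[of K G "tensor K ?L1 ?V"]
      by (rule generate.incl, rule CollectI, rule exI[of _ "fst b"], rule exI[of _ "\<one>\<^bsub>G\<^esub>"],
          rule exI[of _ "pure_tensor K ?L1 ?V ?o (snd b)"], rule exI[of _ ?o])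
        (use s o B'[OF b] G_closed one in simp)
    then have "pure_tensor K (tensor K ?L1 ?V) ?L2 (pure_tensor K ?L1 ?V ?o (snd b)) ?o
        \<in> two_sided_grading K G kG (group_algebra_grading K G) ?V (gC' i) (fst b)"
      by (simp add: two_sided_grading_def Let_def)
    then show ?thesis using gr B'[OF b] by (auto simp: x_def kG.two_sided_pure_def)
  qed
  ultimately show ?thesis using B' q by blast
qed

lemma D_basis: "\<exists>F y p. copower (D j) (enveloping_algebra K S) F (\<lambda>f t. t \<odot>\<^bsub>env_module (D j)\<^esub> y f) p \<and>
    (\<forall>f \<in> F. y f \<in> carrier (D j)) \<and>
    (\<exists>q. copower (D' j) K F (\<lambda>f c. c \<odot>\<^bsub>D' j\<^esub> f) q) \<and> F \<subseteq> carrier (D' j)"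
proof -
  obtain F q where F: "F \<subseteq> carrier (D' j)" and q: "copower (D' j) K F (\<lambda>b c. c \<odot>\<^bsub>D' j\<^esub> b) q"
    using vector_space_copower[OF field_axioms D.D'_space[of j]] by auto
  obtain \<psi> where \<psi>: "\<psi> \<in> left_module_iso (enveloping_algebra K S)
      (env_module (two_sided_tensor K S (space_bimodule (D' j)))) (env_module (D j))"
    using D.D_free[of j] by auto
  define y where "y b = \<psi> (two_sided_pure (space_bimodule (D' j)) \<one>\<^bsub>S\<^esub> b \<one>\<^bsub>S\<^esub>)" for b
  note t = env_copower_transport[OF algebra_over_field_axioms D.D'_space D_central q _ \<psi>, folded y_def]
  have "\<exists>p. copower (D j) (enveloping_algebra K S) F (\<lambda>f t. t \<odot>\<^bsub>env_module (D j)\<^esub> y f) p"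
    using t(1) F by blast
  moreover have "\<forall>f \<in> F. y f \<in> carrier (D j)" using t(2) F by blast
  ultimately show ?thesis using F q by blast
qed

text \<open>Left freeness of kG \<otimes> kG on the 1 \<otimes> h; composed with the basis x_b it
  makes C_i left free over kG on the x_b h.\<close>

lemma kG_env_copower:
  "\<exists>p. copower (enveloping_algebra K kG) kG (carrier G)
    (\<lambda>h l. pure_tensor K (space_bimodule kG) (space_bimodule kG) l (group_elt K G h)) p"
proof -
  let ?L2 = "with_actions kG (smult kG) (monoid.mult kG)"
  have c: "copower ?L2 K (carrier G) (\<lambda>g c. c \<odot>\<^bsub>kG\<^esub> group_elt K G g) (\<lambda>g b. b g)"
    by (rule copower_cong_structure[OF kG_copower]) simp_all
  have t: "copower (tensor K (with_actions kG (monoid.mult kG) (\<lambda>x c. c \<odot>\<^bsub>kG\<^esub> x)) ?L2)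
      (with_actions kG (monoid.mult kG) (\<lambda>x c. c \<odot>\<^bsub>kG\<^esub> x)) (carrier G)
      (\<lambda>j m. pure_tensor K (with_actions kG (monoid.mult kG) (\<lambda>x c. c \<odot>\<^bsub>kG\<^esub> x)) ?L2 m (group_elt K G j))
      (\<lambda>j. tensor_lift (with_actions kG (monoid.mult kG) (\<lambda>x c. c \<odot>\<^bsub>kG\<^esub> x))
        (\<lambda>m n. ract (with_actions kG (monoid.mult kG) (\<lambda>x c. c \<odot>\<^bsub>kG\<^esub> x)) m (n j)))"
    by (rule kG.cp.tensor_copower_right[OF c]) (simp_all add: group_elt_closed)
  show ?thesis
    by (rule exI, rule copower_cong_structure[OF t[unfolded kG.env_tensor_eq]]) (simp_all add: kG.env_tensor_eq)
qed

context
  fixes i :: nat and B :: "('g \<times> 'v) set" and x :: "'g \<times> 'v \<Rightarrow> 'c" and p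
  assumes B: "\<And>b. b \<in> B \<Longrightarrow> fst b \<in> carrier G" "\<And>b. b \<in> B \<Longrightarrow> x b \<in> gC i (fst b)"
    and cB: "copower (C i) (enveloping_algebra K kG) B (\<lambda>b t. t \<odot>\<^bsub>env_module (C i)\<^esub> x b) p"
begin

lemma basis_closed: "b \<in> B \<Longrightarrow> x b \<in> carrier (C i)"
  using B C_homogeneous_closed by blast

lemma C_left_copower:
  "\<exists>q. copower (C i) kG (B \<times> carrier G) (\<lambda>(b, h) l. lact (C i) l (ract (C i) (x b) (group_elt K G h))) q"
proof -
  obtain q where q: "copower (enveloping_algebra K kG) kG (carrier G)
    (\<lambda>h l. pure_tensor K (space_bimodule kG) (space_bimodule kG) l (group_elt K G h)) q"
    using kG_env_copower by auto
  show ?thesis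
  proof (rule exI, rule copower_cong[OF copower_comp[OF cB q]])
    fix k l assume "k \<in> B \<times> carrier G" "l \<in> carrier kG"
    then show "(case k of (b, h) \<Rightarrow> \<lambda>l. pure_tensor K (space_bimodule kG) (space_bimodule kG) l (group_elt K G h) \<odot>\<^bsub>env_module (C i)\<^esub> x b) l
      = (case k of (b, h) \<Rightarrow> \<lambda>l. lact (C i) l (ract (C i) (x b) (group_elt K G h))) l"
      using basis_closed group_elt_closed by (auto simp: CB.env_module_smult CB.env_act_pure)
  qed
qed

text \<open>No twist occurs on this side, as the left action of A does not involve the grading. The
  right A-basis is derived from this left one.\<close>

lemma PC_left_copower:
  "\<exists>q. copower (PC i) A (B \<times> carrier G) (\<lambda>(b, h) a. pc i a (ract (C i) (x b) (group_elt K G h))) q"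
proof -
  obtain q where q: "copower (C i) kG (B \<times> carrier G) (\<lambda>(b, h) l. lact (C i) l (ract (C i) (x b) (group_elt K G h))) q"
    using C_left_copower by auto
  have e: "(case k of (b, h) \<Rightarrow> ract (C i) (x b) (group_elt K G h)) \<in> carrier (C i)" if "k \<in> B \<times> carrier G" for k
    using that basis_closed group_elt_closed CB.ract_closed by auto
  have i: "(case k of (b, h) \<Rightarrow> \<lambda>l. lact (C i) l (ract (C i) (x b) (group_elt K G h))) r
      = lact (C i) r (case k of (b, h) \<Rightarrow> ract (C i) (x b) (group_elt K G h))" for k r
    by (simp add: case_prod_unfold)
  show ?thesis
    by (rule exI, rule copower_cong_structure[OF copower_cong[OF tC.tensor_copower_right[OF q e i]]])
      (auto simp: case_prod_unfold)
qed

definition right_basis :: "'g \<times> 'g \<times> 'v \<Rightarrow> ('g \<Rightarrow> 's, 'c) tensor"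
  where "right_basis = (\<lambda>(g, b). pc i (skew_elt g \<one>\<^bsub>S\<^esub>) (x b))"

lemma right_basis_closed: "k \<in> carrier G \<times> B \<Longrightarrow> right_basis k \<in> carrier (PC i)"
  using pc_closed[OF skew_elt_closed basis_closed] by (auto simp: right_basis_def)

lemma right_basis_ract:
  assumes "g \<in> carrier G" "b \<in> B" "h \<in> carrier G" "s \<in> carrier S"
  shows "ract (PC i) (right_basis (g, b)) (skew_elt h s)
    = pc i (skew_elt g (act (g \<otimes>\<^bsub>G\<^esub> fst b) s)) (ract (C i) (x b) (group_elt K G h))"
  using PC_ract_pure[OF assms(3,4) skew_elt_closed[OF L.one_closed] B(1,2)[OF assms(2)], of g] assms B(1)
  by (simp add: right_basis_def skew_elt_mult G_closed act_closed act_act monoid.r_one[OF group.is_monoid[OF group_axioms]]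
      del: PC_sel(5))

text \<open>The left decomposition, refined to copies of S, has the summands s g \<otimes> x_b h.
  For fixed g and b those with h in G make up the right multiples of g \<otimes> x_b, up to the
  twist by g|b|, so \<open>copower_fuse\<close> regroups them.\<close>

lemma PC_right_copower:
  "\<exists>q. copower (PC i) A (carrier G \<times> B) (\<lambda>k a. ract (PC i) (right_basis k) a) q"
proof -
  obtain q where q: "copower (PC i) A (B \<times> carrier G) (\<lambda>(b, h) a. pc i a (ract (C i) (x b) (group_elt K G h))) q"
    using PC_left_copower by auto
  \<comment> \<open>The group element g|b| by which s is twisted when it acts on g \<otimes> x_b
    from the right.\<close>
  define u where "u = (\<lambda>k :: 'g \<times> 'g \<times> 'v. fst k \<otimes>\<^bsub>G\<^esub> fst (snd k))"
  have u: "u k \<in> carrier G" if "k \<in> carrier G \<times> B" for k using that B G_closed by (auto simp: u_def)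
  define I where "I = (\<lambda>((b, h), g) s. pc i (skew_elt g s) (ract (C i) (x b) (group_elt K G h)))"
  \<comment> \<open>Regroups the indices: h is split off, and (g, b) becomes the index of the new
    basis.\<close>
  define \<sigma> :: "('g \<times> 'g \<times> 'v) \<times> 'g \<Rightarrow> (('g \<times> 'v) \<times> 'g) \<times> 'g" where "\<sigma> = (\<lambda>((g, b), h). ((b, h), g))"
  have c: "copower (PC i) S ((B \<times> carrier G) \<times> carrier G) I (\<lambda>(k, g) t. q k t g)"
    using copower_comp[OF q A_copower] by (simp add: case_prod_unfold I_def)
  have bij: "bij_betw \<sigma> ((carrier G \<times> B) \<times> carrier G) ((B \<times> carrier G) \<times> carrier G)"
    unfolding \<sigma>_def by (rule bij_betwI[where g = "\<lambda>((b, h), g). ((g, b), h)"]) auto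
  note c' = copower_reindex[OF c bij]
  \<comment> \<open>Inside A the inverse twist is inserted, so that after acting on g \<otimes> x_b
    the element s itself appears.\<close>
  have a: "copower A S (carrier G) (\<lambda>h s. skew_elt h (act (inv\<^bsub>G\<^esub> (u k)) s)) (\<lambda>h t. act (u k) (t h))" if "k \<in> carrier G \<times> B" for k
    by (rule copower_twist[OF A_copower]) (simp_all add: u[OF that] act_additive G_closed act_inv act_inv')
  show ?thesis
  proof (rule copower_fuse[where inc' = "\<lambda>k h s. skew_elt h (act (inv\<^bsub>G\<^esub> (u k)) s)" and prj' = "\<lambda>k h t. act (u k) (t h)",
        OF c' a abelian_group_A])
    fix k assume k: "k \<in> carrier G \<times> B"
    have "additive A (TC i) (ract (PC i) (right_basis k))"
      using PC_right_action2 right_basis_closed[OF k] by simp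
    then show "additive A (PC i) (ract (PC i) (right_basis k))" by (simp add: additive_def)
    fix h s assume hs: "h \<in> carrier G" "s \<in> carrier S"
    obtain g b where gb: "k = (g, b)" "g \<in> carrier G" "b \<in> B" using k by auto
    have "act (inv\<^bsub>G\<^esub> (u k)) s \<in> carrier S" "act (u k) (act (inv\<^bsub>G\<^esub> (u k)) s) = s"
      using u[OF k] hs by (simp_all add: act_closed G_closed act_inv)
    then show "ract (PC i) (right_basis k) (skew_elt h (act (inv\<^bsub>G\<^esub> (u k)) s)) = I (\<sigma> (k, h)) s"
      using right_basis_ract[OF gb(2,3) hs(1), of "act (inv\<^bsub>G\<^esub> (u k)) s"] gb by (simp add: u_def I_def \<sigma>_def del: PC_sel(5))
  qed
qed

end

subsection \<open>The double complex\<close>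

sublocale tX: bimodule_pair A A A "PC i" "QD j" for i j
  by (intro bimodule_pair.intro PC_bimodule QD_bimodule)

abbreviation (input) "XX i j \<equiv> tensor A (PC i) (QD j)"
abbreviation (input) "px i j \<equiv> pure_tensor A (PC i) (QD j)"

lemma XX_central: "central_bimodule K A (XX i j)"
  by (rule central_bimodule_tensor[OF PC_central QD_central])

sublocale XC: central_bimodule K A "XX i j" for i j by (rule XX_central)

lemma XX_abelian: "abelian_group (XX i j)"
  using tX.tensor_bimodule by (rule bimodule.axioms)

lemma XX_eqI:
  assumes "abelian_group N" "additive (XX i j) N f" "additive (XX i j) N f'"
    "\<And>y a. \<lbrakk>y \<in> carrier (PC i); a \<in> carrier (QD j)\<rbrakk> \<Longrightarrow> f (px i j y a) = f' (px i j y a)" "X \<in> carrier (XX i j)"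
  shows "f X = f' X"
  using tX.tensor_additive_eqI[of N i j f f' X] assms by (simp add: additive_def)

lemma PC_right_basis: "\<exists>(I :: ('g \<times> 'g \<times> 'v) set) r q. (\<forall>k \<in> I. r k \<in> carrier (PC i)) \<and> copower (PC i) A I (\<lambda>k a. ract (PC i) (r k) a) q"
proof -
  obtain B :: "('g \<times> 'v) set" and x p where B': "\<forall>b \<in> B. fst b \<in> carrier G \<and> x b \<in> gC i (fst b)"
    and cB: "copower (C i) (enveloping_algebra K kG) B (\<lambda>b t. t \<odot>\<^bsub>env_module (C i)\<^esub> x b) p"
    using C_basis[of i] by (elim exE conjE) (rule that, assumption+)
  from B' have B: "\<And>b. b \<in> B \<Longrightarrow> fst b \<in> carrier G" "\<And>b. b \<in> B \<Longrightarrow> x b \<in> gC i (fst b)" by auto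
  have "\<exists>q. copower (PC i) A (carrier G \<times> B) (\<lambda>k a. ract (PC i) (right_basis i x k) a) q"
    by (rule PC_right_copower[OF _ _ cB]) (simp_all add: B)
  then obtain q where q: "copower (PC i) A (carrier G \<times> B) (\<lambda>k a. ract (PC i) (right_basis i x k) a) q" ..
  show ?thesis
  proof (rule exI, rule exI, rule exI, rule conjI[OF ballI q])
    fix k assume "k \<in> carrier G \<times> B"
    then show "right_basis i x k \<in> carrier (PC i)" by (rule right_basis_closed[OF _ _ cB, rotated 2]) (simp_all add: B)
  qed
qed

abbreviation (input) "HX i j \<equiv> horizontal_diff A PC QD dP (Suc i) j"
abbreviation (input) "VX i j \<equiv> vertical_diff A PC QD dQ i (Suc j)"
abbreviation (input) "vX i j \<equiv> tensor_map A (PC i) (QD (Suc j)) (PC i) (QD j) (\<lambda>x. x) (dQ (Suc j))"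

sublocale hm: bimodule_pair_maps A A A "PC (Suc i)" "QD j" A A "PC i" "QD j" "dP (Suc i)" "\<lambda>y. y" for i j
  by (intro bimodule_pair_maps.intro bimodule_pair_maps_axioms.intro tX.bimodule_pair_axioms left_linear_id
      bimodule_homD(5)[OF dP_hom])

sublocale vm: bimodule_pair_maps A A A "PC i" "QD (Suc j)" A A "PC i" "QD j" "\<lambda>x. x" "dQ (Suc j)" for i j
  by (intro bimodule_pair_maps.intro bimodule_pair_maps_axioms.intro tX.bimodule_pair_axioms right_linear_id
      bimodule_homD(4)[OF dQ_hom])

lemma HX_eq: "HX i j = tensor_map A (PC (Suc i)) (QD j) (PC i) (QD j) (dP (Suc i)) (\<lambda>y. y)"
  by (simp add: horizontal_diff_def fun_eq_iff)

lemma VX_eq: "VX i j t = [((- 1 :: int) ^ i)] \<cdot>\<^bsub>XX i j\<^esub> vX i j t"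
  by (simp add: vertical_diff_def)

lemma HX_hom: "bimodule_hom A (XX (Suc i) j) (XX i j) (HX i j)"
  unfolding bimodule_hom_def HX_eq
  using tensor_map_left_linear[OF hm.bimodule_pair_maps_axioms bimodule_homD(4)[OF dP_hom]]
    tensor_map_right_linear[OF hm.bimodule_pair_maps_axioms right_linear_id] by simp

lemma vX_hom: "bimodule_hom A (XX i (Suc j)) (XX i j) (vX i j)"
  unfolding bimodule_hom_def
  using tensor_map_left_linear[OF vm.bimodule_pair_maps_axioms left_linear_id]
    tensor_map_right_linear[OF vm.bimodule_pair_maps_axioms bimodule_homD(5)[OF dQ_hom]] by simp

text \<open>A power of -1 acts as the identity or as negation, and both commute with the actions of
  A.\<close>

lemma sign_hom:
  assumes "bimodule A A M" "bimodule A A N" "bimodule_hom A M N f"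
  shows "bimodule_hom A M N (\<lambda>x. [((- 1 :: int) ^ i)] \<cdot>\<^bsub>N\<^esub> f x)"
proof -
  interpret M: bimodule A A M by fact
  interpret N: bimodule A A N by fact
  note f = bimodule_homD[OF assms(3)] and fc = additive_closed[OF bimodule_homD(1)[OF assms(3)]]
  have l: "additive N N (lact N r)" "additive N N (\<lambda>x. ract N x r)" if "r \<in> carrier A" for r
    using that by (auto intro!: additiveI N.lact_closed N.lact_add_right N.ract_closed N.ract_add_left)
  have n: "additive N N (\<lambda>x. \<ominus>\<^bsub>N\<^esub> x)" by (rule additiveI) (simp_all add: N.M.minus_add)
  have m: "bimodule_hom A M N (\<lambda>x. \<ominus>\<^bsub>N\<^esub> f x)"
    unfolding bimodule_hom_def left_linear_def right_linear_def
  proof (intro conjI ballI additive_comp[OF f(1) n])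
    fix r x assume rx: "r \<in> carrier A" "x \<in> carrier M"
    show "\<ominus>\<^bsub>N\<^esub> f (lact M r x) = lact N r (\<ominus>\<^bsub>N\<^esub> f x)" "\<ominus>\<^bsub>N\<^esub> f (ract M x r) = ract N (\<ominus>\<^bsub>N\<^esub> f x) r"
      using additive_a_inv[OF N.M.abelian_group_axioms N.M.abelian_group_axioms l(1)[OF rx(1)] fc[OF rx(2)]]
        additive_a_inv[OF N.M.abelian_group_axioms N.M.abelian_group_axioms l(2)[OF rx(1)] fc[OF rx(2)]]
        f(2,3)[OF rx] by simp_all
  qed
  have cong: "bimodule_hom A M N f'" if "bimodule_hom A M N g" "\<And>x. x \<in> carrier M \<Longrightarrow> f' x = g x" for f' g
    using that M.lact_closed M.ract_closed M.M.a_closed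
    by (simp add: bimodule_hom_def left_linear_def right_linear_def additive_def Pi_def)
  show ?thesis
    by (rule cong[of "if even i then f else (\<lambda>x. \<ominus>\<^bsub>N\<^esub> f x)"]) (simp_all add: assms(3) m fc N.M.add_pow_sign)
qed

lemma VX_hom: "bimodule_hom A (XX i (Suc j)) (XX i j) (VX i j)"
  using sign_hom[OF tX.tensor_bimodule tX.tensor_bimodule vX_hom] by (simp only: VX_eq[abs_def])

end

text \<open>Negation is bijective on the source and fixes zero, so it changes neither image nor
  kernel. The flags b and c allow a sign in either map.\<close>

lemma exact_up_to_sign:
  assumes M: "abelian_group M" "abelian_group N" "abelian_group L" and f: "additive M N f" and g: "additive N L g"
    and e: "f ` carrier M = {x \<in> carrier N. g x = \<zero>\<^bsub>L\<^esub>}"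
    and f': "\<And>x. x \<in> carrier M \<Longrightarrow> f' x = (if b then f x else \<ominus>\<^bsub>N\<^esub> f x)"
    and g': "\<And>x. x \<in> carrier N \<Longrightarrow> g' x = (if c then g x else \<ominus>\<^bsub>L\<^esub> g x)"
  shows "f' ` carrier M = {x \<in> carrier N. g' x = \<zero>\<^bsub>L\<^esub>}"
proof -
  interpret M: abelian_group M by fact
  interpret N: abelian_group N by fact
  interpret L: abelian_group L by fact
  have "f' ` carrier M = f ` carrier M"
  proof (cases b)
    case True
    then show ?thesis using f' by simp
  next
    case False
    then have 1: "f' x = f (\<ominus>\<^bsub>M\<^esub> x)" if "x \<in> carrier M" for x
      using f'[OF that] additive_a_inv[OF M(1,2) f that] by simp
    show ?thesis
    proof (intro equalityI subsetI)
      fix y assume "y \<in> f' ` carrier M"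
      then show "y \<in> f ` carrier M" using 1 by (auto intro!: imageI)
    next
      fix y assume "y \<in> f ` carrier M"
      then obtain x where "x \<in> carrier M" "y = f x" by auto
      then have "y = f' (\<ominus>\<^bsub>M\<^esub> x)" "\<ominus>\<^bsub>M\<^esub> x \<in> carrier M" using 1[of "\<ominus>\<^bsub>M\<^esub> x"] by simp_all
      then show "y \<in> f' ` carrier M" by (rule image_eqI)
    qed
  qed
  moreover have "g' x = \<zero>\<^bsub>L\<^esub> \<longleftrightarrow> g x = \<zero>\<^bsub>L\<^esub>" if x: "x \<in> carrier N" for x
  proof (cases c)
    case False
    have "\<ominus>\<^bsub>L\<^esub> g x = \<zero>\<^bsub>L\<^esub> \<longleftrightarrow> g x = \<zero>\<^bsub>L\<^esub>"
      using L.minus_minus[OF additive_closed[OF g x]] L.r_neg[OF L.zero_closed] L.l_zero[OF L.a_inv_closed[OF L.zero_closed]] by metis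
    then show ?thesis using g'[OF x] False by simp
  qed (use g'[OF x] in simp)
  ultimately show ?thesis using e by auto
qed

context resolution_pair
begin

lemma \<epsilon>Q_closed: "z \<in> carrier (QD 0) \<Longrightarrow> \<epsilon>Q z \<in> carrier A"
  using additive_closed[OF \<epsilon>Q_additive] by simp

lemma \<epsilon>Q_add: "\<lbrakk>z \<in> carrier (QD 0); z' \<in> carrier (QD 0)\<rbrakk> \<Longrightarrow> \<epsilon>Q (z \<oplus>\<^bsub>QD 0\<^esub> z') = \<epsilon>Q z \<oplus>\<^bsub>A\<^esub> \<epsilon>Q z'"
  using additive_add[OF \<epsilon>Q_additive] by simp

lemma \<epsilon>Q_lact: "\<lbrakk>a \<in> carrier A; z \<in> carrier (QD 0)\<rbrakk> \<Longrightarrow> \<epsilon>Q (lact (QD 0) a z) = a \<otimes>\<^bsub>A\<^esub> \<epsilon>Q z"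
  using bimodule_homD(2)[OF \<epsilon>Q_hom] by (simp only: regular_bimodule_simps)

text \<open>The map id \<otimes> \<epsilon> followed by P_i \<otimes> A \<cong> P_i, written
  directly as y \<otimes> z \<mapsto> y \<epsilon>(z).\<close>

definition \<eta>X :: "nat \<Rightarrow> (('g \<Rightarrow> 's, 'c) tensor, ('d, 'g \<Rightarrow> 's) tensor) tensor \<Rightarrow> ('g \<Rightarrow> 's, 'c) tensor"
  where "\<eta>X i = tensor_lift (PC i) (\<lambda>y z. ract (PC i) y (\<epsilon>Q z))"

lemma \<eta>X_balanced: "balanced_map A (PC i) (QD 0) (PC i) (\<lambda>y z. ract (PC i) y (\<epsilon>Q z))"
proof (rule balanced_mapI)
  fix y z assume "y \<in> carrier (PC i)" "z \<in> carrier (QD 0)"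
  then show "ract (PC i) y (\<epsilon>Q z) \<in> carrier (PC i)" by (intro tX.M.ract_closed \<epsilon>Q_closed)
next
  fix y y' z assume "y \<in> carrier (PC i)" "y' \<in> carrier (PC i)" "z \<in> carrier (QD 0)"
  then show "ract (PC i) (y \<oplus>\<^bsub>PC i\<^esub> y') (\<epsilon>Q z) = ract (PC i) y (\<epsilon>Q z) \<oplus>\<^bsub>PC i\<^esub> ract (PC i) y' (\<epsilon>Q z)"
    by (intro tX.M.ract_add_left \<epsilon>Q_closed)
next
  fix y z z' assume y: "y \<in> carrier (PC i)" and z: "z \<in> carrier (QD 0)" "z' \<in> carrier (QD 0)"
  then show "ract (PC i) y (\<epsilon>Q (z \<oplus>\<^bsub>QD 0\<^esub> z')) = ract (PC i) y (\<epsilon>Q z) \<oplus>\<^bsub>PC i\<^esub> ract (PC i) y (\<epsilon>Q z')"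
    unfolding \<epsilon>Q_add[OF z] by (intro tX.M.ract_add_right \<epsilon>Q_closed)
next
  fix y a z assume y: "y \<in> carrier (PC i)" and a: "a \<in> carrier A" and z: "z \<in> carrier (QD 0)"
  then show "ract (PC i) (ract (PC i) y a) (\<epsilon>Q z) = ract (PC i) y (\<epsilon>Q (lact (QD 0) a z))"
    unfolding \<epsilon>Q_lact[OF a z] by (intro tX.M.ract_mult[symmetric] \<epsilon>Q_closed)
qed

lemma PC_abelian: "abelian_group (PC i)"
  using PC_bimodule by (rule bimodule.axioms)

lemma \<eta>X_additive: "additive (XX i 0) (PC i) (\<eta>X i)"
  unfolding \<eta>X_def additive_def[of "XX i 0"] tensor_simps
  by (rule tX.lift_additive[OF PC_abelian \<eta>X_balanced, unfolded additive_def])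

lemma \<eta>X_pure: "\<lbrakk>y \<in> carrier (PC i); z \<in> carrier (QD 0)\<rbrakk> \<Longrightarrow> \<eta>X i (px i 0 y z) = ract (PC i) y (\<epsilon>Q z)"
  unfolding \<eta>X_def by (rule tX.lift_pure[OF PC_abelian \<eta>X_balanced])

lemma px_closed: "\<lbrakk>y \<in> carrier (PC i); z \<in> carrier (QD j)\<rbrakk> \<Longrightarrow> px i j y z \<in> carrier (XX i j)"
  unfolding tensor_simps by (rule tX.pure_closed)

lemma HX_pure: "\<lbrakk>y \<in> carrier (PC (Suc i)); z \<in> carrier (QD j)\<rbrakk> \<Longrightarrow> HX i j (px (Suc i) j y z) = px i j (dP (Suc i) y) z"
  unfolding HX_eq by (rule hm.map_pure)

lemma dP_closed: "y \<in> carrier (PC (Suc i)) \<Longrightarrow> dP (Suc i) y \<in> carrier (PC i)"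
  by (rule additive_closed[OF dP_additive])

lemma dQ_closed: "z \<in> carrier (QD (Suc j)) \<Longrightarrow> dQ (Suc j) z \<in> carrier (QD j)"
  by (rule additive_closed[OF dQ_additive])

lemma HX_HX:
  assumes "x \<in> carrier (XX (Suc (Suc i)) j)"
  shows "HX i j (HX (Suc i) j x) = \<zero>\<^bsub>XX i j\<^esub>"
proof (rule XX_eqI[OF XX_abelian _ _ _ assms])
  show "additive (XX (Suc (Suc i)) j) (XX i j) (\<lambda>x. HX i j (HX (Suc i) j x))"
    by (rule additive_comp[OF bimodule_homD(1)[OF HX_hom] bimodule_homD(1)[OF HX_hom]])
  show "additive (XX (Suc (Suc i)) j) (XX i j) (\<lambda>x. \<zero>\<^bsub>XX i j\<^esub>)"
    by (rule additiveI) (rule XC.M.zero_closed, rule XC.M.r_zero[OF XC.M.zero_closed, symmetric])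
  fix y z assume yz: "y \<in> carrier (PC (Suc (Suc i)))" "z \<in> carrier (QD j)"
  have "dP (Suc i) (dP (Suc (Suc i)) y) = \<zero>\<^bsub>PC i\<^esub>" using P_exact(3)[of i] yz(1) by blast
  then have "HX i j (HX (Suc i) j (px (Suc (Suc i)) j y z)) = px i j \<zero>\<^bsub>PC i\<^esub> z"
    by (simp only: HX_pure yz dP_closed)
  also have "\<dots> = \<zero>\<^bsub>tensor_group A (PC i) (QD j)\<^esub>"
    by (rule additive_zero[OF PC_abelian tX.tensor_abelian_group tX.pure_left_additive[OF yz(2)]])
  finally show "HX i j (HX (Suc i) j (px (Suc (Suc i)) j y z)) = \<zero>\<^bsub>XX i j\<^esub>" unfolding tensor_simps .
qed

lemma HX_vX:
  assumes "x \<in> carrier (XX (Suc i) (Suc j))"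
  shows "HX i j (vX (Suc i) j x) = vX i j (HX i (Suc j) x)"
  by (rule XX_eqI[OF XX_abelian additive_comp[OF bimodule_homD(1)[OF vX_hom] bimodule_homD(1)[OF HX_hom]]
        additive_comp[OF bimodule_homD(1)[OF HX_hom] bimodule_homD(1)[OF vX_hom]] _ assms])
    (simp only: HX_pure vm.map_pure dP_closed dQ_closed)

lemma vX_closed: "x \<in> carrier (XX i (Suc j)) \<Longrightarrow> vX i j x \<in> carrier (XX i j)"
  by (rule additive_closed[OF bimodule_homD(1)[OF vX_hom]])

lemma VX_sign: "x \<in> carrier (XX i (Suc j)) \<Longrightarrow> VX i j x = (if even i then vX i j x else \<ominus>\<^bsub>XX i j\<^esub> vX i j x)"
  unfolding VX_eq by (rule abelian_group.add_pow_sign[OF XX_abelian vX_closed])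

text \<open>Without signs the square commutes, see \<open>HX_vX\<close>; the columns i + 1 and i
  carry opposite signs.\<close>

lemma HX_VX:
  assumes x: "x \<in> carrier (XX (Suc i) (Suc j))"
  shows "HX i j (VX (Suc i) j x) \<oplus>\<^bsub>XX i j\<^esub> VX i j (HX i (Suc j) x) = \<zero>\<^bsub>XX i j\<^esub>"
proof -
  let ?w = "vX i j (HX i (Suc j) x)"
  have h: "HX i (Suc j) x \<in> carrier (XX i (Suc j))" by (rule additive_closed[OF bimodule_homD(1)[OF HX_hom] x])
  note w = vX_closed[OF h]
  show ?thesis
  proof (cases "even i")
    case True
    have "HX i j (VX (Suc i) j x) = \<ominus>\<^bsub>XX i j\<^esub> ?w"
      using VX_sign[OF x] True additive_a_inv[OF XX_abelian XX_abelian bimodule_homD(1)[OF HX_hom] vX_closed[OF x]] HX_vX[OF x]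
      by (simp only: even_Suc not_True_eq_False if_False)
    moreover have "VX i j (HX i (Suc j) x) = ?w" using VX_sign[OF h] True by (simp only: if_True)
    ultimately show ?thesis using XC.M.l_neg[OF w] by (simp only:)
  next
    case False
    have "HX i j (VX (Suc i) j x) = ?w"
      using VX_sign[OF x] False HX_vX[OF x] by (simp only: even_Suc not_False_eq_True if_True)
    moreover have "VX i j (HX i (Suc j) x) = \<ominus>\<^bsub>XX i j\<^esub> ?w" using VX_sign[OF h] False by (simp only: if_False)
    ultimately show ?thesis using XC.M.r_neg[OF w] by (simp only:)
  qed
qed

lemma \<eta>X_HX:
  assumes "x \<in> carrier (XX (Suc i) 0)"
  shows "\<eta>X i (HX i 0 x) = dP (Suc i) (\<eta>X (Suc i) x)"
  by (rule XX_eqI[OF PC_abelian additive_comp[OF bimodule_homD(1)[OF HX_hom] \<eta>X_additive]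
        additive_comp[OF \<eta>X_additive dP_additive] _ assms])
    (simp only: HX_pure \<eta>X_pure dP_closed bimodule_homD(3)[OF dP_hom] \<epsilon>Q_closed)

lemma column_exact:
  "VX i (Suc j) ` carrier (XX i (Suc (Suc j))) = {x \<in> carrier (XX i (Suc j)). VX i j x = \<zero>\<^bsub>XX i j\<^esub>}"
  "VX i 0 ` carrier (XX i (Suc 0)) = {x \<in> carrier (XX i 0). \<eta>X i x = \<zero>\<^bsub>PC i\<^esub>}"
  "\<eta>X i ` carrier (XX i 0) = carrier (PC i)"
proof -
  obtain I :: "('g \<times> 'g \<times> 'v) set" and r q where r: "\<forall>k \<in> I. r k \<in> carrier (PC i)"
    and q: "copower (PC i) A I (\<lambda>k a. ract (PC i) (r k) a) q"
    using PC_right_basis[of i] by (elim exE conjE)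
  have "\<exists>q'. copower (XX i j) (QD j) I (\<lambda>k z. px i j (r k) z) q'" for j
    by (rule exI, rule tX.tensor_copower_left[OF q bspec[OF r] refl])
  \<comment> \<open>The splitting uses the same vectors r_k for every j, so the whole column is a
    sum of copies of the complex D \<otimes> A, the vertical maps acting in each copy.\<close>
  then obtain Q where Q: "copower (XX i j) (QD j) I (\<lambda>k z. px i j (r k) z) (Q j)" for j by metis
  note vadd = bimodule_homD(1)[OF vX_hom]
  have vpure: "vX i j (px i (Suc j) (r k) z) = px i j (r k) (dQ (Suc j) z)" if "k \<in> I" "z \<in> carrier (QD (Suc j))" for j k z
    by (rule vm.map_pure[OF bspec[OF r that(1)] that(2)])
  have \<eta>pure: "\<eta>X i (px i 0 (r k) z) = ract (PC i) (r k) (\<epsilon>Q z)" if "k \<in> I" "z \<in> carrier (QD 0)" for k z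
    by (rule \<eta>X_pure[OF bspec[OF r that(1)] that(2)])
  have \<epsilon>add: "additive (QD 0) A \<epsilon>Q"
    using \<epsilon>Q_additive unfolding additive_def regular_bimodule_simps .
  have "vX i (Suc j) ` carrier (XX i (Suc (Suc j))) = {x \<in> carrier (XX i (Suc j)). vX i j x = \<zero>\<^bsub>XX i j\<^esub>}" for j
  proof (rule copower_exact[OF Q[of "Suc (Suc j)"] Q[of "Suc j"] Q[of j] vadd dQ_additive vadd dQ_additive _ _ Q_exact(3)])
    fix k z assume k: "k \<in> I"
    show "vX i (Suc j) (px i (Suc (Suc j)) (r k) z) = px i (Suc j) (r k) (dQ (Suc (Suc j)) z)"
      if "z \<in> carrier (QD (Suc (Suc j)))" using that by (rule vpure[OF k])
    show "vX i j (px i (Suc j) (r k) z) = px i j (r k) (dQ (Suc j) z)"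
      if "z \<in> carrier (QD (Suc j))" using that by (rule vpure[OF k])
  qed
  \<comment> \<open>The column has been treated without its sign (-1)^i, which is restored
    here.\<close>
  from exact_up_to_sign[OF XX_abelian XX_abelian XX_abelian vadd vadd this VX_sign VX_sign]
  show "VX i (Suc j) ` carrier (XX i (Suc (Suc j))) = {x \<in> carrier (XX i (Suc j)). VX i j x = \<zero>\<^bsub>XX i j\<^esub>}" .
  have "vX i 0 ` carrier (XX i (Suc 0)) = {x \<in> carrier (XX i 0). \<eta>X i x = \<zero>\<^bsub>PC i\<^esub>}"
  \<comment> \<open>At the bottom the target P_i is itself a sum of copies of A over the same r_k,
    so the augmented column consists of copies of D \<otimes> A \<rightarrow> A.\<close>
  proof (rule copower_exact[OF Q[of "Suc 0"] Q[of 0] q vadd dQ_additive \<eta>X_additive \<epsilon>add _ _ Q_exact(2)])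
    fix k z assume k: "k \<in> I"
    show "vX i 0 (px i (Suc 0) (r k) z) = px i 0 (r k) (dQ (Suc 0) z)"
      if "z \<in> carrier (QD (Suc 0))" using that by (rule vpure[OF k])
    show "\<eta>X i (px i 0 (r k) z) = ract (PC i) (r k) (\<epsilon>Q z)"
      if "z \<in> carrier (QD 0)" using that by (rule \<eta>pure[OF k])
  qed
  from exact_up_to_sign[OF XX_abelian XX_abelian PC_abelian vadd \<eta>X_additive this VX_sign, of _ True]
  show "VX i 0 ` carrier (XX i (Suc 0)) = {x \<in> carrier (XX i 0). \<eta>X i x = \<zero>\<^bsub>PC i\<^esub>}" by (simp only: if_True)
  show "\<eta>X i ` carrier (XX i 0) = carrier (PC i)"
    by (rule copower_surj[OF Q q \<eta>X_additive \<eta>pure Q_exact(1)])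
qed

sublocale dc: exact_column_double_complex "\<lambda>i j. XX i j" "\<lambda>i j. HX i j" "\<lambda>i j. VX i j" "\<lambda>i. PC i" "\<lambda>i. dP (Suc i)" "\<lambda>i. \<eta>X i"
    A "\<epsilon>P"
proof
  show "additive (PC 0) A \<epsilon>P" using \<epsilon>P_additive unfolding additive_def regular_bimodule_simps .
qed (rule XX_abelian PC_abelian abelian_group_A bimodule_homD(1)[OF HX_hom] bimodule_homD(1)[OF VX_hom] \<eta>X_additive
    dP_additive HX_HX HX_VX \<eta>X_HX column_exact P_exact; assumption?)+

end

section \<open>Homomorphisms into direct sums\<close>

lemma bimodule_hom_comp:
  assumes "bimodule_hom R M N f" "bimodule_hom R N P g"
  shows "bimodule_hom R M P (\<lambda>x. g (f x))"
  using assms additive_comp[of M N f P g] additive_closed[OF bimodule_homD(1)[OF assms(1)]]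
  unfolding bimodule_hom_def left_linear_def right_linear_def by simp

lemma bimodule_hom_add:
  assumes N: "bimodule R R N" and f: "bimodule_hom R M N f" and g: "bimodule_hom R M N g"
  shows "bimodule_hom R M N (\<lambda>x. f x \<oplus>\<^bsub>N\<^esub> g x)"
proof -
  interpret N: bimodule R R N by fact
  note c = additive_closed[OF bimodule_homD(1)[OF f]] additive_closed[OF bimodule_homD(1)[OF g]]
  have "additive M N (\<lambda>x. f x \<oplus>\<^bsub>N\<^esub> g x)"
    by (rule additiveI) (simp_all add: c additive_add[OF bimodule_homD(1)[OF f]] additive_add[OF bimodule_homD(1)[OF g]]
        N.M.add.m_ac)
  then show ?thesis unfolding bimodule_hom_def left_linear_def right_linear_def
    by (simp add: c bimodule_homD(2,3)[OF f] bimodule_homD(2,3)[OF g] N.lact_add_right N.ract_add_left)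
qed

lemma bimodule_hom_sumI:
  assumes f: "\<And>i. i \<in> I \<Longrightarrow> bimodule_hom R M (N i) (f i)"
  shows "bimodule_hom R M (bimodule_sum I N) (\<lambda>x. \<lambda>i \<in> I. f i x)"
proof -
  note h = bimodule_homD[OF f] and c = additive_closed[OF bimodule_homD(1)[OF f]]
  have "additive M (bimodule_sum I N) (\<lambda>x. \<lambda>i \<in> I. f i x)"
  proof (rule additiveI)
    fix x y assume "x \<in> carrier M" "y \<in> carrier M"
    then show "(\<lambda>i \<in> I. f i (x \<oplus>\<^bsub>M\<^esub> y)) = (\<lambda>i \<in> I. f i x) \<oplus>\<^bsub>bimodule_sum I N\<^esub> (\<lambda>i \<in> I. f i y)"
      by (simp add: restrict_def fun_eq_iff additive_add[OF h(1)])
  qed (simp add: c)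
  moreover have "(\<lambda>i \<in> I. f i (lact M r x)) = lact (bimodule_sum I N) r (\<lambda>i \<in> I. f i x)"
    "(\<lambda>i \<in> I. f i (ract M x r)) = ract (bimodule_sum I N) (\<lambda>i \<in> I. f i x) r"
    if "r \<in> carrier R" "x \<in> carrier M" for r x
    using that by (simp_all add: restrict_def fun_eq_iff h(2,3))
  ultimately show ?thesis unfolding bimodule_hom_def left_linear_def right_linear_def by blast
qed

section \<open>The total complex and its augmentation\<close>

context resolution_pair
begin

abbreviation (input) "XT n \<equiv> total_complex A (\<lambda>i. PC i) (\<lambda>j. QD j) n"
abbreviation (input) "dX n \<equiv> total_diff A (\<lambda>i. PC i) (\<lambda>j. QD j) (\<lambda>i. dP i) (\<lambda>j. dQ j) n"
abbreviation (input) "\<epsilon>X \<equiv> total_aug A (\<lambda>i. PC i) (\<lambda>j. QD j) \<epsilon>P \<epsilon>Q"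

lemma XT_central: "central_bimodule K A (XT n)"
  unfolding total_complex_def by (rule bimodule_sum_central[OF _ A_algebra]) (auto intro: XX_central)

lemma XT_carrier: "carrier (XT n) = dc.total n"
  unfolding total_complex_def bimodule_sum_simps dc.total_def by (rule PiE_cong) auto

lemma XT_zero: "\<zero>\<^bsub>XT n\<^esub> = (\<lambda>(i, j) \<in> {(i, j). i + j = n}. \<zero>\<^bsub>XX i j\<^esub>)"
  by (simp add: total_complex_def restrict_def fun_eq_iff)

text \<open>A shift of numbering: \<open>total_diff\<close> is numbered by its source,
  \<open>dc.diff\<close> by its target.\<close>

lemma dX_eq: "dX (Suc n) x = dc.diff n x"
  by (simp only: total_diff_def dc.diff_def diff_Suc_1 Suc_eq_plus1[symmetric] tensor_simps)

lemma XT_component: "i + j = n \<Longrightarrow> bimodule_hom A (XT n) (XX i j) (\<lambda>x. x (i, j))"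
  unfolding total_complex_def using bimodule_hom_component[of "(i, j)" "{(i, j). i + j = n}" A "\<lambda>(i, j). XX i j"]
  by (simp only: mem_Collect_eq prod.case)

lemma dX_hom: "bimodule_hom A (XT (Suc n)) (XT n) (dX (Suc n))"
proof -
  have e: "dX (Suc n) = (\<lambda>x. \<lambda>p \<in> {(i, j). i + j = n}. HX (fst p) (snd p) (x (Suc (fst p), snd p))
      \<oplus>\<^bsub>XX (fst p) (snd p)\<^esub> VX (fst p) (snd p) (x (fst p, Suc (snd p))))"
    by (simp add: total_diff_def restrict_def fun_eq_iff)
  have t: "XT n = bimodule_sum {(i, j). i + j = n} (\<lambda>p. XX (fst p) (snd p))"
    by (simp add: total_complex_def case_prod_unfold)
  show ?thesis unfolding e t
    by (intro bimodule_hom_sumI bimodule_hom_add tX.tensor_bimodule bimodule_hom_comp[OF XT_component HX_hom]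
        bimodule_hom_comp[OF XT_component VX_hom]) auto
qed

sublocale rA: bimodule_pair A A A "regular_bimodule A" "regular_bimodule A"
  by (intro bimodule_pair.intro regular_A)

sublocale aX: bimodule_pair_maps A A A "PC 0" "QD 0" A A "regular_bimodule A" "regular_bimodule A" \<epsilon>P \<epsilon>Q
  by (intro bimodule_pair_maps.intro bimodule_pair_maps_axioms.intro tX.bimodule_pair_axioms rA.bimodule_pair_axioms
      bimodule_homD(5)[OF \<epsilon>P_hom] bimodule_homD(4)[OF \<epsilon>Q_hom])

abbreviation (input) "aug0 t \<equiv> tensor_lift A (monoid.mult A)
  (tensor_map A (PC 0) (QD 0) (regular_bimodule A) (regular_bimodule A) \<epsilon>P \<epsilon>Q t)"

lemma A_mult_balanced: "balanced_map A (regular_bimodule A) (regular_bimodule A) A (monoid.mult A)"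
  by (rule balanced_mapI)
    (simp_all del: A_simps add: A.L.m_assoc A.L.l_distr A.L.r_distr)

lemma \<epsilon>P_closed: "y \<in> carrier (PC 0) \<Longrightarrow> \<epsilon>P y \<in> carrier A"
  using additive_closed[OF \<epsilon>P_additive] by simp

lemma aug0_additive: "additive (XX 0 0) A aug0"
proof (rule additive_comp[OF aX.map_additive])
  show "additive (tensor A (regular_bimodule A) (regular_bimodule A)) A (tensor_lift A (monoid.mult A))"
    using rA.lift_additive[OF abelian_group_A A_mult_balanced] unfolding additive_def tensor_simps .
qed

lemma aug0_pure: "\<lbrakk>y \<in> carrier (PC 0); z \<in> carrier (QD 0)\<rbrakk> \<Longrightarrow> aug0 (px 0 0 y z) = \<epsilon>P y \<otimes>\<^bsub>A\<^esub> \<epsilon>Q z"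
  unfolding aX.map_pure
  by (rule rA.lift_pure[OF abelian_group_A A_mult_balanced]) (simp_all only: regular_bimodule_simps \<epsilon>P_closed \<epsilon>Q_closed)

text \<open>The augmentation through A \<otimes> A \<cong> A agrees with the one used in the chase,
  as \<epsilon>(y) \<epsilon>(z) = \<epsilon>(y \<epsilon>(z)) by right linearity. This puts
  exactness at X_0 and surjectivity into the required form.\<close>

lemma aug0_eq: "t \<in> carrier (XX 0 0) \<Longrightarrow> aug0 t = \<epsilon>P (\<eta>X 0 t)"
proof (rule XX_eqI[OF abelian_group_A aug0_additive])
  show "additive (XX 0 0) A (\<lambda>t. \<epsilon>P (\<eta>X 0 t))" by (rule additive_comp[OF \<eta>X_additive dc.\<epsilon>_additive])
  fix y z assume y: "y \<in> carrier (PC 0)" "z \<in> carrier (QD 0)"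
  show "aug0 (px 0 0 y z) = \<epsilon>P (\<eta>X 0 (px 0 0 y z))"
    unfolding aug0_pure[OF y] \<eta>X_pure[OF y] bimodule_homD(3)[OF \<epsilon>P_hom \<epsilon>Q_closed[OF y(2)] y(1)] by simp
qed

lemma aug0_hom: "bimodule_hom A (XX 0 0) (regular_bimodule A) aug0"
  unfolding bimodule_hom_def left_linear_def right_linear_def
proof (intro conjI ballI)
  show a: "additive (XX 0 0) (regular_bimodule A) aug0"
    using aug0_additive unfolding additive_def regular_bimodule_simps .
  then show "additive (XX 0 0) (regular_bimodule A) aug0" .
  fix r t assume r: "r \<in> carrier A" and t: "t \<in> carrier (XX 0 0)"
  have l: "additive (XX 0 0) (XX 0 0) (lact (XX 0 0) r)" "additive (XX 0 0) (XX 0 0) (\<lambda>t. ract (XX 0 0) t r)"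
    using tX.lact_additive[OF r] tX.ract_additive[OF r] unfolding additive_def tensor_simps .
  have m: "additive A A (\<lambda>x. r \<otimes>\<^bsub>A\<^esub> x)" "additive A A (\<lambda>x. x \<otimes>\<^bsub>A\<^esub> r)"
    using r by (simp_all only: A_mult_additive_left A_mult_additive_right)
  have "aug0 (lact (XX 0 0) r t) = r \<otimes>\<^bsub>A\<^esub> aug0 t"
  proof (rule XX_eqI[OF abelian_group_A additive_comp[OF l(1) aug0_additive] additive_comp[OF aug0_additive m(1)] _ t])
    fix y z assume y: "y \<in> carrier (PC 0)" "z \<in> carrier (QD 0)"
    show "aug0 (lact (XX 0 0) r (px 0 0 y z)) = r \<otimes>\<^bsub>A\<^esub> aug0 (px 0 0 y z)"
      unfolding tX.lact_pure[OF r y] aug0_pure[OF y] aug0_pure[OF tX.M.lact_closed[OF r y(1)] y(2)]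
        bimodule_homD(2)[OF \<epsilon>P_hom r y(1)] regular_bimodule_simps
      by (rule A.L.m_assoc[OF r \<epsilon>P_closed[OF y(1)] \<epsilon>Q_closed[OF y(2)]])
  qed
  then show "aug0 (lact (XX 0 0) r t) = lact (regular_bimodule A) r (aug0 t)" unfolding regular_bimodule_simps .
  have "aug0 (ract (XX 0 0) t r) = aug0 t \<otimes>\<^bsub>A\<^esub> r"
  proof (rule XX_eqI[OF abelian_group_A additive_comp[OF l(2) aug0_additive] additive_comp[OF aug0_additive m(2)] _ t])
    fix y z assume y: "y \<in> carrier (PC 0)" "z \<in> carrier (QD 0)"
    show "aug0 (ract (XX 0 0) (px 0 0 y z) r) = aug0 (px 0 0 y z) \<otimes>\<^bsub>A\<^esub> r"
      unfolding tX.ract_pure[OF r y] aug0_pure[OF y] aug0_pure[OF y(1) tX.N.ract_closed[OF y(2) r]]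
        bimodule_homD(3)[OF \<epsilon>Q_hom r y(2)] regular_bimodule_simps
      by (rule A.L.m_assoc[OF \<epsilon>P_closed[OF y(1)] \<epsilon>Q_closed[OF y(2)] r, symmetric])
  qed
  then show "aug0 (ract (XX 0 0) t r) = ract (regular_bimodule A) (aug0 t) r" unfolding regular_bimodule_simps .
qed

lemma \<epsilon>X_hom: "bimodule_hom A (XT 0) (regular_bimodule A) \<epsilon>X"
proof -
  have "bimodule_hom A (XT 0) (regular_bimodule A) (\<lambda>x. aug0 (x (0, 0)))"
    by (rule bimodule_hom_comp[OF XT_component aug0_hom]) simp
  then show ?thesis by (simp only: total_aug_def[abs_def])
qed

lemma \<epsilon>X_eq: "x \<in> carrier (XT 0) \<Longrightarrow> \<epsilon>X x = \<epsilon>P (\<eta>X 0 (x (0, 0)))"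
  unfolding total_aug_def XT_carrier by (rule aug0_eq[OF dc.total_closed]) simp_all

lemma XT_exact:
  "\<epsilon>X ` carrier (XT 0) = carrier A"
  "dX 1 ` carrier (XT 1) = {x \<in> carrier (XT 0). \<epsilon>X x = \<zero>\<^bsub>A\<^esub>}"
  "dX (Suc (Suc n)) ` carrier (XT (Suc (Suc n))) = {x \<in> carrier (XT (Suc n)). dX (Suc n) x = \<zero>\<^bsub>XT n\<^esub>}"
proof -
  show "\<epsilon>X ` carrier (XT 0) = carrier A"
    using dc.total_augmentation_surj \<epsilon>X_eq unfolding XT_carrier by (simp cong: image_cong del: A_simps)
  have "dX (Suc 0) ` carrier (XT (Suc 0)) = dc.diff 0 ` dc.total (Suc 0)" unfolding XT_carrier dX_eq ..
  also have "\<dots> = {x \<in> carrier (XT 0). \<epsilon>X x = \<zero>\<^bsub>A\<^esub>}"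
    unfolding dc.total_augmentation_exact using \<epsilon>X_eq unfolding XT_carrier by (intro Collect_cong conj_cong refl) simp
  finally show "dX 1 ` carrier (XT 1) = {x \<in> carrier (XT 0). \<epsilon>X x = \<zero>\<^bsub>A\<^esub>}" by (simp only: One_nat_def)
  show "dX (Suc (Suc n)) ` carrier (XT (Suc (Suc n))) = {x \<in> carrier (XT (Suc n)). dX (Suc n) x = \<zero>\<^bsub>XT n\<^esub>}"
    unfolding XT_carrier dX_eq XT_zero by (rule dc.total_exact)
qed

section \<open>Bases over the enveloping algebra of A\<close>

abbreviation (input) "sS \<equiv> space_bimodule S"
abbreviation (input) "sA \<equiv> space_bimodule A"
abbreviation (input) "eS \<equiv> pure_tensor K (space_bimodule S) (space_bimodule S)"
abbreviation (input) "eA \<equiv> pure_tensor K (space_bimodule A) (space_bimodule A)"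

lemma twisted_skew_elt_linear:
  assumes "g \<in> carrier G" "v \<in> carrier G"
  shows "left_linear K sS sA (\<lambda>s. skew_elt g (act v s))" "right_linear K sS sA (\<lambda>s. skew_elt g (act v s))"
proof -
  have a: "additive S A (\<lambda>s. skew_elt g (act v s))"
    by (rule additive_comp[OF act_additive[OF assms(2)] skew_elt_additive[OF assms(1)]])
  have l: "skew_elt g (act v (c \<odot>\<^bsub>S\<^esub> s)) = c \<odot>\<^bsub>A\<^esub> skew_elt g (act v s)" if "c \<in> carrier K" "s \<in> carrier S" for c s
    using that assms act_linear[of v c s] act_closed[of v s] by (simp add: A_smult_elt)
  show "left_linear K sS sA (\<lambda>s. skew_elt g (act v s))" "right_linear K sS sA (\<lambda>s. skew_elt g (act v s))"
    using a l by (simp_all add: left_linear_def right_linear_def additive_def del: A_simps)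
qed

text \<open>The left tensor factor is twisted by u g, which will be g|b| and so depends on the basis
  vector b; hence u is a parameter.\<close>

lemma env_A_copower:
  assumes u: "\<And>g. g \<in> carrier G \<Longrightarrow> u g \<in> carrier G"
  shows "\<exists>q. copower (enveloping_algebra K A) (enveloping_algebra K S) (carrier G \<times> carrier G)
    (\<lambda>(g, h). tensor_map K sS sS sA sA (\<lambda>s. skew_elt g (act (u g) s)) (\<lambda>s. skew_elt h (act \<one>\<^bsub>G\<^esub> s))) q"
proof -
  have t: "copower sA sS (carrier G) (\<lambda>g s. skew_elt g (act (v g) s)) (\<lambda>g a. act (inv\<^bsub>G\<^esub> (v g)) (a g))"
    if v: "\<And>g. g \<in> carrier G \<Longrightarrow> v g \<in> carrier G" for v
  proof (rule copower_cong_structure[OF copower_twist[OF A_copower]])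
    fix g assume g: "g \<in> carrier G"
    show "additive S S (act (v g))" "additive S S (act (inv\<^bsub>G\<^esub> (v g)))"
      using v[OF g] by (simp_all add: act_additive G_closed)
    show "act (v g) (act (inv\<^bsub>G\<^esub> (v g)) s) = s" "act (inv\<^bsub>G\<^esub> (v g)) (act (v g) s) = s" if "s \<in> carrier S" for s
      using v[OF g] that by (simp_all add: act_inv act_inv')
  qed simp_all
  note sb = space_bimodule_bimodule[OF A.module_axioms'] space_bimodule_bimodule[OF module_axioms']
  \<comment> \<open>The right factor carries the trivial twist by the unit of G, so one statement t
    covers both factors.\<close>
  note 1 = t[OF u] and 2 = t[of "\<lambda>_. \<one>\<^bsub>G\<^esub>", OF G_closed(3)]
  note l = twisted_skew_elt_linear(2)[OF _ u] twisted_skew_elt_linear(1)[OF _ G_closed(3)]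
  have "copower (tensor K sA sA) (tensor K sS sS) (carrier G \<times> carrier G)
    (\<lambda>(g, h). tensor_map K sS sS sA sA (\<lambda>s. skew_elt g (act (u g) s)) (\<lambda>s. skew_elt h (act \<one>\<^bsub>G\<^esub> s)))
    (\<lambda>(g, h). tensor_map K sA sA sS sS (\<lambda>a. act (inv\<^bsub>G\<^esub> (u g)) (a g)) (\<lambda>a. act (inv\<^bsub>G\<^esub> \<one>\<^bsub>G\<^esub>) (a h)))"
    by (rule tensor_copower[OF sb(1) sb(1) sb(2) sb(2) 1 2 l(1) copower_prj_right_linear[OF 1 sb l(1)]
          l(2) copower_prj_left_linear[OF 2 sb l(2)]])
  then show ?thesis
    by - (rule exI, erule copower_cong_structure; simp only: A.env_simps env_simps tensor_simps)
qed

context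
  fixes i j :: nat and B :: "('g \<times> 'v) set" and x :: "'g \<times> 'v \<Rightarrow> 'c" and p
    and F :: "'w set" and y :: "'w \<Rightarrow> 'd" and p'
  assumes B: "\<And>b. b \<in> B \<Longrightarrow> fst b \<in> carrier G" "\<And>b. b \<in> B \<Longrightarrow> x b \<in> gC i (fst b)"
    and cB: "copower (C i) (enveloping_algebra K kG) B (\<lambda>b t. t \<odot>\<^bsub>env_module (C i)\<^esub> x b) p"
    and F: "\<And>f. f \<in> F \<Longrightarrow> y f \<in> carrier (D j)"
    and cF: "copower (D j) (enveloping_algebra K S) F (\<lambda>f t. t \<odot>\<^bsub>env_module (D j)\<^esub> y f) p'"
begin

definition two_sided_basis :: "('g \<times> 'v) \<times> 'w \<Rightarrow> (('g \<Rightarrow> 's, 'c) tensor, ('d, 'g \<Rightarrow> 's) tensor) tensor"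
  where "two_sided_basis = (\<lambda>(b, f). px i j (pc i \<one>\<^bsub>A\<^esub> (x b)) (pd j (y f) \<one>\<^bsub>A\<^esub>))"

lemma two_sided_basis_closed: "k \<in> B \<times> F \<Longrightarrow> two_sided_basis k \<in> carrier (XX i j)"
proof -
  assume "k \<in> B \<times> F"
  then have "pc i \<one>\<^bsub>A\<^esub> (x (fst k)) \<in> carrier (PC i)" "pd j (y (snd k)) \<one>\<^bsub>A\<^esub> \<in> carrier (QD j)"
    using pc_closed[OF A.L.one_closed C_homogeneous_closed[OF B(2,1)]] pd_closed[OF F A.L.one_closed]
    by (auto simp del: A_simps)
  then show ?thesis by (simp only: two_sided_basis_def case_prod_unfold px_closed)
qed

text \<open>The twist in the first factor is chosen so that s arrives untwisted at y_f; then s and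
  s' only meet the bimodule structure of D_j.\<close>

lemma env_act_two_sided_basis:
  assumes g: "g \<in> carrier G" and h: "h \<in> carrier G" and b: "b \<in> B" and f: "f \<in> F" and s: "s \<in> carrier S" "s' \<in> carrier S"
  shows "XC.env_act i j (eA (skew_elt g (act (g \<otimes>\<^bsub>G\<^esub> fst b) s)) (skew_elt h s')) (two_sided_basis (b, f))
    = px i j (right_basis i x (g, b)) (pd j (lact (D j) s (ract (D j) (y f) s')) (skew_elt h \<one>\<^bsub>S\<^esub>))"
proof -
  let ?a = "skew_elt g (act (g \<otimes>\<^bsub>G\<^esub> fst b) s)"
  note xb = C_homogeneous_closed[OF B(2)[OF b] B(1)[OF b]] and yf = F[OF f]
  have a: "?a \<in> carrier A" "skew_elt h s' \<in> carrier A"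
    by (intro skew_elt_closed act_closed G_closed g B(1)[OF b] s)+
  have P: "pc i \<one>\<^bsub>A\<^esub> (x b) \<in> carrier (PC i)" and Q: "pd j (y f) \<one>\<^bsub>A\<^esub> \<in> carrier (QD j)"
    using pc_closed[OF A.L.one_closed xb] pd_closed[OF yf A.L.one_closed] by (simp_all del: A_simps)
  have r: "ract (QD j) (pd j (y f) \<one>\<^bsub>A\<^esub>) (skew_elt h s') = pd j (y f) (skew_elt h s')"
    unfolding QD_sel(4) TD_ract_pure[OF a(2) yf A.L.one_closed] A.L.l_one[OF a(2)] ..
  have l: "lact (PC i) ?a (pc i \<one>\<^bsub>A\<^esub> (x b)) = pc i ?a (x b)"
    using tC.lact_pure[OF a(1) _ xb, of "\<one>\<^bsub>A\<^esub>"] A.L.r_one[OF a(1)] A.L.one_closed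
    by (simp only: PC_sel(4) A_r_sel)
  have Q': "pd j (y f) (skew_elt h s') \<in> carrier (QD j)" using pd_closed[OF yf a(2)] by simp
  have "XC.env_act i j (eA ?a (skew_elt h s')) (two_sided_basis (b, f))
      = lact (XX i j) ?a (ract (XX i j) (px i j (pc i \<one>\<^bsub>A\<^esub> (x b)) (pd j (y f) \<one>\<^bsub>A\<^esub>)) (skew_elt h s'))"
    unfolding two_sided_basis_def prod.case by (rule XC.env_act_pure[OF a px_closed[OF P Q]])
  also have "\<dots> = px i j (pc i ?a (x b)) (pd j (y f) (skew_elt h s'))"
    unfolding tX.ract_pure[OF a(2) P Q] r tX.lact_pure[OF a(1) P Q'] l ..
  \<comment> \<open>The twisted element is g \<otimes> x_b acted on by s from the right, which frees
    s to cross the tensor sign over A.\<close>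
  also have "pc i ?a (x b) = ract (PC i) (right_basis i x (g, b)) (skew_elt \<one>\<^bsub>G\<^esub> s)"
  proof -
    have "ract (PC i) (right_basis i x (g, b)) (skew_elt \<one>\<^bsub>G\<^esub> s) = pc i ?a (ract (C i) (x b) (group_elt K G \<one>\<^bsub>G\<^esub>))"
      by (rule right_basis_ract[OF B cB g b G_closed(3) s(1)])
    then show ?thesis using group_elt_one_act(2)[OF xb] by (simp only:)
  qed
  also have "px i j \<dots> (pd j (y f) (skew_elt h s'))
      = px i j (right_basis i x (g, b)) (lact (QD j) (skew_elt \<one>\<^bsub>G\<^esub> s) (pd j (y f) (skew_elt h s')))"
    by (rule tX.pure_balanced[OF right_basis_closed[OF B cB] skew_elt_closed[OF s(1)] Q']) (simp_all add: g b)
  also have "lact (QD j) (skew_elt \<one>\<^bsub>G\<^esub> s) (pd j (y f) (skew_elt h s')) = pd j (lact (D j) s (y f)) (skew_elt h s')"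
    using QD_lact_pure[OF G_closed(3) s(1) yf a(2)] gact_one[OF yf] A.L.l_one[OF a(2)] by (simp only: A_simps(3))
  \<comment> \<open>Now s' \<otimes> h = (s' \<otimes> 1)(1 \<otimes> h), and s' crosses the tensor
    sign over S to the right of y_f.\<close>
  also have "pd j (lact (D j) s (y f)) (skew_elt h s') = pd j (lact (D j) s (y f)) (lact A\<^sub>l s' (skew_elt h \<one>\<^bsub>S\<^esub>))"
    using skew_elt_mult[OF G_closed(3) h s(2) L.one_closed] act_one[OF L.one_closed] h s
    by (simp add: monoid.l_one[OF group.is_monoid[OF group_axioms]])
  also have "\<dots> = pd j (ract (D j) (lact (D j) s (y f)) s') (skew_elt h \<one>\<^bsub>S\<^esub>)"
    by (rule tD.pure_balanced[symmetric]) (simp_all add: s yf DB.lact_closed skew_elt_closed del: A_simps)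
  also have "ract (D j) (lact (D j) s (y f)) s' = lact (D j) s (ract (D j) (y f) s')"
    by (rule DB.lact_ract[OF s(1) yf s(2)])
  finally show ?thesis .
qed

text \<open>Three splittings are composed: X_{i,j} into copies of D_j \<otimes> A over (g, b), each
  of these into copies of D_j over h, and D_j into copies of S^e over f. As A^e is a sum of copies
  of S^e over (g, h), \<open>copower_fuse\<close> leaves the index (b, f).\<close>

lemma XX_env_copower_of_bases:
  "\<exists>q. copower (XX i j) (enveloping_algebra K A) (B \<times> F) (\<lambda>k t. t \<odot>\<^bsub>env_module (XX i j)\<^esub> two_sided_basis k) q"
proof -
  have rc: "right_basis i x k \<in> carrier (PC i)" if "k \<in> carrier G \<times> B" for k
    by (rule right_basis_closed[OF B cB that])
  have "\<exists>q. copower (PC i) A (carrier G \<times> B) (\<lambda>k a. ract (PC i) (right_basis i x k) a) q"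
    by (rule PC_right_copower[OF B cB])
  then obtain q where "copower (PC i) A (carrier G \<times> B) (\<lambda>k a. ract (PC i) (right_basis i x k) a) q" ..
  note 1 = tX.tensor_copower_left[OF this rc refl, of j]
  obtain q' where "copower (QD j) (D j) (carrier G) (\<lambda>g y. pd j y (skew_elt g \<one>\<^bsub>S\<^esub>)) q'"
    using QD_copower[of j] by (elim exE)
  note 2 = copower_comp[OF copower_comp[OF 1 this] cF]
  define I where "I = (\<lambda>((b :: 'g \<times> 'v, f), (g, h)) t. px i j (right_basis i x (g, b))
    (pd j (t \<odot>\<^bsub>env_module (D j)\<^esub> y f) (skew_elt h \<one>\<^bsub>S\<^esub>)))"
  \<comment> \<open>Collects (g, h), the index of A^e over S^e, in the last place, as
    \<open>copower_fuse\<close> requires.\<close>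
  define \<sigma> :: "(('g \<times> 'v) \<times> 'w) \<times> 'g \<times> 'g \<Rightarrow> ((('g \<times> 'g \<times> 'v) \<times> 'g) \<times> 'w)"
    where "\<sigma> = (\<lambda>((b, f), (g, h)). (((g, b), h), f))"
  have bij: "bij_betw \<sigma> ((B \<times> F) \<times> (carrier G \<times> carrier G)) (((carrier G \<times> B) \<times> carrier G) \<times> F)"
    unfolding \<sigma>_def by (rule bij_betwI[where g = "\<lambda>(((g, b), h), f). ((b, f), (g, h))"]) auto
  have 3: "\<exists>q. copower (XX i j) (enveloping_algebra K S) ((B \<times> F) \<times> (carrier G \<times> carrier G)) I q"
  proof (rule exI, rule copower_cong[OF copower_reindex[OF 2 bij]])
    fix k t assume "k \<in> (B \<times> F) \<times> (carrier G \<times> carrier G)"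
    show "(case \<sigma> k of (i', f) \<Rightarrow> \<lambda>t. (case i' of (k, g) \<Rightarrow> \<lambda>y. px i j (right_basis i x k) (pd j y (skew_elt g \<one>\<^bsub>S\<^esub>)))
        (t \<odot>\<^bsub>env_module (D j)\<^esub> y f)) t = I k t"
      by (simp add: \<sigma>_def I_def case_prod_unfold)
  qed
  then obtain q3 where q3: "copower (XX i j) (enveloping_algebra K S) ((B \<times> F) \<times> (carrier G \<times> carrier G)) I q3" ..
  \<comment> \<open>The splitting of A^e depends on b through the twist g|b|;
    \<open>copower_fuse\<close> admits this, since there each block may be split
    differently.\<close>
  define \<kappa> where "\<kappa> = (\<lambda>(b :: 'g \<times> 'v) (g, h). tensor_map K sS sS sA sA
    (\<lambda>s. skew_elt g (act (g \<otimes>\<^bsub>G\<^esub> fst b) s)) (\<lambda>s. skew_elt h (act \<one>\<^bsub>G\<^esub> s)))"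
  have "\<exists>q. copower (enveloping_algebra K A) (enveloping_algebra K S) (carrier G \<times> carrier G) (\<kappa> b) q" if "b \<in> B" for b
    unfolding \<kappa>_def by (rule env_A_copower) (intro G_closed B(1)[OF that])
  then obtain q4 where q4: "\<And>b. b \<in> B \<Longrightarrow>
      copower (enveloping_algebra K A) (enveloping_algebra K S) (carrier G \<times> carrier G) (\<kappa> b) (q4 b)"
    by metis
  show ?thesis
  proof (rule copower_fuse[OF q3, where inc' = "\<lambda>k. \<kappa> (fst k)" and prj' = "\<lambda>k. q4 (fst k)"])
    show "copower (enveloping_algebra K A) (enveloping_algebra K S) (carrier G \<times> carrier G) (\<kappa> (fst k)) (q4 (fst k))"
      if "k \<in> B \<times> F" for k using that by (intro q4) auto
    show "abelian_group (enveloping_algebra K A)" by (rule A.env_abelian_group)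
    show add: "additive (enveloping_algebra K A) (XX i j) (\<lambda>t. t \<odot>\<^bsub>env_module (XX i j)\<^esub> two_sided_basis k)"
      if "k \<in> B \<times> F" for k
      unfolding XC.env_module_smult by (rule XC.env_act_additive_left[OF two_sided_basis_closed[OF that]])
    fix k l t assume k: "k \<in> B \<times> F" and l: "l \<in> carrier G \<times> carrier G" and t: "t \<in> carrier (enveloping_algebra K S)"
    obtain b f g h where kl: "k = (b, f)" "l = (g, h)" "b \<in> B" "f \<in> F" "g \<in> carrier G" "h \<in> carrier G"
      using k l by auto
    have bf: "(b, f) \<in> B \<times> F" using kl by simp
    note Q4 = q4[OF kl(3)]
    have \<kappa>: "additive (enveloping_algebra K S) (enveloping_algebra K A) (\<kappa> b l)"
      by (rule copower.inc_additive[OF Q4 l])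
    have I: "additive (enveloping_algebra K S) (XX i j) (I (k, l))"
      by (rule copower.inc_additive[OF q3]) (simp add: k l)
    have ug: "g \<otimes>\<^bsub>G\<^esub> fst b \<in> carrier G" by (intro G_closed kl B(1))
    interpret tw: bimodule_pair_maps K K K sS sS K K sA sA "\<lambda>s. skew_elt g (act (g \<otimes>\<^bsub>G\<^esub> fst b) s)"
        "\<lambda>s. skew_elt h (act \<one>\<^bsub>G\<^esub> s)"
      by (intro bimodule_pair_maps.intro bimodule_pair_maps_axioms.intro sp.bimodule_pair_axioms A.sp.bimodule_pair_axioms
          twisted_skew_elt_linear kl ug G_closed)
    have "\<kappa> b l t \<odot>\<^bsub>env_module (XX i j)\<^esub> two_sided_basis k = I (k, l) t"
    \<comment> \<open>Both sides are additive in t, so pure tensors s \<otimes> s' suffice, and for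
      these the computation on the basis element applies.\<close>
    proof (rule sp.tensor_additive_eqI[OF XX_abelian])
      show "additive (tensor_group K sS sS) (XX i j) (\<lambda>t. \<kappa> b l t \<odot>\<^bsub>env_module (XX i j)\<^esub> two_sided_basis k)"
        using additive_comp[OF \<kappa> add[OF k]] unfolding additive_def env_simps .
      show "additive (tensor_group K sS sS) (XX i j) (I (k, l))"
        using I unfolding additive_def env_simps .
      show "t \<in> carrier (tensor_group K sS sS)" using t unfolding env_simps .
      fix s s' assume "s \<in> carrier sS" "s' \<in> carrier sS"
      then have s: "s \<in> carrier S" "s' \<in> carrier S" by simp_all
      have "\<kappa> b l (eS s s') = eA (skew_elt g (act (g \<otimes>\<^bsub>G\<^esub> fst b) s)) (skew_elt h s')"
        unfolding \<kappa>_def kl(2) prod.case using tw.map_pure[of s s'] s act_one[OF s(2)] by simp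
      then show "\<kappa> b l (eS s s') \<odot>\<^bsub>env_module (XX i j)\<^esub> two_sided_basis k = I (k, l) (eS s s')"
        unfolding XC.env_module_smult kl(1) I_def prod.case kl(2)
        using env_act_two_sided_basis[OF kl(5,6,3,4) s] DB.env_module_smult DB.env_act_pure[OF s F[OF kl(4)]]
        by (simp only:)
    qed
    then show "\<kappa> (fst k) l t \<odot>\<^bsub>env_module (XX i j)\<^esub> two_sided_basis k = I (k, l) t" by (simp only: kl fst_conv)
  qed
qed

end

text \<open>The k-bases of C'_i and D'_j stay attached to the index sets, because freeness of the
  total complex and the comparison with A \<otimes> C'_i \<otimes> D'_j \<otimes> A are both read
  off from this statement.\<close>

lemma XX_env_copower: "\<exists>(B :: ('g \<times> 'v) set) (F :: 'w set) e q.
    copower (XX i j) (enveloping_algebra K A) (B \<times> F) (\<lambda>k t. t \<odot>\<^bsub>env_module (XX i j)\<^esub> e k) q \<and>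
    (\<forall>k \<in> B \<times> F. e k \<in> carrier (XX i j)) \<and>
    (\<exists>q. copower (C' i) K B (\<lambda>b c. c \<odot>\<^bsub>C' i\<^esub> snd b) q) \<and> (\<forall>b \<in> B. snd b \<in> carrier (C' i)) \<and>
    (\<exists>q. copower (D' j) K F (\<lambda>f c. c \<odot>\<^bsub>D' j\<^esub> f) q) \<and> F \<subseteq> carrier (D' j)"
proof -
  obtain B :: "('g \<times> 'v) set" and x p where B: "\<forall>b \<in> B. fst b \<in> carrier G \<and> x b \<in> gC i (fst b)"
    and cB: "copower (C i) (enveloping_algebra K kG) B (\<lambda>b t. t \<odot>\<^bsub>env_module (C i)\<^esub> x b) p"
    and B': "\<exists>q. copower (C' i) K B (\<lambda>b c. c \<odot>\<^bsub>C' i\<^esub> snd b) q" "\<forall>b \<in> B. snd b \<in> carrier (C' i)"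
    using C_basis[of i] by (elim exE conjE) (rule that; (assumption | rule exI))
  obtain F :: "'w set" and y p' where cF: "copower (D j) (enveloping_algebra K S) F (\<lambda>f t. t \<odot>\<^bsub>env_module (D j)\<^esub> y f) p'"
    and y: "\<forall>f \<in> F. y f \<in> carrier (D j)"
    and F': "\<exists>q. copower (D' j) K F (\<lambda>f c. c \<odot>\<^bsub>D' j\<^esub> f) q" "F \<subseteq> carrier (D' j)"
    using D_basis[of j] by (elim exE conjE) (rule that; (assumption | rule exI))
  note h = bspec[OF B, THEN conjunct1] bspec[OF B, THEN conjunct2] cB bspec[OF y] cF
  have "\<exists>q. copower (XX i j) (enveloping_algebra K A) (B \<times> F)
      (\<lambda>k t. t \<odot>\<^bsub>env_module (XX i j)\<^esub> two_sided_basis i j x y k) q"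
    by (rule XX_env_copower_of_bases[OF h])
  then obtain q where q: "copower (XX i j) (enveloping_algebra K A) (B \<times> F)
      (\<lambda>k t. t \<odot>\<^bsub>env_module (XX i j)\<^esub> two_sided_basis i j x y k) q" ..
  have e: "\<forall>k \<in> B \<times> F. two_sided_basis i j x y k \<in> carrier (XX i j)"
    by (rule ballI, rule two_sided_basis_closed[OF h])
  show ?thesis by ((rule exI)+, (rule conjI q e B' F')+)
qed

lemma XT_free: "free_module (enveloping_algebra K A) (env_module (XT n))"
proof -
  let ?I = "{(i, j). i + j = n}"
  have fin: "finite ?I" by (rule finite_subset[of _ "{..n} \<times> {..n}"]) auto
  \<comment> \<open>Names the property for which bases are chosen, so that they can be selected for
    all positions (i, j) at once.\<close>
  define good where "good = (\<lambda>p B (F :: 'w set) e q.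
      copower (XX (fst p) (snd p)) (enveloping_algebra K A) ((B :: ('g \<times> 'v) set) \<times> F)
        (\<lambda>k t. t \<odot>\<^bsub>env_module (XX (fst p) (snd p))\<^esub> e k) q \<and> (\<forall>k \<in> B \<times> F. e k \<in> carrier (XX (fst p) (snd p))))"
  have "\<forall>p. \<exists>B F e q. good p B F e q"
  proof
    fix p show "\<exists>B F e q. good p B F e q"
      unfolding good_def using XX_env_copower[of "fst p" "snd p"] by (elim exE conjE) ((rule exI)+, rule conjI)
  qed
  then obtain B F e q where g: "\<And>p. good p (B p) (F p) (e p) (q p)" by metis
  have t: "XT n = bimodule_sum ?I (\<lambda>p. XX (fst p) (snd p))"
    by (simp add: total_complex_def case_prod_unfold)
  show ?thesis unfolding t
  proof (rule bimodule_sum_copower[OF A_algebra fin XX_central, where J = "\<lambda>p. B p \<times> F p" and e = e and prj = q])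
    fix p
    show "copower (XX (fst p) (snd p)) (enveloping_algebra K A) (B p \<times> F p)
        (\<lambda>k t. t \<odot>\<^bsub>env_module (XX (fst p) (snd p))\<^esub> e p k) (q p)"
      using g[of p] unfolding good_def by (rule conjunct1)
    show "e p k \<in> carrier (XX (fst p) (snd p))" if "k \<in> B p \<times> F p" for k
      using g[of p] that unfolding good_def by (elim conjE bspec)
  qed
qed

text \<open>Both modules are free over A^e on B \<times> F: the right-hand one because the v_b
  \<otimes> f form a k-basis of C'_i \<otimes> D'_j. Matching the bases gives \<theta>.\<close>

lemma XX_two_sided: "\<exists>\<theta>. \<theta> \<in> left_module_iso (enveloping_algebra K A) (env_module (XX i j))
    (env_module (two_sided_tensor K A (tensor K (space_bimodule (C' i)) (space_bimodule (D' j)))))"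
proof -
  obtain B :: "('g \<times> 'v) set" and F :: "'w set" and e q qC qD
    where X: "copower (XX i j) (enveloping_algebra K A) (B \<times> F) (\<lambda>k t. t \<odot>\<^bsub>env_module (XX i j)\<^esub> e k) q"
      "\<forall>k \<in> B \<times> F. e k \<in> carrier (XX i j)"
    and C: "copower (C' i) K B (\<lambda>b c. c \<odot>\<^bsub>C' i\<^esub> snd b) qC" "\<forall>b \<in> B. snd b \<in> carrier (C' i)"
    and D: "copower (D' j) K F (\<lambda>f c. c \<odot>\<^bsub>D' j\<^esub> f) qD" "F \<subseteq> carrier (D' j)"
    using XX_env_copower[of i j] by (elim exE conjE) (rule that; assumption)
  let ?U = "space_bimodule (C' i)" and ?W = "space_bimodule (D' j)"
  let ?V = "tensor K ?U ?W"
  have m: "module K (C' i)" using C.C'_graded[of i] by (simp add: graded_space_def)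
  interpret U: module K "C' i" by (rule m)
  interpret V: bimodule_pair K K K ?U ?W
    by (intro bimodule_pair.intro space_bimodule_bimodule m D.D'_space)
  have d: "copower ?W K F (\<lambda>f c. c \<odot>\<^bsub>D' j\<^esub> f) qD"
    by (rule copower_cong_structure[OF D(1)]) simp_all
  have c: "copower ?U K B (\<lambda>b c. c \<odot>\<^bsub>C' i\<^esub> snd b) qC"
    by (rule copower_cong_structure[OF C(1)]) simp_all
  have "copower ?V ?U F (\<lambda>f m. V.p m f) (\<lambda>f. tensor_lift ?U (\<lambda>m n. ract ?U m (qD f n)))"
    by (rule V.tensor_copower_right[OF d]) (use D(2) in auto)
  note 0 = copower_comp[OF this c]
  \<comment> \<open>The tensor product was split over the basis of D'_j first, so the indices arrive
    as (f, b).\<close>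
  have "bij_betw prod.swap (B \<times> F) (F \<times> B)" by (rule bij_betwI[of _ _ _ prod.swap]) auto
  note 1 = copower_reindex[OF 0 this]
  have e': "V.p (snd (fst k)) (snd k) \<in> carrier ?V" if "k \<in> B \<times> F" for k
  proof -
    have "snd (fst k) \<in> carrier ?U" "snd k \<in> carrier ?W" using that C(2) D(2) by auto
    then show ?thesis unfolding tensor_simps by (rule V.pure_closed)
  qed
  have "\<exists>q. copower ?V K (B \<times> F) (\<lambda>k c. lact ?V c (V.p (snd (fst k)) (snd k))) q"
  proof (rule exI, rule copower_cong[OF 1])
    fix k c assume k: "k \<in> B \<times> F" and c: "c \<in> carrier K"
    have "snd (fst k) \<in> carrier ?U" "snd k \<in> carrier ?W" using k C(2) D(2) by auto
    from V.lact_pure[OF c this]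
    show "(case prod.swap k of (f, b) \<Rightarrow> \<lambda>c. V.p (c \<odot>\<^bsub>C' i\<^esub> snd b) f) c = lact ?V c (V.p (snd (fst k)) (snd k))"
      by (simp add: case_prod_unfold)
  qed
  then obtain q2 where 2: "copower ?V K (B \<times> F) (\<lambda>k c. lact ?V c (V.p (snd (fst k)) (snd k))) q2" ..
  have s: "lact ?V c v = ract ?V v c" if c: "c \<in> carrier K" and v: "v \<in> carrier ?V" for c v
  proof (rule V.tensor_additive_eqI[OF V.tensor_abelian_group V.lact_additive[OF c] V.ract_additive[OF c]])
    fix m n assume m: "m \<in> carrier ?U" "n \<in> carrier ?W"
    show "lact ?V c (V.p m n) = ract ?V (V.p m n) c"
      using V.lact_pure[OF c m] V.ract_pure[OF c m] V.pure_balanced[OF m(1) c m(2)] by simp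
  qed (use v in simp)
  note ts = A.two_sided_copower[OF V.tensor_bimodule s 2 e' refl]
  interpret T: central_bimodule K A "two_sided_tensor K A ?V"
    by (rule A.two_sided_central[OF V.tensor_bimodule s])
  have "\<exists>q'. copower (two_sided_tensor K A ?V) (enveloping_algebra K A) (B \<times> F)
      (\<lambda>k t. t \<odot>\<^bsub>env_module (two_sided_tensor K A ?V)\<^esub> A.two_sided_pure ?V \<one>\<^bsub>A\<^esub> (V.p (snd (fst k)) (snd k)) \<one>\<^bsub>A\<^esub>) q'"
    by (rule ts(1))
  then obtain q' where q': "copower (two_sided_tensor K A ?V) (enveloping_algebra K A) (B \<times> F)
      (\<lambda>k t. t \<odot>\<^bsub>env_module (two_sided_tensor K A ?V)\<^esub> A.two_sided_pure ?V \<one>\<^bsub>A\<^esub> (V.p (snd (fst k)) (snd k)) \<one>\<^bsub>A\<^esub>) q'" ..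
  show ?thesis
  proof (rule copower_left_module_iso[OF _ XC.env_module_left_module _ T.env_module_left_module refl _ refl])
    show "copower (env_module (XX i j)) (enveloping_algebra K A) (B \<times> F) (\<lambda>k t. t \<odot>\<^bsub>env_module (XX i j)\<^esub> e k) q"
      by (rule copower_cong_structure[OF X(1)]) simp_all
    show "copower (env_module (two_sided_tensor K A ?V)) (enveloping_algebra K A) (B \<times> F)
      (\<lambda>k t. t \<odot>\<^bsub>env_module (two_sided_tensor K A ?V)\<^esub> A.two_sided_pure ?V \<one>\<^bsub>A\<^esub> (V.p (snd (fst k)) (snd k)) \<one>\<^bsub>A\<^esub>) q'"
      by (rule copower_cong_structure[OF q']) simp_all
    fix k assume k: "k \<in> B \<times> F"
    show "e k \<in> carrier (env_module (XX i j))" unfolding env_module_simps using X(2) k by (rule bspec)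
    show "A.two_sided_pure ?V \<one>\<^bsub>A\<^esub> (V.p (snd (fst k)) (snd k)) \<one>\<^bsub>A\<^esub> \<in> carrier (env_module (two_sided_tensor K A ?V))"
      unfolding env_module_simps by (rule ts(2); (assumption | rule e'[OF k]))
  qed
qed

lemma XT_resolution: "free_env_resolution K A (\<lambda>n. XT n) (\<lambda>n. dX n) \<epsilon>X (regular_bimodule A)"
proof -
  note r = central_regular_bimodule[OF A_algebra]
  interpret r: central_bimodule K A "regular_bimodule A" by (rule r)
  show ?thesis
    unfolding free_env_resolution_def free_resolution_def left_module_hom_env_module[OF XT_central XT_central]
      left_module_hom_env_module[OF XT_central r] env_module_simps regular_bimodule_simps
    by (intro conjI allI XT_central r XT_free r.env_module_left_module dX_hom \<epsilon>X_hom XT_exact)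
qed

end

theorem theorem4p3:
  fixes K :: "'k ring" and S :: "('k, 's) module" and G :: "'g monoid" and act :: "'g \<Rightarrow> 's \<Rightarrow> 's"
    and C :: "nat \<Rightarrow> ('g \<Rightarrow> 'k, 'g \<Rightarrow> 'k, 'c) bimodule" and gC :: "nat \<Rightarrow> 'g \<Rightarrow> 'c set"
    and dC :: "nat \<Rightarrow> 'c \<Rightarrow> 'c" and \<epsilon>C :: "'c \<Rightarrow> 'g \<Rightarrow> 'k"
    and C' :: "nat \<Rightarrow> ('k, 'v) module" and gC' :: "nat \<Rightarrow> 'g \<Rightarrow> 'v set"
    and D :: "nat \<Rightarrow> ('s, 's, 'd) bimodule" and aD :: "nat \<Rightarrow> ('g \<Rightarrow> 'k) \<Rightarrow> 'd \<Rightarrow> 'd"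
    and dD :: "nat \<Rightarrow> 'd \<Rightarrow> 'd" and \<epsilon>D :: "'d \<Rightarrow> 's"
    and D' :: "nat \<Rightarrow> ('k, 'w) module"
  defines "A \<equiv> skew_group_algebra S G act"
    and "P \<equiv> \<lambda>i. kG_induced K S G act (C i) (gC i)"
    and "dP \<equiv> \<lambda>i. kG_induced_map K S G act (C i) (C (i - 1)) (dC i)"
    and "\<epsilon>P \<equiv> kG_induced_aug K S G act (C 0) \<epsilon>C"
    and "Q \<equiv> \<lambda>j. S_induced K S G act (D j) (aD j)"
    and "dQ \<equiv> \<lambda>j. S_induced_map K S G act (D j) (D (j - 1)) (dD j)"
    and "\<epsilon>Q \<equiv> S_induced_aug K S G act (D 0) \<epsilon>D"
  assumes "group_acting_on_algebra K S G act"
    and "graded_resolution_of_kG K G C gC dC \<epsilon>C C' gC'"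
    and "equivariant_resolution K S G act D aD dD \<epsilon>D D'"
  shows "free_env_resolution K A (total_complex A P Q) (total_diff A P Q dP dQ)
           (total_aug A P Q \<epsilon>P \<epsilon>Q) (regular_bimodule A) \<and>
         (\<forall>i j. central_bimodule K A (tensor A (P i) (Q j)) \<and>
           (\<exists>\<theta>. \<theta> \<in> left_module_iso (enveloping_algebra K A)
             (env_module (tensor A (P i) (Q j)))
             (env_module (two_sided_tensor K A
                (tensor K (space_bimodule (C' i)) (space_bimodule (D' j)))))))"
proof -
  interpret resolution_pair K S G act C gC dC \<epsilon>C C' gC' D aD dD \<epsilon>D D'
    by (rule resolution_pair.intro) fact+
  show ?thesis unfolding A_def P_def dP_def \<epsilon>P_def Q_def dQ_def \<epsilon>Q_def
    by (intro conjI allI XT_resolution XX_central XX_two_sided)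
qed

end
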